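(* Let $N\ge2$, $\Lambda_N=\mathbb{Z}[\frac1N]$ (as a discrete abelian group), and let $K_N$ be the Gelfand space of the abelian $C^*$-algebra $\mathcal{A}_N\subset\mathfrak{A}_N$ generated by the elements $U^{-i}fU^i$, $f\in C(\mathbb{T})$, $i\in\{0,1,2,\dots\}$. (i) The Gelfand space $K_N$ of $\mathcal{A}_N$ is the compact group $\widehat{\Lambda_N}$ (the Pontryagin dual of $\Lambda_N$). (ii) If $m_0$ is a non-singular wavelet filter of order $N$, and $h\in L^1(\mathbb{T})$, $h\ge0$, solves $R_{m_0}(h)=h$, then there is a unique measure $\nu=\nu(m_0,h)$ on $K_N\simeq\widehat{\Lambda_N}$ such that $$\int_{K_N}U^{-i}fU^i\,d\nu=\int_{\mathbb{T}}R^i(fh)\,d\mu,\qquad f\in C(\mathbb{T}),\ i=0,1,2,\dots,$$ where $R=R_{m_0}$ and $\mu$ is the normalized Haar measure on $\mathbb{T}$. (iii) Let $m_0,h,\nu$ be as in (ii), and let $e(\frac n{N^k})$ be identified with the $2\pi N^k$-periodic function $x\mapsto\exp(i\frac{nx}{N^k})$ on $\mathbb{R}$. Then the vectors $\{e(\frac n{N^k}) : n\in\mathbb{Z},\ k\in\{0,1,2,\dots\}\}$ span $L^2(K_N,\nu)$ (i.e., have dense linear span), and the representation $(\pi,U)$ of $\mathfrak{A}_N$ which corresponds to $(m_0,h)$ is given on $L^2(K_N,\nu)$ by $$\pi(e_n)e(\lambda)=e(n+\lambda),\qquad n\in\mathbb{Z},\ \lambda\in\Lambda_N,$$ $$Ue\Bigl(\frac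 n{N^{k+1}}\Bigr)=\sum_{j\in\mathbb{Z}}a_j\,e\Bigl(j+\frac n{N^k}\Bigr),$$ where $m_0(z)=\sum_{j\in\mathbb{Z}}a_je_j(z)=\sum_{j\in\mathbb{Z}}a_jz^j$, and $$Ue_0=m_0=\sum_{n\in\mathbb{Z}}a_ne_n,$$ where $e_0$ is the constant function $1$.
   Context: $\mathbb{T}$ is the unit circle, $e_n(z)=z^n$. A wavelet filter of order $N$ is a function $m_0\in L^\infty(\mathbb{T})$ such that $\sum_{k=0}^{N-1}|m_0(e^{i2\pi k/N}z)|^2=N$ for a.a. $z$, $m_0$ is continuous near $z=1$, and $m_0(1)=\sqrt N$. Non-singular means not vanishing on a subset of $\mathbb{T}$ of positive measure. The Ruelle operator is $(R_{m_0}f)(z)=\frac1N\sum_{w^N=z}|m_0(w)|^2f(w)$, $f\in L^1(\mathbb{T})$. $\mathfrak{A}_N$ is the universal $C^*$-algebra generated by $C(\mathbb{T})$ and a unitary $U$ subject to $UfU^{-1}=f(z^N)$; hence $U^{-i}fU^i=U^{-(i+1)}f(z^N)U^{i+1}$, so $\mathcal{A}_N$ is abelian and $\mathcal{A}_N\simeq C(K_N)$. Elements of $\mathcal{A}_N$ are regarded as continuous functions on $K_N$; the element $U^{-k}e_nU^k$ corresponds to the function $\chi\mapsto\chi(\frac n{N^k})$ on $K_N=\widehat{\Lambda_N}$, which is denoted $e(\frac n{N^k})$; it depends only on $\lambda=n/N^k\in\Lambda_N$. ($K_N$ is the Bohr compactification of $\mathbb{R}$ for frequencies in $\mathbb{Z}[\frac1N]$,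 and this function restricts on $\mathbb{R}$ to the periodic function named in (iii).) Measures on $K_N$ are finite positive Borel measures. A representation of $\mathfrak{A}_N$ is a pair $(\pi,U)$ with $\pi$ a representation of $L^\infty(\mathbb{T})$ and $U$ unitary with $U\pi(f)U^{-1}=\pi(f(z^N))$. The representation corresponding to $(m_0,h)$ is the one, unique up to unitary equivalence, having a vector $\varphi$ cyclic for $(\pi,U)$ with $\langle\varphi,\pi(f)\varphi\rangle=\int_{\mathbb{T}}fh\,d\mu$ for $f\in L^\infty(\mathbb{T})$ and $U\varphi=\pi(m_0)\varphi$; here $\varphi$ is the constant function $1=e_0$ in $L^2(K_N,\nu)$. Functions on $\mathbb{T}$ are regarded as functions on $K_N$ via $z=\chi(1)$, and a series $\sum_ja_je(j+\lambda)$ is understood as the Fourier expansion of the product $m_0\cdot e(\lambda)=\pi(m_0)e(\lambda)$. *)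

theory Defs
  imports "HOL-Analysis.Analysis" "HOL-Algebra.Module"
begin

section \<open>C*-algebras with explicit carriers\<close>

definition complex_ring :: "complex ring" where
  "complex_ring = \<lparr>carrier = UNIV, mult = (*), one = 1, zero = 0, add = (+)\<rparr>"

record 'a cstar = "(complex, 'a) module" +
  cstar_star :: "'a \<Rightarrow> 'a"
  cstar_norm :: "'a \<Rightarrow> real"

text \<open>All C*-algebras are unital. The zero algebra is allowed.\<close>

locale cstar_algebra =
  fixes A :: "'a cstar" (structure)
  assumes ring: "ring A"
    and complex_module: "module complex_ring A"
    and smult_mult_left:
      "\<And>c a b. a \<in> carrier A \<Longrightarrow> b \<in> carrier A \<Longrightarrow> (c \<odot> a) \<otimes> b = c \<odot> (a \<otimes> b)"
    and smult_mult_right: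
      "\<And>c a b. a \<in> carrier A \<Longrightarrow> b \<in> carrier A \<Longrightarrow> a \<otimes> (c \<odot> b) = c \<odot> (a \<otimes> b)"
    and star_closed: "\<And>a. a \<in> carrier A \<Longrightarrow> cstar_star A a \<in> carrier A"
    and star_star: "\<And>a. a \<in> carrier A \<Longrightarrow> cstar_star A (cstar_star A a) = a"
    and star_add: "\<And>a b. a \<in> carrier A \<Longrightarrow> b \<in> carrier A \<Longrightarrow>
      cstar_star A (a \<oplus> b) = cstar_star A a \<oplus> cstar_star A b"
    and star_smult: "\<And>c a. a \<in> carrier A \<Longrightarrow>
      cstar_star A (c \<odot> a) = cnj c \<odot> cstar_star A a"
    and star_mult: "\<And>a b. a \<in> carrier A \<Longrightarrow> b \<in> carrier A \<Longrightarrow>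
      cstar_star A (a \<otimes> b) = cstar_star A b \<otimes> cstar_star A a"
    and norm_nonneg: "\<And>a. a \<in> carrier A \<Longrightarrow> cstar_norm A a \<ge> 0"
    and norm_eq_zero: "\<And>a. a \<in> carrier A \<Longrightarrow> cstar_norm A a = 0 \<longleftrightarrow> a = \<zero>"
    and norm_triangle: "\<And>a b. a \<in> carrier A \<Longrightarrow> b \<in> carrier A \<Longrightarrow>
      cstar_norm A (a \<oplus> b) \<le> cstar_norm A a + cstar_norm A b"
    and norm_smult: "\<And>c a. a \<in> carrier A \<Longrightarrow> cstar_norm A (c \<odot> a) = cmod c * cstar_norm A a"
    and norm_mult: "\<And>a b. a \<in> carrier A \<Longrightarrow> b \<in> carrier A \<Longrightarrow>
      cstar_norm A (a \<otimes> b) \<le> cstar_norm A a * cstar_norm A b"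
    and cstar_identity: "\<And>a. a \<in> carrier A \<Longrightarrow>
      cstar_norm A (cstar_star A a \<otimes> a) = (cstar_norm A a)\<^sup>2"
    and complete: "\<And>X :: nat \<Rightarrow> 'a. (\<And>n. X n \<in> carrier A) \<Longrightarrow>
      (\<forall>\<epsilon>>0. \<exists>M. \<forall>m\<ge>M. \<forall>n\<ge>M. cstar_norm A (X m \<ominus> X n) < \<epsilon>) \<Longrightarrow>
      \<exists>x\<in>carrier A. (\<lambda>n. cstar_norm A (X n \<ominus> x)) \<longlonglongrightarrow> 0"

definition cstar_hom :: "'a cstar \<Rightarrow> 'b cstar \<Rightarrow> ('a \<Rightarrow> 'b) \<Rightarrow> bool" where
  "cstar_hom A B \<Phi> \<longleftrightarrow> \<Phi> \<in> ring_hom A B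
    \<and> (\<forall>c. \<forall>a\<in>carrier A. \<Phi> (c \<odot>\<^bsub>A\<^esub> a) = c \<odot>\<^bsub>B\<^esub> \<Phi> a)
    \<and> (\<forall>a\<in>carrier A. \<Phi> (cstar_star A a) = cstar_star B (\<Phi> a))"

definition cstar_subalgebra :: "'a cstar \<Rightarrow> 'a set \<Rightarrow> bool" where
  "cstar_subalgebra A B \<longleftrightarrow> B \<subseteq> carrier A \<and> \<zero>\<^bsub>A\<^esub> \<in> B
    \<and> (\<forall>a\<in>B. \<forall>b\<in>B. a \<oplus>\<^bsub>A\<^esub> b \<in> B \<and> a \<otimes>\<^bsub>A\<^esub> b \<in> B)
    \<and> (\<forall>c. \<forall>a\<in>B. c \<odot>\<^bsub>A\<^esub> a \<in> B)
    \<and> (\<forall>a\<in>B. cstar_star A a \<in> B)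
    \<and> (\<forall>X :: nat \<Rightarrow> 'a. \<forall>x\<in>carrier A. (\<forall>n. X n \<in> B) \<longrightarrow>
         (\<lambda>n. cstar_norm A (X n \<ominus>\<^bsub>A\<^esub> x)) \<longlonglongrightarrow> 0 \<longrightarrow> x \<in> B)"

definition cstar_generated :: "'a cstar \<Rightarrow> 'a set \<Rightarrow> 'a set" where
  "cstar_generated A S = \<Inter>{B. cstar_subalgebra A B \<and> S \<subseteq> B}"

text \<open>
  The Gelfand space consists of the nonzero multiplicative linear functionals with the topology of
  pointwise convergence. The functionals are taken to be extensional on the carrier, so that
  they are points of the product topology.
\<close>

definition characters :: "'a cstar \<Rightarrow> ('a \<Rightarrow> complex) set" where
  "characters A = {\<omega> \<in> extensional (carrier A).
     (\<exists>a\<in>carrier A. \<omega> a \<noteq> 0)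
   \<and> (\<forall>a\<in>carrier A. \<forall>b\<in>carrier A. \<omega> (a \<oplus>\<^bsub>A\<^esub> b) = \<omega> a + \<omega> b \<and> \<omega> (a \<otimes>\<^bsub>A\<^esub> b) = \<omega> a * \<omega> b)
   \<and> (\<forall>c. \<forall>a\<in>carrier A. \<omega> (c \<odot>\<^bsub>A\<^esub> a) = c * \<omega> a)}"

definition gelfand_space :: "'a cstar \<Rightarrow> ('a \<Rightarrow> complex) topology" where
  "gelfand_space A =
     subtopology (product_topology (\<lambda>_. euclidean) (carrier A)) (characters A)"


section \<open>The universal algebra and its abelian subalgebra\<close>

abbreviation circle :: "complex set" where
  "circle \<equiv> sphere 0 1"

definition continuous_circle :: "(complex \<Rightarrow> complex) cstar" where
  "continuous_circle = \<lparr>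
     carrier = {f \<in> extensional circle. continuous_on circle f},
     mult = (\<lambda>f g. \<lambda>z\<in>circle. f z * g z),
     one = (\<lambda>z\<in>circle. 1),
     zero = (\<lambda>z\<in>circle. 0),
     add = (\<lambda>f g. \<lambda>z\<in>circle. f z + g z),
     smult = (\<lambda>c f. \<lambda>z\<in>circle. c * f z),
     cstar_star = (\<lambda>f. \<lambda>z\<in>circle. cnj (f z)),
     cstar_norm = (\<lambda>f. SUP z\<in>circle. cmod (f z))\<rparr>"

definition circle_monomial :: "int \<Rightarrow> complex \<Rightarrow> complex" where
  "circle_monomial n = (\<lambda>z\<in>circle. z powi n)"

definition covariant_pair ::
    "nat \<Rightarrow> 'a cstar \<Rightarrow> ((complex \<Rightarrow> complex) \<Rightarrow> 'a) \<Rightarrow> 'a \<Rightarrow> bool" where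
  "covariant_pair N A \<iota> U \<longleftrightarrow> cstar_hom continuous_circle A \<iota>
    \<and> U \<in> carrier A \<and> cstar_star A U \<otimes>\<^bsub>A\<^esub> U = \<one>\<^bsub>A\<^esub> \<and> U \<otimes>\<^bsub>A\<^esub> cstar_star A U = \<one>\<^bsub>A\<^esub>
    \<and> (\<forall>f\<in>carrier continuous_circle.
         U \<otimes>\<^bsub>A\<^esub> \<iota> f \<otimes>\<^bsub>A\<^esub> inv\<^bsub>A\<^esub> U = \<iota> (\<lambda>z\<in>circle. f (z ^ N)))"

text \<open>
  \<open>A\<close> is generated by a covariant pair and every covariant pair in a C*-algebra \<open>B\<close> is the image of
  the given one under a homomorphism (which is unique because \<open>A\<close> is generated by the pair).
  One cannot quantify over the type of \<open>B\<close>; the type of maps on complex sequences loses nothing: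
  the subalgebra of \<open>B\<close> generated by a covariant pair is separable, hence isomorphic to an algebra
  of operators on square-summable sequences, so it has a copy whose carrier lies in this type.
\<close>

definition universal_covariant ::
    "nat \<Rightarrow> 'a cstar \<Rightarrow> ((complex \<Rightarrow> complex) \<Rightarrow> 'a) \<Rightarrow> 'a \<Rightarrow> bool" where
  "universal_covariant N A \<iota> U \<longleftrightarrow> cstar_algebra A \<and> covariant_pair N A \<iota> U
    \<and> cstar_generated A (insert U (\<iota> ` carrier continuous_circle)) = carrier A
    \<and> (\<forall>(B :: ((nat \<Rightarrow> complex) \<Rightarrow> (nat \<Rightarrow> complex)) cstar) \<rho> V.
         cstar_algebra B \<and> covariant_pair N B \<rho> V \<longrightarrow>
         (\<exists>\<Phi>. cstar_hom A B \<Phi> \<and> \<Phi> U = V \<and> (\<forall>f\<in>carrier continuous_circle. \<Phi> (\<iota> f) = \<rho> f)))"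

definition conj_power ::
    "'a cstar \<Rightarrow> ((complex \<Rightarrow> complex) \<Rightarrow> 'a) \<Rightarrow> 'a \<Rightarrow> nat \<Rightarrow> (complex \<Rightarrow> complex) \<Rightarrow> 'a" where
  "conj_power A \<iota> U i f = (inv\<^bsub>A\<^esub> U) [^]\<^bsub>A\<^esub> i \<otimes>\<^bsub>A\<^esub> \<iota> f \<otimes>\<^bsub>A\<^esub> U [^]\<^bsub>A\<^esub> i"

definition abelian_part ::
    "'a cstar \<Rightarrow> ((complex \<Rightarrow> complex) \<Rightarrow> 'a) \<Rightarrow> 'a \<Rightarrow> 'a cstar" where
  "abelian_part A \<iota> U = A\<lparr>carrier :=
     cstar_generated A {conj_power A \<iota> U i f | i f. f \<in> carrier continuous_circle}\<rparr>"


section \<open>The dual of the discrete group of $N$-adic rationals\<close>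

definition Lambda :: "nat \<Rightarrow> real set" where
  "Lambda N = {of_int n / of_nat N ^ k | n k. True}"

definition dual_group :: "nat \<Rightarrow> (real \<Rightarrow> complex) monoid" where
  "dual_group N = \<lparr>
     carrier = {\<xi> \<in> extensional (Lambda N). (\<forall>x\<in>Lambda N. \<xi> x \<in> circle)
       \<and> (\<forall>x\<in>Lambda N. \<forall>y\<in>Lambda N. \<xi> (x + y) = \<xi> x * \<xi> y)},
     mult = (\<lambda>\<xi> \<psi>. \<lambda>x\<in>Lambda N. \<xi> x * \<psi> x),
     one = (\<lambda>x\<in>Lambda N. 1)\<rparr>"

text \<open>On the dual of a discrete group the compact-open topology is that of pointwise convergence.\<close>

definition dual_topology :: "nat \<Rightarrow> (real \<Rightarrow> complex) topology" where
  "dual_topology N =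
     subtopology (product_topology (\<lambda>_. euclidean) (Lambda N)) (carrier (dual_group N))"

definition compact_topological_group :: "'g monoid \<Rightarrow> 'g topology \<Rightarrow> bool" where
  "compact_topological_group G X \<longleftrightarrow> group G \<and> topspace X = carrier G
    \<and> compact_space X \<and> Hausdorff_space X
    \<and> continuous_map (prod_topology X X) X (\<lambda>(x, y). x \<otimes>\<^bsub>G\<^esub> y)
    \<and> continuous_map X X (\<lambda>x. inv\<^bsub>G\<^esub> x)"

definition gelfand_point ::
    "nat \<Rightarrow> 'a cstar \<Rightarrow> ((complex \<Rightarrow> complex) \<Rightarrow> 'a) \<Rightarrow> 'a \<Rightarrow> (real \<Rightarrow> complex) \<Rightarrow> 'a \<Rightarrow> complex" where
  "gelfand_point N A \<iota> U \<xi> = (THE \<omega>. \<omega> \<in> characters (abelian_part A \<iota> U) \<and>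
     (\<forall>n k. \<omega> (conj_power A \<iota> U k (circle_monomial n)) = \<xi> (of_int n / of_nat N ^ k)))"

text \<open>The Gelfand transform of an element, as a function on the dual group.\<close>

definition as_function ::
    "nat \<Rightarrow> 'a cstar \<Rightarrow> ((complex \<Rightarrow> complex) \<Rightarrow> 'a) \<Rightarrow> 'a \<Rightarrow> 'a \<Rightarrow> (real \<Rightarrow> complex) \<Rightarrow> complex" where
  "as_function N A \<iota> U a = (\<lambda>\<xi>. gelfand_point N A \<iota> U \<xi> a)"

definition efun :: "real \<Rightarrow> (real \<Rightarrow> complex) \<Rightarrow> complex" where
  "efun x = (\<lambda>\<xi>. \<xi> x)"

definition real_point :: "nat \<Rightarrow> real \<Rightarrow> real \<Rightarrow> complex" where
  "real_point N t = (\<lambda>x\<in>Lambda N. cis (x * t))"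


section \<open>Wavelet filters and the Ruelle operator\<close>

definition circle_measure :: "complex measure" where
  "circle_measure =
     distr (uniform_measure lborel {0..2 * pi}) (restrict_space borel circle) cis"

text \<open>Elements of $L^\infty$ and $L^1$ of the circle are represented by functions.\<close>

definition Linf :: "(complex \<Rightarrow> complex) set" where
  "Linf = {f \<in> borel_measurable circle_measure. \<exists>C. AE z in circle_measure. cmod (f z) \<le> C}"

definition wavelet_filter :: "nat \<Rightarrow> (complex \<Rightarrow> complex) \<Rightarrow> bool" where
  "wavelet_filter N m0 \<longleftrightarrow> m0 \<in> Linf
    \<and> (AE z in circle_measure. (\<Sum>k<N. (cmod (m0 (cis (2 * pi * real k / real N) * z)))\<^sup>2) = real N)
    \<and> (\<exists>\<epsilon>>0. continuous_on (circle \<inter> ball 1 \<epsilon>) m0)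
    \<and> m0 1 = of_real (sqrt (real N))"

definition nonsingular :: "(complex \<Rightarrow> complex) \<Rightarrow> bool" where
  "nonsingular m0 \<longleftrightarrow>
     \<not> (\<exists>S\<in>sets circle_measure. emeasure circle_measure S > 0 \<and> (\<forall>z\<in>S. m0 z = 0))"

definition ruelle :: "nat \<Rightarrow> (complex \<Rightarrow> complex) \<Rightarrow> (complex \<Rightarrow> complex) \<Rightarrow> complex \<Rightarrow> complex" where
  "ruelle N m0 f z =
     (1 / of_nat N) * (\<Sum>w | w ^ N = z. of_real ((cmod (m0 w))\<^sup>2) * f w)"

definition ruelle_harmonic :: "nat \<Rightarrow> (complex \<Rightarrow> complex) \<Rightarrow> (complex \<Rightarrow> real) \<Rightarrow> bool" where
  "ruelle_harmonic N m0 h \<longleftrightarrow> integrable circle_measure h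
    \<and> (AE z in circle_measure. h z \<ge> 0)
    \<and> (AE z in circle_measure. ruelle N m0 (\<lambda>w. of_real (h w)) z = of_real (h z))"

definition finite_borel_measure :: "'x topology \<Rightarrow> 'x measure \<Rightarrow> bool" where
  "finite_borel_measure X \<nu> \<longleftrightarrow> space \<nu> = topspace X
    \<and> sets \<nu> = sigma_sets (topspace X) {V. openin X V} \<and> finite_measure \<nu>"

definition filter_measure ::
    "nat \<Rightarrow> 'a cstar \<Rightarrow> ((complex \<Rightarrow> complex) \<Rightarrow> 'a) \<Rightarrow> 'a \<Rightarrow>
     (complex \<Rightarrow> complex) \<Rightarrow> (complex \<Rightarrow> real) \<Rightarrow> (real \<Rightarrow> complex) measure \<Rightarrow> bool" where
  "filter_measure N A \<iota> U m0 h \<nu> \<longleftrightarrow> finite_borel_measure (dual_topology N) \<nu>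
    \<and> (\<forall>f\<in>carrier continuous_circle. \<forall>i.
         (\<integral>\<xi>. as_function N A \<iota> U (conj_power A \<iota> U i f) \<xi> \<partial>\<nu>) =
         (\<integral>z. (ruelle N m0 ^^ i) (\<lambda>w. f w * of_real (h w)) z \<partial>circle_measure))"


section \<open>Hilbert spaces\<close>

text \<open>
  The fields for multiplication and unit, inherited from the library's record of modules, play no
  role. The inner product is conjugate linear in the first argument.
\<close>

record 'h hilbert = "(complex, 'h) module" +
  hinner :: "'h \<Rightarrow> 'h \<Rightarrow> complex"

definition hnorm :: "'h hilbert \<Rightarrow> 'h \<Rightarrow> real" where
  "hnorm H x = sqrt (Re (hinner H x x))"

locale hilbert_space =
  fixes H :: "'h hilbert" (structure)
  assumes complex_module: "module complex_ring H"
    and inner_add: "\<And>x y z. x \<in> carrier H \<Longrightarrow> y \<in> carrier H \<Longrightarrow> z \<in> carrier H \<Longrightarrow>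
      hinner H x (y \<oplus> z) = hinner H x y + hinner H x z"
    and inner_smult: "\<And>c x y. x \<in> carrier H \<Longrightarrow> y \<in> carrier H \<Longrightarrow>
      hinner H x (c \<odot> y) = c * hinner H x y"
    and inner_commute: "\<And>x y. x \<in> carrier H \<Longrightarrow> y \<in> carrier H \<Longrightarrow>
      hinner H y x = cnj (hinner H x y)"
    and inner_nonneg: "\<And>x. x \<in> carrier H \<Longrightarrow> Re (hinner H x x) \<ge> 0"
    and inner_eq_zero: "\<And>x. x \<in> carrier H \<Longrightarrow> hinner H x x = 0 \<longleftrightarrow> x = \<zero>"
    and complete: "\<And>X :: nat \<Rightarrow> 'h. (\<And>n. X n \<in> carrier H) \<Longrightarrow>
      (\<forall>\<epsilon>>0. \<exists>M. \<forall>m\<ge>M. \<forall>n\<ge>M. hnorm H (X m \<ominus> X n) < \<epsilon>) \<Longrightarrow>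
      \<exists>x\<in>carrier H. (\<lambda>n. hnorm H (X n \<ominus> x)) \<longlonglongrightarrow> 0"

definition linear_op :: "'h hilbert \<Rightarrow> 'k hilbert \<Rightarrow> ('h \<Rightarrow> 'k) \<Rightarrow> bool" where
  "linear_op H K T \<longleftrightarrow> T \<in> carrier H \<rightarrow> carrier K
    \<and> (\<forall>x\<in>carrier H. \<forall>y\<in>carrier H. T (x \<oplus>\<^bsub>H\<^esub> y) = T x \<oplus>\<^bsub>K\<^esub> T y)
    \<and> (\<forall>c. \<forall>x\<in>carrier H. T (c \<odot>\<^bsub>H\<^esub> x) = c \<odot>\<^bsub>K\<^esub> T x)"

definition bounded_op :: "'h hilbert \<Rightarrow> ('h \<Rightarrow> 'h) \<Rightarrow> bool" where
  "bounded_op H T \<longleftrightarrow> linear_op H H T \<and> (\<exists>C. \<forall>x\<in>carrier H. hnorm H (T x) \<le> C * hnorm H x)"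

definition unitary_op :: "'h hilbert \<Rightarrow> 'k hilbert \<Rightarrow> ('h \<Rightarrow> 'k) \<Rightarrow> bool" where
  "unitary_op H K T \<longleftrightarrow> linear_op H K T \<and> bij_betw T (carrier H) (carrier K)
    \<and> (\<forall>x\<in>carrier H. \<forall>y\<in>carrier H. hinner K (T x) (T y) = hinner H x y)"

definition linear_subspace :: "'h hilbert \<Rightarrow> 'h set \<Rightarrow> bool" where
  "linear_subspace H M \<longleftrightarrow> M \<subseteq> carrier H \<and> \<zero>\<^bsub>H\<^esub> \<in> M
    \<and> (\<forall>x\<in>M. \<forall>y\<in>M. x \<oplus>\<^bsub>H\<^esub> y \<in> M) \<and> (\<forall>c. \<forall>x\<in>M. c \<odot>\<^bsub>H\<^esub> x \<in> M)"

definition linear_span :: "'h hilbert \<Rightarrow> 'h set \<Rightarrow> 'h set" where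
  "linear_span H S = \<Inter>{M. linear_subspace H M \<and> S \<subseteq> M}"

definition dense_in :: "'h hilbert \<Rightarrow> 'h set \<Rightarrow> bool" where
  "dense_in H M \<longleftrightarrow> (\<forall>x\<in>carrier H. \<forall>\<epsilon>>0. \<exists>y\<in>M. hnorm H (x \<ominus>\<^bsub>H\<^esub> y) < \<epsilon>)"

text \<open>The space $L^2(\nu)$ consists of classes of square integrable functions modulo null functions.\<close>

definition L2_functions :: "'x measure \<Rightarrow> ('x \<Rightarrow> complex) set" where
  "L2_functions \<nu> = {f \<in> borel_measurable \<nu>. integrable \<nu> (\<lambda>x. (cmod (f x))\<^sup>2)}"

definition L2_class :: "'x measure \<Rightarrow> ('x \<Rightarrow> complex) \<Rightarrow> ('x \<Rightarrow> complex) set" where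
  "L2_class \<nu> f = {g \<in> L2_functions \<nu>. AE x in \<nu>. g x = f x}"

definition L2_rep :: "('x \<Rightarrow> complex) set \<Rightarrow> 'x \<Rightarrow> complex" where
  "L2_rep F = (SOME f. f \<in> F)"

definition L2_space :: "'x measure \<Rightarrow> ('x \<Rightarrow> complex) set hilbert" where
  "L2_space \<nu> = \<lparr>
     carrier = L2_class \<nu> ` L2_functions \<nu>,
     mult = undefined,
     one = undefined,
     zero = L2_class \<nu> (\<lambda>_. 0),
     add = (\<lambda>F G. L2_class \<nu> (\<lambda>x. L2_rep F x + L2_rep G x)),
     smult = (\<lambda>c F. L2_class \<nu> (\<lambda>x. c * L2_rep F x)),
     hinner = (\<lambda>F G. \<integral>x. cnj (L2_rep F x) * L2_rep G x \<partial>\<nu>)\<rparr>"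


section \<open>Representations\<close>

definition Linf_representation ::
    "'h hilbert \<Rightarrow> ((complex \<Rightarrow> complex) \<Rightarrow> 'h \<Rightarrow> 'h) \<Rightarrow> bool" where
  "Linf_representation H \<pi> \<longleftrightarrow>
      (\<forall>f\<in>Linf. bounded_op H (\<pi> f))
    \<and> (\<forall>f\<in>Linf. \<forall>g\<in>Linf. (AE z in circle_measure. f z = g z) \<longrightarrow>
         (\<forall>x\<in>carrier H. \<pi> f x = \<pi> g x))
    \<and> (\<forall>f\<in>Linf. \<forall>g\<in>Linf. \<forall>x\<in>carrier H.
         \<pi> (\<lambda>z. f z + g z) x = \<pi> f x \<oplus>\<^bsub>H\<^esub> \<pi> g x \<and> \<pi> (\<lambda>z. f z * g z) x = \<pi> f (\<pi> g x))
    \<and> (\<forall>c. \<forall>f\<in>Linf. \<forall>x\<in>carrier H. \<pi> (\<lambda>z. c * f z) x = c \<odot>\<^bsub>H\<^esub> \<pi> f x)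
    \<and> (\<forall>x\<in>carrier H. \<pi> (\<lambda>z. 1) x = x)
    \<and> (\<forall>f\<in>Linf. \<forall>x\<in>carrier H. \<forall>y\<in>carrier H.
         hinner H (\<pi> (\<lambda>z. cnj (f z)) x) y = hinner H x (\<pi> f y))"

definition representation ::
    "nat \<Rightarrow> 'h hilbert \<Rightarrow> ((complex \<Rightarrow> complex) \<Rightarrow> 'h \<Rightarrow> 'h) \<Rightarrow> ('h \<Rightarrow> 'h) \<Rightarrow> bool" where
  "representation N H \<pi> V \<longleftrightarrow> hilbert_space H \<and> Linf_representation H \<pi> \<and> unitary_op H H V
    \<and> (\<forall>f\<in>Linf. \<forall>x\<in>carrier H.
         V (\<pi> f (inv_into (carrier H) V x)) = \<pi> (\<lambda>z. f (z ^ N)) x)"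

definition cyclic_vector ::
    "'h hilbert \<Rightarrow> ((complex \<Rightarrow> complex) \<Rightarrow> 'h \<Rightarrow> 'h) \<Rightarrow> ('h \<Rightarrow> 'h) \<Rightarrow> 'h \<Rightarrow> bool" where
  "cyclic_vector H \<pi> V \<phi> \<longleftrightarrow> \<phi> \<in> carrier H
    \<and> dense_in H (\<Inter>{M. linear_subspace H M \<and> \<phi> \<in> M
         \<and> (\<forall>f\<in>Linf. \<forall>x\<in>M. \<pi> f x \<in> M) \<and> (\<forall>x\<in>M. V x \<in> M \<and> inv_into (carrier H) V x \<in> M)})"

definition corresponding_representation ::
    "nat \<Rightarrow> (complex \<Rightarrow> complex) \<Rightarrow> (complex \<Rightarrow> real) \<Rightarrow>
     'h hilbert \<Rightarrow> ((complex \<Rightarrow> complex) \<Rightarrow> 'h \<Rightarrow> 'h) \<Rightarrow> ('h \<Rightarrow> 'h) \<Rightarrow> 'h \<Rightarrow> bool" where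
  "corresponding_representation N m0 h H \<pi> V \<phi> \<longleftrightarrow>
      representation N H \<pi> V \<and> cyclic_vector H \<pi> V \<phi>
    \<and> (\<forall>f\<in>Linf. hinner H \<phi> (\<pi> f \<phi>) = (\<integral>z. f z * of_real (h z) \<partial>circle_measure))
    \<and> V \<phi> = \<pi> m0 \<phi>"

definition unitarily_equivalent ::
    "'h hilbert \<Rightarrow> ((complex \<Rightarrow> complex) \<Rightarrow> 'h \<Rightarrow> 'h) \<Rightarrow> ('h \<Rightarrow> 'h) \<Rightarrow> 'h \<Rightarrow>
     'k hilbert \<Rightarrow> ((complex \<Rightarrow> complex) \<Rightarrow> 'k \<Rightarrow> 'k) \<Rightarrow> ('k \<Rightarrow> 'k) \<Rightarrow> 'k \<Rightarrow> bool" where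
  "unitarily_equivalent H \<pi> V \<phi> K \<rho> W \<psi> \<longleftrightarrow>
     (\<exists>T. unitary_op H K T \<and> T \<phi> = \<psi>
       \<and> (\<forall>x\<in>carrier H. T (V x) = W (T x))
       \<and> (\<forall>f\<in>Linf. \<forall>x\<in>carrier H. T (\<pi> f x) = \<rho> f (T x)))"

definition fourier_coeff :: "(complex \<Rightarrow> complex) \<Rightarrow> int \<Rightarrow> complex" where
  "fourier_coeff f j = (\<integral>z. f z * z powi (- j) \<partial>circle_measure)"

definition circle_times_efun ::
    "(real \<Rightarrow> complex) measure \<Rightarrow> (complex \<Rightarrow> complex) \<Rightarrow> real \<Rightarrow> ((real \<Rightarrow> complex) \<Rightarrow> complex) set" where
  "circle_times_efun \<nu> m x = L2_class \<nu> (\<lambda>\<xi>. m (\<xi> 1) * efun x \<xi>)"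

text \<open>
  The formal series $\sum_j a_j e(j+x)$ need not converge in $L^2(\nu)$ when $h$ is unbounded. It
  stands for the product of $e(x)$ with the essentially bounded function whose Fourier coefficients
  are the $a_j$ (this function is determined up to null sets).
\<close>

definition has_fourier_expansion ::
    "(real \<Rightarrow> complex) measure \<Rightarrow> ((real \<Rightarrow> complex) \<Rightarrow> complex) set \<Rightarrow> (int \<Rightarrow> complex) \<Rightarrow> real \<Rightarrow> bool" where
  "has_fourier_expansion \<nu> v a x \<longleftrightarrow>
     (\<exists>m\<in>Linf. (\<forall>j. fourier_coeff m j = a j) \<and> v = circle_times_efun \<nu> m x)"

end

theory Submission
  imports Defs "HOL-Probability.Projective_Limit"
begin

text \<open>
  Everything is read off from the coordinates \<open>\<xi>(N\<^sup>-\<^sup>k)\<close> of a point \<open>\<xi>\<close> of the dual group. Since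
  \<open>\<Lambda>\<close> is the union of the cyclic groups generated by \<open>N\<^sup>-\<^sup>k\<close>, these coordinates identify the dual group
  with the solenoid, the space of sequences in the circle in which every term is the \<open>N\<close>-th power of
  the next one.

  The Gelfand space. The elements \<open>\<rho>\<^sub>k(f) = U\<^sup>-\<^sup>k f U\<^sup>k\<close> satisfy \<open>\<rho>\<^sub>k(f) = \<rho>\<^sub>k\<^sub>+\<^sub>1(f(z\<^sup>N))\<close>, so they lie in an
  increasing sequence of commutative algebras and the subalgebra generated by them is commutative
  (\<open>gen_commutative\<close>). A character restricted to the \<open>k\<close>-th of these algebras is evaluation at the
  point \<open>z\<^sub>k = \<omega>(\<rho>\<^sub>k(e\<^sub>1))\<close> of the circle (\<open>character_value\<close>), and \<open>z\<^sub>k\<^sub>+\<^sub>1\<^sup>N = z\<^sub>k\<close>; so a character is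
  determined by a point of the solenoid. Every point \<open>\<xi>\<close> occurs, and this is where universality is
  used. On \<open>\<ell>\<^sup>2\<close> of the integers let \<open>f\<close> act by multiplication by \<open>f(\<xi>(N\<^sup>j))\<close> and \<open>U\<close> by the bilateral
  shift (\<open>orbit_covariant\<close>). In the resulting representation of the algebra the basis vector with index
  0 is a joint eigenvector of the abelian subalgebra, and its eigenvalue is the character sought
  (\<open>character_from_orbit\<close>). A continuous bijection between compact Hausdorff spaces is a homeomorphism
  (\<open>gelfand_homeomorphism\<close>). The facts on C*-algebras used here are the Neumann series, which makes
  characters contractive, the C*-algebra of operators on a Hilbert space, and the contractivity of
  homomorphisms into it (\<open>operator_hom_contractive\<close>).

  The measure. The transform of \<open>\<rho>\<^sub>k(f)\<close> is \<open>f(\<xi>(N\<^sup>-\<^sup>k))\<close>, so the required identities prescribe the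
  distribution of each coordinate. The transpose of the Ruelle operator is \<open>F \<mapsto> |m\<^sub>0|\<^sup>2 F(z\<^sup>N)\<close>; hence
  the \<open>k\<close>-th coordinate must have density \<open>h(z) \<Prod>\<^sub>j\<^sub><\<^sub>k |m\<^sub>0(z\<^sup>N\<^sup>^\<^sup>j)|\<^sup>2\<close> with respect to Haar measure
  (\<open>filter_measure_iff\<close>). The equation \<open>R h = h\<close> says that the \<open>N\<close>-th power map carries each of these
  distributions to the previous one (\<open>law_Suc\<close>), so by Kolmogorov's theorem they come from a unique
  measure on the solenoid (\<open>dual_measure_exists\<close>, \<open>dual_measure_eqI\<close>).

  The representation. Comparing distributions of coordinates shows that the shift \<open>\<xi> \<mapsto> \<xi>(N \<cdot>)\<close>
  carries the measure \<open>|m\<^sub>0(\<xi>(1))|\<^sup>2 d\<nu>\<close> to \<open>d\<nu>\<close> (\<open>shift_quasi_invariant\<close>). Consequently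
  \<open>V F = m\<^sub>0(\<xi>(1)) F(\<xi>(N \<cdot>))\<close> is isometric; it is onto because \<open>m\<^sub>0\<close> vanishes almost nowhere
  (\<open>weighted_shift_surj\<close>). With \<open>\<pi>(f)\<close> acting as multiplication by \<open>f(\<xi>(1))\<close> all formulas are
  computations, and \<open>1\<close> is cyclic since an invariant subspace containing it contains all \<open>e(\<lambda>)\<close>
  (\<open>one_cyclic\<close>), whose span is dense (\<open>exponentials_dense\<close>). Finally, in any representation
  corresponding to \<open>(m\<^sub>0, h)\<close> the vectors \<open>V\<^sup>-\<^sup>k \<pi>(f) \<phi>\<close> form a dense subspace, and their inner products
  are integrals over the circle in which only \<open>m\<^sub>0\<close> and \<open>h\<close> enter (\<open>vec_inner\<close>); so two such
  representations are unitarily equivalent (\<open>corresponding_representation_unique\<close>).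
\<close>

section \<open>Limits, subalgebras and Neumann series in C*-algebras\<close>

lemma (in abelian_group) minus_eq_zero_imp_eq:
  assumes "x \<ominus> y = \<zero>" "x \<in> carrier G" "y \<in> carrier G"
  shows "x = y"
proof -
  have "x = (x \<ominus> y) \<oplus> y" using assms(2,3) by (simp add: a_minus_def a_assoc l_neg)
  then show ?thesis using assms by simp
qed

lemma (in abelian_group) minus_self: "x \<in> carrier G \<Longrightarrow> x \<ominus> x = \<zero>"
  by (simp add: a_minus_def r_neg)

lemma (in abelian_group) add_minus_add:
  assumes "a \<in> carrier G" "b \<in> carrier G" "c \<in> carrier G" "d \<in> carrier G"
  shows "(a \<oplus> b) \<ominus> (c \<oplus> d) = (a \<ominus> c) \<oplus> (b \<ominus> d)"
  using assms by (simp add: a_minus_def minus_add a_ac)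

lemma complex_ring_simps [simp]:
  "carrier complex_ring = UNIV" "x \<oplus>\<^bsub>complex_ring\<^esub> y = x + y" "x \<otimes>\<^bsub>complex_ring\<^esub> y = x * y"
  "\<one>\<^bsub>complex_ring\<^esub> = 1" "\<zero>\<^bsub>complex_ring\<^esub> = 0"
  by (auto simp: complex_ring_def)

lemma cring_complex_ring: "cring complex_ring"
proof (rule cringI)
  show "abelian_group complex_ring"
    by (rule abelian_groupI) (auto simp: algebra_simps intro: exI[of _ "- x" for x])
  show "Group.comm_monoid complex_ring"
    by (rule comm_monoidI) auto
qed (auto simp: algebra_simps)

lemma complex_ring_minus [simp]: "\<ominus>\<^bsub>complex_ring\<^esub> x = - x"
proof -
  interpret cring complex_ring by (rule cring_complex_ring)
  show ?thesis by (rule minus_equality) auto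
qed

sublocale cstar_algebra \<subseteq> ring A by (rule ring)
sublocale cstar_algebra \<subseteq> mod: module complex_ring A by (rule complex_module)

context cstar_algebra
begin

lemma smult_one_c: "a \<in> carrier A \<Longrightarrow> 1 \<odot> a = a"
  using mod.smult_one[of a] by simp

lemma minus_eq_smult: "a \<in> carrier A \<Longrightarrow> b \<in> carrier A \<Longrightarrow> a \<ominus> b = a \<oplus> (-1) \<odot> b"
  using mod.smult_l_minus[of 1 b] smult_one_c[of b] by (simp add: a_minus_def)

lemma cnorm_neg: "a \<in> carrier A \<Longrightarrow> cstar_norm A (\<ominus> a) = cstar_norm A a"
  using mod.smult_l_minus[of 1 a] norm_smult[of a "-1"] smult_one_c[of a] by simp

lemma cnorm_zero [simp]: "cstar_norm A \<zero> = 0"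
  using norm_eq_zero by simp

lemma cnorm_minus_triangle:
  assumes "a \<in> carrier A" "b \<in> carrier A" "c \<in> carrier A"
  shows "cstar_norm A (a \<ominus> c) \<le> cstar_norm A (a \<ominus> b) + cstar_norm A (b \<ominus> c)"
proof -
  have "a \<ominus> c = (a \<ominus> b) \<oplus> (b \<ominus> c)" using assms
    by (simp add: a_minus_def a_assoc r_neg1)
  then show ?thesis using norm_triangle[of "a \<ominus> b" "b \<ominus> c"] assms by simp
qed

lemma cnorm_minus_commute:
  assumes "a \<in> carrier A" "b \<in> carrier A"
  shows "cstar_norm A (a \<ominus> b) = cstar_norm A (b \<ominus> a)"
proof -
  have "b \<ominus> a = \<ominus> (a \<ominus> b)" using assms by (simp add: a_minus_def minus_add a_comm)
  then show ?thesis using cnorm_neg[of "a \<ominus> b"] assms by simp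
qed

lemma cnorm_star: 
  assumes a: "a \<in> carrier A"
  shows "cstar_norm A (cstar_star A a) = cstar_norm A a"
proof -
  have le: "cstar_norm A b \<le> cstar_norm A (cstar_star A b)" if "b \<in> carrier A" for b
  proof (cases "cstar_norm A b = 0")
    case True then show ?thesis using norm_nonneg star_closed that by simp
  next
    case False
    have "cstar_norm A b * cstar_norm A b \<le> cstar_norm A (cstar_star A b) * cstar_norm A b"
      using cstar_identity[OF that] norm_mult[OF star_closed[OF that] that]
      by (simp add: power2_eq_square)
    then show ?thesis using False norm_nonneg[OF that] by simp
  qed
  show ?thesis using le[OF a] le[OF star_closed[OF a]] star_star[OF a] by simp
qed

lemma star_one: "cstar_star A \<one> = \<one>"
proof -
  have "cstar_star A \<one> = cstar_star A \<one> \<otimes> cstar_star A (cstar_star A \<one>)"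
    by (simp add: star_closed star_star)
  also have "\<dots> = cstar_star A (cstar_star A \<one> \<otimes> \<one>)" 
    using star_mult[of "cstar_star A \<one>" \<one>] star_closed by simp
  also have "\<dots> = \<one>" by (simp add: star_closed star_star)
  finally show ?thesis .
qed

lemma cnorm_one: "\<one> \<noteq> \<zero> \<Longrightarrow> cstar_norm A \<one> = 1"
  using cstar_identity[of \<one>] norm_eq_zero[of \<one>] by (simp add: star_one power2_eq_square)

lemma star_minus:
  "a \<in> carrier A \<Longrightarrow> b \<in> carrier A \<Longrightarrow> cstar_star A (a \<ominus> b) = cstar_star A a \<ominus> cstar_star A b"
  by (simp add: minus_eq_smult star_add star_smult star_closed)

lemma mult_minus_left:
  assumes "a \<in> carrier A" "b \<in> carrier A" "c \<in> carrier A"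
  shows "a \<otimes> c \<ominus> b \<otimes> c = (a \<ominus> b) \<otimes> c"
  using assms by (simp add: a_minus_def l_distr l_minus)

lemma mult_minus_right:
  assumes "a \<in> carrier A" "b \<in> carrier A" "c \<in> carrier A"
  shows "c \<otimes> a \<ominus> c \<otimes> b = c \<otimes> (a \<ominus> b)"
  using assms by (simp add: a_minus_def r_distr r_minus)

lemma clim_mult_right:
  assumes "\<And>n. X n \<in> carrier A" "x \<in> carrier A" "c \<in> carrier A"
    and "(\<lambda>n. cstar_norm A (X n \<ominus> x)) \<longlonglongrightarrow> 0"
  shows "(\<lambda>n. cstar_norm A (X n \<otimes> c \<ominus> x \<otimes> c)) \<longlonglongrightarrow> 0"
proof (rule tendsto_sandwich[OF _ _ tendsto_const])
  show "(\<lambda>n. cstar_norm A (X n \<ominus> x) * cstar_norm A c) \<longlonglongrightarrow> 0"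
    using tendsto_mult[OF assms(4) tendsto_const] by simp
qed (use assms norm_nonneg in \<open>auto simp: mult_minus_left intro!: always_eventually norm_mult\<close>)

lemma clim_mult_left:
  assumes "\<And>n. X n \<in> carrier A" "x \<in> carrier A" "c \<in> carrier A"
    and "(\<lambda>n. cstar_norm A (X n \<ominus> x)) \<longlonglongrightarrow> 0"
  shows "(\<lambda>n. cstar_norm A (c \<otimes> X n \<ominus> c \<otimes> x)) \<longlonglongrightarrow> 0"
proof (rule tendsto_sandwich[OF _ _ tendsto_const])
  show "(\<lambda>n. cstar_norm A c * cstar_norm A (X n \<ominus> x)) \<longlonglongrightarrow> 0"
    using tendsto_mult[OF tendsto_const assms(4)] by simp
qed (use assms norm_nonneg in \<open>auto simp: mult_minus_right intro!: always_eventually norm_mult\<close>)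

lemma clim_star:
  assumes "\<And>n. X n \<in> carrier A" "x \<in> carrier A"
    and "(\<lambda>n. cstar_norm A (X n \<ominus> x)) \<longlonglongrightarrow> 0"
  shows "(\<lambda>n. cstar_norm A (cstar_star A (X n) \<ominus> cstar_star A x)) \<longlonglongrightarrow> 0"
  using assms by (simp add: star_minus[symmetric] cnorm_star)

lemma clim_unique:
  assumes "\<And>n. X n \<in> carrier A" "x \<in> carrier A" "y \<in> carrier A"
    and "(\<lambda>n. cstar_norm A (X n \<ominus> x)) \<longlonglongrightarrow> 0" "(\<lambda>n. cstar_norm A (X n \<ominus> y)) \<longlonglongrightarrow> 0"
  shows "x = y"
proof -
  have "(\<lambda>n. cstar_norm A (X n \<ominus> x) + cstar_norm A (X n \<ominus> y)) \<longlonglongrightarrow> 0 + 0"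
    by (intro tendsto_add assms)
  moreover have "cstar_norm A (x \<ominus> y) \<le> cstar_norm A (X n \<ominus> x) + cstar_norm A (X n \<ominus> y)" for n
    using cnorm_minus_triangle[of x "X n" y] cnorm_minus_commute[of x "X n"] assms by simp
  ultimately have "cstar_norm A (x \<ominus> y) \<le> 0"
    by (intro LIMSEQ_le_const) auto
  then have "x \<ominus> y = \<zero>" using norm_nonneg[of "x \<ominus> y"] norm_eq_zero[of "x \<ominus> y"] assms by simp
  then show ?thesis using assms minus_eq_zero_imp_eq by blast
qed

lemma subalgebra_carrier: "cstar_subalgebra A (carrier A)"
  by (auto simp: cstar_subalgebra_def star_closed)

lemma generated_subalgebra:
  assumes "S \<subseteq> carrier A" shows "cstar_subalgebra A (cstar_generated A S)"
proof -
  have 1: "cstar_generated A S \<subseteq> B" if "cstar_subalgebra A B" "S \<subseteq> B" for B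
    using that by (auto simp: cstar_generated_def)
  have 2: "cstar_generated A S \<subseteq> carrier A" using 1[OF subalgebra_carrier assms] .
  show ?thesis unfolding cstar_subalgebra_def
  proof (intro conjI ballI allI impI)
    fix X :: "nat \<Rightarrow> 'a" and x assume *: "x \<in> carrier A" "\<forall>n. X n \<in> cstar_generated A S"
      "(\<lambda>n. cstar_norm A (X n \<ominus> x)) \<longlonglongrightarrow> 0"
    show "x \<in> cstar_generated A S" unfolding cstar_generated_def
    proof safe
      fix B assume B: "cstar_subalgebra A B" "S \<subseteq> B"
      then have "\<forall>n. X n \<in> B" using * 1 by blast
      then show "x \<in> B" using B * unfolding cstar_subalgebra_def by blast
    qed
  qed (use 2 in \<open>auto simp: cstar_generated_def cstar_subalgebra_def\<close>)
qed

text \<open>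
  The partial sums satisfy \<open>s\<^sub>n\<^sub>+\<^sub>1 = 1 + a s\<^sub>n\<close>. Working inside a closed subalgebra makes the lemma
  applicable to characters of a subalgebra.
\<close>

lemma neumann_inverse:
  assumes B: "cstar_subalgebra A B" "\<one> \<in> B" and a: "a \<in> B" and small: "cstar_norm A a < 1"
  shows "\<exists>b\<in>B. (\<one> \<ominus> a) \<otimes> b = \<one>"
proof -
  have BA: "B \<subseteq> carrier A" and Badd: "\<And>x y. x \<in> B \<Longrightarrow> y \<in> B \<Longrightarrow> x \<oplus> y \<in> B"
    and Bmul: "\<And>x y. x \<in> B \<Longrightarrow> y \<in> B \<Longrightarrow> x \<otimes> y \<in> B"
    and Bz: "\<zero> \<in> B"
    and Bcl: "\<And>X x. x \<in> carrier A \<Longrightarrow> (\<And>n::nat. X n \<in> B) \<Longrightarrow>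
      (\<lambda>n. cstar_norm A (X n \<ominus> x)) \<longlonglongrightarrow> 0 \<Longrightarrow> x \<in> B"
    using B(1) unfolding cstar_subalgebra_def by blast+
  have aA: "a \<in> carrier A" using a BA by auto
  define r where "r = cstar_norm A a"
  have r: "0 \<le> r" "r < 1" using small norm_nonneg[OF aA] by (auto simp: r_def)
  define s where "s = rec_nat \<zero> (\<lambda>_ x. \<one> \<oplus> a \<otimes> x)"
  have s0: "s 0 = \<zero>" and sS: "s (Suc n) = \<one> \<oplus> a \<otimes> s n" for n by (simp_all add: s_def)
  have sB: "s n \<in> B" for n by (induction n) (auto simp: s0 sS Bz intro!: Badd Bmul B(2) a)
  have sA: "s n \<in> carrier A" for n using sB BA by blast
  define C where "C = cstar_norm A \<one>"
  have C: "C \<ge> 0" by (simp add: C_def norm_nonneg)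
  have step: "cstar_norm A (s (Suc n) \<ominus> s n) \<le> C * r ^ n" for n
  proof (induction n)
    case 0
    show ?case by (simp add: s0 sS aA C_def a_minus_def)
  next
    case (Suc n)
    have "s (Suc (Suc n)) \<ominus> s (Suc n) = a \<otimes> (s (Suc n) \<ominus> s n)"
      using aA sA add_minus_add[of \<one> "a \<otimes> s (Suc n)" \<one> "a \<otimes> s n"]
      by (simp only: sS[of "Suc n"] sS[of n]) (simp add: mult_minus_right minus_self)
    then have "cstar_norm A (s (Suc (Suc n)) \<ominus> s (Suc n)) \<le> r * cstar_norm A (s (Suc n) \<ominus> s n)"
      using norm_mult[of a "s (Suc n) \<ominus> s n"] aA sA by (simp add: r_def)
    also have "\<dots> \<le> r * (C * r ^ n)" using Suc r by (intro mult_left_mono) auto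
    finally show ?case by (simp add: mult_ac)
  qed
  have tail: "cstar_norm A (s (n + d) \<ominus> s n) \<le> C * r ^ n * (\<Sum>i<d. r ^ i)" for n d
  proof (induction d)
    case 0 then show ?case using sA by (simp add: a_minus_def r_neg)
  next
    case (Suc d)
    have "cstar_norm A (s (n + Suc d) \<ominus> s n) 
        \<le> cstar_norm A (s (Suc (n + d)) \<ominus> s (n + d)) + cstar_norm A (s (n + d) \<ominus> s n)"
      using cnorm_minus_triangle sA by simp
    also have "\<dots> \<le> C * r ^ (n + d) + C * r ^ n * (\<Sum>i<d. r ^ i)"
      using Suc step by (intro add_mono) auto
    finally show ?case by (simp add: algebra_simps power_add)
  qed
  have tail2: "cstar_norm A (s m \<ominus> s n) \<le> C / (1 - r) * r ^ n" if "n \<le> m" for m n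
  proof -
    have "(\<Sum>i<m - n. r ^ i) \<le> 1 / (1 - r)"
      using sum_gp_strict[of r "m - n"] r by (simp add: divide_right_mono)
    then have "C * r ^ n * (\<Sum>i<m - n. r ^ i) \<le> C * r ^ n * (1 / (1 - r))"
      using C r by (intro mult_left_mono) auto
    then show ?thesis using tail[of n "m - n"] that by (simp add: mult_ac)
  qed
  have lim0: "(\<lambda>n. C / (1 - r) * r ^ n) \<longlonglongrightarrow> 0"
    using tendsto_mult[OF tendsto_const LIMSEQ_power_zero[of r]] r by simp
  have "\<forall>\<epsilon>>0. \<exists>M. \<forall>m\<ge>M. \<forall>n\<ge>M. cstar_norm A (s m \<ominus> s n) < \<epsilon>"
  proof (intro allI impI)
    fix \<epsilon> :: real assume "\<epsilon> > 0"
    then obtain M where M: "\<And>n. n \<ge> M \<Longrightarrow> C / (1 - r) * r ^ n < \<epsilon>"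
      using order_tendstoD(2)[OF lim0] by (auto simp: eventually_sequentially)
    show "\<exists>M. \<forall>m\<ge>M. \<forall>n\<ge>M. cstar_norm A (s m \<ominus> s n) < \<epsilon>"
    proof (intro exI[of _ M] allI impI)
      fix m n assume mn: "M \<le> m" "M \<le> n"
      show "cstar_norm A (s m \<ominus> s n) < \<epsilon>"
      proof (cases "n \<le> m")
        case True then show ?thesis using tail2[of n m] M[of n] mn by linarith
      next
        case False then show ?thesis using tail2[of m n] M[of m] mn
          cnorm_minus_commute[OF sA sA, of m n] by simp
      qed
    qed
  qed
  then obtain b where b: "b \<in> carrier A" and lim: "(\<lambda>n. cstar_norm A (s n \<ominus> b)) \<longlonglongrightarrow> 0"
    using complete sA by blast
  have bB: "b \<in> B" using Bcl b sB lim by blast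
  have "(\<lambda>n. cstar_norm A (s (Suc n) \<ominus> (\<one> \<oplus> a \<otimes> b))) \<longlonglongrightarrow> 0"
    using clim_mult_left[OF sA b aA lim] aA b sA
    by (simp add: sS add_minus_add) (simp add: a_minus_def r_neg)
  moreover have "(\<lambda>n. cstar_norm A (s (Suc n) \<ominus> b)) \<longlonglongrightarrow> 0"
    using lim by (rule LIMSEQ_Suc)
  ultimately have eq: "\<one> \<oplus> a \<otimes> b = b" using aA b sA clim_unique[of "\<lambda>n. s (Suc n)"] by simp
  have "(\<one> \<ominus> a) \<otimes> b = b \<ominus> a \<otimes> b" using aA b mult_minus_left[of \<one> a b] by simp
  also have "\<dots> = \<one> \<oplus> a \<otimes> b \<ominus> a \<otimes> b" using eq by simp
  also have "\<dots> = \<one>" using aA b by (simp add: a_minus_def a_assoc r_neg)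
  finally show ?thesis using bB by blast
qed

text \<open>
  If \<open>\<omega> a = 1\<close> and \<open>\<parallel>a\<parallel> < 1\<close>, then \<open>\<omega>\<close> annihilates the invertible element \<open>1 - a\<close>.
\<close>

lemma multiplicative_functional_bound:
  assumes B: "cstar_subalgebra A B" "\<one> \<in> B" 
    and add: "\<And>a b. a \<in> B \<Longrightarrow> b \<in> B \<Longrightarrow> \<omega> (a \<oplus> b) = \<omega> a + \<omega> b"
    and mul: "\<And>a b. a \<in> B \<Longrightarrow> b \<in> B \<Longrightarrow> \<omega> (a \<otimes> b) = \<omega> a * \<omega> b"
    and smul: "\<And>c a. a \<in> B \<Longrightarrow> \<omega> (c \<odot> a) = c * (\<omega> a :: complex)"
    and a: "a \<in> B"
  shows "cmod (\<omega> a) \<le> cstar_norm A a"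
proof (rule ccontr)
  assume less: "\<not> cmod (\<omega> a) \<le> cstar_norm A a"
  have BA: "B \<subseteq> carrier A" and Bsm: "\<And>c x. x \<in> B \<Longrightarrow> c \<odot> x \<in> B"
    and Badd: "\<And>x y. x \<in> B \<Longrightarrow> y \<in> B \<Longrightarrow> x \<oplus> y \<in> B"
    using B(1) unfolding cstar_subalgebra_def by blast+
  have aA: "a \<in> carrier A" using a BA by auto
  have nz: "\<omega> a \<noteq> 0" using less norm_nonneg[OF aA] by auto
  have one: "\<omega> \<one> = 1" using mul[OF B(2) a] nz aA by simp
  define b where "b = (1 / \<omega> a) \<odot> a"
  have b: "b \<in> B" "\<omega> b = 1" using a nz by (auto simp: b_def Bsm smul)
  have "cstar_norm A b < 1" using less nz aA by (simp add: b_def norm_smult norm_divide field_simps)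
  then obtain c where c: "c \<in> B" "(\<one> \<ominus> b) \<otimes> c = \<one>" using neumann_inverse[OF B b(1)] by blast
  have *: "\<one> \<ominus> b = \<one> \<oplus> (-1) \<odot> b" using b BA by (auto intro: minus_eq_smult)
  have "\<omega> (\<one> \<ominus> b) = 0" using b B(2) by (simp add: * add smul Bsm one)
  moreover have "\<omega> ((\<one> \<ominus> b) \<otimes> c) = \<omega> (\<one> \<ominus> b) * \<omega> c"
    using c b B(2) by (intro mul) (auto simp: * intro!: Badd Bsm)
  ultimately show False using c one by simp
qed

end

section \<open>Hilbert spaces\<close>

sublocale hilbert_space \<subseteq> abelian_group H
  using complex_module by (simp add: module_def)
sublocale hilbert_space \<subseteq> mod: module complex_ring H by (rule complex_module)

context hilbert_space
begin

lemma smult_closed_h [simp, intro]: "x \<in> carrier H \<Longrightarrow> c \<odot> x \<in> carrier H"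
  by (rule mod.smult_closed) auto

lemma smult_one_c: "a \<in> carrier H \<Longrightarrow> 1 \<odot> a = a"
  using mod.smult_one[of a] by simp

lemma minus_eq_smult: "a \<in> carrier H \<Longrightarrow> b \<in> carrier H \<Longrightarrow> a \<ominus> b = a \<oplus> (-1) \<odot> b"
  using mod.smult_l_minus[of 1 b] smult_one_c[of b] by (simp add: a_minus_def)

lemma inner_add_left:
  assumes "x \<in> carrier H" "y \<in> carrier H" "z \<in> carrier H"
  shows "hinner H (x \<oplus> y) z = hinner H x z + hinner H y z"
  using assms inner_commute[of z "x \<oplus> y"] inner_commute[of z x] inner_commute[of z y]
  by (simp add: inner_add)

lemma inner_smult_left:
  assumes "x \<in> carrier H" "y \<in> carrier H" 
  shows "hinner H (c \<odot> x) y = cnj c * hinner H x y"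
  using assms inner_commute[of y "c \<odot> x"] inner_commute[of y x] by (simp add: inner_smult)

lemma inner_minus:
  assumes "x \<in> carrier H" "y \<in> carrier H" "z \<in> carrier H"
  shows "hinner H x (y \<ominus> z) = hinner H x y - hinner H x z"
  using assms by (simp add: minus_eq_smult inner_add inner_smult)

lemma inner_minus_left:
  assumes "x \<in> carrier H" "y \<in> carrier H" "z \<in> carrier H"
  shows "hinner H (x \<ominus> y) z = hinner H x z - hinner H y z"
  using assms by (simp add: minus_eq_smult inner_add_left inner_smult_left)

lemmas inner_simps = inner_add inner_smult inner_add_left inner_smult_left inner_minus inner_minus_left

lemma inner_self: "x \<in> carrier H \<Longrightarrow> hinner H x x = of_real ((hnorm H x)\<^sup>2)"
  using inner_commute[of x x] inner_nonneg[of x] by (simp add: hnorm_def complex_eq_iff)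

lemma hnorm_nonneg [simp]: "x \<in> carrier H \<Longrightarrow> hnorm H x \<ge> 0"
  using inner_nonneg by (simp add: hnorm_def)

lemma hnorm_eq_zero: "x \<in> carrier H \<Longrightarrow> hnorm H x = 0 \<longleftrightarrow> x = \<zero>"
  using inner_eq_zero[of x] inner_self[of x] by auto

lemma hnorm_zero [simp]: "hnorm H \<zero> = 0" using hnorm_eq_zero by simp

lemma hnorm_smult: 
  assumes "x \<in> carrier H" shows "hnorm H (c \<odot> x) = cmod c * hnorm H x"
proof -
  have "hinner H (c \<odot> x) (c \<odot> x) = (c * cnj c) * hinner H x x"
    using assms by (simp add: inner_smult inner_smult_left)
  also have "\<dots> = of_real ((cmod c * hnorm H x)\<^sup>2)"
    using assms complex_norm_square[of c] by (simp add: inner_self power_mult_distrib)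
  finally show ?thesis using assms by (simp add: hnorm_def[of H "c \<odot> x"] del: of_real_power)
qed

lemma cauchy_schwarz:
  assumes x: "x \<in> carrier H" and y: "y \<in> carrier H"
  shows "cmod (hinner H x y) \<le> hnorm H x * hnorm H y"
proof (cases "hnorm H y = 0")
  case True
  then have "y = \<zero>" using hnorm_eq_zero y by simp
  then have "y = 0 \<odot> y" using y by simp
  then have "hinner H x y = 0" using inner_smult[OF x y, of 0] by simp
  then show ?thesis using x y by simp
next
  case False
  define p where "p = hinner H x y"
  define s where "s = (hnorm H y)\<^sup>2"
  have s: "s > 0" using False by (simp add: s_def)
  have yx: "hinner H y x = cnj p" using inner_commute[OF x y] by (simp add: p_def)
  \<comment> \<open>\<open>?w\<close> is \<open>\<parallel>y\<parallel>\<^sup>2\<close> times the component of \<open>x\<close> orthogonal to \<open>y\<close>.\<close>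
  let ?w = "of_real s \<odot> x \<ominus> cnj p \<odot> y"
  have "hinner H ?w ?w = of_real s * (of_real s * hinner H x x - p * cnj p)"
    using x y by (simp add: inner_simps yx p_def[symmetric] inner_self[OF y] s_def[symmetric] algebra_simps)
  also have "\<dots> = of_real (s * (s * (hnorm H x)\<^sup>2 - (cmod p)\<^sup>2))"
    using complex_norm_square[of p] by (simp add: inner_self[OF x])
  finally have "s * (s * (hnorm H x)\<^sup>2 - (cmod p)\<^sup>2) \<ge> 0"
    using inner_nonneg[of ?w] x y by simp
  then have "(cmod p)\<^sup>2 \<le> (hnorm H x * hnorm H y)\<^sup>2"
    using s by (simp add: zero_le_mult_iff s_def power_mult_distrib mult.commute)
  then show ?thesis unfolding p_def by (rule power2_le_imp_le) (use x y in auto)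
qed

lemma hnorm_triangle:
  assumes x: "x \<in> carrier H" and y: "y \<in> carrier H"
  shows "hnorm H (x \<oplus> y) \<le> hnorm H x + hnorm H y"
proof (rule power2_le_imp_le)
  have "of_real ((hnorm H (x \<oplus> y))\<^sup>2) = hinner H (x \<oplus> y) (x \<oplus> y)" using inner_self x y by simp
  also have "\<dots> = hinner H x x + hinner H y y + (hinner H x y + cnj (hinner H x y))"
    using x y inner_commute[OF x y] by (simp add: inner_simps)
  also have "\<dots> = of_real ((hnorm H x)\<^sup>2 + (hnorm H y)\<^sup>2 + 2 * Re (hinner H x y))"
    using x y by (simp add: inner_self complex_add_cnj)
  finally have "(hnorm H (x \<oplus> y))\<^sup>2 = (hnorm H x)\<^sup>2 + (hnorm H y)\<^sup>2 + 2 * Re (hinner H x y)"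
    using of_real_eq_iff by blast
  moreover have "Re (hinner H x y) \<le> hnorm H x * hnorm H y"
    using cauchy_schwarz[OF x y] complex_Re_le_cmod[of "hinner H x y"] by linarith
  ultimately show "(hnorm H (x \<oplus> y))\<^sup>2 \<le> (hnorm H x + hnorm H y)\<^sup>2"
    by (simp add: power2_sum)
qed (use x y in auto)

lemma hnorm_minus_commute:
  assumes "a \<in> carrier H" "b \<in> carrier H"
  shows "hnorm H (a \<ominus> b) = hnorm H (b \<ominus> a)"
proof -
  have "Re (hinner H (a \<ominus> b) (a \<ominus> b)) = Re (hinner H (b \<ominus> a) (b \<ominus> a))"
    using assms by (simp add: inner_simps)
  then show ?thesis by (simp add: hnorm_def)
qed

lemma hnorm_minus_triangle:
  assumes "a \<in> carrier H" "b \<in> carrier H" "c \<in> carrier H"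
  shows "hnorm H (a \<ominus> c) \<le> hnorm H (a \<ominus> b) + hnorm H (b \<ominus> c)"
proof -
  have "a \<ominus> c = (a \<ominus> b) \<oplus> (b \<ominus> c)" using assms
    by (simp add: a_minus_def a_assoc r_neg1)
  then show ?thesis using hnorm_triangle[of "a \<ominus> b" "b \<ominus> c"] assms by simp
qed

lemma hlim_inner:
  assumes "\<And>n. X n \<in> carrier H" "x \<in> carrier H" "y \<in> carrier H"
    and "(\<lambda>n. hnorm H (X n \<ominus> x)) \<longlonglongrightarrow> 0"
  shows "(\<lambda>n. hinner H (X n) y) \<longlonglongrightarrow> hinner H x y"
proof -
  have "(\<lambda>n. hinner H (X n) y - hinner H x y) \<longlonglongrightarrow> 0"
  proof (rule tendsto_norm_zero_cancel, rule tendsto_sandwich[OF _ _ tendsto_const])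
    show "(\<lambda>n. hnorm H (X n \<ominus> x) * hnorm H y) \<longlonglongrightarrow> 0"
      using tendsto_mult[OF assms(4) tendsto_const] by simp
  qed (use assms cauchy_schwarz[of "X _ \<ominus> x" y] in \<open>auto simp: inner_simps\<close>)
  then show ?thesis by (simp add: LIM_zero_iff)
qed

lemma hlim_inner_right:
  assumes "\<And>n. X n \<in> carrier H" "x \<in> carrier H" "y \<in> carrier H"
    and "(\<lambda>n. hnorm H (X n \<ominus> x)) \<longlonglongrightarrow> 0"
  shows "(\<lambda>n. hinner H y (X n)) \<longlonglongrightarrow> hinner H y x"
proof -
  have "hinner H y (X n) = cnj (hinner H (X n) y)" for n by (rule inner_commute) (use assms in auto)
  moreover have "hinner H y x = cnj (hinner H x y)" by (rule inner_commute) (use assms in auto)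
  ultimately show ?thesis using tendsto_cnj[OF hlim_inner[OF assms]] by (simp only:)
qed

lemma hlim_norm:
  assumes "\<And>n. X n \<in> carrier H" "x \<in> carrier H" "(\<lambda>n. hnorm H (X n \<ominus> x)) \<longlonglongrightarrow> 0"
  shows "(\<lambda>n. hnorm H (X n)) \<longlonglongrightarrow> hnorm H x"
proof -
  have z: "a \<ominus> \<zero> = a" if "a \<in> carrier H" for a using that by (simp add: a_minus_def)
  have "\<bar>hnorm H (X n) - hnorm H x\<bar> \<le> hnorm H (X n \<ominus> x)" for n
    using hnorm_minus_triangle[of "X n" x \<zero>] hnorm_minus_triangle[of x "X n" \<zero>] assms
      hnorm_minus_commute[of x "X n"] by (simp add: z)
  then have "(\<lambda>n. hnorm H (X n) - hnorm H x) \<longlonglongrightarrow> 0"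
    by (intro tendsto_rabs_zero_cancel[OF tendsto_sandwich[OF _ _ tendsto_const assms(3)]]) auto
  then show ?thesis by (simp add: LIM_zero_iff)
qed

lemma eq_if_inner_eq:
  assumes "x \<in> carrier H" "y \<in> carrier H" "\<And>z. z \<in> carrier H \<Longrightarrow> hinner H z x = hinner H z y"
  shows "x = y"
proof -
  have "hinner H (x \<ominus> y) (x \<ominus> y) = 0" using assms by (simp add: inner_minus)
  then have "x \<ominus> y = \<zero>" using inner_eq_zero assms by simp
  then show ?thesis using assms minus_eq_zero_imp_eq by blast
qed

text \<open>
  The difference \<open>w\<close> is orthogonal to vectors \<open>z\<close> arbitrarily close to \<open>w\<close> itself, and
  \<open>\<parallel>w\<parallel>\<^sup>2 = \<langle>w - z, w\<rangle> \<le> \<parallel>w - z\<parallel> \<parallel>w\<parallel>\<close>.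
\<close>

lemma eq_if_inner_dense_eq:
  assumes "x \<in> carrier H" "y \<in> carrier H" and D: "dense_in H D" "D \<subseteq> carrier H"
    and "\<And>z. z \<in> D \<Longrightarrow> hinner H z x = hinner H z y"
  shows "x = y"
proof -
  define w where "w = x \<ominus> y"
  have w: "w \<in> carrier H" using assms by (simp add: w_def)
  have "hnorm H w \<le> 0 + \<epsilon>" if e: "\<epsilon> > 0" for \<epsilon>
  proof -
    obtain z where z: "z \<in> D" "hnorm H (w \<ominus> z) < \<epsilon>" using D(1) w e unfolding dense_in_def by blast
    have zH: "z \<in> carrier H" using z D by auto
    have "hinner H z w = 0" using assms z zH by (simp add: w_def inner_minus)
    then have "hinner H (w \<ominus> z) w = of_real ((hnorm H w)\<^sup>2)" using w zH by (simp add: inner_minus_left inner_self)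
    then have "(hnorm H w)\<^sup>2 \<le> hnorm H (w \<ominus> z) * hnorm H w"
      using cauchy_schwarz[of "w \<ominus> z" w] w zH by (simp add: norm_power)
    then have "hnorm H w \<le> hnorm H (w \<ominus> z)"
    proof (cases "hnorm H w > 0")
      case False
      then show ?thesis using hnorm_nonneg[OF minus_closed[OF w zH]] by linarith
    qed (simp add: power2_eq_square)
    then show ?thesis using z by simp
  qed
  then have "hnorm H w \<le> 0" by (rule field_le_epsilon)
  then have "w = \<zero>" using hnorm_nonneg[OF w] hnorm_eq_zero[OF w] by simp
  then show ?thesis using assms minus_eq_zero_imp_eq by (simp add: w_def)
qed

end

section \<open>The C*-algebra of adjointable operators\<close>

definition adjoint_pair :: "'h hilbert \<Rightarrow> ('h \<Rightarrow> 'h) \<Rightarrow> ('h \<Rightarrow> 'h) \<Rightarrow> bool" where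
  "adjoint_pair H T S \<longleftrightarrow> T \<in> carrier H \<rightarrow> carrier H \<and> S \<in> carrier H \<rightarrow> carrier H
    \<and> (\<forall>x\<in>carrier H. \<forall>y\<in>carrier H. hinner H (T x) y = hinner H x (S y))"

definition op_bound :: "'h hilbert \<Rightarrow> ('h \<Rightarrow> 'h) \<Rightarrow> real \<Rightarrow> bool" where
  "op_bound H T C \<longleftrightarrow> C \<ge> 0 \<and> (\<forall>x\<in>carrier H. hnorm H (T x) \<le> C * hnorm H x)"

text \<open>
  The condition on members is the existence of an adjoint: linearity, the involution and the
  completeness of the algebra are all consequences of this one relation.
\<close>

definition operator_algebra :: "'h hilbert \<Rightarrow> ('h \<Rightarrow> 'h) cstar" where
  "operator_algebra H = \<lparr>
     carrier = {T \<in> extensional (carrier H). (\<exists>S. adjoint_pair H T S) \<and> (\<exists>C. op_bound H T C)},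
     mult = (\<lambda>S T. \<lambda>x\<in>carrier H. S (T x)),
     one = (\<lambda>x\<in>carrier H. x),
     zero = (\<lambda>x\<in>carrier H. \<zero>\<^bsub>H\<^esub>),
     add = (\<lambda>S T. \<lambda>x\<in>carrier H. S x \<oplus>\<^bsub>H\<^esub> T x),
     smult = (\<lambda>c T. \<lambda>x\<in>carrier H. c \<odot>\<^bsub>H\<^esub> T x),
     cstar_star = (\<lambda>T. THE S. S \<in> extensional (carrier H) \<and> adjoint_pair H T S),
     cstar_norm = (\<lambda>T. Inf {C. op_bound H T C})\<rparr>"

context hilbert_space
begin

abbreviation "B \<equiv> operator_algebra H"

lemma adjoint_pairD:
  assumes "adjoint_pair H T S"
  shows "x \<in> carrier H \<Longrightarrow> T x \<in> carrier H" "x \<in> carrier H \<Longrightarrow> S x \<in> carrier H"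
    "x \<in> carrier H \<Longrightarrow> y \<in> carrier H \<Longrightarrow> hinner H (T x) y = hinner H x (S y)"
  using assms by (auto simp: adjoint_pair_def)

lemma adjoint_pair_sym: 
  assumes "adjoint_pair H T S" shows "adjoint_pair H S T"
  unfolding adjoint_pair_def
proof (intro conjI ballI)
  fix x y assume xy: "x \<in> carrier H" "y \<in> carrier H"
  note c = adjoint_pairD[OF assms]
  have "hinner H (S x) y = cnj (hinner H y (S x))" by (rule inner_commute) (use xy c in auto)
  also have "\<dots> = cnj (hinner H (T y) x)" using c(3)[of y x] xy by simp
  also have "\<dots> = hinner H x (T y)" by (rule inner_commute[symmetric]) (use xy c in auto)
  finally show "hinner H (S x) y = hinner H x (T y)" .
qed (use assms in \<open>auto simp: adjoint_pair_def\<close>)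

lemma adjoint_pair_add:
  assumes "adjoint_pair H T S" "x \<in> carrier H" "y \<in> carrier H"
  shows "T (x \<oplus> y) = T x \<oplus> T y"
proof (rule eq_if_inner_eq)
  note c = adjoint_pairD[OF assms(1)] and d = adjoint_pairD(3)[OF adjoint_pair_sym[OF assms(1)]]
  fix z assume z: "z \<in> carrier H"
  show "hinner H z (T (x \<oplus> y)) = hinner H z (T x \<oplus> T y)"
    using assms z c by (simp add: d[symmetric] inner_add)
qed (use assms adjoint_pairD in auto)

lemma adjoint_pair_smult:
  assumes "adjoint_pair H T S" "x \<in> carrier H"
  shows "T (c \<odot> x) = c \<odot> T x"
proof (rule eq_if_inner_eq)
  note c = adjoint_pairD[OF assms(1)] and d = adjoint_pairD(3)[OF adjoint_pair_sym[OF assms(1)]]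
  fix z assume z: "z \<in> carrier H"
  show "hinner H z (T (c \<odot> x)) = hinner H z (c \<odot> T x)"
    using assms z c by (simp add: d[symmetric] inner_smult)
qed (use assms adjoint_pairD in auto)

lemma adjoint_pair_minus:
  assumes "adjoint_pair H T S" "x \<in> carrier H" "y \<in> carrier H"
  shows "T (x \<ominus> y) = T x \<ominus> T y"
  using assms adjoint_pairD(1)[OF assms(1)]
  by (simp add: minus_eq_smult adjoint_pair_add adjoint_pair_smult)

lemma adjoint_unique:
  assumes "adjoint_pair H T S" "adjoint_pair H T S'" "x \<in> carrier H"
  shows "S x = S' x"
proof (rule eq_if_inner_eq)
  fix z assume z: "z \<in> carrier H"
  show "hinner H z (S x) = hinner H z (S' x)"
    using adjoint_pairD(3)[OF assms(1) z assms(3)] adjoint_pairD(3)[OF assms(2) z assms(3)] by simp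
qed (use assms adjoint_pairD in auto)

text \<open>
  \<open>\<parallel>S y\<parallel>\<^sup>2 = \<langle>T S y, y\<rangle> \<le> C \<parallel>S y\<parallel> \<parallel>y\<parallel>\<close> by the Cauchy-Schwarz inequality; cancel \<open>\<parallel>S y\<parallel>\<close>.
\<close>

lemma op_bound_adjoint:
  assumes TS: "adjoint_pair H T S" and T: "op_bound H T C"
  shows "op_bound H S C"
  unfolding op_bound_def
proof (intro conjI ballI)
  show "C \<ge> 0" using T by (simp add: op_bound_def)
  fix y assume y: "y \<in> carrier H"
  have Sy: "S y \<in> carrier H" "T (S y) \<in> carrier H" using adjoint_pairD[OF TS] y by auto
  have "hinner H (T (S y)) y = of_real ((hnorm H (S y))\<^sup>2)"
    using adjoint_pairD(3)[OF TS Sy(1) y] inner_self[OF Sy(1)] by simp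
  then have "(hnorm H (S y))\<^sup>2 \<le> hnorm H (T (S y)) * hnorm H y"
    using cauchy_schwarz[OF Sy(2) y] by (simp add: norm_power)
  also have "\<dots> \<le> C * hnorm H (S y) * hnorm H y"
    using T Sy y by (intro mult_right_mono) (auto simp: op_bound_def)
  finally have *: "hnorm H (S y) * hnorm H (S y) \<le> (C * hnorm H y) * hnorm H (S y)"
    by (simp add: power2_eq_square mult_ac)
  show "hnorm H (S y) \<le> C * hnorm H y"
  proof (cases "hnorm H (S y) > 0")
    case False
    then show ?thesis using mult_nonneg_nonneg[OF \<open>C \<ge> 0\<close> hnorm_nonneg[OF y]] by linarith
  qed (use * in simp)
qed

lemma operator_algebra_simps:
  "S \<otimes>\<^bsub>B\<^esub> T = (\<lambda>x\<in>carrier H. S (T x))" "\<one>\<^bsub>B\<^esub> = (\<lambda>x\<in>carrier H. x)"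
  "\<zero>\<^bsub>B\<^esub> = (\<lambda>x\<in>carrier H. \<zero>)" "S \<oplus>\<^bsub>B\<^esub> T = (\<lambda>x\<in>carrier H. S x \<oplus> T x)"
  "c \<odot>\<^bsub>B\<^esub> T = (\<lambda>x\<in>carrier H. c \<odot> T x)"
  by (simp_all add: operator_algebra_def)

lemma operator_apply:
  assumes "x \<in> carrier H"
  shows "(S \<otimes>\<^bsub>B\<^esub> T) x = S (T x)" "\<one>\<^bsub>B\<^esub> x = x" "\<zero>\<^bsub>B\<^esub> x = \<zero>"
    "(S \<oplus>\<^bsub>B\<^esub> T) x = S x \<oplus> T x" "(c \<odot>\<^bsub>B\<^esub> T) x = c \<odot> T x"
  using assms by (simp_all add: operator_algebra_simps)

lemma operatorI:
  "T \<in> extensional (carrier H) \<Longrightarrow> adjoint_pair H T S \<Longrightarrow> op_bound H T C \<Longrightarrow> T \<in> carrier B"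
  by (auto simp: operator_algebra_def)

lemma star_eqI:
  assumes "S \<in> extensional (carrier H)" "adjoint_pair H T S"
  shows "cstar_star B T = S"
proof -
  have "(THE S. S \<in> extensional (carrier H) \<and> adjoint_pair H T S) = S"
    using assms by (intro the_equality conjI) (blast intro: extensionalityI adjoint_unique)+
  then show ?thesis by (simp add: operator_algebra_def)
qed

lemma operator_star:
  assumes "T \<in> carrier B"
  shows "adjoint_pair H T (cstar_star B T)" "cstar_star B T \<in> extensional (carrier H)"
proof -
  obtain S where S: "adjoint_pair H T S" using assms by (auto simp: operator_algebra_def)
  then have "adjoint_pair H T (restrict S (carrier H))" by (auto simp: adjoint_pair_def)
  with star_eqI[OF restrict_extensional this] 
  show "adjoint_pair H T (cstar_star B T)" "cstar_star B T \<in> extensional (carrier H)" by auto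
qed

lemma operator_bound:
  assumes "T \<in> carrier B"
  shows "op_bound H T (cstar_norm B T)"
proof -
  obtain C where C: "op_bound H T C" using assms by (auto simp: operator_algebra_def)
  let ?S = "{C. op_bound H T C}"
  have ne: "?S \<noteq> {}" and bb: "bdd_below ?S" using C by (auto simp: op_bound_def intro!: bdd_belowI[of _ 0])
  have n: "cstar_norm B T = Inf ?S" by (simp add: operator_algebra_def)
  have "Inf ?S \<ge> 0" using ne by (rule cInf_greatest) (auto simp: op_bound_def)
  moreover have "hnorm H (T x) \<le> Inf ?S * hnorm H x" if x: "x \<in> carrier H" for x
  proof (cases "hnorm H x > 0")
    case True
    have "hnorm H (T x) / hnorm H x \<le> Inf ?S"
      using ne True x by (intro cInf_greatest) (auto simp: op_bound_def field_simps)
    then show ?thesis using True by (simp add: field_simps)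
  next
    case False
    then have "hnorm H x = 0" using x hnorm_nonneg[of x] by linarith
    then show ?thesis using C x by (force simp: op_bound_def)
  qed
  ultimately show ?thesis by (simp add: op_bound_def n)
qed

lemma operator_norm_le: "op_bound H T C \<Longrightarrow> cstar_norm B T \<le> C"
  by (auto simp: operator_algebra_def op_bound_def intro!: cInf_lower bdd_belowI[of _ 0])

lemma operatorD:
  assumes "T \<in> carrier B"
  shows "T \<in> extensional (carrier H)" "x \<in> carrier H \<Longrightarrow> T x \<in> carrier H"
    "x \<in> carrier H \<Longrightarrow> hnorm H (T x) \<le> cstar_norm B T * hnorm H x" "cstar_norm B T \<ge> 0"
  using assms operator_bound[OF assms] operator_star[OF assms] 
  by (auto simp: op_bound_def adjoint_pair_def) (auto simp: operator_algebra_def)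

lemma operator_eqI:
  "S \<in> carrier B \<Longrightarrow> T \<in> carrier B \<Longrightarrow> (\<And>x. x \<in> carrier H \<Longrightarrow> S x = T x) \<Longrightarrow> S = T"
  by (rule extensionalityI[of _ "carrier H"]) (auto dest: operatorD(1))

lemma operator_mult:
  assumes S: "S \<in> carrier B" and T: "T \<in> carrier B"
  shows "S \<otimes>\<^bsub>B\<^esub> T \<in> carrier B"
    "cstar_star B (S \<otimes>\<^bsub>B\<^esub> T) = cstar_star B T \<otimes>\<^bsub>B\<^esub> cstar_star B S"
    "op_bound H (S \<otimes>\<^bsub>B\<^esub> T) (cstar_norm B S * cstar_norm B T)"
proof -
  have adj: "adjoint_pair H (S \<otimes>\<^bsub>B\<^esub> T) (cstar_star B T \<otimes>\<^bsub>B\<^esub> cstar_star B S)"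
    using operator_star(1)[OF S] operator_star(1)[OF T]
    by (auto simp: adjoint_pair_def operator_algebra_simps Pi_iff)
  show bd: "op_bound H (S \<otimes>\<^bsub>B\<^esub> T) (cstar_norm B S * cstar_norm B T)"
    unfolding op_bound_def
  proof (intro conjI ballI)
    fix x assume x: "x \<in> carrier H"
    have "hnorm H (S (T x)) \<le> cstar_norm B S * hnorm H (T x)" using operatorD[OF S] operatorD[OF T] x by auto
    also have "\<dots> \<le> cstar_norm B S * (cstar_norm B T * hnorm H x)"
      using operatorD[OF S] operatorD[OF T] x by (intro mult_left_mono) auto
    finally show "hnorm H ((S \<otimes>\<^bsub>B\<^esub> T) x) \<le> cstar_norm B S * cstar_norm B T * hnorm H x"
      using x by (simp add: operator_algebra_simps mult_ac)
  qed (use operatorD[OF S] operatorD[OF T] in auto)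
  show "S \<otimes>\<^bsub>B\<^esub> T \<in> carrier B"
    by (rule operatorI[OF _ adj bd]) (simp add: operator_algebra_simps)
  show "cstar_star B (S \<otimes>\<^bsub>B\<^esub> T) = cstar_star B T \<otimes>\<^bsub>B\<^esub> cstar_star B S"
    by (rule star_eqI[OF _ adj]) (simp add: operator_algebra_simps)
qed

lemma operator_add:
  assumes S: "S \<in> carrier B" and T: "T \<in> carrier B"
  shows "S \<oplus>\<^bsub>B\<^esub> T \<in> carrier B"
    "cstar_star B (S \<oplus>\<^bsub>B\<^esub> T) = cstar_star B S \<oplus>\<^bsub>B\<^esub> cstar_star B T"
    "op_bound H (S \<oplus>\<^bsub>B\<^esub> T) (cstar_norm B S + cstar_norm B T)"
proof -
  have adj: "adjoint_pair H (S \<oplus>\<^bsub>B\<^esub> T) (cstar_star B S \<oplus>\<^bsub>B\<^esub> cstar_star B T)"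
    using operator_star(1)[OF S] operator_star(1)[OF T]
    by (auto simp: adjoint_pair_def operator_algebra_simps Pi_iff inner_add inner_add_left)
  show bd: "op_bound H (S \<oplus>\<^bsub>B\<^esub> T) (cstar_norm B S + cstar_norm B T)"
    unfolding op_bound_def
  proof (intro conjI ballI)
    fix x assume x: "x \<in> carrier H"
    have "hnorm H (S x \<oplus> T x) \<le> hnorm H (S x) + hnorm H (T x)" 
      using operatorD[OF S] operatorD[OF T] x by (intro hnorm_triangle) auto
    also have "\<dots> \<le> cstar_norm B S * hnorm H x + cstar_norm B T * hnorm H x"
      using operatorD[OF S] operatorD[OF T] x by (intro add_mono) auto
    finally show "hnorm H ((S \<oplus>\<^bsub>B\<^esub> T) x) \<le> (cstar_norm B S + cstar_norm B T) * hnorm H x"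
      using x by (simp add: operator_algebra_simps algebra_simps)
  qed (use operatorD[OF S] operatorD[OF T] in auto)
  show "S \<oplus>\<^bsub>B\<^esub> T \<in> carrier B"
    by (rule operatorI[OF _ adj bd]) (simp add: operator_algebra_simps)
  show "cstar_star B (S \<oplus>\<^bsub>B\<^esub> T) = cstar_star B S \<oplus>\<^bsub>B\<^esub> cstar_star B T"
    by (rule star_eqI[OF _ adj]) (simp add: operator_algebra_simps)
qed

lemma operator_smult:
  assumes T: "T \<in> carrier B"
  shows "c \<odot>\<^bsub>B\<^esub> T \<in> carrier B"
    "cstar_star B (c \<odot>\<^bsub>B\<^esub> T) = cnj c \<odot>\<^bsub>B\<^esub> cstar_star B T"
    "op_bound H (c \<odot>\<^bsub>B\<^esub> T) (cmod c * cstar_norm B T)"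
proof -
  have adj: "adjoint_pair H (c \<odot>\<^bsub>B\<^esub> T) (cnj c \<odot>\<^bsub>B\<^esub> cstar_star B T)"
    using operator_star(1)[OF T]
    by (auto simp: adjoint_pair_def operator_algebra_simps Pi_iff inner_smult inner_smult_left)
  show bd: "op_bound H (c \<odot>\<^bsub>B\<^esub> T) (cmod c * cstar_norm B T)"
    using operatorD[OF T]
    by (auto simp: op_bound_def operator_algebra_simps hnorm_smult mult.assoc intro!: mult_left_mono)
  show "c \<odot>\<^bsub>B\<^esub> T \<in> carrier B"
    by (rule operatorI[OF _ adj bd]) (simp add: operator_algebra_simps)
  show "cstar_star B (c \<odot>\<^bsub>B\<^esub> T) = cnj c \<odot>\<^bsub>B\<^esub> cstar_star B T"
    by (rule star_eqI[OF _ adj]) (simp add: operator_algebra_simps)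
qed

lemma operator_one: "\<one>\<^bsub>B\<^esub> \<in> carrier B"
proof -
  have "adjoint_pair H \<one>\<^bsub>B\<^esub> \<one>\<^bsub>B\<^esub>" "op_bound H \<one>\<^bsub>B\<^esub> 1"
    by (auto simp: adjoint_pair_def op_bound_def operator_algebra_simps)
  then show ?thesis by (intro operatorI) (auto simp: operator_algebra_simps)
qed

lemma operator_zero: "\<zero>\<^bsub>B\<^esub> \<in> carrier B"
proof -
  have "\<zero>\<^bsub>B\<^esub> = 0 \<odot>\<^bsub>B\<^esub> \<one>\<^bsub>B\<^esub>"
    using mod.smult_l_null by (auto simp: operator_algebra_simps restrict_def)
  then show ?thesis using operator_smult(1)[OF operator_one] by simp
qed

lemma operator_linear:
  assumes "T \<in> carrier B" "x \<in> carrier H" 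
  shows "y \<in> carrier H \<Longrightarrow> T (x \<oplus> y) = T x \<oplus> T y" "T (c \<odot> x) = c \<odot> T x"
    "y \<in> carrier H \<Longrightarrow> T (x \<ominus> y) = T x \<ominus> T y"
  using assms operator_star(1)[OF assms(1)]
  by (auto simp: adjoint_pair_add adjoint_pair_smult adjoint_pair_minus)

lemmas operator_rules = operator_mult(1) operator_add(1) operator_smult(1) operator_one operator_zero

lemma operator_ring: "ring B"
proof (rule ringI)
  show "abelian_group B"
  proof (rule abelian_groupI)
    fix T assume T: "T \<in> carrier B"
    have "((-1) \<odot>\<^bsub>B\<^esub> T) \<oplus>\<^bsub>B\<^esub> T = \<zero>\<^bsub>B\<^esub>"
      using operatorD[OF T] mod.smult_l_minus[of 1] smult_one_c
      by (auto simp: operator_algebra_simps restrict_def l_neg)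
    then show "\<exists>y\<in>carrier B. y \<oplus>\<^bsub>B\<^esub> T = \<zero>\<^bsub>B\<^esub>" using operator_smult(1)[OF T] by blast
  qed (auto simp: operator_rules operator_linear operatorD operator_apply a_assoc intro!: operator_eqI a_comm)
  show "Group.monoid B"
    by (rule monoidI) (auto simp: operator_rules operatorD operator_apply intro!: operator_eqI)
qed (auto simp: operator_rules operator_linear operatorD operator_apply intro!: operator_eqI)

lemma operator_module: "module complex_ring B"
proof (rule moduleI)
  show "abelian_group B" using operator_ring by (rule ring.is_abelian_group)
  show "cring complex_ring" by (rule cring_complex_ring)
qed (use mod.smult_l_distr mod.smult_r_distr mod.smult_assoc1 smult_one_c in
    \<open>auto simp: operator_rules operatorD operator_apply intro!: operator_eqI\<close>)

lemma operator_minus: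
  assumes "S \<in> carrier B" "T \<in> carrier B" "x \<in> carrier H"
  shows "(S \<ominus>\<^bsub>B\<^esub> T) x = S x \<ominus> T x"
proof -
  interpret R: ring B by (rule operator_ring)
  interpret M: module complex_ring B by (rule operator_module)
  have "\<ominus>\<^bsub>B\<^esub> T = (-1) \<odot>\<^bsub>B\<^esub> T"
    using M.smult_l_minus[of 1 T] M.smult_one[of T] assms by simp
  then have "S \<ominus>\<^bsub>B\<^esub> T = S \<oplus>\<^bsub>B\<^esub> ((-1) \<odot>\<^bsub>B\<^esub> T)" by (simp add: a_minus_def)
  then show ?thesis using assms by (simp add: operator_algebra_simps minus_eq_smult operatorD)
qed

lemma operator_norm_star_le: "T \<in> carrier B \<Longrightarrow> op_bound H (cstar_star B T) (cstar_norm B T)"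
  using op_bound_adjoint operator_star(1) operator_bound by blast

lemma operator_star_closed: "T \<in> carrier B \<Longrightarrow> cstar_star B T \<in> carrier B"
  using operatorI[OF operator_star(2) adjoint_pair_sym[OF operator_star(1)] operator_norm_star_le] by blast

lemma operator_star_star: 
  assumes "T \<in> carrier B" shows "cstar_star B (cstar_star B T) = T"
  using star_eqI[OF operatorD(1)[OF assms] adjoint_pair_sym[OF operator_star(1)[OF assms]]] .

text \<open>
  The inequality \<open>\<parallel>T\<parallel>\<^sup>2 \<le> \<parallel>T\<^sup>* T\<parallel>\<close> comes from \<open>\<parallel>T x\<parallel>\<^sup>2 = \<langle>x, T\<^sup>* T x\<rangle>\<close>.
\<close>

lemma operator_cstar_identity:
  assumes T: "T \<in> carrier B"
  shows "cstar_norm B (cstar_star B T \<otimes>\<^bsub>B\<^esub> T) = (cstar_norm B T)\<^sup>2"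
proof (rule antisym)
  note sc = operator_star_closed[OF T]
  have n: "cstar_norm B (cstar_star B T) \<le> cstar_norm B T"
    by (rule operator_norm_le[OF operator_norm_star_le[OF T]])
  show "cstar_norm B (cstar_star B T \<otimes>\<^bsub>B\<^esub> T) \<le> (cstar_norm B T)\<^sup>2"
    using operator_norm_le[OF operator_mult(3)[OF sc T]] mult_right_mono[OF n operatorD(4)[OF T]]
    by (simp add: power2_eq_square)
  let ?P = "cstar_star B T \<otimes>\<^bsub>B\<^esub> T"
  have P: "?P \<in> carrier B" using operator_mult(1)[OF sc T] .
  have "op_bound H T (sqrt (cstar_norm B ?P))"
    unfolding op_bound_def
  proof (intro conjI ballI)
    fix x assume x: "x \<in> carrier H"
    have Tx: "T x \<in> carrier H" "?P x \<in> carrier H" using operatorD[OF T] operatorD[OF P] x by auto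
    have "of_real ((hnorm H (T x))\<^sup>2) = hinner H x (?P x)"
      using adjoint_pairD(3)[OF operator_star(1)[OF T] x Tx(1)] inner_self[OF Tx(1)] x
      by (simp add: operator_algebra_simps)
    then have "(hnorm H (T x))\<^sup>2 \<le> hnorm H x * hnorm H (?P x)"
      using cauchy_schwarz[OF x Tx(2)] by (metis norm_of_real abs_of_nonneg zero_le_power2)
    also have "\<dots> \<le> hnorm H x * (cstar_norm B ?P * hnorm H x)"
      using operatorD[OF P] x by (intro mult_left_mono) auto
    also have "\<dots> = (sqrt (cstar_norm B ?P) * hnorm H x)\<^sup>2"
      using operatorD(4)[OF P] by (simp add: power_mult_distrib power2_eq_square)
    finally show "hnorm H (T x) \<le> sqrt (cstar_norm B ?P) * hnorm H x"
      by (rule power2_le_imp_le) (use x operatorD(4)[OF P] in auto)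
  qed (use operatorD(4)[OF P] in auto)
  then have "cstar_norm B T \<le> sqrt (cstar_norm B ?P)" by (rule operator_norm_le)
  then show "(cstar_norm B T)\<^sup>2 \<le> cstar_norm B ?P"
    using operatorD(4)[OF T] operatorD(4)[OF P] by (metis power_mono real_sqrt_pow2)
qed

lemma operator_pointwise_limit:
  fixes X :: "nat \<Rightarrow> 'h \<Rightarrow> 'h"
  assumes X: "\<And>n. X n \<in> carrier B" and x: "x \<in> carrier H"
    and C: "\<forall>\<epsilon>>0. \<exists>M. \<forall>m\<ge>M. \<forall>n\<ge>M. op_bound H (X m \<ominus>\<^bsub>B\<^esub> X n) \<epsilon>"
  shows "\<exists>y\<in>carrier H. (\<lambda>n. hnorm H (X n x \<ominus> y)) \<longlonglongrightarrow> 0"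
proof (rule complete)
  show "\<forall>\<epsilon>>0. \<exists>M. \<forall>m\<ge>M. \<forall>n\<ge>M. hnorm H (X m x \<ominus> X n x) < \<epsilon>"
  proof (intro allI impI)
    fix \<epsilon> :: real assume e: "\<epsilon> > 0"
    define \<delta> where "\<delta> = \<epsilon> / (hnorm H x + 1)"
    have p: "hnorm H x + 1 > 0" using hnorm_nonneg[OF x] by linarith
    have d: "\<delta> > 0" using e p by (simp add: \<delta>_def)
    then obtain M where M: "\<And>m n. M \<le> m \<Longrightarrow> M \<le> n \<Longrightarrow> op_bound H (X m \<ominus>\<^bsub>B\<^esub> X n) \<delta>" using C by blast
    have "\<delta> * hnorm H x < \<epsilon>" using d p by (simp add: \<delta>_def field_simps e)
    then show "\<exists>M. \<forall>m\<ge>M. \<forall>n\<ge>M. hnorm H (X m x \<ominus> X n x) < \<epsilon>"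
      using M x by (intro exI[of _ M]) (fastforce simp: op_bound_def operator_minus[OF X X])
  qed
qed (use operatorD X x in auto)

text \<open>
  Along a Cauchy sequence of operators both the values at a vector and the values of the adjoints
  converge. The two pointwise limits are adjoint to each other, so the limit belongs to the algebra.
\<close>

lemma operator_complete:
  fixes X :: "nat \<Rightarrow> 'h \<Rightarrow> 'h"
  assumes X: "\<And>n. X n \<in> carrier B"
    and C: "\<forall>\<epsilon>>0. \<exists>M. \<forall>m\<ge>M. \<forall>n\<ge>M. cstar_norm B (X m \<ominus>\<^bsub>B\<^esub> X n) < \<epsilon>"
  shows "\<exists>T\<in>carrier B. (\<lambda>n. cstar_norm B (X n \<ominus>\<^bsub>B\<^esub> T)) \<longlonglongrightarrow> 0"
proof -
  interpret R: ring B by (rule operator_ring)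
  interpret M: module complex_ring B by (rule operator_module)
  have Bd: "op_bound H T \<epsilon>" if "cstar_norm B T < \<epsilon>" "T \<in> carrier B" for T \<epsilon>
  proof -
    have "cstar_norm B T * hnorm H x \<le> \<epsilon> * hnorm H x" if "x \<in> carrier H" for x
      using that \<open>cstar_norm B T < \<epsilon>\<close> by (intro mult_right_mono) auto
    then show ?thesis using operatorD[OF that(2)] that(1) unfolding op_bound_def by fastforce
  qed
  have C1: "\<forall>\<epsilon>>0. \<exists>M. \<forall>m\<ge>M. \<forall>n\<ge>M. op_bound H (X m \<ominus>\<^bsub>B\<^esub> X n) \<epsilon>"
    using C Bd X R.minus_closed by metis
  have sm: "cstar_star B (S \<ominus>\<^bsub>B\<^esub> T) = cstar_star B S \<ominus>\<^bsub>B\<^esub> cstar_star B T" 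
    if "S \<in> carrier B" "T \<in> carrier B" for S T
  proof -
    have *: "S' \<ominus>\<^bsub>B\<^esub> T' = S' \<oplus>\<^bsub>B\<^esub> ((-1) \<odot>\<^bsub>B\<^esub> T')" if "S' \<in> carrier B" "T' \<in> carrier B" for S' T'
      using M.smult_l_minus[of 1 T'] M.smult_one[of T'] that by (simp add: a_minus_def)
    show ?thesis using that by (simp add: * operator_add operator_smult operator_star_closed)
  qed
  define Y where "Y n = cstar_star B (X n)" for n
  have Y: "Y n \<in> carrier B" for n using X by (simp add: Y_def operator_star_closed)
  have C2: "\<forall>\<epsilon>>0. \<exists>M. \<forall>m\<ge>M. \<forall>n\<ge>M. op_bound H (Y m \<ominus>\<^bsub>B\<^esub> Y n) \<epsilon>"
    using C1 X R.minus_closed op_bound_adjoint[OF operator_star(1)]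
    unfolding Y_def by (metis (no_types, lifting) sm)
  obtain T where T: "\<And>x. x \<in> carrier H \<Longrightarrow> T x \<in> carrier H" 
    "\<And>x. x \<in> carrier H \<Longrightarrow> (\<lambda>n. hnorm H (X n x \<ominus> T x)) \<longlonglongrightarrow> 0"
    using operator_pointwise_limit[OF X _ C1] by metis
  obtain S where S: "\<And>x. x \<in> carrier H \<Longrightarrow> S x \<in> carrier H" 
    "\<And>x. x \<in> carrier H \<Longrightarrow> (\<lambda>n. hnorm H (Y n x \<ominus> S x)) \<longlonglongrightarrow> 0"
    using operator_pointwise_limit[OF Y _ C2] by metis
  define T' where "T' = restrict T (carrier H)"
  have adj: "adjoint_pair H T' S"
    unfolding adjoint_pair_def
  proof (intro conjI ballI)
    fix x y assume xy: "x \<in> carrier H" "y \<in> carrier H"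
    have "(\<lambda>n. hinner H (X n x) y) \<longlonglongrightarrow> hinner H (T x) y"
      by (intro hlim_inner) (use T xy operatorD[OF X] in auto)
    moreover have "(\<lambda>n. hinner H x (Y n y)) \<longlonglongrightarrow> hinner H x (S y)"
      by (intro hlim_inner_right) (use S xy operatorD[OF Y] in auto)
    moreover have "hinner H (X n x) y = hinner H x (Y n y)" for n
      using adjoint_pairD(3)[OF operator_star(1)[OF X] xy] by (simp add: Y_def)
    ultimately show "hinner H (T' x) y = hinner H x (S y)"
      using LIMSEQ_unique xy by (simp add: T'_def)
  qed (use T S in \<open>auto simp: T'_def\<close>)
  have near: "\<exists>M. \<forall>n\<ge>M. op_bound H (\<lambda>x. X n x \<ominus> T x) \<epsilon>" if "\<epsilon> > 0" for \<epsilon>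
  proof -
    obtain M where M: "\<And>m n. M \<le> m \<Longrightarrow> M \<le> n \<Longrightarrow> op_bound H (X m \<ominus>\<^bsub>B\<^esub> X n) \<epsilon>" using C1 \<open>\<epsilon> > 0\<close> by blast
    have "hnorm H (X n x \<ominus> T x) \<le> \<epsilon> * hnorm H x" if "M \<le> n" and x: "x \<in> carrier H" for n x
    proof (rule LIMSEQ_le_const2)
      have 1: "(\<lambda>m. hnorm H ((X n x \<ominus> X m x) \<ominus> (X n x \<ominus> T x))) \<longlonglongrightarrow> 0"
      proof -
        have "hnorm H ((X n x \<ominus> X m x) \<ominus> (X n x \<ominus> T x)) = hnorm H (X m x \<ominus> T x)" for m
        proof -
          have "(X n x \<ominus> X m x) \<ominus> (X n x \<ominus> T x) = T x \<ominus> X m x"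
            using T(1)[OF x] operatorD(2)[OF X x, of n] operatorD(2)[OF X x, of m]
            by (intro eq_if_inner_eq) (auto simp: inner_minus)
          then show ?thesis using hnorm_minus_commute T(1)[OF x] operatorD(2)[OF X x] by simp
        qed
        then show ?thesis using T(2)[OF x] by simp
      qed
      show "(\<lambda>m. hnorm H (X n x \<ominus> X m x)) \<longlonglongrightarrow> hnorm H (X n x \<ominus> T x)"
        by (rule hlim_norm[OF _ _ 1]) (use T(1)[OF x] operatorD(2)[OF X x] in auto)
      show "\<exists>N. \<forall>m\<ge>N. hnorm H (X n x \<ominus> X m x) \<le> \<epsilon> * hnorm H x"
        using M[of n] that by (intro exI[of _ M]) (auto simp: op_bound_def operator_minus[OF X X])
    qed
    then show ?thesis using \<open>\<epsilon> > 0\<close> by (auto simp: op_bound_def intro!: exI[of _ M])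
  qed
  obtain M where M: "op_bound H (\<lambda>x. X M x \<ominus> T x) 1" using near[of 1] by auto
  have "op_bound H T' (1 + cstar_norm B (X M))"
    unfolding op_bound_def
  proof (intro conjI ballI)
    fix x assume x: "x \<in> carrier H"
    have xs: "T x \<in> carrier H" "X M x \<in> carrier H" using T(1) operatorD(2)[OF X] x by auto
    have z: "a \<ominus> \<zero> = a" if "a \<in> carrier H" for a using that by (simp add: a_minus_def)
    have "hnorm H (T x) \<le> hnorm H (T x \<ominus> X M x) + hnorm H (X M x)"
      using hnorm_minus_triangle[of "T x" "X M x" \<zero>] xs by (simp add: z)
    also have "\<dots> \<le> 1 * hnorm H x + cstar_norm B (X M) * hnorm H x"
      using M x operatorD(3)[OF X x, of M] hnorm_minus_commute[OF xs] by (intro add_mono) (auto simp: op_bound_def)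
    finally show "hnorm H (T' x) \<le> (1 + cstar_norm B (X M)) * hnorm H x"
      using x by (simp add: T'_def algebra_simps)
  qed (use operatorD(4)[OF X] in \<open>auto intro: add_nonneg_nonneg\<close>)
  then have T': "T' \<in> carrier B" using adj by (intro operatorI) (auto simp: T'_def)
  have "(\<lambda>n. cstar_norm B (X n \<ominus>\<^bsub>B\<^esub> T')) \<longlonglongrightarrow> 0"
  proof (rule LIMSEQ_I)
    fix r :: real assume "r > 0"
    then obtain M where M: "\<And>n. n \<ge> M \<Longrightarrow> op_bound H (\<lambda>x. X n x \<ominus> T x) (r / 2)" using near[of "r/2"] by auto
    have "norm (cstar_norm B (X n \<ominus>\<^bsub>B\<^esub> T') - 0) < r" if "n \<ge> M" for n
    proof -
      have "op_bound H (X n \<ominus>\<^bsub>B\<^esub> T') (r / 2)"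
      proof -
        have "(X n \<ominus>\<^bsub>B\<^esub> T') x = X n x \<ominus> T x" if "x \<in> carrier H" for x
          using operator_minus[OF X T' that] that by (simp add: T'_def)
        then show ?thesis using M[OF that] by (simp add: op_bound_def)
      qed
      then show ?thesis using operator_norm_le operatorD(4)[OF R.minus_closed[OF X[of n] T']] \<open>r > 0\<close> by fastforce
    qed
    then show "\<exists>no. \<forall>n\<ge>no. norm (cstar_norm B (X n \<ominus>\<^bsub>B\<^esub> T') - 0) < r" by blast
  qed
  then show ?thesis using T' by blast
qed

theorem operator_algebra_cstar: "cstar_algebra B"
proof (rule cstar_algebra.intro)
  show "ring B" by (rule operator_ring)
  show "module complex_ring B" by (rule operator_module)
  show "cstar_norm B a = 0 \<longleftrightarrow> a = \<zero>\<^bsub>B\<^esub>" if a: "a \<in> carrier B" for a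
  proof
    assume "cstar_norm B a = 0"
    then have "hnorm H (a x) = 0" if "x \<in> carrier H" for x 
      using operatorD(3)[OF a that] operatorD(2)[OF a that] hnorm_nonneg by fastforce
    then have "a x = \<zero>" if "x \<in> carrier H" for x
      using hnorm_eq_zero[OF operatorD(2)[OF a that]] that by simp
    then show "a = \<zero>\<^bsub>B\<^esub>" using a operator_zero by (intro operator_eqI) (auto simp: operator_algebra_simps)
  next
    assume "a = \<zero>\<^bsub>B\<^esub>"
    then have "op_bound H a 0" by (simp add: op_bound_def operator_algebra_simps)
    then show "cstar_norm B a = 0" using operator_norm_le operatorD(4)[OF a] by fastforce
  qed
  show "cstar_norm B (c \<odot>\<^bsub>B\<^esub> a) = cmod c * cstar_norm B a" if a: "a \<in> carrier B" for c a
  proof (rule antisym)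
    show "cstar_norm B (c \<odot>\<^bsub>B\<^esub> a) \<le> cmod c * cstar_norm B a"
      by (rule operator_norm_le[OF operator_smult(3)[OF a]])
    show "cmod c * cstar_norm B a \<le> cstar_norm B (c \<odot>\<^bsub>B\<^esub> a)"
    proof (cases "c = 0")
      case False
      have "op_bound H a (cstar_norm B (c \<odot>\<^bsub>B\<^esub> a) / cmod c)"
        using operator_bound[OF operator_smult(1)[OF a, of c]] False operatorD[OF a]
        by (auto simp: op_bound_def operator_algebra_simps hnorm_smult field_simps)
      then have "cstar_norm B a \<le> cstar_norm B (c \<odot>\<^bsub>B\<^esub> a) / cmod c" by (rule operator_norm_le)
      then show ?thesis using False by (simp add: field_simps)
    qed (use operatorD(4)[OF operator_smult(1)[OF a]] in auto)
  qed
  show "\<exists>x\<in>carrier B. (\<lambda>n. cstar_norm B (X n \<ominus>\<^bsub>B\<^esub> x)) \<longlonglongrightarrow> 0"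
    if "\<And>n. X n \<in> carrier B" "\<forall>\<epsilon>>0. \<exists>M. \<forall>m\<ge>M. \<forall>n\<ge>M. cstar_norm B (X m \<ominus>\<^bsub>B\<^esub> X n) < \<epsilon>" for X
    using that by (rule operator_complete)
next
  show "(c \<odot>\<^bsub>B\<^esub> a) \<otimes>\<^bsub>B\<^esub> b = c \<odot>\<^bsub>B\<^esub> (a \<otimes>\<^bsub>B\<^esub> b)" if "a \<in> carrier B" "b \<in> carrier B" for c a b
    using that by (intro operator_eqI) (auto simp: operator_rules operatorD operator_linear operator_apply)
  show "a \<otimes>\<^bsub>B\<^esub> (c \<odot>\<^bsub>B\<^esub> b) = c \<odot>\<^bsub>B\<^esub> (a \<otimes>\<^bsub>B\<^esub> b)" if "a \<in> carrier B" "b \<in> carrier B" for c a b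
    using that by (intro operator_eqI) (auto simp: operator_rules operatorD operator_linear operator_apply)
qed (auto simp: operator_star_closed operator_star_star operator_mult operator_add operator_smult 
    operatorD operator_cstar_identity intro!: operator_norm_le)

text \<open>
  Let \<open>s = \<parallel>T\<parallel>\<close> with \<open>T = \<Phi> a\<close>. If \<open>\<parallel>a\<parallel> < s\<close>, then \<open>1 - a\<^sup>* a / s\<^sup>2\<close> is invertible by the Neumann
  series, so \<open>1 - T\<^sup>* T / s\<^sup>2\<close> is bounded below. This contradicts
  \<open>\<parallel>x - T\<^sup>* T x / s\<^sup>2\<parallel>\<^sup>2 \<le> \<parallel>x\<parallel>\<^sup>2 - \<parallel>T x\<parallel>\<^sup>2 / s\<^sup>2\<close>, whose right-hand side is small at vectors where
  \<open>T\<close> almost attains its norm.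
\<close>

theorem operator_hom_contractive:
  assumes A: "cstar_algebra A" and hom: "cstar_hom A B \<Phi>" and a: "a \<in> carrier A"
  shows "cstar_norm B (\<Phi> a) \<le> cstar_norm A a"
proof (rule ccontr)
  assume "\<not> ?thesis"
  then have lt: "cstar_norm A a < cstar_norm B (\<Phi> a)" by simp
  interpret A: cstar_algebra A by (rule A)
  have \<Phi>: "\<And>x. x \<in> carrier A \<Longrightarrow> \<Phi> x \<in> carrier B"
    "\<And>x y. x \<in> carrier A \<Longrightarrow> y \<in> carrier A \<Longrightarrow> \<Phi> (x \<otimes>\<^bsub>A\<^esub> y) = \<Phi> x \<otimes>\<^bsub>B\<^esub> \<Phi> y"
    "\<And>x y. x \<in> carrier A \<Longrightarrow> y \<in> carrier A \<Longrightarrow> \<Phi> (x \<oplus>\<^bsub>A\<^esub> y) = \<Phi> x \<oplus>\<^bsub>B\<^esub> \<Phi> y"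
    "\<Phi> \<one>\<^bsub>A\<^esub> = \<one>\<^bsub>B\<^esub>" "\<And>c x. x \<in> carrier A \<Longrightarrow> \<Phi> (c \<odot>\<^bsub>A\<^esub> x) = c \<odot>\<^bsub>B\<^esub> \<Phi> x"
    "\<And>x. x \<in> carrier A \<Longrightarrow> \<Phi> (cstar_star A x) = cstar_star B (\<Phi> x)"
    using hom by (auto simp: cstar_hom_def ring_hom_def)
  define T where "T = \<Phi> a"
  define s where "s = cstar_norm B T"
  have s: "s > 0" "cstar_norm A a < s" using lt A.norm_nonneg[OF a] by (auto simp: s_def T_def)
  have T: "T \<in> carrier B" using \<Phi>(1)[OF a] by (simp add: T_def)
  define b where "b = of_real (1 / s\<^sup>2) \<odot>\<^bsub>A\<^esub> (cstar_star A a \<otimes>\<^bsub>A\<^esub> a)"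
  have b: "b \<in> carrier A" using a by (simp add: b_def A.star_closed)
  have bs: "cstar_star A b = b"
    using a by (simp add: b_def A.star_smult A.star_mult A.star_closed A.star_star)
  have "cstar_norm A b = (cstar_norm A a)\<^sup>2 / s\<^sup>2"
    using a A.star_closed[OF a] by (simp add: b_def A.norm_smult A.cstar_identity norm_divide norm_power)
  also have "\<dots> < 1" using s A.norm_nonneg[OF a] by (simp add: power_strict_mono)
  finally have "cstar_norm A b < 1" .
  then obtain c where c: "c \<in> carrier A" "(\<one>\<^bsub>A\<^esub> \<ominus>\<^bsub>A\<^esub> b) \<otimes>\<^bsub>A\<^esub> c = \<one>\<^bsub>A\<^esub>"
    using A.neumann_inverse[OF A.subalgebra_carrier _ b] by auto
  define d where "d = cstar_star A c"
  have d: "d \<in> carrier A" using c by (simp add: d_def A.star_closed)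
  have "d \<otimes>\<^bsub>A\<^esub> (\<one>\<^bsub>A\<^esub> \<ominus>\<^bsub>A\<^esub> b) = cstar_star A ((\<one>\<^bsub>A\<^esub> \<ominus>\<^bsub>A\<^esub> b) \<otimes>\<^bsub>A\<^esub> c)"
    using b c A.star_mult[of "\<one>\<^bsub>A\<^esub> \<ominus>\<^bsub>A\<^esub> b" c] A.star_minus[of "\<one>\<^bsub>A\<^esub>" b] by (simp add: d_def A.star_one bs)
  then have d1: "d \<otimes>\<^bsub>A\<^esub> (\<one>\<^bsub>A\<^esub> \<oplus>\<^bsub>A\<^esub> ((-1) \<odot>\<^bsub>A\<^esub> b)) = \<one>\<^bsub>A\<^esub>"
    using c A.star_one b A.minus_eq_smult by simp
  \<comment> \<open>The element \<open>d\<close> is a left inverse of \<open>1 - b\<close>; the maximum with 1 makes \<open>L\<close> positive and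
    \<open>1 - 1/L\<^sup>2\<close> nonnegative.\<close>
  define L where "L = max 1 (cstar_norm B (\<Phi> d))"
  have L: "L \<ge> 1" "cstar_norm B (\<Phi> d) \<le> L" by (auto simp: L_def)
  have key: "(hnorm H (T x))\<^sup>2 \<le> s\<^sup>2 * (1 - 1 / L\<^sup>2) * (hnorm H x)\<^sup>2" if x: "x \<in> carrier H" for x
  proof -
    let ?S = "cstar_star B T"
    have S: "?S \<in> carrier B" by (rule operator_star_closed[OF T])
    define y where "y = ?S (T x)"
    have Tx: "T x \<in> carrier H" and y: "y \<in> carrier H"
      using operatorD(2)[OF T] operatorD(2)[OF S] x by (auto simp: y_def)
    define w where "w = x \<ominus> of_real (1 / s\<^sup>2) \<odot> y"
    have w: "w \<in> carrier H" using x y by (simp add: w_def)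
    have "\<Phi> b = of_real (1 / s\<^sup>2) \<odot>\<^bsub>B\<^esub> (?S \<otimes>\<^bsub>B\<^esub> T)"
      using a by (simp add: b_def \<Phi> A.star_closed T_def)
    then have bx: "\<Phi> b x = of_real (1 / s\<^sup>2) \<odot> y" using x by (simp add: operator_algebra_simps y_def)
    have "(-1) \<odot>\<^bsub>A\<^esub> b \<in> carrier A" using b by simp
    then have "\<one>\<^bsub>B\<^esub> = \<Phi> d \<otimes>\<^bsub>B\<^esub> (\<one>\<^bsub>B\<^esub> \<oplus>\<^bsub>B\<^esub> ((-1) \<odot>\<^bsub>B\<^esub> \<Phi> b))"
      using arg_cong[OF d1, of \<Phi>] b d by (simp add: \<Phi>)
    then have "x = (\<Phi> d \<otimes>\<^bsub>B\<^esub> (\<one>\<^bsub>B\<^esub> \<oplus>\<^bsub>B\<^esub> ((-1) \<odot>\<^bsub>B\<^esub> \<Phi> b))) x"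
      using x by (metis operator_algebra_simps(2) restrict_apply')
    also have "\<dots> = \<Phi> d w" using x y 
      by (simp add: operator_algebra_simps bx w_def minus_eq_smult)
    finally have "hnorm H x \<le> cstar_norm B (\<Phi> d) * hnorm H w"
      using operatorD(3)[OF \<Phi>(1)[OF d] w] by simp
    also have "\<dots> \<le> L * hnorm H w" using L w by (intro mult_right_mono) auto
    finally have "(hnorm H x)\<^sup>2 \<le> L\<^sup>2 * (hnorm H w)\<^sup>2"
      using x by (metis hnorm_nonneg power_mono power_mult_distrib)
    moreover have "(hnorm H w)\<^sup>2 \<le> (hnorm H x)\<^sup>2 - (hnorm H (T x))\<^sup>2 / s\<^sup>2"
    proof -
      have xy: "hinner H x y = of_real ((hnorm H (T x))\<^sup>2)"
        using adjoint_pairD(3)[OF operator_star(1)[OF T] x Tx] inner_self[OF Tx] by (simp add: y_def)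
      then have yx: "hinner H y x = of_real ((hnorm H (T x))\<^sup>2)" using inner_commute[OF x y] by simp
      have "of_real ((hnorm H w)\<^sup>2) = hinner H w w" using inner_self[OF w] by simp
      also have "\<dots> = of_real ((hnorm H x)\<^sup>2 - 2 * (hnorm H (T x))\<^sup>2 / s\<^sup>2 + (hnorm H y)\<^sup>2 / s\<^sup>2 / s\<^sup>2)"
        using x y by (simp add: w_def inner_simps xy yx inner_self[OF x] inner_self[OF y] diff_divide_distrib power4_eq_xxxx power2_eq_square)
      finally have eq: "(hnorm H w)\<^sup>2 = (hnorm H x)\<^sup>2 - 2 * (hnorm H (T x))\<^sup>2 / s\<^sup>2 + (hnorm H y)\<^sup>2 / s\<^sup>2 / s\<^sup>2"
        using of_real_eq_iff by blast
      have "hnorm H y \<le> s * hnorm H (T x)"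
        using operator_norm_star_le[OF T] Tx by (simp add: op_bound_def s_def y_def)
      then have "(hnorm H y)\<^sup>2 \<le> s\<^sup>2 * (hnorm H (T x))\<^sup>2"
        using y by (metis hnorm_nonneg power_mono power_mult_distrib)
      then have "(hnorm H y)\<^sup>2 / s\<^sup>2 \<le> (hnorm H (T x))\<^sup>2" using s by (simp add: field_simps)
      then have "(hnorm H y)\<^sup>2 / s\<^sup>2 / s\<^sup>2 \<le> (hnorm H (T x))\<^sup>2 / s\<^sup>2" by (rule divide_right_mono) simp
      then show ?thesis using eq by simp
    qed
    ultimately have "(hnorm H x)\<^sup>2 \<le> L\<^sup>2 * ((hnorm H x)\<^sup>2 - (hnorm H (T x))\<^sup>2 / s\<^sup>2)"
      by (smt (verit) mult_left_mono zero_le_power2)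
    then show ?thesis using s L by (simp add: field_simps)
  qed
  \<comment> \<open>A bound for \<open>T\<close> that is smaller than its norm.\<close>
  define C where "C = s * sqrt (1 - 1 / L\<^sup>2)"
  have L2: "1 / L\<^sup>2 \<le> 1" "1 / L\<^sup>2 > 0" using L by (auto simp: divide_simps)
  have C0: "C \<ge> 0" using s L2 by (simp add: C_def)
  have "op_bound H T C"
    unfolding op_bound_def
  proof (intro conjI ballI C0)
    fix x assume x: "x \<in> carrier H"
    have "(hnorm H (T x))\<^sup>2 \<le> (C * hnorm H x)\<^sup>2"
      using key[OF x] L2 by (simp add: C_def power_mult_distrib)
    then show "hnorm H (T x) \<le> C * hnorm H x"
      by (rule power2_le_imp_le) (use x C0 in simp)
  qed
  then have "s \<le> C" unfolding s_def by (rule operator_norm_le)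
  moreover have "sqrt (1 - 1 / L\<^sup>2) < 1" using L2 by simp
  then have "C < s" using s by (simp add: C_def)
  ultimately show False by simp
qed

end

section \<open>Completeness of square integrable functions\<close>

lemma borel_measurable_cnj [measurable (raw)]:
  assumes [measurable]: "f \<in> borel_measurable M"
  shows "(\<lambda>x. cnj (f x)) \<in> borel_measurable M"
proof -
  have "cnj \<in> borel_measurable borel" by (intro borel_measurable_continuous_onI continuous_intros)
  then show ?thesis by measurable
qed

lemma integral_cnj_mult_commute:
  "(\<integral>x. cnj (g x) * f x \<partial>M) = cnj (\<integral>x. cnj (f x) * g x \<partial>M)"
proof -
  have "(\<integral>x. cnj (g x) * f x \<partial>M) = (\<integral>x. cnj (cnj (f x) * g x) \<partial>M)" by (simp add: mult.commute)
  then show ?thesis by (simp only: Bochner_Integration.integral_cnj)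
qed

lemma L2_measurable [dest]: "f \<in> L2_functions M \<Longrightarrow> f \<in> borel_measurable M"
  by (simp add: L2_functions_def)

lemma L2_integrable: "f \<in> L2_functions M \<Longrightarrow> integrable M (\<lambda>x. (cmod (f x))\<^sup>2)"
  by (simp add: L2_functions_def)

lemma cmod_add_square_le: "(cmod (a + b))\<^sup>2 \<le> 2 * (cmod a)\<^sup>2 + 2 * (cmod b)\<^sup>2"
proof -
  have "(cmod (a + b))\<^sup>2 \<le> (cmod a + cmod b)\<^sup>2"
    by (intro power_mono norm_triangle_ineq) auto
  also have "\<dots> \<le> 2 * (cmod a)\<^sup>2 + 2 * (cmod b)\<^sup>2"
    using zero_le_power2[of "cmod a - cmod b"] by (simp add: power2_eq_square algebra_simps)
  finally show ?thesis .
qed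

lemma L2_add:
  assumes "f \<in> L2_functions M" "g \<in> L2_functions M"
  shows "(\<lambda>x. f x + g x) \<in> L2_functions M"
proof -
  have [measurable]: "f \<in> borel_measurable M" "g \<in> borel_measurable M" using assms by auto
  have "integrable M (\<lambda>x. (cmod (f x + g x))\<^sup>2)"
    by (rule Bochner_Integration.integrable_bound[of _ "\<lambda>x. 2 * (cmod (f x))\<^sup>2 + 2 * (cmod (g x))\<^sup>2"])
      (use assms cmod_add_square_le in \<open>auto simp: L2_functions_def\<close>)
  then show ?thesis by (simp add: L2_functions_def)
qed

lemma L2_smult: "f \<in> L2_functions M \<Longrightarrow> (\<lambda>x. c * f x) \<in> L2_functions M"
  by (auto simp: L2_functions_def norm_mult power_mult_distrib)

lemma L2_diff:
  assumes "f \<in> L2_functions M" "g \<in> L2_functions M"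
  shows "(\<lambda>x. f x - g x) \<in> L2_functions M"
  using L2_add[OF assms(1) L2_smult[OF assms(2), of "-1"]] by simp

lemma L2_zero: "(\<lambda>_. 0) \<in> L2_functions M"
  by (simp add: L2_functions_def)

lemma L2_product_integrable:
  assumes "f \<in> L2_functions M" "g \<in> L2_functions M"
  shows "integrable M (\<lambda>x. cnj (f x) * g x)"
proof (rule Bochner_Integration.integrable_bound[of _ "\<lambda>x. (cmod (f x))\<^sup>2 + (cmod (g x))\<^sup>2"])
  have [measurable]: "f \<in> borel_measurable M" "g \<in> borel_measurable M" using assms by auto
  show "(\<lambda>x. cnj (f x) * g x) \<in> borel_measurable M" by measurable
  have "cmod a * cmod b \<le> (cmod a)\<^sup>2 + (cmod b)\<^sup>2" for a b
  proof -
    have "2 * (cmod a * cmod b) \<le> (cmod a)\<^sup>2 + (cmod b)\<^sup>2"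
      using zero_le_power2[of "cmod a - cmod b"] by (simp add: power2_diff)
    moreover have "0 \<le> cmod a * cmod b" by simp
    ultimately show ?thesis by linarith
  qed
  then show "AE x in M. norm (cnj (f x) * g x) \<le> norm ((cmod (f x))\<^sup>2 + (cmod (g x))\<^sup>2)"
    by (simp add: norm_mult)
qed (use assms in \<open>auto simp: L2_functions_def\<close>)

lemma L2_cong:
  assumes "f \<in> L2_functions M" "g \<in> borel_measurable M" "AE x in M. g x = f x"
  shows "g \<in> L2_functions M"
proof -
  have "integrable M (\<lambda>x. (cmod (g x))\<^sup>2) \<longleftrightarrow> integrable M (\<lambda>x. (cmod (f x))\<^sup>2)"
    by (rule integrable_cong_AE) (use assms in \<open>auto simp: L2_functions_def\<close>)
  then show ?thesis using assms by (auto simp: L2_functions_def)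
qed

text \<open>
  Along a subsequence whose increments \<open>d\<^sub>k\<close> satisfy \<open>\<integral>|d\<^sub>k|\<^sup>2 < 16\<^sup>-\<^sup>k\<close>, the sum of the \<open>4\<^sup>k|d\<^sub>k|\<^sup>2\<close> is
  finite almost everywhere, so the subsequence converges there geometrically. The limit is a limit
  in mean by Fatou's lemma.
\<close>

lemma L2_complete:
  fixes X :: "nat \<Rightarrow> 'x \<Rightarrow> complex"
  assumes X: "\<And>n. X n \<in> L2_functions M"
    and C: "\<forall>\<epsilon>>0. \<exists>K. \<forall>m\<ge>K. \<forall>n\<ge>K. (\<integral>x. (cmod (X m x - X n x))\<^sup>2 \<partial>M) < \<epsilon>"
  shows "\<exists>f\<in>L2_functions M. (\<lambda>n. \<integral>x. (cmod (X n x - f x))\<^sup>2 \<partial>M) \<longlonglongrightarrow> 0"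
proof -
  have [measurable]: "X n \<in> borel_measurable M" for n using X by auto
  define I where "I f = (\<integral>\<^sup>+x. ennreal ((cmod (f x))\<^sup>2) \<partial>M)" for f :: "'x \<Rightarrow> complex"
  have I_eq: "I f = ennreal (\<integral>x. (cmod (f x))\<^sup>2 \<partial>M)" if "f \<in> L2_functions M" for f
    unfolding I_def by (rule nn_integral_eq_integral) (use that in \<open>auto simp: L2_functions_def\<close>)
  obtain K where K: "\<And>k m n. K k \<le> m \<Longrightarrow> K k \<le> n \<Longrightarrow> (\<integral>x. (cmod (X m x - X n x))\<^sup>2 \<partial>M) < (1/16)^k"
  proof -
    have "\<forall>k. \<exists>K. \<forall>m\<ge>K. \<forall>n\<ge>K. (\<integral>x. (cmod (X m x - X n x))\<^sup>2 \<partial>M) < (1/16)^k"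
      using C by simp
    then show ?thesis using that by metis
  qed
  define r where "r k = (\<Sum>i\<le>k. K i)" for k
  have rK: "K k \<le> r j" if "k \<le> j" for k j
    unfolding r_def using that by (intro member_le_sum) auto
  define d where "d k x = X (r (Suc k)) x - X (r k) x" for k x
  have [measurable]: "d k \<in> borel_measurable M" for k by (simp add: d_def[abs_def])
  have dI: "I (d k) \<le> ennreal ((1/16)^k)" for k
    using K[OF rK rK, of k "Suc k" k] I_eq[of "d k"] L2_diff[OF X X]
    by (simp add: d_def[abs_def] ennreal_leI)
  have "(\<integral>\<^sup>+x. (\<Sum>k. ennreal (4^k * (cmod (d k x))\<^sup>2)) \<partial>M) = (\<Sum>k. (\<integral>\<^sup>+x. ennreal (4^k * (cmod (d k x))\<^sup>2) \<partial>M))"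
    by (rule nn_integral_suminf) measurable
  also have "\<dots> = (\<Sum>k. ennreal (4^k) * I (d k))"
    unfolding I_def by (intro suminf_cong) (simp add: ennreal_mult nn_integral_cmult)
  also have "\<dots> \<le> (\<Sum>k. ennreal ((1/4)^k))"
  proof (rule suminf_le)
    fix k :: nat
    have "ennreal (4^k) * I (d k) \<le> ennreal (4^k) * ennreal ((1/16)^k)"
      by (intro mult_left_mono dI) auto
    also have "\<dots> = ennreal ((1/4)^k)" 
      by (simp add: ennreal_mult[symmetric] flip: power_mult_distrib)
    finally show "ennreal (4^k) * I (d k) \<le> ennreal ((1/4)^k)" .
  qed auto
  also have "\<dots> < \<infinity>" by (subst suminf_ennreal2) (auto simp: summable_geometric)
  finally have "AE x in M. (\<Sum>k. ennreal (4^k * (cmod (d k x))\<^sup>2)) \<noteq> \<infinity>"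
    by (intro nn_integral_noteq_infinite) auto
  then have conv: "AE x in M. convergent (\<lambda>k. X (r k) x)"
  proof (rule eventually_mono)
    fix x assume fin: "(\<Sum>k. ennreal (4^k * (cmod (d k x))\<^sup>2)) \<noteq> \<infinity>"
    have sm: "summable (\<lambda>k. 4^k * (cmod (d k x))\<^sup>2)"
      using fin by (intro summable_suminf_not_top) auto
    define S where "S = (\<Sum>k. 4^k * (cmod (d k x))\<^sup>2)"
    have S0: "S \<ge> 0" unfolding S_def using sm by (intro suminf_nonneg) auto
    have le: "norm (d k x) \<le> sqrt S * (1/2)^k" for k
    proof (rule power2_le_imp_le)
      have "4^k * (cmod (d k x))\<^sup>2 \<le> S"
        unfolding S_def using sum_le_suminf[OF sm, of "{k}"] by simp
      then have "(cmod (d k x))\<^sup>2 \<le> S * (1/4)^k" by (simp add: field_simps)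
      also have "\<dots> = (sqrt S * (1/2)^k)\<^sup>2"
      proof -
        have "((1/2::real)^k)\<^sup>2 = (1/4)^k" by (simp add: power2_eq_square flip: power_mult_distrib)
        then show ?thesis using S0 by (simp only: power_mult_distrib real_sqrt_pow2)
      qed
      finally show "(norm (d k x))\<^sup>2 \<le> (sqrt S * (1/2)^k)\<^sup>2" .
    qed (use S0 in auto)
    have "summable (\<lambda>k. d k x)"
      by (rule summable_comparison_test'[OF summable_mult[OF summable_geometric[of "1/2"]], where N = 0])
        (use le in auto)
    then have "convergent (\<lambda>n. \<Sum>k<n. d k x)" by (simp add: summable_iff_convergent)
    moreover have "(\<Sum>k<n. d k x) = X (r n) x - X (r 0) x" for n
      unfolding d_def by (rule sum_lessThan_telescope)
    ultimately have "convergent (\<lambda>n. X (r 0) x + (X (r n) x - X (r 0) x))"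
      by (intro convergent_add convergent_const) auto
    then show "convergent (\<lambda>k. X (r k) x)" by simp
  qed
  define f where "f x = lim (\<lambda>k. X (r k) x)" for x
  have f [measurable]: "f \<in> borel_measurable M"
    unfolding f_def[abs_def] by (rule borel_measurable_lim_metric) measurable
  have lim: "AE x in M. (\<lambda>k. X (r k) x) \<longlonglongrightarrow> f x"
    using conv by eventually_elim (simp add: f_def convergent_LIMSEQ_iff)
  have bound: "I (\<lambda>x. X n x - f x) \<le> ennreal ((1/16)^k)" if n: "K k \<le> n" for n k
  proof -
    have "I (\<lambda>x. X n x - f x) = (\<integral>\<^sup>+x. liminf (\<lambda>j. ennreal ((cmod (X n x - X (r j) x))\<^sup>2)) \<partial>M)"
      unfolding I_def
    proof (rule nn_integral_cong_AE, use lim in eventually_elim)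
      fix x assume "(\<lambda>k. X (r k) x) \<longlonglongrightarrow> f x"
      then have "(\<lambda>j. ennreal ((cmod (X n x - X (r j) x))\<^sup>2)) \<longlonglongrightarrow> ennreal ((cmod (X n x - f x))\<^sup>2)"
        by (intro tendsto_intros tendsto_ennrealI)
      then show "ennreal ((cmod (X n x - f x))\<^sup>2) = liminf (\<lambda>j. ennreal ((cmod (X n x - X (r j) x))\<^sup>2))"
        by (intro lim_imp_Liminf[symmetric]) auto
    qed
    also have "\<dots> \<le> liminf (\<lambda>j. I (\<lambda>x. X n x - X (r j) x))"
      unfolding I_def by (rule nn_integral_liminf) measurable
    also have "\<dots> \<le> ennreal ((1/16)^k)"
    proof (rule Liminf_le)
      show "\<forall>\<^sub>F j in sequentially. I (\<lambda>x. X n x - X (r j) x) \<le> ennreal ((1/16)^k)"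
        unfolding eventually_sequentially
        using K[OF n rK] I_eq[OF L2_diff[OF X X]]
        by (intro exI[of _ k]) (auto intro!: ennreal_leI less_imp_le)
    qed auto
    finally show ?thesis .
  qed
  have diffL2: "(\<lambda>x. X (K 0) x - f x) \<in> L2_functions M"
  proof -
    have "I (\<lambda>x. X (K 0) x - f x) < \<infinity>" using bound[of 0 "K 0"] by (simp add: le_less_trans)
    then have "integrable M (\<lambda>x. (cmod (X (K 0) x - f x))\<^sup>2)"
      unfolding I_def by (intro integrableI_bounded) auto
    then show ?thesis by (simp add: L2_functions_def)
  qed
  have fL2: "f \<in> L2_functions M"
    using L2_diff[OF X[of "K 0"] diffL2] by (simp)
  have "(\<lambda>n. \<integral>x. (cmod (X n x - f x))\<^sup>2 \<partial>M) \<longlonglongrightarrow> 0"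
  proof (rule LIMSEQ_I)
    fix e :: real assume "e > 0"
    then obtain k where k: "(1/16::real)^k < e" using real_arch_pow_inv[of e "1/16"] by auto
    have "norm ((\<integral>x. (cmod (X n x - f x))\<^sup>2 \<partial>M) - 0) < e" if "n \<ge> K k" for n
      using bound[OF that] I_eq[OF L2_diff[OF X fL2]] k by (simp add: ennreal_le_iff)
    then show "\<exists>no. \<forall>n\<ge>no. norm ((\<integral>x. (cmod (X n x - f x))\<^sup>2 \<partial>M) - 0) < e" by blast
  qed
  then show ?thesis using fL2 by blast
qed

section \<open>The Hilbert space of classes of square integrable functions\<close>

lemma L2_class_self: "f \<in> L2_functions M \<Longrightarrow> f \<in> L2_class M f"
  by (simp add: L2_class_def)

lemma L2_class_eqI:
  assumes "AE x in M. f x = g x" shows "L2_class M f = L2_class M g"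
proof -
  have "(AE x in M. u x = f x) \<longleftrightarrow> (AE x in M. u x = g x)" for u
  proof
    assume "AE x in M. u x = f x"
    then show "AE x in M. u x = g x" using assms by eventually_elim simp
  next
    assume "AE x in M. u x = g x"
    then show "AE x in M. u x = f x" using assms by eventually_elim simp
  qed
  then show ?thesis by (simp add: L2_class_def)
qed

lemma L2_rep:
  assumes "F \<in> carrier (L2_space M)"
  shows "L2_rep F \<in> L2_functions M" "L2_class M (L2_rep F) = F"
proof -
  obtain f where f: "f \<in> L2_functions M" "F = L2_class M f" using assms by (auto simp: L2_space_def)
  then have "f \<in> F" by (simp add: L2_class_self)
  then have "L2_rep F \<in> F" unfolding L2_rep_def by (rule someI[where P = "\<lambda>f. f \<in> F"])
  then have "L2_rep F \<in> L2_functions M" "AE x in M. L2_rep F x = f x" using f by (auto simp: L2_class_def)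
  then show "L2_rep F \<in> L2_functions M" "L2_class M (L2_rep F) = F" using f L2_class_eqI by auto
qed

lemma L2_class_carrier [simp, intro]: "f \<in> L2_functions M \<Longrightarrow> L2_class M f \<in> carrier (L2_space M)"
  by (simp add: L2_space_def)

lemma L2_rep_class:
  assumes "f \<in> L2_functions M" shows "AE x in M. L2_rep (L2_class M f) x = f x"
proof -
  have "L2_rep (L2_class M f) \<in> L2_class M f"
    unfolding L2_rep_def using L2_class_self[OF assms] by (rule someI[where P = "\<lambda>g. g \<in> L2_class M f"])
  then show ?thesis by (simp add: L2_class_def)
qed

lemma L2_space_zero: "\<zero>\<^bsub>L2_space M\<^esub> = L2_class M (\<lambda>_. 0)"
  by (simp add: L2_space_def)

lemma L2_space_add:
  assumes "f \<in> L2_functions M" "g \<in> L2_functions M"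
  shows "L2_class M f \<oplus>\<^bsub>L2_space M\<^esub> L2_class M g = L2_class M (\<lambda>x. f x + g x)"
proof -
  have "AE x in M. L2_rep (L2_class M f) x + L2_rep (L2_class M g) x = f x + g x"
    using L2_rep_class[OF assms(1)] L2_rep_class[OF assms(2)] by eventually_elim auto
  then show ?thesis by (simp add: L2_space_def L2_class_eqI)
qed

lemma L2_space_smult:
  assumes "f \<in> L2_functions M"
  shows "c \<odot>\<^bsub>L2_space M\<^esub> L2_class M f = L2_class M (\<lambda>x. c * f x)"
proof -
  have "AE x in M. c * L2_rep (L2_class M f) x = c * f x"
    using L2_rep_class[OF assms] by eventually_elim auto
  then show ?thesis by (simp add: L2_space_def L2_class_eqI)
qed

lemma L2_space_inner:
  assumes "f \<in> L2_functions M" "g \<in> L2_functions M"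
  shows "hinner (L2_space M) (L2_class M f) (L2_class M g) = (\<integral>x. cnj (f x) * g x \<partial>M)"
proof -
  note r = L2_rep(1)[OF L2_class_carrier]
  have "(\<integral>x. cnj (L2_rep (L2_class M f) x) * L2_rep (L2_class M g) x \<partial>M) = (\<integral>x. cnj (f x) * g x \<partial>M)"
  proof (rule integral_cong_AE)
    show "AE x in M. cnj (L2_rep (L2_class M f) x) * L2_rep (L2_class M g) x = cnj (f x) * g x"
      using L2_rep_class[OF assms(1)] L2_rep_class[OF assms(2)] by eventually_elim auto
  qed (use L2_measurable[OF assms(1)] L2_measurable[OF assms(2)] 
      L2_measurable[OF r[OF assms(1)]] L2_measurable[OF r[OF assms(2)]] in measurable)
  then show ?thesis by (simp add: L2_space_def)
qed

lemma L2_space_cases: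
  assumes "F \<in> carrier (L2_space M)"
  obtains f where "f \<in> L2_functions M" "F = L2_class M f"
  using assms by (auto simp: L2_space_def)

lemma L2_space_module: "module complex_ring (L2_space M)"
proof (rule moduleI)
  show "abelian_group (L2_space M)"
  proof (rule abelian_groupI)
    fix F assume "F \<in> carrier (L2_space M)"
    then obtain f where f: "f \<in> L2_functions M" "F = L2_class M f" by (rule L2_space_cases)
    then have "L2_class M (\<lambda>x. -1 * f x) \<oplus>\<^bsub>L2_space M\<^esub> F = \<zero>\<^bsub>L2_space M\<^esub>"
      using L2_space_add[OF L2_smult[OF f(1), of "-1"] f(1)] by (simp add: L2_space_zero)
    then show "\<exists>G\<in>carrier (L2_space M). G \<oplus>\<^bsub>L2_space M\<^esub> F = \<zero>\<^bsub>L2_space M\<^esub>"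
      using L2_smult[OF f(1), of "-1"] by blast
  qed (auto elim!: L2_space_cases simp: L2_space_add L2_space_zero L2_add L2_zero add_ac)
qed (auto elim!: L2_space_cases simp: cring_complex_ring L2_space_add L2_space_smult L2_add L2_smult algebra_simps)

lemma L2_space_minus:
  assumes "f \<in> L2_functions M" "g \<in> L2_functions M"
  shows "L2_class M f \<ominus>\<^bsub>L2_space M\<^esub> L2_class M g = L2_class M (\<lambda>x. f x - g x)"
proof -
  interpret module complex_ring "L2_space M" by (rule L2_space_module)
  have "\<ominus>\<^bsub>L2_space M\<^esub> L2_class M g = (-1) \<odot>\<^bsub>L2_space M\<^esub> L2_class M g"
    using smult_l_minus[of 1 "L2_class M g"] smult_one[of "L2_class M g"] assms by simp
  also have "\<dots> = L2_class M (\<lambda>x. -1 * g x)" using assms by (simp only: L2_space_smult)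
  finally show ?thesis
    using L2_space_add[OF assms(1) L2_smult[OF assms(2), of "-1"]] by (simp add: a_minus_def)
qed

lemma L2_space_hnorm:
  assumes "f \<in> L2_functions M"
  shows "hnorm (L2_space M) (L2_class M f) = sqrt (\<integral>x. (cmod (f x))\<^sup>2 \<partial>M)"
proof -
  have "(\<lambda>x. cnj (f x) * f x) = (\<lambda>x. of_real ((cmod (f x))\<^sup>2))"
    by (simp add: complex_norm_square[symmetric] mult.commute[of "cnj _"] del: of_real_power)
  then show ?thesis using L2_space_inner[OF assms assms] by (simp add: hnorm_def del: of_real_power)
qed

theorem L2_space_hilbert: "hilbert_space (L2_space M)"
proof (rule hilbert_space.intro)
  show "module complex_ring (L2_space M)" by (rule L2_space_module)
  show "hinner (L2_space M) F (G \<oplus>\<^bsub>L2_space M\<^esub> G') = hinner (L2_space M) F G + hinner (L2_space M) F G'"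
    if FG: "F \<in> carrier (L2_space M)" "G \<in> carrier (L2_space M)" "G' \<in> carrier (L2_space M)" for F G G'
  proof -
    obtain f g g' where fg: "f \<in> L2_functions M" "F = L2_class M f" "g \<in> L2_functions M" "G = L2_class M g"
      "g' \<in> L2_functions M" "G' = L2_class M g'" using FG by (elim L2_space_cases)
    have "(\<integral>x. cnj (f x) * (g x + g' x) \<partial>M) = (\<integral>x. cnj (f x) * g x \<partial>M) + (\<integral>x. cnj (f x) * g' x \<partial>M)"
      unfolding distrib_left
      by (rule Bochner_Integration.integral_add) (use L2_product_integrable fg in auto)
    then show ?thesis using fg by (simp add: L2_space_add L2_space_inner L2_add)
  qed
  show "hinner (L2_space M) F (c \<odot>\<^bsub>L2_space M\<^esub> G) = c * hinner (L2_space M) F G"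
    if FG: "F \<in> carrier (L2_space M)" "G \<in> carrier (L2_space M)" for c F G
    using FG by (auto elim!: L2_space_cases simp: L2_space_smult L2_space_inner L2_smult mult.left_commute)
  show "hinner (L2_space M) G F = cnj (hinner (L2_space M) F G)"
    if FG: "F \<in> carrier (L2_space M)" "G \<in> carrier (L2_space M)" for F G
    using FG by (auto elim!: L2_space_cases simp: L2_space_inner intro: integral_cnj_mult_commute)
  show "Re (hinner (L2_space M) F F) \<ge> 0" if F: "F \<in> carrier (L2_space M)" for F
  proof -
    obtain f where f: "f \<in> L2_functions M" "F = L2_class M f" using F by (rule L2_space_cases)
    have "(\<lambda>x. cnj (f x) * f x) = (\<lambda>x. of_real ((cmod (f x))\<^sup>2))"
      by (simp add: complex_norm_square[symmetric] mult.commute[of "cnj _"] del: of_real_power)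
    then show ?thesis using f by (simp add: L2_space_inner del: of_real_power)
  qed
  show "hinner (L2_space M) F F = 0 \<longleftrightarrow> F = \<zero>\<^bsub>L2_space M\<^esub>" if F: "F \<in> carrier (L2_space M)" for F
  proof -
    obtain f where f: "f \<in> L2_functions M" "F = L2_class M f" using F by (rule L2_space_cases)
    have "(\<lambda>x. cnj (f x) * f x) = (\<lambda>x. of_real ((cmod (f x))\<^sup>2))"
      by (simp add: complex_norm_square[symmetric] mult.commute[of "cnj _"] del: of_real_power)
    then have "hinner (L2_space M) F F = of_real (\<integral>x. (cmod (f x))\<^sup>2 \<partial>M)"
      using f by (simp add: L2_space_inner del: of_real_power)
    then have "hinner (L2_space M) F F = 0 \<longleftrightarrow> (\<integral>x. (cmod (f x))\<^sup>2 \<partial>M) = 0" by simp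
    also have "\<dots> \<longleftrightarrow> (AE x in M. f x = 0)"
      by (subst integral_nonneg_eq_0_iff_AE) (use L2_integrable[OF f(1)] in auto)
    also have "\<dots> \<longleftrightarrow> F = \<zero>\<^bsub>L2_space M\<^esub>"
    proof
      assume "AE x in M. f x = 0"
      then show "F = \<zero>\<^bsub>L2_space M\<^esub>" using f by (auto simp: L2_space_zero intro!: L2_class_eqI)
    next
      assume "F = \<zero>\<^bsub>L2_space M\<^esub>"
      then have "f \<in> L2_class M (\<lambda>_. 0)" using L2_class_self f by (auto simp: L2_space_zero)
      then show "AE x in M. f x = 0" by (simp add: L2_class_def)
    qed
    finally show ?thesis .
  qed
  fix X :: "nat \<Rightarrow> ('a \<Rightarrow> complex) set"
  assume X: "\<And>n. X n \<in> carrier (L2_space M)"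
    and C: "\<forall>\<epsilon>>0. \<exists>K. \<forall>m\<ge>K. \<forall>n\<ge>K. hnorm (L2_space M) (X m \<ominus>\<^bsub>L2_space M\<^esub> X n) < \<epsilon>"
  define x where "x n = L2_rep (X n)" for n
  have x: "x n \<in> L2_functions M" "X n = L2_class M (x n)" for n using L2_rep[OF X] by (auto simp: x_def)
  have "\<forall>\<epsilon>>0. \<exists>K. \<forall>m\<ge>K. \<forall>n\<ge>K. (\<integral>t. (cmod (x m t - x n t))\<^sup>2 \<partial>M) < \<epsilon>"
  proof (intro allI impI)
    fix e :: real assume "e > 0"
    then obtain K where K: "\<And>m n. m \<ge> K \<Longrightarrow> n \<ge> K \<Longrightarrow> hnorm (L2_space M) (X m \<ominus>\<^bsub>L2_space M\<^esub> X n) < sqrt e"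
      using C by (meson real_sqrt_gt_zero)
    then show "\<exists>K. \<forall>m\<ge>K. \<forall>n\<ge>K. (\<integral>t. (cmod (x m t - x n t))\<^sup>2 \<partial>M) < e"
      by (intro exI[of _ K]) (simp add: x L2_space_minus L2_space_hnorm L2_diff)
  qed
  from L2_complete[OF x(1) this] obtain f where f: "f \<in> L2_functions M"
    "(\<lambda>n. \<integral>t. (cmod (x n t - f t))\<^sup>2 \<partial>M) \<longlonglongrightarrow> 0" by blast
  have "(\<lambda>n. hnorm (L2_space M) (X n \<ominus>\<^bsub>L2_space M\<^esub> L2_class M f)) \<longlonglongrightarrow> 0"
    using tendsto_real_sqrt[OF f(2)] f(1) by (simp add: x L2_space_minus L2_space_hnorm L2_diff)
  then show "\<exists>F\<in>carrier (L2_space M). (\<lambda>n. hnorm (L2_space M) (X n \<ominus>\<^bsub>L2_space M\<^esub> F)) \<longlonglongrightarrow> 0"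
    using f by blast
qed

text \<open>
  For counting measure the classes are singletons and can be dropped. Operators on this copy of
  \<open>\<ell>\<^sup>2\<close> are maps on complex sequences, which is the type over which the universal property of the
  algebra ranges.
\<close>

definition ell2 :: "(nat \<Rightarrow> complex) hilbert" where
  "ell2 = \<lparr>carrier = L2_functions (count_space UNIV), mult = undefined, one = undefined,
     zero = (\<lambda>_. 0), add = (\<lambda>f g n. f n + g n), smult = (\<lambda>c f n. c * f n),
     hinner = (\<lambda>f g. \<integral>n. cnj (f n) * g n \<partial>count_space UNIV)\<rparr>"

lemma ell2_simps [simp]:
  "carrier ell2 = L2_functions (count_space UNIV)" "\<zero>\<^bsub>ell2\<^esub> = (\<lambda>_. 0)"
  "f \<oplus>\<^bsub>ell2\<^esub> g = (\<lambda>n. f n + g n)" "c \<odot>\<^bsub>ell2\<^esub> f = (\<lambda>n. c * f n)"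
  "hinner ell2 f g = (\<integral>n. cnj (f n) * g n \<partial>count_space UNIV)"
  by (simp_all add: ell2_def)

lemma ell2_module: "module complex_ring ell2"
proof (rule moduleI)
  show "abelian_group ell2"
  proof (rule abelian_groupI)
    fix f assume "f \<in> carrier ell2"
    then show "\<exists>g\<in>carrier ell2. g \<oplus>\<^bsub>ell2\<^esub> f = \<zero>\<^bsub>ell2\<^esub>"
      using L2_smult[of f _ "-1"] by (intro bexI[of _ "\<lambda>n. -1 * f n"]) auto
  qed (auto simp: L2_add L2_zero add_ac)
qed (auto simp: cring_complex_ring L2_add L2_smult algebra_simps)

lemma ell2_minus:
  assumes "f \<in> carrier ell2" "g \<in> carrier ell2"
  shows "f \<ominus>\<^bsub>ell2\<^esub> g = (\<lambda>n. f n - g n)"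
proof -
  interpret module complex_ring ell2 by (rule ell2_module)
  have "\<ominus>\<^bsub>ell2\<^esub> g = (-1) \<odot>\<^bsub>ell2\<^esub> g"
    using smult_l_minus[of 1 g] smult_one[of g] assms by simp
  then show ?thesis by (simp add: a_minus_def)
qed

lemma ell2_inner_self:
  "hinner ell2 f f = of_real (\<integral>n. (cmod (f n))\<^sup>2 \<partial>count_space UNIV)"
proof -
  have "(\<lambda>x. cnj (f x) * f x) = (\<lambda>x. of_real ((cmod (f x))\<^sup>2))"
    by (simp add: complex_norm_square[symmetric] mult.commute[of "cnj _"] del: of_real_power)
  then show ?thesis by (simp del: of_real_power)
qed

lemma ell2_hnorm: "hnorm ell2 f = sqrt (\<integral>n. (cmod (f n))\<^sup>2 \<partial>count_space UNIV)"
  unfolding hnorm_def ell2_inner_self by simp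

theorem ell2_hilbert: "hilbert_space ell2"
proof (rule hilbert_space.intro)
  show "module complex_ring ell2" by (rule ell2_module)
  show "hinner ell2 f (g \<oplus>\<^bsub>ell2\<^esub> g') = hinner ell2 f g + hinner ell2 f g'"
    if "f \<in> carrier ell2" "g \<in> carrier ell2" "g' \<in> carrier ell2" for f g g'
    using that L2_product_integrable[of f _ g] L2_product_integrable[of f _ g']
    by (simp add: distrib_left)
  show "hinner ell2 f f = 0 \<longleftrightarrow> f = \<zero>\<^bsub>ell2\<^esub>" if f: "f \<in> carrier ell2" for f
  proof -
    have "hinner ell2 f f = 0 \<longleftrightarrow> (\<integral>n. (cmod (f n))\<^sup>2 \<partial>count_space UNIV) = 0"
      unfolding ell2_inner_self by (rule of_real_eq_0_iff)
    also have "\<dots> \<longleftrightarrow> (AE n in count_space UNIV. (cmod (f n))\<^sup>2 = 0)"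
      by (rule integral_nonneg_eq_0_iff_AE) (use f in \<open>auto simp: L2_functions_def\<close>)
    also have "\<dots> \<longleftrightarrow> f = \<zero>\<^bsub>ell2\<^esub>" by (auto simp: AE_count_space)
    finally show ?thesis .
  qed
  show "Re (hinner ell2 f f) \<ge> 0" for f unfolding ell2_inner_self by simp
  fix X :: "nat \<Rightarrow> nat \<Rightarrow> complex"
  assume X: "\<And>n. X n \<in> carrier ell2"
    and C: "\<forall>\<epsilon>>0. \<exists>K. \<forall>m\<ge>K. \<forall>n\<ge>K. hnorm ell2 (X m \<ominus>\<^bsub>ell2\<^esub> X n) < \<epsilon>"
  have "\<forall>\<epsilon>>0. \<exists>K. \<forall>m\<ge>K. \<forall>n\<ge>K. (\<integral>t. (cmod (X m t - X n t))\<^sup>2 \<partial>count_space UNIV) < \<epsilon>"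
  proof (intro allI impI)
    fix e :: real assume "e > 0"
    then obtain K where K: "\<And>m n. m \<ge> K \<Longrightarrow> n \<ge> K \<Longrightarrow> hnorm ell2 (X m \<ominus>\<^bsub>ell2\<^esub> X n) < sqrt e"
      using C by (meson real_sqrt_gt_zero)
    then show "\<exists>K. \<forall>m\<ge>K. \<forall>n\<ge>K. (\<integral>t. (cmod (X m t - X n t))\<^sup>2 \<partial>count_space UNIV) < e"
      by (intro exI[of _ K]) (simp add: ell2_minus[OF X X] ell2_hnorm)
  qed
  with L2_complete[of X "count_space UNIV"] X obtain f where f: "f \<in> carrier ell2"
    "(\<lambda>n. \<integral>t. (cmod (X n t - f t))\<^sup>2 \<partial>count_space UNIV) \<longlonglongrightarrow> 0" by auto
  have "(\<lambda>n. hnorm ell2 (X n \<ominus>\<^bsub>ell2\<^esub> f)) \<longlonglongrightarrow> 0"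
    using tendsto_real_sqrt[OF f(2)] by (simp add: ell2_minus[OF X f(1)] ell2_hnorm)
  then show "\<exists>f\<in>carrier ell2. (\<lambda>n. hnorm ell2 (X n \<ominus>\<^bsub>ell2\<^esub> f)) \<longlonglongrightarrow> 0"
    using f by blast
qed (auto simp: mult.left_commute intro: integral_cnj_mult_commute)

section \<open>Trigonometric polynomials\<close>

inductive_set trig_poly :: "(complex \<Rightarrow> complex) set" where
  monomial: "(\<lambda>z. z powi n) \<in> trig_poly"
| add: "p \<in> trig_poly \<Longrightarrow> q \<in> trig_poly \<Longrightarrow> (\<lambda>z. p z + q z) \<in> trig_poly"
| smult: "p \<in> trig_poly \<Longrightarrow> (\<lambda>z. c * p z) \<in> trig_poly"

lemma trig_poly_mult:
  assumes "p \<in> trig_poly" "q \<in> trig_poly"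
  shows "\<exists>r\<in>trig_poly. \<forall>z\<in>circle. r z = p z * q z"
  using assms(1)
proof induction
  case (monomial m)
  show ?case using assms(2)
  proof induction
    case (monomial n)
    have "z powi (m + n) = z powi m * z powi n" if "z \<in> circle" for z :: complex
      by (rule power_int_add) (use that in auto)
    then show ?case by (intro bexI[OF _ trig_poly.monomial[of "m + n"]]) simp
  next
    case (add p q)
    then obtain r s where "r \<in> trig_poly" "s \<in> trig_poly" "\<forall>z\<in>circle. r z = z powi m * p z"
      "\<forall>z\<in>circle. s z = z powi m * q z" by blast
    then show ?case by (intro bexI[OF _ trig_poly.add[of r s]]) (auto simp: algebra_simps)
  next
    case (smult p c)
    then obtain r where "r \<in> trig_poly" "\<forall>z\<in>circle. r z = z powi m * p z" by blast
    then show ?case by (intro bexI[OF _ trig_poly.smult[of r c]]) auto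
  qed
next
  case (add p p')
  then obtain r s where "r \<in> trig_poly" "s \<in> trig_poly" "\<forall>z\<in>circle. r z = p z * q z"
    "\<forall>z\<in>circle. s z = p' z * q z" by blast
  then show ?case by (intro bexI[OF _ trig_poly.add[of r s]]) (auto simp: algebra_simps)
next
  case (smult p c)
  then obtain r where "r \<in> trig_poly" "\<forall>z\<in>circle. r z = p z * q z" by blast
  then show ?case by (intro bexI[OF _ trig_poly.smult[of r c]]) auto
qed

lemma trig_poly_const: "(\<lambda>_. c) \<in> trig_poly"
  using trig_poly.smult[OF trig_poly.monomial[of 0], of c] by simp

lemma trig_poly_real_polynomial:
  assumes "real_polynomial_function f"
  shows "\<exists>p\<in>trig_poly. \<forall>z\<in>circle. p z = of_real (f z)"
  using assms
proof induction
  case (linear f)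
  interpret bounded_linear f by fact
  define a b where "a = f 1" and "b = f \<i>"
  \<comment> \<open>On the circle \<open>Re z = (z + z\<^sup>-\<^sup>1) / 2\<close> and \<open>Im z = (z - z\<^sup>-\<^sup>1) / (2 \<i>)\<close>.\<close>
  define p where "p z = (of_real a - \<i> * of_real b) / 2 * z powi 1 + (of_real a + \<i> * of_real b) / 2 * z powi (-1)" for z
  have "p \<in> trig_poly"
    unfolding p_def[abs_def] by (intro trig_poly.add trig_poly.smult trig_poly.monomial)
  moreover have "p z = of_real (f z)" if "z \<in> circle" for z
  proof -
    have "z = Re z *\<^sub>R 1 + Im z *\<^sub>R \<i>" by (simp add: complex_eq_iff)
    then have "f z = Re z * a + Im z * b" unfolding a_def b_def by (metis add scaleR real_scaleR_def)
    moreover have "z * cnj z = 1" using that complex_norm_square[of z] by simp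
    then have "z powi (-1) = cnj z" using that by (simp add: power_int_minus inverse_unique)
    ultimately show ?thesis by (simp only: p_def power_int_1_right) (simp add: complex_eq_iff field_simps)
  qed
  ultimately show ?case by (intro bexI[of _ p]) auto
next
  case (const c)
  then show ?case by (intro bexI[OF _ trig_poly_const[of "of_real c"]]) auto
next
  case (add f g)
  obtain r where r: "r \<in> trig_poly" "\<forall>z\<in>circle. r z = of_real (f z)" using add.IH(1) by (rule bexE)
  obtain s where s: "s \<in> trig_poly" "\<forall>z\<in>circle. s z = of_real (g z)" using add.IH(2) by (rule bexE)
  show ?case using r s by (intro bexI[OF _ trig_poly.add[of r s]]) auto
next
  case (mult f g)
  obtain r where r: "r \<in> trig_poly" "\<forall>z\<in>circle. r z = of_real (f z)" using mult.IH(1) by (rule bexE)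
  obtain s where s: "s \<in> trig_poly" "\<forall>z\<in>circle. s z = of_real (g z)" using mult.IH(2) by (rule bexE)
  show ?case using trig_poly_mult[OF r(1) s(1)] r s by auto
qed

text \<open>
  The theorem of Stone and Weierstrass gives approximation by polynomials in \<open>Re z\<close> and \<open>Im z\<close>,
  and on the circle these are trigonometric polynomials.
\<close>

theorem trig_poly_dense:
  assumes f: "continuous_on circle f" and e: "\<epsilon> > 0"
  shows "\<exists>p\<in>trig_poly. \<forall>z\<in>circle. cmod (f z - p z) < \<epsilon>"
proof -
  have cs: "compact circle" by simp
  have cont: "continuous_on circle (\<lambda>z. Re (f z))" "continuous_on circle (\<lambda>z. Im (f z))"
    using f by (auto intro: continuous_intros)
  have e2: "\<epsilon> / 2 > 0" using e by simp
  obtain g where g: "real_polynomial_function g" "\<And>z. z \<in> circle \<Longrightarrow> \<bar>Re (f z) - g z\<bar> < \<epsilon> / 2"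
    using Stone_Weierstrass_real_polynomial_function[OF cs cont(1) e2] by metis
  obtain h where h: "real_polynomial_function h" "\<And>z. z \<in> circle \<Longrightarrow> \<bar>Im (f z) - h z\<bar> < \<epsilon> / 2"
    using Stone_Weierstrass_real_polynomial_function[OF cs cont(2) e2] by metis
  obtain p where p: "p \<in> trig_poly" "\<forall>z\<in>circle. p z = of_real (g z)"
    using trig_poly_real_polynomial[OF g(1)] by (rule bexE)
  obtain q where q: "q \<in> trig_poly" "\<forall>z\<in>circle. q z = of_real (h z)"
    using trig_poly_real_polynomial[OF h(1)] by (rule bexE)
  have "cmod (f z - (p z + \<i> * q z)) < \<epsilon>" if "z \<in> circle" for z
    using cmod_le[of "f z - (p z + \<i> * q z)"] g(2)[OF that] h(2)[OF that] p q that by simp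
  then show ?thesis by (intro bexI[OF _ trig_poly.add[OF p(1) trig_poly.smult[OF q(1), of \<i>]]]) auto
qed

lemma continuous_on_trig_poly: "p \<in> trig_poly \<Longrightarrow> continuous_on circle p"
  by (induction rule: trig_poly.induct) (auto intro!: continuous_intros)

section \<open>The dual group as a solenoid\<close>

text \<open>
  The group \<open>\<Lambda>\<close> is the increasing union of the cyclic groups generated by \<open>N\<^sup>-\<^sup>k\<close>. Hence a character
  of \<open>\<Lambda>\<close> is the same as a sequence of points of the circle each of which is the \<open>N\<close>-th power of the
  next one.
\<close>

definition solenoid :: "nat \<Rightarrow> (nat \<Rightarrow> complex) set" where
  "solenoid N = {z. \<forall>k. z k \<in> circle \<and> z (Suc k) ^ N = z k}"

definition seq_of :: "nat \<Rightarrow> (real \<Rightarrow> complex) \<Rightarrow> nat \<Rightarrow> complex" where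
  "seq_of N \<xi> k = \<xi> (1 / of_nat N ^ k)"

text \<open>
  The value at \<open>n/N\<^sup>k\<close> is \<open>z\<^sub>k\<^sup>n\<close>. On the solenoid it depends only on the quotient, so the choice of a
  numerator and an exponent is harmless.
\<close>

definition dual_of :: "nat \<Rightarrow> (nat \<Rightarrow> complex) \<Rightarrow> real \<Rightarrow> complex" where
  "dual_of N z = (\<lambda>x\<in>Lambda N.
     let p = SOME p. x = of_int (fst p) / of_nat N ^ snd p in z (snd p) powi fst p)"

locale scaling =
  fixes N :: nat
  assumes N_ge_2: "N \<ge> 2"
begin

lemma N_pos [simp]: "N > 0" "N \<noteq> 0" using N_ge_2 by auto

lemma LambdaI [intro]: "of_int n / of_nat N ^ k \<in> Lambda N"
  by (auto simp: Lambda_def)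

lemma LambdaE:
  assumes "x \<in> Lambda N"
  obtains n k where "x = of_int n / of_nat N ^ k"
  using assms by (auto simp: Lambda_def)

lemma Lambda_expand: "of_int n / real N ^ k = of_int (n * int N ^ d) / real N ^ (k + d)"
  by (simp add: power_add)

lemma Lambda_common:
  assumes "x \<in> Lambda N" "y \<in> Lambda N"
  obtains m n k where "x = of_int m / real N ^ k" "y = of_int n / real N ^ k"
proof -
  obtain m a where "x = of_int m / real N ^ a" using assms(1) by (rule LambdaE)
  moreover obtain n b where "y = of_int n / real N ^ b" using assms(2) by (rule LambdaE)
  ultimately have "x = of_int (m * int N ^ b) / real N ^ (a + b)" "y = of_int (n * int N ^ a) / real N ^ (a + b)"
    using Lambda_expand[of m a b] Lambda_expand[of n b a] by (auto simp: add.commute)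
  then show ?thesis using that by blast
qed

lemma Lambda_add: "x \<in> Lambda N \<Longrightarrow> y \<in> Lambda N \<Longrightarrow> x + y \<in> Lambda N"
proof -
  assume "x \<in> Lambda N" "y \<in> Lambda N"
  then obtain m n k where "x = of_int m / real N ^ k" "y = of_int n / real N ^ k" by (rule Lambda_common)
  then have "x + y = of_int (m + n) / real N ^ k" by (simp add: add_divide_distrib)
  then show ?thesis by (simp only: LambdaI)
qed

lemma Lambda_int [simp]: "of_int n \<in> Lambda N" using LambdaI[of n 0] by simp
lemma Lambda_0 [simp]: "0 \<in> Lambda N" using Lambda_int[of 0] by simp
lemma Lambda_1 [simp]: "1 \<in> Lambda N" using Lambda_int[of 1] by simp
lemma Lambda_inv [simp]: "1 / real N ^ k \<in> Lambda N" using LambdaI[of 1 k] by simp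

lemma Lambda_uminus: "x \<in> Lambda N \<Longrightarrow> - x \<in> Lambda N"
proof (elim LambdaE)
  fix n k assume "x = of_int n / real N ^ k"
  then have "- x = of_int (- n) / real N ^ k" by simp
  then show "- x \<in> Lambda N" by (simp only: LambdaI)
qed

lemma Lambda_mult_N: "x \<in> Lambda N \<Longrightarrow> real N * x \<in> Lambda N"
proof (elim LambdaE)
  fix n k assume "x = of_int n / real N ^ k"
  then have "real N * x = of_int (int N * n) / real N ^ k" by simp
  then show "real N * x \<in> Lambda N" by (simp only: LambdaI)
qed

lemma Lambda_div_N: "x \<in> Lambda N \<Longrightarrow> x / real N \<in> Lambda N"
proof (elim LambdaE)
  fix n k assume "x = of_int n / real N ^ k"
  then have "x / real N = of_int n / real N ^ Suc k" by simp
  then show "x / real N \<in> Lambda N" by (simp only: LambdaI)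
qed

lemma Lambda_powi: "real N powi j \<in> Lambda N"
proof (cases "j \<ge> 0")
  case True
  then have "real N powi j = of_int (int N ^ nat j)" by (simp add: power_int_def)
  then show ?thesis by (simp only: Lambda_int)
next
  case False
  then have "real N powi j = 1 / real N ^ nat (- j)" by (simp add: power_int_def field_simps)
  then show ?thesis by (simp only: Lambda_inv)
qed

abbreviation "K \<equiv> carrier (dual_group N)"

lemma dualD:
  assumes "\<xi> \<in> K"
  shows "\<xi> \<in> extensional (Lambda N)" "x \<in> Lambda N \<Longrightarrow> \<xi> x \<in> circle" "x \<in> Lambda N \<Longrightarrow> cmod (\<xi> x) = 1"
    "x \<in> Lambda N \<Longrightarrow> y \<in> Lambda N \<Longrightarrow> \<xi> (x + y) = \<xi> x * \<xi> y" "x \<in> Lambda N \<Longrightarrow> \<xi> x \<noteq> 0"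
  using assms by (auto simp: dual_group_def)

lemma dualI:
  assumes "\<xi> \<in> extensional (Lambda N)" "\<And>x. x \<in> Lambda N \<Longrightarrow> \<xi> x \<in> circle"
    "\<And>x y. x \<in> Lambda N \<Longrightarrow> y \<in> Lambda N \<Longrightarrow> \<xi> (x + y) = \<xi> x * \<xi> y"
  shows "\<xi> \<in> K"
  using assms by (auto simp: dual_group_def)

lemma dual_zero: "\<xi> \<in> K \<Longrightarrow> \<xi> 0 = 1"
  using dualD(4)[of \<xi> 0 0] dualD(5)[of \<xi> 0] by simp

lemma dual_uminus: 
  assumes "\<xi> \<in> K" "x \<in> Lambda N" shows "\<xi> (- x) = inverse (\<xi> x)"
proof -
  have "\<xi> x * \<xi> (- x) = 1"
    using dualD(4)[OF assms Lambda_uminus[OF assms(2)]] dual_zero[OF assms(1)] by simp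
  then show ?thesis using dualD(5)[OF assms] by (simp add: field_simps)
qed

lemma Lambda_of_nat_mult: "x \<in> Lambda N \<Longrightarrow> of_nat n * x \<in> Lambda N"
  by (induction n) (auto simp: distrib_right intro!: Lambda_add)

lemma dual_power:
  assumes "\<xi> \<in> K" "x \<in> Lambda N" shows "\<xi> (of_nat n * x) = \<xi> x ^ n"
  by (induction n) (use assms in \<open>auto simp: dual_zero distrib_right dualD Lambda_of_nat_mult\<close>)

lemma dual_power_int:
  assumes "\<xi> \<in> K" "x \<in> Lambda N" shows "\<xi> (of_int n * x) = \<xi> x powi n"
proof (cases n rule: int_cases2)
  case (nonneg m)
  then show ?thesis using dual_power[OF assms, of m] by simp
next
  case (nonpos m)
  then show ?thesis using dual_power[OF assms, of m] dual_uminus[OF assms(1) Lambda_of_nat_mult[OF assms(2)], of m]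
    by (simp add: power_int_minus)
qed

lemma dual_apply: "\<xi> \<in> K \<Longrightarrow> \<xi> (of_int n / of_nat N ^ k) = seq_of N \<xi> k powi n"
  using dual_power_int[of \<xi> "1 / real N ^ k" n] by (simp add: seq_of_def)

lemma seq_of_solenoid: "\<xi> \<in> K \<Longrightarrow> seq_of N \<xi> \<in> solenoid N"
  using dual_power[of \<xi> "1 / real N ^ Suc k" N for k, OF _ Lambda_inv] dualD(2)[of \<xi>, OF _ Lambda_inv]
  by (auto simp: solenoid_def seq_of_def)

lemma solenoid_circle: "z \<in> solenoid N \<Longrightarrow> z k \<in> circle" "z \<in> solenoid N \<Longrightarrow> z k \<noteq> 0"
proof -
  assume "z \<in> solenoid N"
  then show "z k \<in> circle" by (simp add: solenoid_def)
  then show "z k \<noteq> 0" by auto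
qed

lemma solenoid_power: "z \<in> solenoid N \<Longrightarrow> z (k + d) ^ (N ^ d) = z k"
  by (induction d arbitrary: k) (auto simp: solenoid_def power_mult)

lemma dual_of_apply:
  assumes z: "z \<in> solenoid N" shows "dual_of N z (of_int n / of_nat N ^ k) = z k powi n"
proof -
  have wd: "z l powi m = z k powi n" if "of_int m / real N ^ l = of_int n / real N ^ k" for m l n k
  proof -
    have shift: "z k powi n = z (k + d) powi (n * int N ^ d)" for k d n
      using solenoid_power[OF z, of k d] by (metis power_int_mult mult.commute of_nat_power power_int_of_nat)
    have "real_of_int (m * int N ^ k) = of_int (n * int N ^ l)" using that by (simp add: field_simps)
    then have "m * int N ^ k = n * int N ^ l" by (simp only: of_int_eq_iff)
    then show ?thesis using shift[of k n l] shift[of l m k] by (simp add: add.commute)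
  qed
  let ?P = "\<lambda>p. of_int n / real N ^ k = of_int (fst p) / real N ^ snd p"
  have "?P (SOME p. ?P p)" by (rule someI[of ?P "(n, k)"]) simp
  then show ?thesis using wd[of "fst (SOME p. ?P p)" "snd (SOME p. ?P p)" n k]
    by (simp add: dual_of_def Let_def LambdaI)
qed

lemma dual_of_carrier: 
  assumes z: "z \<in> solenoid N" shows "dual_of N z \<in> K"
proof (rule dualI)
  show "dual_of N z \<in> extensional (Lambda N)" by (simp add: dual_of_def)
  fix x y assume x: "x \<in> Lambda N"
  then obtain n k where "x = of_int n / real N ^ k" by (rule LambdaE)
  then show "dual_of N z x \<in> circle" 
    using solenoid_circle[OF z, of k] by (simp add: dual_of_apply[OF z] norm_power_int)
  assume y: "y \<in> Lambda N"
  from x y obtain m n k where xy: "x = of_int m / real N ^ k" "y = of_int n / real N ^ k" by (rule Lambda_common)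
  then have "x + y = of_int (m + n) / real N ^ k" by (simp add: add_divide_distrib)
  then show "dual_of N z (x + y) = dual_of N z x * dual_of N z y"
    unfolding xy using solenoid_circle[OF z, of k] by (simp only: dual_of_apply[OF z]) (simp add: power_int_add)
qed

lemma seq_of_dual_of: "z \<in> solenoid N \<Longrightarrow> seq_of N (dual_of N z) = z"
  using dual_of_apply[of z 1] by (auto simp: seq_of_def)

lemma dual_eqI:
  assumes "\<xi> \<in> K" "\<psi> \<in> K" "\<And>k. seq_of N \<xi> k = seq_of N \<psi> k"
  shows "\<xi> = \<psi>"
proof (rule extensionalityI[of _ "Lambda N"])
  fix x assume "x \<in> Lambda N"
  then obtain n k where "x = of_int n / real N ^ k" by (rule LambdaE)
  then show "\<xi> x = \<psi> x" using dual_apply[of \<xi> n k] dual_apply[of \<psi> n k] assms by simp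
qed (use assms dualD in auto)

lemma real_point_dual: "real_point N t \<in> K"
  by (rule dualI) (auto simp: real_point_def Lambda_add distrib_right cis_mult)

section \<open>The dual group is compact\<close>

lemma topspace_dual [simp]: "topspace (dual_topology N) = K"
  by (auto simp: dual_topology_def PiE_def dual_group_def)

lemma continuous_map_dual_eval:
  assumes "x \<in> Lambda N" shows "continuous_map (dual_topology N) euclidean (\<lambda>\<xi>. \<xi> x)"
  unfolding dual_topology_def
  by (rule continuous_map_from_subtopology) (rule continuous_map_product_projection[OF assms])

lemma continuous_map_euclidean_tendsto:
  "continuous_map X euclidean f \<longleftrightarrow> (\<forall>x\<in>topspace X. (f \<longlongrightarrow> f x) (atin X x))"
  by (simp add: continuous_map_atin limitin_canonical_iff)

lemma continuous_map_into_dual: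
  assumes f: "f \<in> topspace X \<rightarrow> K" and c: "\<And>x. x \<in> Lambda N \<Longrightarrow> continuous_map X euclidean (\<lambda>p. f p x)"
  shows "continuous_map X (dual_topology N) f"
  unfolding dual_topology_def continuous_map_in_subtopology continuous_map_componentwise
  using assms dualD(1) by auto

lemma dual_group_group: "group (dual_group N)"
proof (rule groupI)
  show "\<one>\<^bsub>dual_group N\<^esub> \<in> K" by (auto simp: dual_group_def Lambda_add)
  fix \<xi> assume \<xi>: "\<xi> \<in> K"
  let ?\<psi> = "\<lambda>x\<in>Lambda N. inverse (\<xi> x)"
  have "?\<psi> \<in> K" by (rule dualI) (use dualD[OF \<xi>] in \<open>auto simp: Lambda_add norm_inverse\<close>)
  moreover have "?\<psi> \<otimes>\<^bsub>dual_group N\<^esub> \<xi> = \<one>\<^bsub>dual_group N\<^esub>"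
    using dualD(5)[OF \<xi>] by (auto simp: dual_group_def restrict_def)
  ultimately show "\<exists>\<psi>\<in>K. \<psi> \<otimes>\<^bsub>dual_group N\<^esub> \<xi> = \<one>\<^bsub>dual_group N\<^esub>" by blast
  show "\<one>\<^bsub>dual_group N\<^esub> \<otimes>\<^bsub>dual_group N\<^esub> \<xi> = \<xi>"
    using dualD(1)[OF \<xi>] by (auto simp: dual_group_def restrict_def extensional_def)
  fix \<psi> assume \<psi>: "\<psi> \<in> K"
  show "\<xi> \<otimes>\<^bsub>dual_group N\<^esub> \<psi> \<in> K"
    using \<xi> \<psi> by (auto simp: dual_group_def Lambda_add norm_mult)
qed (auto simp: dual_group_def restrict_def mult.assoc)

lemma dual_inv:
  assumes \<xi>: "\<xi> \<in> K" shows "inv\<^bsub>dual_group N\<^esub> \<xi> = (\<lambda>x\<in>Lambda N. inverse (\<xi> x))"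
proof -
  interpret group "dual_group N" by (rule dual_group_group)
  let ?\<psi> = "\<lambda>x\<in>Lambda N. inverse (\<xi> x)"
  have "?\<psi> \<in> K" by (rule dualI) (use dualD[OF \<xi>] in \<open>auto simp: Lambda_add norm_inverse\<close>)
  moreover have "?\<psi> \<otimes>\<^bsub>dual_group N\<^esub> \<xi> = \<one>\<^bsub>dual_group N\<^esub>"
    using dualD(5)[OF \<xi>] by (auto simp: dual_group_def restrict_def)
  ultimately show ?thesis using \<xi> by (intro inv_equality) auto
qed

text \<open>
  Characters form a closed subset of a product of circles, which is compact by Tychonoff's theorem.
\<close>

lemma compact_space_dual: "compact_space (dual_topology N)"
proof -
  let ?P = "product_topology (\<lambda>_. euclidean :: complex topology) (Lambda N)"
  have proj: "continuous_map ?P euclidean (\<lambda>\<xi>. \<xi> x)" if "x \<in> Lambda N" for x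
    by (rule continuous_map_product_projection[OF that])
  have box: "compactin ?P (\<Pi>\<^sub>E x\<in>Lambda N. circle)"
    by (simp add: compactin_PiE)
  have closed_box: "closedin ?P (\<Pi>\<^sub>E x\<in>Lambda N. circle)"
    by (simp add: closedin_product_topology)
  have hom: "closedin ?P {\<xi> \<in> topspace ?P. \<xi> (x + y) = \<xi> x * \<xi> y}" if "x \<in> Lambda N" "y \<in> Lambda N" for x y
  proof (rule closedin_continuous_maps_eq[of euclidean])
    show "continuous_map ?P euclidean (\<lambda>\<xi>. \<xi> (x + y))" using proj Lambda_add that by blast
    show "continuous_map ?P euclidean (\<lambda>\<xi>. \<xi> x * \<xi> y)"
      using proj that unfolding continuous_map_euclidean_tendsto by (auto intro!: tendsto_mult)
  qed simp
  have "K = (\<Pi>\<^sub>E x\<in>Lambda N. circle) \<inter> (\<Inter>x\<in>Lambda N. \<Inter>y\<in>Lambda N. {\<xi> \<in> topspace ?P. \<xi> (x + y) = \<xi> x * \<xi> y})"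
    (is "_ = _ \<inter> ?E")
    using Lambda_0 by (auto simp: dual_group_def PiE_def extensional_def)
  moreover have "closedin ?P ?E"
    using hom Lambda_0 by (intro closedin_INT) auto
  ultimately have "compactin ?P K" using box by (simp add: compact_Int_closedin)
  then show ?thesis by (simp add: dual_topology_def compact_space_subtopology)
qed

lemma Hausdorff_dual: "Hausdorff_space (dual_topology N)"
  unfolding dual_topology_def by (intro Hausdorff_space_subtopology) (simp add: Hausdorff_space_product_topology)

theorem dual_compact_group: "compact_topological_group (dual_group N) (dual_topology N)"
  unfolding compact_topological_group_def
proof (intro conjI)
  show "continuous_map (prod_topology (dual_topology N) (dual_topology N)) (dual_topology N)
     (\<lambda>(\<xi>, \<psi>). \<xi> \<otimes>\<^bsub>dual_group N\<^esub> \<psi>)"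
  proof (rule continuous_map_into_dual)
    interpret group "dual_group N" by (rule dual_group_group)
    show "(\<lambda>(\<xi>, \<psi>). \<xi> \<otimes>\<^bsub>dual_group N\<^esub> \<psi>) \<in> topspace (prod_topology (dual_topology N) (dual_topology N)) \<rightarrow> K"
      by auto
    fix x assume x: "x \<in> Lambda N"
    have "continuous_map (prod_topology (dual_topology N) (dual_topology N)) euclidean (\<lambda>p. fst p x)"
      "continuous_map (prod_topology (dual_topology N) (dual_topology N)) euclidean (\<lambda>p. snd p x)"
      using continuous_map_compose[OF continuous_map_fst continuous_map_dual_eval[OF x]]
        continuous_map_compose[OF continuous_map_snd continuous_map_dual_eval[OF x]] by (auto simp: o_def)
    then have "continuous_map (prod_topology (dual_topology N) (dual_topology N)) euclidean (\<lambda>p. fst p x * snd p x)"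
      unfolding continuous_map_euclidean_tendsto by (auto intro!: tendsto_mult)
    moreover have "(case p of (\<xi>, \<psi>) \<Rightarrow> \<xi> \<otimes>\<^bsub>dual_group N\<^esub> \<psi>) x = fst p x * snd p x" for p
      using x by (simp add: dual_group_def split: prod.split)
    ultimately show "continuous_map (prod_topology (dual_topology N) (dual_topology N)) euclidean
        (\<lambda>p. (case p of (\<xi>, \<psi>) \<Rightarrow> \<xi> \<otimes>\<^bsub>dual_group N\<^esub> \<psi>) x)"
      by simp
  qed
  show "continuous_map (dual_topology N) (dual_topology N) (\<lambda>\<xi>. inv\<^bsub>dual_group N\<^esub> \<xi>)"
  proof (rule continuous_map_into_dual)
    interpret group "dual_group N" by (rule dual_group_group)
    show "(\<lambda>\<xi>. inv\<^bsub>dual_group N\<^esub> \<xi>) \<in> topspace (dual_topology N) \<rightarrow> K" by auto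
    fix x assume x: "x \<in> Lambda N"
    have "continuous_map (dual_topology N) euclidean (\<lambda>\<xi>. inverse (\<xi> x))"
      using continuous_map_dual_eval[OF x] dualD(5)[OF _ x]
      unfolding continuous_map_euclidean_tendsto by (auto intro!: tendsto_inverse)
    then show "continuous_map (dual_topology N) euclidean (\<lambda>\<xi>. (inv\<^bsub>dual_group N\<^esub> \<xi>) x)"
      by (rule continuous_map_eq) (simp add: dual_inv x)
  qed
qed (simp_all add: dual_group_group compact_space_dual Hausdorff_dual)

end

section \<open>Homomorphisms from the continuous functions on the circle\<close>

lemma continuous_circle_simps:
  "carrier continuous_circle = {f \<in> extensional circle. continuous_on circle f}"
  "f \<otimes>\<^bsub>continuous_circle\<^esub> g = (\<lambda>z\<in>circle. f z * g z)" "\<one>\<^bsub>continuous_circle\<^esub> = (\<lambda>z\<in>circle. 1)"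
  "f \<oplus>\<^bsub>continuous_circle\<^esub> g = (\<lambda>z\<in>circle. f z + g z)" "c \<odot>\<^bsub>continuous_circle\<^esub> f = (\<lambda>z\<in>circle. c * f z)"
  "cstar_star continuous_circle f = (\<lambda>z\<in>circle. cnj (f z))"
  by (simp_all add: continuous_circle_def)

lemma restrict_continuous_circle [intro]:
  "continuous_on circle f \<Longrightarrow> restrict f circle \<in> carrier continuous_circle"
  by (auto simp: continuous_circle_simps intro: continuous_on_eq)

lemma continuous_circle_restrict:
  "f \<in> carrier continuous_circle \<Longrightarrow> (\<lambda>z\<in>circle. f z) = f"
  by (auto simp: continuous_circle_simps extensional_restrict)

lemma continuous_circleD: "f \<in> carrier continuous_circle \<Longrightarrow> continuous_on circle f"
  by (simp add: continuous_circle_simps)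

lemma continuous_on_circle_power:
  assumes "continuous_on circle f" shows "continuous_on circle (\<lambda>z. f (z ^ n))"
  by (rule continuous_on_compose2[OF assms]) (auto intro!: continuous_intros simp: norm_power)

lemma circle_monomial_closed: "circle_monomial n \<in> carrier continuous_circle"
  unfolding circle_monomial_def by (intro restrict_continuous_circle continuous_intros) auto

context
  fixes A :: "'a cstar" (structure) and \<rho>
  assumes hom: "cstar_hom continuous_circle A \<rho>"
begin

lemma circle_hom_closed: "f \<in> carrier continuous_circle \<Longrightarrow> \<rho> f \<in> carrier A"
  using hom by (auto simp: cstar_hom_def ring_hom_def)

lemma circle_hom_simps:
  assumes "f \<in> carrier continuous_circle" "g \<in> carrier continuous_circle"
  shows "\<rho> (\<lambda>z\<in>circle. f z + g z) = \<rho> f \<oplus> \<rho> g" "\<rho> (\<lambda>z\<in>circle. f z * g z) = \<rho> f \<otimes> \<rho> g"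
    "\<rho> (\<lambda>z\<in>circle. c * f z) = c \<odot> \<rho> f" "\<rho> (\<lambda>z\<in>circle. cnj (f z)) = cstar_star A (\<rho> f)"
  using hom assms unfolding cstar_hom_def ring_hom_def continuous_circle_simps(2-6) by auto

lemma circle_hom_one: "\<rho> (\<lambda>z\<in>circle. 1) = \<one>"
  using hom unfolding cstar_hom_def ring_hom_def continuous_circle_simps(2-6) by auto

end

context cstar_algebra
begin

text \<open>
  A real function \<open>f\<close> with \<open>|f| \<le> 1\<close> is \<open>(u + u\<^sup>*) / 2\<close> for the unitary function
  \<open>u = f + \<i> \<surd>(1 - f\<^sup>2)\<close>, and homomorphisms preserve unitaries. The C*-identity reduces the
  general case to this one.
\<close>

lemma circle_hom_contractive:
  assumes hom: "cstar_hom continuous_circle A \<rho>"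
    and f: "f \<in> carrier continuous_circle" and le: "\<And>z. z \<in> circle \<Longrightarrow> cmod (f z) \<le> r"
  shows "cstar_norm A (\<rho> f) \<le> r"
proof -
  note cl = circle_hom_closed[OF hom] and sm = circle_hom_simps[OF hom] and on = circle_hom_one[OF hom]
  have n1: "cstar_norm A \<one> \<le> 1" using cnorm_one by (cases "\<one> = \<zero>") auto
  have real: "cstar_norm A (\<rho> (\<lambda>z\<in>circle. of_real (g z))) \<le> 1"
    if g: "continuous_on circle g" and g1: "\<And>z. z \<in> circle \<Longrightarrow> \<bar>g z\<bar> \<le> 1" for g :: "complex \<Rightarrow> real"
  proof -
    define u where "u = (\<lambda>z\<in>circle. of_real (g z) + \<i> * of_real (sqrt (1 - (g z)\<^sup>2)))"
    define u' where "u' = (\<lambda>z\<in>circle. cnj (u z))"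
    have u: "u \<in> carrier continuous_circle"
      unfolding u_def by (intro restrict_continuous_circle continuous_intros g)
    have u': "u' \<in> carrier continuous_circle"
      unfolding u'_def by (intro restrict_continuous_circle continuous_on_cnj continuous_circleD[OF u])
    have uu: "(\<lambda>z\<in>circle. u' z * u z) = (\<lambda>z\<in>circle. 1)"
    proof (rule restrict_ext)
      fix z :: complex assume z: "z \<in> circle"
      then have "(g z)\<^sup>2 \<le> 1" using g1[OF z] by (simp add: abs_square_le_1)
      then show "u' z * u z = 1"
        using z by (simp add: u'_def u_def complex_eq_iff power2_eq_square[symmetric])
    qed
    have star: "\<rho> u' = cstar_star A (\<rho> u)" unfolding u'_def by (rule sm(4)[OF u u])
    have "(cstar_norm A (\<rho> u))\<^sup>2 = cstar_norm A (\<rho> u' \<otimes> \<rho> u)"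
      using cstar_identity[OF cl[OF u]] by (simp add: star)
    also have "\<dots> = cstar_norm A \<one>" using sm(2)[OF u' u] on by (simp add: uu)
    finally have "(cstar_norm A (\<rho> u))\<^sup>2 \<le> 1" using n1 by simp
    then have un: "cstar_norm A (\<rho> u) \<le> 1" using norm_nonneg[OF cl[OF u]] by (simp add: power2_le_iff_abs_le abs_square_le_1)
    define s where "s = (\<lambda>z\<in>circle. u z + u' z)"
    have s: "s \<in> carrier continuous_circle"
      unfolding s_def by (intro restrict_continuous_circle continuous_intros continuous_circleD u u')
    have "(\<lambda>z\<in>circle. of_real (g z)) = (\<lambda>z\<in>circle. 1/2 * s z)"
      by (rule restrict_ext) (simp add: s_def u'_def u_def complex_eq_iff)
    then have "\<rho> (\<lambda>z\<in>circle. of_real (g z)) = (1/2) \<odot> (\<rho> u \<oplus> \<rho> u')"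
      using sm(3)[OF s s, of "1/2"] sm(1)[OF u u'] by (simp add: s_def[symmetric])
    then have "cstar_norm A (\<rho> (\<lambda>z\<in>circle. of_real (g z))) = 1/2 * cstar_norm A (\<rho> u \<oplus> \<rho> u')"
      using cl[OF u] cl[OF u'] by (simp add: norm_smult)
    also have "\<dots> \<le> 1/2 * (cstar_norm A (\<rho> u) + cstar_norm A (\<rho> u'))"
      using norm_triangle[OF cl[OF u] cl[OF u']] by simp
    also have "\<dots> \<le> 1" using un cnorm_star[OF cl[OF u]] by (simp add: star)
    finally show ?thesis .
  qed
  have unit: "cstar_norm A (\<rho> g) \<le> 1"
    if g: "g \<in> carrier continuous_circle" and g1: "\<And>z. z \<in> circle \<Longrightarrow> cmod (g z) \<le> 1" for g
  proof -
    define g' where "g' = (\<lambda>z\<in>circle. cnj (g z))"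
    have g': "g' \<in> carrier continuous_circle"
      unfolding g'_def by (intro restrict_continuous_circle continuous_on_cnj continuous_circleD[OF g])
    have "(\<lambda>z\<in>circle. g' z * g z) = (\<lambda>z\<in>circle. of_real ((cmod (g z))\<^sup>2))"
      by (rule restrict_ext) (simp add: g'_def complex_norm_square[symmetric] mult.commute[of "cnj _"] del: of_real_power)
    moreover have "cstar_norm A (\<rho> (\<lambda>z\<in>circle. of_real ((cmod (g z))\<^sup>2))) \<le> 1"
      by (rule real) (use g g1 in \<open>auto intro!: continuous_intros continuous_circleD simp: abs_square_le_1 power_le_one\<close>)
    ultimately have "cstar_norm A (\<rho> g' \<otimes> \<rho> g) \<le> 1" using sm(2)[OF g' g] by simp
    then have "(cstar_norm A (\<rho> g))\<^sup>2 \<le> 1"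
      using cstar_identity[OF cl[OF g]] sm(4)[OF g g] by (simp add: g'_def)
    then show ?thesis using norm_nonneg[OF cl[OF g]] by (simp add: power2_le_iff_abs_le abs_square_le_1)
  qed
  have pos: "cstar_norm A (\<rho> f) \<le> s" if s: "s > 0" "r \<le> s" for s
  proof -
    define g where "g = (\<lambda>z\<in>circle. of_real (1 / s) * f z)"
    have g: "g \<in> carrier continuous_circle"
      unfolding g_def by (intro restrict_continuous_circle continuous_intros continuous_circleD f)
    have "cmod (g z) \<le> 1" if "z \<in> circle" for z
      using le[OF that] s that by (simp add: g_def norm_mult norm_divide field_simps)
    then have "cstar_norm A (\<rho> g) \<le> 1" by (rule unit[OF g])
    moreover have "\<rho> g = of_real (1 / s) \<odot> \<rho> f" unfolding g_def by (rule sm(3)[OF f f])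
    ultimately show ?thesis using s cl[OF f] by (simp add: norm_smult norm_divide field_simps)
  qed
  have "r \<ge> 0" using le[of 1] norm_ge_zero[of "f 1"] by (simp del: norm_ge_zero)
  then have "cstar_norm A (\<rho> f) \<le> r + e" if "e > 0" for e using pos[of "r + e"] that by simp
  then show ?thesis by (rule field_le_epsilon)
qed

lemma commutant_subalgebra:
  assumes T: "T \<subseteq> carrier A" and star: "\<And>t. t \<in> T \<Longrightarrow> cstar_star A t \<in> T"
  shows "cstar_subalgebra A {a \<in> carrier A. \<forall>t\<in>T. a \<otimes> t = t \<otimes> a}" (is "cstar_subalgebra A ?C")
  unfolding cstar_subalgebra_def
proof (intro conjI ballI allI impI)
  fix a b assume a: "a \<in> ?C" and b: "b \<in> ?C"
  show "a \<oplus> b \<in> ?C" using a b T by (auto simp: l_distr r_distr subset_iff)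
  have "a \<otimes> b \<otimes> t = t \<otimes> (a \<otimes> b)" if "t \<in> T" for t
  proof -
    have t: "t \<in> carrier A" using T that by auto
    have "a \<otimes> b \<otimes> t = a \<otimes> (t \<otimes> b)" using a b t that by (simp add: m_assoc)
    also have "\<dots> = (a \<otimes> t) \<otimes> b" using a b t by (simp add: m_assoc)
    also have "\<dots> = t \<otimes> (a \<otimes> b)" using a b t that by (simp add: m_assoc)
    finally show ?thesis .
  qed
  then show "a \<otimes> b \<in> ?C" using a b by auto
next
  fix c a assume a: "a \<in> ?C"
  show "c \<odot> a \<in> ?C" using a T by (auto simp: smult_mult_left smult_mult_right subset_iff)
next
  fix a assume a: "a \<in> ?C"
  have "cstar_star A a \<otimes> t = t \<otimes> cstar_star A a" if t: "t \<in> T" for t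
  proof -
    have tA: "t \<in> carrier A" "cstar_star A t \<in> carrier A" using T t star by auto
    have "cstar_star A (cstar_star A t \<otimes> a) = cstar_star A (a \<otimes> cstar_star A t)"
      using a star[OF t] by auto
    then show ?thesis using a tA by (simp add: star_mult star_star)
  qed
  then show "cstar_star A a \<in> ?C" using a star_closed by auto
next
  fix X :: "nat \<Rightarrow> 'a" and x
  assume x: "x \<in> carrier A" and X: "\<forall>n. X n \<in> ?C" and lim: "(\<lambda>n. cstar_norm A (X n \<ominus> x)) \<longlonglongrightarrow> 0"
  have "x \<otimes> t = t \<otimes> x" if "t \<in> T" for t
  proof (rule clim_unique)
    have t: "t \<in> carrier A" using T that by auto
    have XA: "X n \<in> carrier A" for n using X by auto
    show "(\<lambda>n. cstar_norm A (X n \<otimes> t \<ominus> x \<otimes> t)) \<longlonglongrightarrow> 0" by (rule clim_mult_right[OF XA x t lim])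
    have "(\<lambda>n. cstar_norm A (t \<otimes> X n \<ominus> t \<otimes> x)) \<longlonglongrightarrow> 0" by (rule clim_mult_left[OF XA x t lim])
    then show "(\<lambda>n. cstar_norm A (X n \<otimes> t \<ominus> t \<otimes> x)) \<longlonglongrightarrow> 0" using X that by simp
    show "X n \<otimes> t \<in> carrier A" "x \<otimes> t \<in> carrier A" "t \<otimes> x \<in> carrier A" for n using XA x t by auto
  qed
  then show "x \<in> ?C" using x by auto
qed (use T in \<open>auto\<close>)

end

section \<open>The abelian subalgebra and its characters\<close>

locale covariant_algebra = scaling N + cstar_algebra A
  for N :: nat and A :: "'a cstar" (structure) +
  fixes \<iota> :: "(complex \<Rightarrow> complex) \<Rightarrow> 'a" and U :: 'a
  assumes covariant: "covariant_pair N A \<iota> U"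
begin

abbreviation "CT \<equiv> carrier continuous_circle"
abbreviation "\<rho> \<equiv> conj_power A \<iota> U"
abbreviation "gen \<equiv> cstar_generated A {\<rho> i f | i f. f \<in> CT}"

lemma \<iota>_hom: "cstar_hom continuous_circle A \<iota>" using covariant by (simp add: covariant_pair_def)

lemma U_closed [simp]: "U \<in> carrier A" and star_U_U: "cstar_star A U \<otimes> U = \<one>" 
  and U_star_U: "U \<otimes> cstar_star A U = \<one>"
  using covariant by (auto simp: covariant_pair_def)

lemma inv_U: "inv U = cstar_star A U"
  by (rule inv_char) (auto simp: star_closed star_U_U U_star_U)

lemma inv_U_closed [simp]: "inv U \<in> carrier A" by (simp add: inv_U star_closed)

lemma inv_U_U: "inv U \<otimes> U = \<one>" "U \<otimes> inv U = \<one>" by (simp_all add: inv_U star_U_U U_star_U)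

lemma covariance: "f \<in> CT \<Longrightarrow> U \<otimes> \<iota> f \<otimes> inv U = \<iota> (\<lambda>z\<in>circle. f (z ^ N))"
  using covariant by (simp add: covariant_pair_def)

lemma star_U_power: "cstar_star A (U [^] i) = inv U [^] (i::nat)"
proof (induction i)
  case (Suc i)
  have "cstar_star A (U [^] Suc i) = inv U \<otimes> inv U [^] i"
    using Suc by (simp add: star_mult inv_U[symmetric])
  also have "\<dots> = inv U [^] Suc i" by (rule nat_pow_Suc2[symmetric]) simp
  finally show ?case .
qed (simp add: star_one)

lemma U_power_inv: "inv U [^] (i::nat) \<otimes> U [^] i = \<one>" "U [^] i \<otimes> inv U [^] i = \<one>"
proof (induction i)
  case (Suc i)
  have "inv U [^] Suc i \<otimes> U [^] Suc i = inv U [^] i \<otimes> ((inv U \<otimes> U) \<otimes> U [^] i)"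
    by (subst nat_pow_Suc2[of U]) (simp_all add: m_assoc)
  then show "inv U [^] Suc i \<otimes> U [^] Suc i = \<one>" using Suc by (simp add: inv_U_U)
  have "U [^] Suc i \<otimes> inv U [^] Suc i = U [^] i \<otimes> ((U \<otimes> inv U) \<otimes> inv U [^] i)"
    by (subst nat_pow_Suc2[of "inv U"]) (simp_all add: m_assoc)
  then show "U [^] Suc i \<otimes> inv U [^] Suc i = \<one>" using Suc by (simp add: inv_U_U)
qed simp_all

lemma \<iota>_closed [simp]: "f \<in> CT \<Longrightarrow> \<iota> f \<in> carrier A" by (rule circle_hom_closed[OF \<iota>_hom])

lemma \<rho>_hom: "cstar_hom continuous_circle A (\<rho> i)"
proof -
  let ?P = "U [^] i" and ?Q = "inv U [^] i"
  have cl: "?P \<in> carrier A" "?Q \<in> carrier A" by auto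
  have cancel: "?Q \<otimes> a \<otimes> ?P \<otimes> (?Q \<otimes> b \<otimes> ?P) = ?Q \<otimes> (a \<otimes> b) \<otimes> ?P" 
    if ab: "a \<in> carrier A" "b \<in> carrier A" for a b
  proof -
    have "?Q \<otimes> a \<otimes> ?P \<otimes> (?Q \<otimes> b \<otimes> ?P) = ?Q \<otimes> a \<otimes> ((?P \<otimes> ?Q) \<otimes> b) \<otimes> ?P"
      using ab cl by (simp add: m_assoc)
    then show ?thesis using ab cl by (simp add: U_power_inv m_assoc)
  qed
  have ring: "\<rho> i \<in> ring_hom continuous_circle A"
  proof (rule ring_hom_memI)
    show "\<rho> i f \<in> carrier A" if "f \<in> CT" for f using that by (simp add: conj_power_def)
    show "\<rho> i (f \<otimes>\<^bsub>continuous_circle\<^esub> g) = \<rho> i f \<otimes> \<rho> i g"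
      if "f \<in> CT" "g \<in> CT" for f g
      using that circle_hom_simps[OF \<iota>_hom that] cancel by (simp add: continuous_circle_simps(2) conj_power_def)
    show "\<rho> i (f \<oplus>\<^bsub>continuous_circle\<^esub> g) = \<rho> i f \<oplus> \<rho> i g"
      if "f \<in> CT" "g \<in> CT" for f g
      using that circle_hom_simps[OF \<iota>_hom that] by (simp add: continuous_circle_simps(4) conj_power_def l_distr r_distr)
    show "\<rho> i \<one>\<^bsub>continuous_circle\<^esub> = \<one>"
      using circle_hom_one[OF \<iota>_hom] by (simp add: continuous_circle_simps(3) conj_power_def U_power_inv)
  qed
  have starP: "cstar_star A ?P = ?Q" "cstar_star A ?Q = ?P"
    using star_U_power[of i] star_star[OF cl(1)] by auto
  show ?thesis unfolding cstar_hom_def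
  proof (intro conjI allI ballI ring)
    fix c f assume f: "f \<in> CT"
    show "\<rho> i (c \<odot>\<^bsub>continuous_circle\<^esub> f) = c \<odot> \<rho> i f"
      using f circle_hom_simps[OF \<iota>_hom f f] by (simp add: continuous_circle_simps(5) conj_power_def smult_mult_left smult_mult_right)
  next
    fix f assume f: "f \<in> CT"
    show "\<rho> i (cstar_star continuous_circle f) = cstar_star A (\<rho> i f)"
      using f circle_hom_simps[OF \<iota>_hom f f] 
      by (simp add: continuous_circle_simps(6) conj_power_def star_mult star_closed starP m_assoc)
  qed
qed

lemmas \<rho>_closed [simp] = circle_hom_closed[OF \<rho>_hom]
lemmas \<rho>_simps = circle_hom_simps[OF \<rho>_hom]
lemmas \<rho>_one = circle_hom_one[OF \<rho>_hom]
lemmas \<rho>_contractive = circle_hom_contractive[OF \<rho>_hom]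

lemma power_CT [intro]: "f \<in> CT \<Longrightarrow> (\<lambda>z\<in>circle. f (z ^ n)) \<in> CT"
  by (intro restrict_continuous_circle continuous_on_circle_power continuous_circleD)

lemma \<rho>_Suc: 
  assumes f: "f \<in> CT" shows "\<rho> (Suc i) (\<lambda>z\<in>circle. f (z ^ N)) = \<rho> i f"
proof -
  have c: "inv U \<otimes> (U \<otimes> x) = x" if "x \<in> carrier A" for x
    using that by (simp add: m_assoc[symmetric] inv_U_U)
  have "\<rho> (Suc i) (\<lambda>z\<in>circle. f (z ^ N)) = (inv U [^] i \<otimes> inv U) \<otimes> (U \<otimes> \<iota> f \<otimes> inv U) \<otimes> (U \<otimes> U [^] i)"
    using covariance[OF f] by (simp add: conj_power_def nat_pow_Suc2[of U, symmetric])
  also have "\<dots> = \<rho> i f" using f by (simp add: conj_power_def m_assoc c)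
  finally show ?thesis .
qed

lemma \<rho>_shift: "f \<in> CT \<Longrightarrow> \<rho> (i + d) (\<lambda>z\<in>circle. f (z ^ (N ^ d))) = \<rho> i f"
proof (induction d arbitrary: f)
  case 0
  then show ?case by (simp add: continuous_circle_restrict)
next
  case (Suc d)
  have "(\<lambda>z\<in>circle. f (z ^ (N ^ Suc d))) = (\<lambda>z\<in>circle. (\<lambda>w\<in>circle. f (w ^ (N ^ d))) (z ^ N))"
    by (rule restrict_ext) (simp add: norm_power power_mult)
  moreover have "\<rho> (Suc (i + d)) (\<lambda>z\<in>circle. (\<lambda>w\<in>circle. f (w ^ (N ^ d))) (z ^ N)) = \<rho> i f"
    using \<rho>_Suc[OF power_CT[OF Suc.prems]] Suc.IH[OF Suc.prems] by (simp only:)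
  ultimately show ?case by (simp only: add_Suc_right)
qed

text \<open>
  By \<open>\<rho>_shift\<close> both elements lie in the image of one and the same \<open>\<rho> k\<close>, where \<open>k\<close> is the larger
  index, and this image is commutative.
\<close>

lemma \<rho>_commute:
  assumes "f \<in> CT" "g \<in> CT" shows "\<rho> i f \<otimes> \<rho> j g = \<rho> j g \<otimes> \<rho> i f"
proof -
  have same: "\<rho> k f \<otimes> \<rho> k g = \<rho> k g \<otimes> \<rho> k f" if "f \<in> CT" "g \<in> CT" for f g k
    using \<rho>_simps(2)[OF that, of k] \<rho>_simps(2)[OF that(2,1), of k] by (simp add: mult.commute)
  show ?thesis
  proof (cases "i \<le> j")
    case True
    then show ?thesis using same[OF power_CT[OF assms(1), of "N ^ (j - i)"] assms(2), of j] 
        \<rho>_shift[OF assms(1), of i "j - i"] by simp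
  next
    case False
    then show ?thesis using same[OF assms(1) power_CT[OF assms(2), of "N ^ (i - j)"], of i] 
        \<rho>_shift[OF assms(2), of j "i - j"] by simp
  qed
qed

lemma gen_subalgebra: "cstar_subalgebra A gen"
  by (rule generated_subalgebra) auto

lemma gen_closed:
  "a \<in> gen \<Longrightarrow> b \<in> gen \<Longrightarrow> a \<oplus> b \<in> gen" "a \<in> gen \<Longrightarrow> b \<in> gen \<Longrightarrow> a \<otimes> b \<in> gen"
  "a \<in> gen \<Longrightarrow> c \<odot> a \<in> gen" "a \<in> gen \<Longrightarrow> cstar_star A a \<in> gen" "\<zero> \<in> gen" "a \<in> gen \<Longrightarrow> a \<in> carrier A"
  using gen_subalgebra unfolding cstar_subalgebra_def by blast+

lemma \<rho>_gen: "f \<in> CT \<Longrightarrow> \<rho> i f \<in> gen"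
  by (auto simp: cstar_generated_def)

lemma one_gen: "\<one> \<in> gen"
  using \<rho>_gen[OF restrict_continuous_circle[OF continuous_on_const], of 0 1] \<rho>_one[of 0] by simp

lemma gen_induct:
  assumes "cstar_subalgebra A T" "\<And>i f. f \<in> CT \<Longrightarrow> \<rho> i f \<in> T" "a \<in> gen"
  shows "a \<in> T"
  using assms by (auto simp: cstar_generated_def)

text \<open>
  The commutant of a set that is closed under the involution is a C*-subalgebra. Applied to the
  generators this shows that the subalgebra commutes with them, and then, applied to the subalgebra
  itself, that it is commutative.
\<close>

theorem gen_commutative: 
  assumes "a \<in> gen" "b \<in> gen" shows "a \<otimes> b = b \<otimes> a"
proof -
  let ?S = "{\<rho> i f | i f. f \<in> CT}"
  have sub: "cstar_subalgebra A {a \<in> carrier A. \<forall>t\<in>?S. a \<otimes> t = t \<otimes> a}"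
  proof (rule commutant_subalgebra)
    fix t assume "t \<in> ?S"
    then obtain i f where "f \<in> CT" "t = \<rho> i f" by auto
    then show "cstar_star A t \<in> ?S"
      using \<rho>_simps(4)[of f f i] continuous_circleD[of f] 
      by (intro CollectI exI[of _ i] exI[of _ "\<lambda>z\<in>circle. cnj (f z)"]) (auto intro!: continuous_intros)
  qed auto
  have 1: "a \<otimes> \<rho> i f = \<rho> i f \<otimes> a" if "a \<in> gen" "f \<in> CT" for a i f
    using gen_induct[OF sub _ that(1)] \<rho>_commute that by auto
  have sub2: "cstar_subalgebra A {a \<in> carrier A. \<forall>t\<in>gen. a \<otimes> t = t \<otimes> a}"
    by (rule commutant_subalgebra) (auto simp: gen_closed)
  show ?thesis using gen_induct[OF sub2 _ assms(1)] 1 assms(2) by auto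
qed

abbreviation "X \<equiv> characters (abelian_part A \<iota> U)"

lemma charactersD:
  assumes "\<omega> \<in> X"
  shows "\<omega> \<in> extensional gen" "\<exists>a\<in>gen. \<omega> a \<noteq> 0"
    "\<And>a b. a \<in> gen \<Longrightarrow> b \<in> gen \<Longrightarrow> \<omega> (a \<oplus> b) = \<omega> a + \<omega> b"
    "\<And>a b. a \<in> gen \<Longrightarrow> b \<in> gen \<Longrightarrow> \<omega> (a \<otimes> b) = \<omega> a * \<omega> b"
    "\<And>c a. a \<in> gen \<Longrightarrow> \<omega> (c \<odot> a) = c * \<omega> a"
  using assms by (auto simp: characters_def abelian_part_def)

lemma charactersI:
  assumes "\<omega> \<in> extensional gen" "\<omega> \<one> = 1"
    "\<And>a b. a \<in> gen \<Longrightarrow> b \<in> gen \<Longrightarrow> \<omega> (a \<oplus> b) = \<omega> a + \<omega> b"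
    "\<And>a b. a \<in> gen \<Longrightarrow> b \<in> gen \<Longrightarrow> \<omega> (a \<otimes> b) = \<omega> a * \<omega> b"
    "\<And>c a. a \<in> gen \<Longrightarrow> \<omega> (c \<odot> a) = c * \<omega> a"
  shows "\<omega> \<in> X"
proof -
  have "\<exists>a\<in>gen. \<omega> a \<noteq> 0" using assms(2) one_gen by (intro bexI[of _ \<one>]) auto
  then show ?thesis using assms by (auto simp: characters_def abelian_part_def)
qed

lemma character_bound: "\<omega> \<in> X \<Longrightarrow> a \<in> gen \<Longrightarrow> cmod (\<omega> a) \<le> cstar_norm A a"
  by (rule multiplicative_functional_bound[OF gen_subalgebra one_gen]) (auto simp: charactersD)

lemma character_one: 
  assumes "\<omega> \<in> X" shows "\<omega> \<one> = 1"
proof -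
  obtain a where "a \<in> gen" "\<omega> a \<noteq> 0" using charactersD(2)[OF assms] by auto
  then show ?thesis using charactersD(4)[OF assms one_gen, of a] gen_closed(6) by simp
qed

lemma character_diff:
  assumes w: "\<omega> \<in> X" and a: "a \<in> gen" and b: "b \<in> gen"
  shows "cmod (\<omega> a - \<omega> b) \<le> cstar_norm A (a \<ominus> b)"
proof -
  have "a \<ominus> b = a \<oplus> (-1) \<odot> b" using a b gen_closed(6) by (intro minus_eq_smult) auto
  moreover from this have "\<omega> (a \<ominus> b) = \<omega> a - \<omega> b" using a b by (simp add: charactersD[OF w] gen_closed)
  ultimately show ?thesis using character_bound[OF w, of "a \<ominus> b"] a b by (simp add: gen_closed)
qed

lemma character_limit:
  assumes w: "\<omega> \<in> X" and Y: "\<And>n. Y n \<in> gen" and x: "x \<in> gen" and lim: "(\<lambda>n. cstar_norm A (Y n \<ominus> x)) \<longlonglongrightarrow> 0"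
  shows "(\<lambda>n. \<omega> (Y n)) \<longlonglongrightarrow> \<omega> x"
proof -
  have "(\<lambda>n. \<omega> (Y n) - \<omega> x) \<longlonglongrightarrow> 0"
    by (rule Lim_null_comparison[OF _ lim]) (use character_diff[OF w Y x] in auto)
  then show ?thesis by (simp add: LIM_zero_iff)
qed

definition char_seq :: "('a \<Rightarrow> complex) \<Rightarrow> nat \<Rightarrow> complex" where
  "char_seq \<omega> k = \<omega> (\<rho> k (circle_monomial 1))"

lemma circle_monomial_mult: "(\<lambda>z\<in>circle. circle_monomial m z * circle_monomial n z) = circle_monomial (m + n)"
  unfolding circle_monomial_def by (rule restrict_ext) (auto intro!: power_int_add[symmetric])

lemma character_monomial_add:
  "\<omega> \<in> X \<Longrightarrow> \<omega> (\<rho> k (circle_monomial (m + n))) = \<omega> (\<rho> k (circle_monomial m)) * \<omega> (\<rho> k (circle_monomial n))"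
  using \<rho>_simps(2)[OF circle_monomial_closed circle_monomial_closed, of k m n]
  by (simp add: circle_monomial_mult charactersD \<rho>_gen circle_monomial_closed)

lemma character_monomial_0: "\<omega> \<in> X \<Longrightarrow> \<omega> (\<rho> k (circle_monomial 0)) = 1"
  using \<rho>_one[of k] character_one by (simp add: circle_monomial_def)

text \<open>
  The values of a character at \<open>\<rho> k e\<^sub>1\<close> and at \<open>\<rho> k e\<^sub>-\<^sub>1\<close> have modulus at most 1 and product 1.
\<close>

lemma char_seq_circle: 
  assumes w: "\<omega> \<in> X" shows "char_seq \<omega> k \<in> circle"
proof -
  have le: "cmod (\<omega> (\<rho> k (circle_monomial n))) \<le> 1" for n
  proof -
    have "cmod (\<omega> (\<rho> k (circle_monomial n))) \<le> cstar_norm A (\<rho> k (circle_monomial n))"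
      by (rule character_bound[OF w \<rho>_gen[OF circle_monomial_closed]])
    also have "\<dots> \<le> 1" by (rule \<rho>_contractive[OF circle_monomial_closed]) (simp add: circle_monomial_def norm_power_int)
    finally show ?thesis .
  qed
  have "char_seq \<omega> k * \<omega> (\<rho> k (circle_monomial (-1))) = 1"
    using character_monomial_add[OF w, of k 1 "-1"] character_monomial_0[OF w] by (simp add: char_seq_def)
  from arg_cong[OF this, of cmod]
  have "cmod (char_seq \<omega> k) * cmod (\<omega> (\<rho> k (circle_monomial (-1)))) = 1"
    by (simp only: Real_Vector_Spaces.norm_mult Real_Vector_Spaces.norm_one)
  moreover have "cmod (char_seq \<omega> k) * cmod (\<omega> (\<rho> k (circle_monomial (-1)))) \<le> cmod (char_seq \<omega> k) * 1"
    by (intro mult_left_mono le) auto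
  ultimately have "cmod (char_seq \<omega> k) = 1" using le[of 1] by (simp add: char_seq_def)
  then show ?thesis by simp
qed

lemma character_monomial:
  assumes w: "\<omega> \<in> X" shows "\<omega> (\<rho> k (circle_monomial n)) = char_seq \<omega> k powi n"
proof -
  have nz: "char_seq \<omega> k \<noteq> 0" using char_seq_circle[OF w, of k] by auto
  have nat: "\<omega> (\<rho> k (circle_monomial (int m))) = char_seq \<omega> k ^ m" for m
  proof (induction m)
    case (Suc m)
    then show ?case using character_monomial_add[OF w, of k "int m" 1] by (simp add: char_seq_def add.commute)
  qed (simp add: character_monomial_0[OF w])
  show ?thesis
  proof (cases n rule: int_cases2)
    case (nonpos m)
    have "\<omega> (\<rho> k (circle_monomial (- int m))) * char_seq \<omega> k ^ m = 1"
      using character_monomial_add[OF w, of k "- int m" "int m"] character_monomial_0[OF w] nat by simp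
    then show ?thesis using nonpos nz by (simp add: power_int_minus field_simps)
  qed (simp add: nat)
qed

text \<open>
  On the copy \<open>\<rho>\<^sub>k(C(\<T>))\<close> of the continuous functions a character is evaluation at the point
  \<open>\<omega>(\<rho>\<^sub>k(e\<^sub>1))\<close>: this holds for monomials, and characters and \<open>\<rho>\<^sub>k\<close> are contractive.
\<close>

theorem character_value:
  assumes w: "\<omega> \<in> X" and f: "f \<in> CT" shows "\<omega> (\<rho> k f) = f (char_seq \<omega> k)"
proof -
  let ?z = "char_seq \<omega> k"
  have z: "?z \<in> circle" by (rule char_seq_circle[OF w])
  have trig: "\<omega> (\<rho> k (restrict p circle)) = p ?z" if "p \<in> trig_poly" for p
    using that
  proof induction
    case (monomial n)
    show ?case using character_monomial[OF w, of k n] unfolding circle_monomial_def .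
  next
    case (add p q)
    have cl: "restrict p circle \<in> CT" "restrict q circle \<in> CT" 
      using continuous_on_trig_poly add by auto
    have "(\<lambda>z\<in>circle. restrict p circle z + restrict q circle z) = (\<lambda>z\<in>circle. p z + q z)"
      by (rule restrict_ext) simp
    with \<rho>_simps(1)[OF cl, of k]
    have "\<omega> (\<rho> k (\<lambda>z\<in>circle. p z + q z)) = \<omega> (\<rho> k (restrict p circle) \<oplus> \<rho> k (restrict q circle))"
      by (simp only:)
    then show ?case by (simp only: charactersD(3)[OF w \<rho>_gen[OF cl(1)] \<rho>_gen[OF cl(2)]] add.IH)
  next
    case (smult p c)
    have cl: "restrict p circle \<in> CT" using continuous_on_trig_poly smult by auto
    have "(\<lambda>z\<in>circle. c * restrict p circle z) = (\<lambda>z\<in>circle. c * p z)"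
      by (rule restrict_ext) simp
    with \<rho>_simps(3)[OF cl cl, of k c]
    have "\<omega> (\<rho> k (\<lambda>z\<in>circle. c * p z)) = \<omega> (c \<odot> \<rho> k (restrict p circle))"
      by (simp only:)
    then show ?case by (simp only: charactersD(5)[OF w \<rho>_gen[OF cl]] smult.IH)
  qed
  have "cmod (\<omega> (\<rho> k f) - f ?z) \<le> 0 + e" if e: "e > 0" for e
  proof -
    have "e / 2 > 0" using e by simp
    from trig_poly_dense[OF continuous_circleD[OF f] this]
    obtain p where p: "p \<in> trig_poly" "\<forall>z\<in>circle. cmod (f z - p z) < e / 2" by (rule bexE)
    have cl: "restrict p circle \<in> CT" using continuous_on_trig_poly p by auto
    define g where "g = (\<lambda>z\<in>circle. -1 * restrict p circle z)"
    have g: "g \<in> CT" unfolding g_def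
      by (intro restrict_continuous_circle continuous_on_mult continuous_on_const continuous_circleD[OF cl])
    define d where "d = (\<lambda>z\<in>circle. f z + g z)"
    have d: "d \<in> CT" unfolding d_def
      by (intro restrict_continuous_circle continuous_on_add continuous_circleD f g)
    have "\<rho> k d = \<rho> k f \<oplus> (-1) \<odot> \<rho> k (restrict p circle)"
      using \<rho>_simps(1)[OF f g, of k] \<rho>_simps(3)[OF cl cl, of k "-1"] by (simp only: d_def g_def)
    then have "\<omega> (\<rho> k d) = \<omega> (\<rho> k f) - p ?z"
      by (simp only: charactersD(3,5)[OF w] gen_closed \<rho>_gen f cl trig[OF p(1)]) simp
    moreover have "cmod (\<omega> (\<rho> k d)) \<le> e / 2"
    proof -
      have "cstar_norm A (\<rho> k d) \<le> e / 2"
        by (rule \<rho>_contractive[OF d]) (use p in \<open>auto simp: d_def g_def intro: less_imp_le\<close>)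
      then show ?thesis using character_bound[OF w \<rho>_gen[OF d], of k] by simp
    qed
    moreover have "cmod (p ?z - f ?z) < e / 2" using p(2) z by (simp add: norm_minus_commute)
    moreover have "cmod (\<omega> (\<rho> k f) - f ?z) \<le> cmod (\<omega> (\<rho> k f) - p ?z) + cmod (p ?z - f ?z)"
      by (rule order_trans[OF _ norm_triangle_ineq]) simp
    ultimately show ?thesis by simp
  qed
  then have "cmod (\<omega> (\<rho> k f) - f ?z) \<le> 0" by (rule field_le_epsilon)
  then show ?thesis by simp
qed

lemma char_seq_solenoid:
  assumes w: "\<omega> \<in> X" shows "char_seq \<omega> \<in> solenoid N"
proof -
  have "char_seq \<omega> (Suc k) ^ N = char_seq \<omega> k" for k
  proof -
    have "(\<lambda>z\<in>circle. circle_monomial 1 (z ^ N)) = circle_monomial (int N)"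
      unfolding circle_monomial_def by (rule restrict_ext) (simp add: norm_power)
    then show ?thesis using \<rho>_Suc[OF circle_monomial_closed[of 1], of k] character_monomial[OF w, of "Suc k" "int N"]
      by (simp add: char_seq_def)
  qed
  then show ?thesis using char_seq_circle[OF w] by (simp add: solenoid_def)
qed

text \<open>
  By \<open>character_value\<close> the two characters agree on the generators. The set on which they agree is
  closed under the involution once agreement is demanded at \<open>a\<close> and at \<open>a\<^sup>*\<close> simultaneously, so that
  \<open>gen_induct\<close> applies.
\<close>

lemma character_eqI:
  assumes w: "\<omega> \<in> X" and w': "\<omega>' \<in> X" and eq: "\<And>k. char_seq \<omega> k = char_seq \<omega>' k"
  shows "\<omega> = \<omega>'"
proof (rule extensionalityI[OF charactersD(1)[OF w] charactersD(1)[OF w']])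
  fix a assume a: "a \<in> gen"
  let ?T = "{a \<in> gen. \<omega> a = \<omega>' a \<and> \<omega> (cstar_star A a) = \<omega>' (cstar_star A a)}"
  have "cstar_subalgebra A ?T"
    unfolding cstar_subalgebra_def
  proof (intro conjI ballI allI impI)
    show "\<zero> \<in> ?T"
    proof -
      have z: "0 \<odot> \<one> = \<zero>" using mod.smult_l_null[of \<one>] by simp
      have s: "cstar_star A \<zero> = \<zero>" using star_smult[of \<one> 0] z by (simp add: star_one)
      have "\<omega> \<zero> = 0" "\<omega>' \<zero> = 0"
        using charactersD(5)[OF w one_gen, of 0] charactersD(5)[OF w' one_gen, of 0] z by simp_all
      then show ?thesis using gen_closed(5) s by simp
    qed
  next
    fix Y :: "nat \<Rightarrow> 'a" and x 
    assume x: "x \<in> carrier A" and Y: "\<forall>n. Y n \<in> ?T" and lim: "(\<lambda>n. cstar_norm A (Y n \<ominus> x)) \<longlonglongrightarrow> 0"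
    have YA: "Y n \<in> carrier A" "Y n \<in> gen" for n using Y gen_closed(6) by auto
    have xg: "x \<in> gen" using gen_subalgebra x YA lim unfolding cstar_subalgebra_def by blast
    note lim' = clim_star[OF YA(1) x lim]
    have "\<omega> x = \<omega>' x" using character_limit[OF w YA(2) xg lim] character_limit[OF w' YA(2) xg lim] Y
      LIMSEQ_unique by fastforce
    moreover have "\<omega> (cstar_star A x) = \<omega>' (cstar_star A x)"
      using character_limit[OF w gen_closed(4)[OF YA(2)] gen_closed(4)[OF xg] lim'] 
        character_limit[OF w' gen_closed(4)[OF YA(2)] gen_closed(4)[OF xg] lim'] Y LIMSEQ_unique by fastforce
    ultimately show "x \<in> ?T" using xg by simp
  qed (auto simp: gen_closed star_add star_smult star_mult star_star charactersD[OF w] charactersD[OF w'])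
  moreover have "\<rho> i f \<in> ?T" if f: "f \<in> CT" for i f
  proof -
    have f': "(\<lambda>z\<in>circle. cnj (f z)) \<in> CT" using continuous_circleD[OF f] by (auto intro!: continuous_intros)
    show ?thesis using f \<rho>_gen character_value[OF w] character_value[OF w'] f' eq \<rho>_simps(4)[OF f f, of i, symmetric] by simp
  qed
  ultimately have "a \<in> ?T" using a by (rule gen_induct)
  then show "\<omega> a = \<omega>' a" by simp
qed

end

section \<open>The bilateral shift along an orbit\<close>

interpretation E: hilbert_space ell2 by (rule ell2_hilbert)

text \<open>
  Sequences indexed by the integers are stored as sequences indexed by the natural numbers, through
  the bijection \<open>int_decode\<close>.
\<close>

definition shift_index :: "int \<Rightarrow> nat \<Rightarrow> nat" where
  "shift_index k n = int_encode (int_decode n + k)"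

definition shift_op :: "int \<Rightarrow> (nat \<Rightarrow> complex) \<Rightarrow> nat \<Rightarrow> complex" where
  "shift_op k = (\<lambda>x\<in>carrier ell2. \<lambda>n. x (shift_index k n))"

definition diag_op :: "(nat \<Rightarrow> complex) \<Rightarrow> (nat \<Rightarrow> complex) \<Rightarrow> nat \<Rightarrow> complex" where
  "diag_op c = (\<lambda>x\<in>carrier ell2. \<lambda>n. c n * x n)"

lemma shift_index_add: "shift_index k (shift_index l n) = shift_index (k + l) n"
  by (simp add: shift_index_def algebra_simps)

lemma shift_index_0 [simp]: "shift_index 0 n = n"
  by (simp add: shift_index_def)

lemma bij_shift_index: "bij (shift_index k)"
  by (rule bijI'[of "shift_index k"])
    (auto simp: shift_index_def int_encode_eq int_decode_eq intro!: exI[of _ "shift_index (- k) y" for y])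

lemma L2_shift: "x \<in> L2_functions (count_space UNIV) \<Longrightarrow> (\<lambda>n. x (shift_index k n)) \<in> L2_functions (count_space UNIV)"
  using integrable_bij_count_space[OF bij_shift_index[of k], of "\<lambda>n. (cmod (x n))\<^sup>2"]
  by (simp add: L2_functions_def)

lemma shift_op_adjoint: "adjoint_pair ell2 (shift_op k) (shift_op (- k))"
proof -
  have "(\<integral>n. cnj (x (shift_index k n)) * y n \<partial>count_space UNIV) = (\<integral>n. cnj (x n) * y (shift_index (- k) n) \<partial>count_space UNIV)" for x y
    using integral_bij_count_space[OF bij_shift_index[of k], of "\<lambda>n. cnj (x n) * y (shift_index (- k) n)"]
    by (simp add: shift_index_add)
  then show ?thesis by (simp add: adjoint_pair_def shift_op_def L2_shift)
qed

lemma shift_op_closed: "shift_op k \<in> carrier E.B"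
proof (rule E.operatorI[OF _ shift_op_adjoint])
  show "op_bound ell2 (shift_op k) 1"
    using integral_bij_count_space[OF bij_shift_index[of k], of "\<lambda>n. (cmod (x n))\<^sup>2" for x]
    by (simp add: op_bound_def shift_op_def ell2_hnorm)
qed (simp add: shift_op_def)

lemma shift_op_star: "cstar_star E.B (shift_op k) = shift_op (- k)"
  by (rule E.star_eqI[OF _ shift_op_adjoint]) (simp add: shift_op_def)

lemma shift_op_mult: "shift_op k \<otimes>\<^bsub>E.B\<^esub> shift_op l = shift_op (k + l)"
  by (rule E.operator_eqI) (auto simp: E.operator_mult shift_op_closed E.operator_apply,
      simp add: shift_op_def L2_shift shift_index_add add.commute)

lemma shift_op_0: "shift_op 0 = \<one>\<^bsub>E.B\<^esub>"
  by (rule E.operator_eqI) (auto simp: shift_op_closed E.operator_one E.operator_apply, simp add: shift_op_def)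

lemma L2_bounded_mult:
  assumes x: "x \<in> L2_functions (count_space UNIV)" and c: "\<And>n. cmod (c n) \<le> C"
  shows "(\<lambda>n. c n * x n) \<in> L2_functions (count_space UNIV)"
    "(\<integral>n. (cmod (c n * x n))\<^sup>2 \<partial>count_space UNIV) \<le> C\<^sup>2 * (\<integral>n. (cmod (x n))\<^sup>2 \<partial>count_space UNIV)"
proof -
  have le: "(cmod (c n * x n))\<^sup>2 \<le> C\<^sup>2 * (cmod (x n))\<^sup>2" for n
    unfolding Real_Vector_Spaces.norm_mult power_mult_distrib by (intro mult_right_mono power_mono c) auto
  have int: "integrable (count_space UNIV) (\<lambda>n. C\<^sup>2 * (cmod (x n))\<^sup>2)" using L2_integrable[OF x] by simp
  have int': "integrable (count_space UNIV) (\<lambda>n. (cmod (c n * x n))\<^sup>2)"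
    by (rule Bochner_Integration.integrable_bound[OF int]) (use le in auto)
  then show "(\<lambda>n. c n * x n) \<in> L2_functions (count_space UNIV)" by (simp add: L2_functions_def)
  have "(\<integral>n. (cmod (c n * x n))\<^sup>2 \<partial>count_space UNIV) \<le> (\<integral>n. C\<^sup>2 * (cmod (x n))\<^sup>2 \<partial>count_space UNIV)"
    by (rule integral_mono[OF int' int le])
  then show "(\<integral>n. (cmod (c n * x n))\<^sup>2 \<partial>count_space UNIV) \<le> C\<^sup>2 * (\<integral>n. (cmod (x n))\<^sup>2 \<partial>count_space UNIV)"
    by simp
qed

context
  fixes c :: "nat \<Rightarrow> complex" and C :: real
  assumes c: "\<And>n. cmod (c n) \<le> C"
begin

lemma diag_op_adjoint: "adjoint_pair ell2 (diag_op c) (diag_op (\<lambda>n. cnj (c n)))"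
  using L2_bounded_mult(1)[OF _ c] L2_bounded_mult(1)[of _ "\<lambda>n. cnj (c n)" C] c
  by (auto simp: adjoint_pair_def diag_op_def mult_ac)

lemma diag_op_closed: "diag_op c \<in> carrier E.B"
proof (rule E.operatorI[OF _ diag_op_adjoint])
  have "C \<ge> 0" using c[of 0] norm_ge_zero[of "c 0"] by (simp del: norm_ge_zero)
  then show "op_bound ell2 (diag_op c) C"
    using real_sqrt_le_mono[OF L2_bounded_mult(2)[OF _ c]]
    by (auto simp: op_bound_def diag_op_def ell2_hnorm real_sqrt_mult)
qed (simp add: diag_op_def)

lemma diag_op_star: "cstar_star E.B (diag_op c) = diag_op (\<lambda>n. cnj (c n))"
  by (rule E.star_eqI[OF _ diag_op_adjoint]) (simp add: diag_op_def)

end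

lemma shift_diag_op:
  assumes c: "\<And>n. cmod (c n) \<le> C"
  shows "shift_op k \<otimes>\<^bsub>E.B\<^esub> diag_op c \<otimes>\<^bsub>E.B\<^esub> shift_op (- k) = diag_op (\<lambda>n. c (shift_index k n))"
proof (rule E.operator_eqI)
  show "shift_op k \<otimes>\<^bsub>E.B\<^esub> diag_op c \<otimes>\<^bsub>E.B\<^esub> shift_op (- k) \<in> carrier E.B"
    by (intro E.operator_mult(1) shift_op_closed diag_op_closed[OF c])
  show "diag_op (\<lambda>n. c (shift_index k n)) \<in> carrier E.B"
    by (rule diag_op_closed[of _ C]) (rule c)
  fix x assume x: "x \<in> carrier ell2"
  have "(\<lambda>n. c n * x (shift_index (- k) n)) \<in> L2_functions (count_space UNIV)"
    using L2_bounded_mult(1)[OF L2_shift c] x by simp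
  then show "(shift_op k \<otimes>\<^bsub>E.B\<^esub> diag_op c \<otimes>\<^bsub>E.B\<^esub> shift_op (- k)) x = diag_op (\<lambda>n. c (shift_index k n)) x"
    using x E.operatorD(2)[OF shift_op_closed[of "- k"] x]
    by (simp add: E.operator_apply) (simp add: shift_op_def diag_op_def shift_index_add L2_shift)
qed

lemma ell2_coordinate_le:
  assumes x: "x \<in> carrier ell2" shows "cmod (x n) \<le> hnorm ell2 x"
proof -
  have s: "summable (\<lambda>n. (cmod (x n))\<^sup>2)"
    using L2_integrable[of x "count_space UNIV"] x by (simp add: integrable_count_space_nat_iff)
  have "(cmod (x n))\<^sup>2 \<le> (\<Sum>n. (cmod (x n))\<^sup>2)"
    using sum_le_suminf[OF s, of "{n}"] by simp
  also have "\<dots> = (\<integral>n. (cmod (x n))\<^sup>2 \<partial>count_space UNIV)"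
    using L2_integrable[of x "count_space UNIV"] x by (simp add: integral_count_space_nat)
  finally show ?thesis using real_sqrt_le_mono by (fastforce simp: ell2_hnorm)
qed

definition vacuum :: "nat \<Rightarrow> complex" where
  "vacuum n = (if n = int_encode 0 then 1 else 0)"

lemma vacuum_closed: "vacuum \<in> carrier ell2"
proof -
  have "summable (\<lambda>n. (cmod (vacuum n))\<^sup>2)"
    by (rule summable_finite[of "{int_encode 0}"]) (auto simp: vacuum_def)
  then show ?thesis by (simp add: L2_functions_def integrable_count_space_nat_iff)
qed

context scaling
begin

definition orbit_eval :: "(real \<Rightarrow> complex) \<Rightarrow> (complex \<Rightarrow> complex) \<Rightarrow> (nat \<Rightarrow> complex) \<Rightarrow> nat \<Rightarrow> complex" where
  "orbit_eval \<xi> f = diag_op (\<lambda>n. f (\<xi> (real N powi int_decode n)))"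

text \<open>
  On basis vectors indexed by the integers, functions act by their values along the two-sided orbit
  \<open>\<xi>(N\<^sup>j)\<close> of the \<open>N\<close>-th power map, and \<open>U\<close> is the shift.
\<close>

lemma orbit_covariant:
  assumes \<xi>: "\<xi> \<in> K"
  shows "covariant_pair N E.B (orbit_eval \<xi>) (shift_op 1)"
proof -
  interpret R: ring E.B by (rule E.operator_ring)
  have pt: "\<xi> (real N powi j) \<in> circle" for j using dualD(2)[OF \<xi> Lambda_powi] .
  have bound: "\<exists>C. \<forall>n. cmod (f (\<xi> (real N powi int_decode n))) \<le> C" 
    if f: "f \<in> carrier continuous_circle" for f
  proof -
    have "compact (f ` circle)"
      by (rule compact_continuous_image[OF continuous_circleD[OF f]]) simp
    then obtain C where "\<forall>w\<in>f ` circle. norm w \<le> C" using compact_imp_bounded bounded_iff by metis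
    then show ?thesis using pt by (intro exI[of _ C]) auto
  qed
  have cl: "orbit_eval \<xi> f \<in> carrier E.B" if f: "f \<in> carrier continuous_circle" for f
  proof -
    obtain C where C: "\<And>n. cmod (f (\<xi> (real N powi int_decode n))) \<le> C" using bound[OF f] by blast
    show ?thesis unfolding orbit_eval_def by (rule diag_op_closed[of _ C]) (rule C)
  qed
  have app: "orbit_eval \<xi> f x = (\<lambda>n. f (\<xi> (real N powi int_decode n)) * x n)" if "x \<in> carrier ell2" for f x
    using that by (simp add: orbit_eval_def diag_op_def)
  have appc: "(\<lambda>n. f (\<xi> (real N powi int_decode n)) * x n) \<in> L2_functions (count_space UNIV)"
    if "f \<in> carrier continuous_circle" "x \<in> carrier ell2" for f x
    using E.operatorD(2)[OF cl[OF that(1)] that(2)] app[OF that(2), of f] by simp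
  have ring: "orbit_eval \<xi> \<in> ring_hom continuous_circle E.B"
  proof (rule ring_hom_memI)
    fix f g assume f: "f \<in> carrier continuous_circle" and g: "g \<in> carrier continuous_circle"
    show "orbit_eval \<xi> f \<in> carrier E.B" by (rule cl[OF f])
    show "orbit_eval \<xi> (f \<otimes>\<^bsub>continuous_circle\<^esub> g) = orbit_eval \<xi> f \<otimes>\<^bsub>E.B\<^esub> orbit_eval \<xi> g"
      "orbit_eval \<xi> (f \<oplus>\<^bsub>continuous_circle\<^esub> g) = orbit_eval \<xi> f \<oplus>\<^bsub>E.B\<^esub> orbit_eval \<xi> g"
      using appc[OF g] pt
      by (auto simp: E.operator_algebra_simps continuous_circle_simps(2-6) orbit_eval_def diag_op_def
          restrict_def algebra_simps)
  next
    show "orbit_eval \<xi> \<one>\<^bsub>continuous_circle\<^esub> = \<one>\<^bsub>E.B\<^esub>"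
      using pt by (auto simp: E.operator_algebra_simps continuous_circle_simps(2-6) orbit_eval_def diag_op_def restrict_def)
  qed
  have hom: "cstar_hom continuous_circle E.B (orbit_eval \<xi>)"
    unfolding cstar_hom_def
  proof (intro conjI allI ballI ring)
    fix c f assume f: "f \<in> carrier continuous_circle"
    show "orbit_eval \<xi> (c \<odot>\<^bsub>continuous_circle\<^esub> f) = c \<odot>\<^bsub>E.B\<^esub> orbit_eval \<xi> f"
      using pt by (auto simp: E.operator_algebra_simps continuous_circle_simps(2-6) orbit_eval_def diag_op_def
          restrict_def algebra_simps)
  next
    fix f assume f: "f \<in> carrier continuous_circle"
    obtain C where C: "\<And>n. cmod (f (\<xi> (real N powi int_decode n))) \<le> C" using bound[OF f] by blast
    show "orbit_eval \<xi> (cstar_star continuous_circle f) = cstar_star E.B (orbit_eval \<xi> f)"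
      using diag_op_star[OF C] pt by (simp add: orbit_eval_def continuous_circle_simps(6))
  qed
  have inv: "inv\<^bsub>E.B\<^esub> (shift_op 1) = shift_op (- 1)"
    by (rule R.inv_char) (simp_all add: shift_op_closed shift_op_mult shift_op_0)
  have cov: "shift_op 1 \<otimes>\<^bsub>E.B\<^esub> orbit_eval \<xi> f \<otimes>\<^bsub>E.B\<^esub> inv\<^bsub>E.B\<^esub> (shift_op 1) = orbit_eval \<xi> (\<lambda>z\<in>circle. f (z ^ N))"
    if f: "f \<in> carrier continuous_circle" for f
  proof -
    obtain C where C: "\<And>n. cmod (f (\<xi> (real N powi int_decode n))) \<le> C" using bound[OF f] by blast
    have "\<xi> (real N powi (j + 1)) = \<xi> (real N powi j) ^ N" for j
      using dual_power[OF \<xi> Lambda_powi, of N j] by (simp add: power_int_add_1 mult.commute)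
    then show ?thesis
      using shift_diag_op[OF C, of 1] pt by (simp add: inv orbit_eval_def shift_index_def)
  qed
  show ?thesis
    unfolding covariant_pair_def
    using hom shift_op_closed cov by (simp add: shift_op_star shift_op_mult shift_op_0)
qed

lemma orbit_conj:
  assumes \<xi>: "\<xi> \<in> K" and f: "f \<in> carrier continuous_circle"
  shows "shift_op (- int k) \<otimes>\<^bsub>E.B\<^esub> orbit_eval \<xi> f \<otimes>\<^bsub>E.B\<^esub> shift_op (int k)
    = diag_op (\<lambda>n. f (\<xi> (real N powi (int_decode n - int k))))"
proof -
  have "compact (f ` circle)"
    by (rule compact_continuous_image[OF continuous_circleD[OF f]]) simp
  then obtain C where "\<forall>w\<in>f ` circle. norm w \<le> C" using compact_imp_bounded bounded_iff by metis
  then have C: "cmod (f (\<xi> (real N powi int_decode n))) \<le> C" for n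
    using dualD(2)[OF \<xi> Lambda_powi] by blast
  show ?thesis using shift_diag_op[OF C, of "- int k"] by (simp add: orbit_eval_def shift_index_def)
qed

end

context covariant_algebra
begin

text \<open>
  The vacuum vector is a joint eigenvector of the image of the abelian subalgebra, because this
  holds for the generators and the image of a limit is the limit of the images. The eigenvalue is
  the character.
\<close>

lemma character_from_orbit:
  assumes hom: "cstar_hom A E.B \<Phi>" and \<Phi>U: "\<Phi> U = shift_op 1" 
    and \<Phi>f: "\<And>f. f \<in> CT \<Longrightarrow> \<Phi> (\<iota> f) = orbit_eval \<xi> f" and \<xi>: "\<xi> \<in> K"
  shows "\<exists>\<omega>\<in>X. char_seq \<omega> = seq_of N \<xi>"
proof -
  interpret R: ring E.B by (rule E.operator_ring)
  have \<Phi>: "\<And>x. x \<in> carrier A \<Longrightarrow> \<Phi> x \<in> carrier E.B"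
    "\<And>x y. x \<in> carrier A \<Longrightarrow> y \<in> carrier A \<Longrightarrow> \<Phi> (x \<otimes> y) = \<Phi> x \<otimes>\<^bsub>E.B\<^esub> \<Phi> y"
    "\<And>x y. x \<in> carrier A \<Longrightarrow> y \<in> carrier A \<Longrightarrow> \<Phi> (x \<oplus> y) = \<Phi> x \<oplus>\<^bsub>E.B\<^esub> \<Phi> y"
    "\<Phi> \<one> = \<one>\<^bsub>E.B\<^esub>" "\<And>c x. x \<in> carrier A \<Longrightarrow> \<Phi> (c \<odot> x) = c \<odot>\<^bsub>E.B\<^esub> \<Phi> x"
    "\<And>x. x \<in> carrier A \<Longrightarrow> \<Phi> (cstar_star A x) = cstar_star E.B (\<Phi> x)"
    using hom by (auto simp: cstar_hom_def ring_hom_def)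
  have U_pow: "\<Phi> (U [^] k) = shift_op (int k)" for k :: nat
    by (induction k) (simp_all add: \<Phi> \<Phi>U shift_op_0 shift_op_mult add.commute)
  have U_pow': "\<Phi> (inv U [^] k) = shift_op (- int k)" for k :: nat
    using \<Phi>(6)[of "U [^] k"] by (simp add: star_U_power U_pow shift_op_star)
  have \<Phi>\<rho>: "\<Phi> (\<rho> k f) = diag_op (\<lambda>n. f (\<xi> (real N powi (int_decode n - int k))))" if f: "f \<in> CT" for k f
    using f orbit_conj[OF \<xi> f, of k] by (simp add: conj_power_def \<Phi> U_pow U_pow' \<Phi>f)
  define n0 where "n0 = int_encode 0"
  define e where "e a = \<Phi> a vacuum" for a
  note vc = vacuum_closed
  have ecl: "e a \<in> carrier ell2" if "a \<in> carrier A" for a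
    using E.operatorD(2)[OF \<Phi>(1)[OF that] vc] by (simp add: e_def)
  have e_add: "e (a \<oplus> b) n = e a n + e b n" if "a \<in> carrier A" "b \<in> carrier A" for a b n
    using \<Phi>(3)[OF that] vc by (simp add: e_def E.operator_algebra_simps)
  have e_smult: "e (c \<odot> a) n = c * e a n" if "a \<in> carrier A" for a c n
    using \<Phi>(5)[OF that, of c] vc by (simp add: e_def E.operator_algebra_simps)
  have e_minus: "e (a \<ominus> b) n = e a n - e b n" if "a \<in> carrier A" "b \<in> carrier A" for a b n
    using that by (simp add: minus_eq_smult e_add e_smult)
  have e_bound: "cmod (e a n) \<le> cstar_norm A a * hnorm ell2 vacuum" if a: "a \<in> carrier A" for a n
  proof -
    have "cmod (e a n) \<le> hnorm ell2 (e a)" by (rule ell2_coordinate_le[OF ecl[OF a]])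
    also have "\<dots> \<le> cstar_norm E.B (\<Phi> a) * hnorm ell2 vacuum"
      unfolding e_def by (rule E.operatorD(3)[OF \<Phi>(1)[OF a] vc])
    also have "\<dots> \<le> cstar_norm A a * hnorm ell2 vacuum"
      by (intro mult_right_mono E.operator_hom_contractive[OF cstar_algebra_axioms hom a] E.hnorm_nonneg vc)
    finally show ?thesis .
  qed
  have e_lim: "e x n = 0" if Y: "\<And>m. Y m \<in> carrier A" "\<And>m. e (Y m) n = 0" and x: "x \<in> carrier A" 
    and lim: "(\<lambda>m. cstar_norm A (Y m \<ominus> x)) \<longlonglongrightarrow> 0" for Y x n
  proof -
    have "cmod (e x n) \<le> cstar_norm A (Y m \<ominus> x) * hnorm ell2 vacuum" for m
      using e_bound[of "Y m \<ominus> x" n] Y x by (simp add: e_minus)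
    moreover have "(\<lambda>m. cstar_norm A (Y m \<ominus> x) * hnorm ell2 vacuum) \<longlonglongrightarrow> 0"
      using tendsto_mult[OF lim tendsto_const] by simp
    ultimately have "cmod (e x n) \<le> 0" by (intro LIMSEQ_le_const) auto
    then show ?thesis by simp
  qed
  define T where "T = {a \<in> carrier A. \<forall>n. n \<noteq> n0 \<longrightarrow> e a n = 0 \<and> e (cstar_star A a) n = 0}"
  have e_mult: "e (a \<otimes> b) n = e b n0 * e a n" 
    if a: "a \<in> carrier A" and b: "b \<in> carrier A" and ev: "\<And>n. n \<noteq> n0 \<Longrightarrow> e b n = 0" for a b n
  proof -
    have "e b = e b n0 \<odot>\<^bsub>ell2\<^esub> vacuum"
    proof
      fix n show "e b n = (e b n0 \<odot>\<^bsub>ell2\<^esub> vacuum) n"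
        using ev[of n] by (auto simp: vacuum_def n0_def)
    qed
    moreover have "e (a \<otimes> b) = \<Phi> a (e b)"
      using \<Phi>(2)[OF a b] vc by (simp add: e_def E.operator_algebra_simps)
    ultimately have "e (a \<otimes> b) = e b n0 \<odot>\<^bsub>ell2\<^esub> e a"
      using E.operator_linear(2)[OF \<Phi>(1)[OF a] vc, of "e b n0"] unfolding e_def by metis
    then show ?thesis by simp
  qed
  have "cstar_subalgebra A T"
    unfolding cstar_subalgebra_def
  proof (intro conjI ballI allI impI)
    have z: "0 \<odot> \<one> = \<zero>" using mod.smult_l_null[of \<one>] by simp
    have s: "cstar_star A \<zero> = \<zero>" using star_smult[of \<one> 0] z by (simp add: star_one)
    show "\<zero> \<in> T" using e_smult[of \<one> 0] z s by (simp add: T_def)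
  next
    fix a b assume "a \<in> T" "b \<in> T"
    then show "a \<otimes> b \<in> T" by (simp add: T_def e_mult star_mult star_closed)
  next
    fix Y :: "nat \<Rightarrow> 'a" and x 
    assume x: "x \<in> carrier A" and Y: "\<forall>n. Y n \<in> T" and lim: "(\<lambda>n. cstar_norm A (Y n \<ominus> x)) \<longlonglongrightarrow> 0"
    have YA: "Y n \<in> carrier A" for n using Y by (simp add: T_def)
    show "x \<in> T"
      using e_lim[OF YA _ x lim] e_lim[OF star_closed[OF YA] _ star_closed[OF x] clim_star[OF YA x lim]] Y x
      by (simp add: T_def)
  qed (auto simp: T_def e_add e_smult star_add star_smult star_closed star_star)
  moreover have \<rho>T: "\<rho> k f \<in> T" if f: "f \<in> CT" for k f
  proof -
    have f': "(\<lambda>z\<in>circle. cnj (f z)) \<in> CT" using continuous_circleD[OF f] by (auto intro!: continuous_intros)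
    have "e (\<rho> k g) n = 0" if "g \<in> CT" "n \<noteq> n0" for g n
      using that vc by (simp add: e_def \<Phi>\<rho> diag_op_def vacuum_def n0_def)
    then show ?thesis using f f' \<rho>_simps(4)[OF f f, of k, symmetric] by (simp add: T_def)
  qed
  ultimately have gT: "a \<in> T" if "a \<in> gen" for a using that by (rule gen_induct)
  define \<omega> where "\<omega> = (\<lambda>a\<in>gen. e a n0)"
  have "\<omega> \<in> X"
  proof (rule charactersI)
    show "\<omega> \<one> = 1" using one_gen vc by (simp add: \<omega>_def e_def \<Phi> E.operator_algebra_simps vacuum_def n0_def)
    fix a b assume ab: "a \<in> gen" "b \<in> gen"
    show "\<omega> (a \<otimes> b) = \<omega> a * \<omega> b"
      using ab gT[OF ab(2)] e_mult[of a b n0] by (simp add: \<omega>_def gen_closed T_def mult.commute)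
  qed (auto simp: \<omega>_def gen_closed e_add e_smult)
  moreover have "char_seq \<omega> k = seq_of N \<xi> k" for k
    using circle_monomial_closed[of 1] \<rho>_gen vc dualD(2)[OF \<xi> Lambda_inv[of k]]
    by (simp add: char_seq_def \<omega>_def e_def \<Phi>\<rho> diag_op_def vacuum_def n0_def circle_monomial_def 
        seq_of_def power_int_minus field_simps)
  ultimately show ?thesis by blast
qed

end

section \<open>The Gelfand space is the dual group\<close>

locale universal_algebra = covariant_algebra +
  assumes universal: "universal_covariant N A \<iota> U"
begin

text \<open>
  Universality provides a homomorphism that sends \<open>U\<close> to the shift along the orbit of \<open>\<xi>\<close>. The vacuum
  vector is then a joint eigenvector of the abelian subalgebra, with eigenvalue \<open>\<xi>(N\<^sup>-\<^sup>k)\<close> for the image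
  of the coordinate function under \<open>\<rho> k\<close>.
\<close>

lemma character_exists: 
  assumes "\<xi> \<in> K" shows "\<exists>\<omega>\<in>X. char_seq \<omega> = seq_of N \<xi>"
proof -
  obtain \<Phi> where "cstar_hom A E.B \<Phi>" "\<Phi> U = shift_op 1" "\<forall>f\<in>CT. \<Phi> (\<iota> f) = orbit_eval \<xi> f"
    using universal E.operator_algebra_cstar orbit_covariant[OF assms] unfolding universal_covariant_def by blast
  then show ?thesis using character_from_orbit assms by blast
qed

abbreviation "gp \<equiv> gelfand_point N A \<iota> U"

lemma gelfand_point_props:
  assumes \<xi>: "\<xi> \<in> K"
  shows gp_character: "gp \<xi> \<in> X" and gp_seq: "char_seq (gp \<xi>) = seq_of N \<xi>"
proof -
  obtain \<omega> where w: "\<omega> \<in> X" "char_seq \<omega> = seq_of N \<xi>" using character_exists[OF \<xi>] by blast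
  have iff: "(\<forall>n k. \<omega>' (\<rho> k (circle_monomial n)) = \<xi> (of_int n / of_nat N ^ k)) \<longleftrightarrow> char_seq \<omega>' = seq_of N \<xi>"
    if "\<omega>' \<in> X" for \<omega>'
  proof
    assume *: "\<forall>n k. \<omega>' (\<rho> k (circle_monomial n)) = \<xi> (of_int n / of_nat N ^ k)"
    show "char_seq \<omega>' = seq_of N \<xi>"
    proof
      fix k show "char_seq \<omega>' k = seq_of N \<xi> k" using *[rule_format, of k 1] by (simp add: char_seq_def seq_of_def)
    qed
  qed (simp add: character_monomial[OF that] dual_apply[OF \<xi>])
  have "gp \<xi> = \<omega>"
    unfolding gelfand_point_def
  proof (rule the_equality)
    show "\<omega> \<in> X \<and> (\<forall>n k. \<omega> (\<rho> k (circle_monomial n)) = \<xi> (of_int n / of_nat N ^ k))" using w iff by simp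
    fix \<omega>' assume "\<omega>' \<in> X \<and> (\<forall>n k. \<omega>' (\<rho> k (circle_monomial n)) = \<xi> (of_int n / of_nat N ^ k))"
    then show "\<omega>' = \<omega>" using iff w by (intro character_eqI) auto
  qed
  then show "gp \<xi> \<in> X" "char_seq (gp \<xi>) = seq_of N \<xi>" using w by auto
qed

lemma as_function_value:
  "\<xi> \<in> K \<Longrightarrow> f \<in> CT \<Longrightarrow> as_function N A \<iota> U (\<rho> k f) \<xi> = f (seq_of N \<xi> k)"
  by (simp add: as_function_def character_value gp_character gp_seq)

lemma as_function_monomial:
  "\<xi> \<in> K \<Longrightarrow> as_function N A \<iota> U (\<rho> k (circle_monomial n)) \<xi> = efun (of_int n / of_nat N ^ k) \<xi>"
  by (simp add: as_function_def character_monomial gp_character gp_seq dual_apply efun_def)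

lemma continuous_map_seq_of: "continuous_map (dual_topology N) euclidean (\<lambda>\<xi>. seq_of N \<xi> k)"
  unfolding seq_of_def by (rule continuous_map_dual_eval) simp

text \<open>
  On the generators the transform is a continuous function of one coordinate. Characters are
  contractive, so convergence in norm makes the transforms converge uniformly in \<open>\<xi>\<close>, and a uniform
  limit of continuous functions is continuous.
\<close>

lemma gelfand_transform_continuous:
  assumes a: "a \<in> gen" shows "continuous_map (dual_topology N) euclidean (\<lambda>\<xi>. gp \<xi> a)"
proof -
  let ?c = "\<lambda>a. continuous_map (dual_topology N) euclidean (\<lambda>\<xi>. gp \<xi> a)"
  let ?T = "{a \<in> gen. ?c a \<and> ?c (cstar_star A a)}"
  note ch = charactersD[OF gp_character]
  have lim: "?c x" if x: "x \<in> gen" and Y: "\<And>n. Y n \<in> gen" "\<And>n. ?c (Y n)" 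
    and l: "(\<lambda>n. cstar_norm A (Y n \<ominus> x)) \<longlonglongrightarrow> 0" for x Y
    unfolding continuous_map_euclidean_tendsto
  proof (intro ballI tendstoI)
    fix \<xi> and e :: real assume \<xi>: "\<xi> \<in> topspace (dual_topology N)" and e: "e > 0"
    obtain n where n: "cstar_norm A (Y n \<ominus> x) < e / 3"
      using order_tendstoD(2)[OF l, of "e / 3"] e by (auto simp: eventually_sequentially)
    have near: "dist (gp \<psi> x) (gp \<psi> (Y n)) < e / 3" if "\<psi> \<in> K" for \<psi>
      using character_diff[OF gp_character[OF that] Y(1) x, of n] n by (simp add: dist_norm norm_minus_commute)
    have "\<forall>\<^sub>F \<psi> in atin (dual_topology N) \<xi>. dist (gp \<psi> (Y n)) (gp \<xi> (Y n)) < e / 3"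
      using Y(2)[of n] \<xi> e unfolding continuous_map_euclidean_tendsto by (intro tendstoD) auto
    moreover have "\<forall>\<^sub>F \<psi> in atin (dual_topology N) \<xi>. \<psi> \<in> K"
      unfolding eventually_atin using openin_topspace[of "dual_topology N"] \<xi> by auto
    ultimately show "\<forall>\<^sub>F \<psi> in atin (dual_topology N) \<xi>. dist (gp \<psi> x) (gp \<xi> x) < e"
    proof eventually_elim
      fix \<psi> assume "dist (gp \<psi> (Y n)) (gp \<xi> (Y n)) < e / 3" "\<psi> \<in> K"
      then show "dist (gp \<psi> x) (gp \<xi> x) < e"
        using near[of \<psi>] near[of \<xi>] \<xi> dist_triangle[of "gp \<psi> x" "gp \<xi> x" "gp \<psi> (Y n)"]
          dist_triangle[of "gp \<psi> (Y n)" "gp \<xi> x" "gp \<xi> (Y n)"] by (simp add: dist_commute)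
    qed
  qed
  have "cstar_subalgebra A ?T"
    unfolding cstar_subalgebra_def
  proof (intro conjI ballI allI impI)
    have z: "0 \<odot> \<one> = \<zero>" using mod.smult_l_null[of \<one>] by simp
    have s: "cstar_star A \<zero> = \<zero>" using star_smult[of \<one> 0] z by (simp add: star_one)
    have "?c \<zero>" 
      by (rule continuous_map_eq[of _ _ "\<lambda>_. 0"]) (use ch(5)[OF _ one_gen, of _ 0] z in auto)
    then show "\<zero> \<in> ?T" using gen_closed(5) s by simp
  next
    fix a b assume a: "a \<in> ?T" and b: "b \<in> ?T"
    have add: "?c (a \<oplus> b)" if "a \<in> gen" "b \<in> gen" "?c a" "?c b" for a b
      by (rule continuous_map_eq[of _ _ "\<lambda>\<xi>. gp \<xi> a + gp \<xi> b"])
        (use that ch in \<open>auto simp: continuous_map_euclidean_tendsto intro!: tendsto_add\<close>)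
    have mult: "?c (a \<otimes> b)" if "a \<in> gen" "b \<in> gen" "?c a" "?c b" for a b
      by (rule continuous_map_eq[of _ _ "\<lambda>\<xi>. gp \<xi> a * gp \<xi> b"])
        (use that ch in \<open>auto simp: continuous_map_euclidean_tendsto intro!: tendsto_mult\<close>)
    show "a \<oplus> b \<in> ?T" "a \<otimes> b \<in> ?T" using a b by (auto simp: gen_closed star_add star_mult intro!: add mult)
  next
    fix c a assume a: "a \<in> ?T"
    have smult: "?c (c \<odot> a)" if "a \<in> gen" "?c a" for a c
      by (rule continuous_map_eq[of _ _ "\<lambda>\<xi>. c * gp \<xi> a"])
        (use that ch in \<open>auto simp: continuous_map_euclidean_tendsto intro!: tendsto_mult\<close>)
    show "c \<odot> a \<in> ?T" using a by (auto simp: gen_closed star_smult intro!: smult)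
  next
    fix Y :: "nat \<Rightarrow> 'a" and x 
    assume x: "x \<in> carrier A" and Y: "\<forall>n. Y n \<in> ?T" and l: "(\<lambda>n. cstar_norm A (Y n \<ominus> x)) \<longlonglongrightarrow> 0"
    have YA: "Y n \<in> carrier A" "Y n \<in> gen" for n using Y gen_closed(6) by auto
    have xg: "x \<in> gen" using gen_subalgebra x YA l unfolding cstar_subalgebra_def by blast
    show "x \<in> ?T"
      using lim[OF xg YA(2) _ l] lim[OF gen_closed(4)[OF xg] gen_closed(4)[OF YA(2)] _ clim_star[OF YA(1) x l]] xg Y
      by simp
  qed (auto simp: gen_closed star_star)
  moreover have "\<rho> k f \<in> ?T" if f: "f \<in> CT" for k f
  proof -
    have *: "?c (\<rho> k g)" if g: "g \<in> CT" for g
    proof (rule continuous_map_eq)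
      have "continuous_map (dual_topology N) (top_of_set circle) (\<lambda>\<xi>. seq_of N \<xi> k)"
        using continuous_map_seq_of solenoid_circle[OF seq_of_solenoid]
        by (auto simp: continuous_map_in_subtopology)
      moreover have "continuous_map (top_of_set circle) euclidean g" using continuous_circleD[OF g] by simp
      ultimately show "continuous_map (dual_topology N) euclidean (g \<circ> (\<lambda>\<xi>. seq_of N \<xi> k))"
        by (rule continuous_map_compose)
    qed (simp add: character_value[OF gp_character g] gp_seq)
    have f': "(\<lambda>z\<in>circle. cnj (f z)) \<in> CT" using continuous_circleD[OF f] by (auto intro!: continuous_intros)
    show ?thesis using *[OF f] *[OF f'] \<rho>_gen[OF f] \<rho>_simps(4)[OF f f, of k, symmetric] by simp
  qed
  ultimately have "a \<in> ?T" using a by (rule gen_induct)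
  then show ?thesis by simp
qed

text \<open>
  The map is a continuous injection from a compact space into a Hausdorff space. It is onto because
  the sequence of a character lies in the solenoid and determines the character.
\<close>

theorem gelfand_homeomorphism:
  "homeomorphic_map (dual_topology N) (gelfand_space (abelian_part A \<iota> U)) gp"
proof (rule continuous_imp_homeomorphic_map)
  have carr: "carrier (abelian_part A \<iota> U) = gen" by (simp add: abelian_part_def)
  have top: "topspace (gelfand_space (abelian_part A \<iota> U)) = X"
    using charactersD(1) by (auto simp: gelfand_space_def carr PiE_def)
  show "continuous_map (dual_topology N) (gelfand_space (abelian_part A \<iota> U)) gp"
    unfolding gelfand_space_def continuous_map_in_subtopology continuous_map_componentwise carr
    using gelfand_transform_continuous gp_character charactersD(1)[OF gp_character] by auto
  show "compact_space (dual_topology N)" by (rule compact_space_dual)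
  show "Hausdorff_space (gelfand_space (abelian_part A \<iota> U))"
    unfolding gelfand_space_def by (intro Hausdorff_space_subtopology) (simp add: Hausdorff_space_product_topology)
  show "gp ` topspace (dual_topology N) = topspace (gelfand_space (abelian_part A \<iota> U))"
    unfolding top topspace_dual
  proof (intro equalityI subsetI)
    fix \<omega> assume w: "\<omega> \<in> X"
    let ?\<xi> = "dual_of N (char_seq \<omega>)"
    have \<xi>: "?\<xi> \<in> K" by (rule dual_of_carrier[OF char_seq_solenoid[OF w]])
    have "gp ?\<xi> = \<omega>"
      by (rule character_eqI[OF gp_character[OF \<xi>] w]) (simp add: gp_seq[OF \<xi>] seq_of_dual_of[OF char_seq_solenoid[OF w]])
    with \<xi> show "\<omega> \<in> gp ` K" by (metis image_eqI)
  qed (use gp_character in auto)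
  show "inj_on gp (topspace (dual_topology N))"
  proof (rule inj_onI)
    fix \<xi> \<psi> assume "\<xi> \<in> topspace (dual_topology N)" "\<psi> \<in> topspace (dual_topology N)" "gp \<xi> = gp \<psi>"
    then show "\<xi> = \<psi>" using gp_seq[of \<xi>] gp_seq[of \<psi>] by (intro dual_eqI) auto
  qed
qed

end

section \<open>Integration over the circle\<close>

abbreviation "\<mu> \<equiv> circle_measure"

lemma space_circle_measure [simp]: "space \<mu> = circle"
  by (simp add: circle_measure_def space_restrict_space)

lemma sets_circle_measure [measurable_cong]: "sets \<mu> = sets (restrict_space borel circle)"
  by (simp add: circle_measure_def)

lemma cis_measurable [measurable]: "cis \<in> borel \<rightarrow>\<^sub>M restrict_space borel circle"
  by (rule measurable_restrict_space2) (auto intro!: borel_measurable_continuous_onI continuous_intros)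

lemma circle_measure_density:
  "\<mu> = distr (density lborel (\<lambda>t. ennreal (indicator {0..2 * pi} t / (2 * pi)))) (restrict_space borel circle) cis"
proof -
  have "uniform_measure lborel {0..2 * pi} = density lborel (\<lambda>t. ennreal (indicator {0..2 * pi} t / (2 * pi)))"
    unfolding uniform_measure_def using divide_ennreal[of 1 "2 * pi"]
    by (intro density_cong) (auto simp: divide_ennreal split: split_indicator)
  then show ?thesis by (simp add: circle_measure_def)
qed

lemma
  fixes G :: "complex \<Rightarrow> 'b::{banach, second_countable_topology}"
  assumes G: "G \<in> borel_measurable \<mu>"
  shows circle_integrable_iff: "integrable \<mu> G \<longleftrightarrow> integrable lborel (\<lambda>t. indicator {0..<2 * pi} t *\<^sub>R G (cis t))"
    and circle_integral_eq: "(\<integral>z. G z \<partial>\<mu>) = (\<integral>t. indicator {0..<2 * pi} t *\<^sub>R G (cis t) \<partial>lborel) /\<^sub>R (2 * pi)"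
proof -
  let ?w = "\<lambda>t::real. indicator {0..2 * pi} t / (2 * pi) :: real"
  have Gm [measurable]: "G \<in> borel_measurable (restrict_space borel circle)"
    using G by (simp add: circle_measure_def)
  have Gc [measurable]: "(\<lambda>t. G (cis t)) \<in> borel_measurable lborel"
    using measurable_compose[OF cis_measurable Gm] by simp
  have ae: "AE t in lborel. ?w t *\<^sub>R G (cis t) = (indicator {0..<2 * pi} t *\<^sub>R G (cis t)) /\<^sub>R (2 * pi)"
    using AE_lborel_singleton[of "2 * pi"] by eventually_elim (auto simp: field_simps split: split_indicator)
  have cis: "cis \<in> density lborel (\<lambda>t. ennreal (?w t)) \<rightarrow>\<^sub>M restrict_space borel circle" by measurable
  have "integrable \<mu> G \<longleftrightarrow> integrable lborel (\<lambda>t. ?w t *\<^sub>R G (cis t))"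
    unfolding circle_measure_density by (subst integrable_distr_eq[OF cis Gm], subst integrable_density) auto
  also have "\<dots> \<longleftrightarrow> integrable lborel (\<lambda>t. (indicator {0..<2 * pi} t *\<^sub>R G (cis t)) /\<^sub>R (2 * pi))"
    by (rule integrable_cong_AE) (use ae in auto)
  also have iff: "\<dots> \<longleftrightarrow> integrable lborel (\<lambda>t. indicator {0..<2 * pi} t *\<^sub>R G (cis t))"
  proof
    assume "integrable lborel (\<lambda>t. (indicator {0..<2 * pi} t *\<^sub>R G (cis t)) /\<^sub>R (2 * pi))"
    from integrable_scaleR_right[OF this, of "2 * pi"]
    have "integrable lborel (\<lambda>t. (2 * pi) *\<^sub>R ((indicator {0..<2 * pi} t *\<^sub>R G (cis t)) /\<^sub>R (2 * pi)))" .
    moreover have "(2 * pi) *\<^sub>R (x /\<^sub>R (2 * pi)) = x" for x :: 'b by simp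
    ultimately show "integrable lborel (\<lambda>t. indicator {0..<2 * pi} t *\<^sub>R G (cis t))" by (simp only:)
  next
    assume "integrable lborel (\<lambda>t. indicator {0..<2 * pi} t *\<^sub>R G (cis t))"
    then show "integrable lborel (\<lambda>t. (indicator {0..<2 * pi} t *\<^sub>R G (cis t)) /\<^sub>R (2 * pi))"
      by (rule integrable_scaleR_right)
  qed
  finally show "integrable \<mu> G \<longleftrightarrow> integrable lborel (\<lambda>t. indicator {0..<2 * pi} t *\<^sub>R G (cis t))" .
  have "(\<integral>z. G z \<partial>\<mu>) = (\<integral>t. ?w t *\<^sub>R G (cis t) \<partial>lborel)"
    unfolding circle_measure_density by (subst integral_distr[OF cis Gm], subst integral_density) auto
  also have "\<dots> = (\<integral>t. (indicator {0..<2 * pi} t *\<^sub>R G (cis t)) /\<^sub>R (2 * pi) \<partial>lborel)"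
    by (rule integral_cong_AE) (use ae in auto)
  also have "\<dots> = (\<integral>t. indicator {0..<2 * pi} t *\<^sub>R G (cis t) \<partial>lborel) /\<^sub>R (2 * pi)"
    by (cases "integrable lborel (\<lambda>t. indicator {0..<2 * pi} t *\<^sub>R G (cis t))")
      (simp_all only: integral_scaleR_right iff not_integrable_integral_eq scaleR_zero_right not_False_eq_True)
  finally show "(\<integral>z. G z \<partial>\<mu>) = (\<integral>t. indicator {0..<2 * pi} t *\<^sub>R G (cis t) \<partial>lborel) /\<^sub>R (2 * pi)" .
qed

lemma prob_space_circle: "prob_space \<mu>"
  unfolding circle_measure_def
proof (rule prob_space.prob_space_distr)
  show "prob_space (uniform_measure lborel {0..2 * pi})" by (rule prob_space_uniform_measure) auto
  show "cis \<in> uniform_measure lborel {0..2 * pi} \<rightarrow>\<^sub>M restrict_space borel circle"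
    by (subst measurable_cong_sets[OF sets_uniform_measure refl]) (simp add: cis_measurable)
qed

interpretation \<mu>: prob_space \<mu> by (rule prob_space_circle)

text \<open>
  Any \<open>N\<close>-th root multiplied by the roots of unity gives all of them; the root can be chosen
  measurably through the argument, which is why the lemma is stated for an arbitrary root.
\<close>

lemma nth_roots_bij:
  assumes n: "n > 0" and w: "w ^ n = c" "c \<noteq> 0"
  shows "bij_betw (\<lambda>k. w * cis (2 * pi * real k / real n)) {..<n} {z. z ^ n = c}"
proof -
  have w0: "w \<noteq> 0" using w n by (auto simp: power_0_left)
  have "bij_betw (\<lambda>z. w * z) {z. z ^ n = 1} {z. z ^ n = c}"
  proof (rule bij_betw_byWitness[of _ "\<lambda>z. z / w"])
    show "(\<lambda>z. z / w) ` {z. z ^ n = c} \<subseteq> {z. z ^ n = 1}" using w by (auto simp: power_divide)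
  qed (use w w0 in \<open>auto simp: power_mult_distrib\<close>)
  from bij_betw_trans[OF Complex.bij_betw_roots_unity[OF n] this] show ?thesis by (simp add: o_def)
qed

lemma Arg_measurable [measurable]: "Arg \<in> borel_measurable (restrict_space borel circle)"
proof -
  have "(\<lambda>z. if z = -1 then pi else Arg z) \<in> borel_measurable (restrict_space borel circle)"
  proof (subst measurable_If_restrict_space_iff)
    show "{x \<in> space (restrict_space borel circle). x = - 1} \<in> sets (restrict_space borel circle)"
      by (auto simp: sets_restrict_space space_restrict_space intro!: image_eqI[of _ _ "{-1}"])
    have "continuous_on (circle \<inter> {z. z \<noteq> -1}) Arg"
    proof (rule continuous_at_imp_continuous_on, rule ballI)
      fix z :: complex assume z: "z \<in> circle \<inter> {z. z \<noteq> -1}"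
      have "z \<notin> \<real>\<^sub>\<le>\<^sub>0"
      proof
        assume "z \<in> \<real>\<^sub>\<le>\<^sub>0"
        then obtain r where "z = of_real r" "r \<le> 0" by (auto elim: nonpos_Reals_cases)
        then show False using z by auto
      qed
      then show "isCont Arg z" by (rule continuous_at_Arg)
    qed
    then have "Arg \<in> borel_measurable (restrict_space borel (circle \<inter> {z. z \<noteq> -1}))"
      by (rule borel_measurable_continuous_on_restrict)
    then show "(\<lambda>z. pi) \<in> borel_measurable (restrict_space (restrict_space borel circle) {z. z = -1}) \<and>
      Arg \<in> borel_measurable (restrict_space (restrict_space borel circle) {z. z \<noteq> -1})"
      by (simp add: restrict_restrict_space)
  qed
  moreover have "Arg (-1) = pi" by (rule cis_Arg_unique) auto
  then have "(\<lambda>z. if z = -1 then pi else Arg z) = Arg" by auto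
  ultimately show ?thesis by simp
qed

lemma circle_power_measurable: "(\<lambda>z. z ^ n) \<in> restrict_space borel circle \<rightarrow>\<^sub>M restrict_space borel circle"
  by (rule measurable_restrict_space2)
    (auto simp: space_restrict_space norm_power intro!: measurable_restrict_space1 borel_measurable_continuous_onI continuous_intros)

lemma circle_id_measurable: "(\<lambda>z. z) \<in> restrict_space borel circle \<rightarrow>\<^sub>M borel"
  by (rule measurable_restrict_space1) simp

definition preimage_sum :: "nat \<Rightarrow> (complex \<Rightarrow> 'b::comm_monoid_add) \<Rightarrow> complex \<Rightarrow> 'b" where
  "preimage_sum N G z = (\<Sum>w | w ^ N = z. G w)"

context scaling
begin

lemma preimage_sum_Arg:
  assumes "z \<in> circle" shows "preimage_sum N G z = (\<Sum>k<N. G (cis (Arg z / real N) * cis (2 * pi * real k / real N)))"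
proof -
  have "cis (Arg z / real N) ^ N = z"
    using assms cis_Arg[of z] by (cases "z = 0") (auto simp: Complex.DeMoivre sgn_eq)
  moreover have "z \<noteq> 0" using assms by auto
  ultimately show ?thesis using nth_roots_bij[of N "cis (Arg z / real N)" z]
    unfolding preimage_sum_def by (intro sum.reindex_bij_betw[symmetric]) auto
qed

lemma preimage_sum_cis: "preimage_sum N G (cis t) = (\<Sum>k<N. G (cis ((t + 2 * pi * real k) / real N)))"
proof -
  have "cis (t / real N) ^ N = cis t" by (simp add: Complex.DeMoivre)
  from nth_roots_bij[OF _ this] have "preimage_sum N G (cis t) = (\<Sum>k<N. G (cis (t / real N) * cis (2 * pi * real k / real N)))"
    unfolding preimage_sum_def by (intro sum.reindex_bij_betw[symmetric]) auto
  then show ?thesis by (simp add: cis_mult add_divide_distrib)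
qed

lemma preimage_sum_measurable [measurable]:
  fixes G :: "complex \<Rightarrow> 'b::{banach, second_countable_topology}"
  assumes G: "G \<in> borel_measurable \<mu>" shows "preimage_sum N G \<in> borel_measurable \<mu>"
proof -
  have [measurable]: "G \<in> borel_measurable (restrict_space borel circle)" using G by (simp add: circle_measure_def)
  have r [measurable]: "(\<lambda>z. cis (Arg z / real N) * cis (2 * pi * real k / real N)) \<in> restrict_space borel circle \<rightarrow>\<^sub>M restrict_space borel circle" for k
    unfolding cis_mult by measurable
  have "(\<lambda>z. \<Sum>k<N. G (cis (Arg z / real N) * cis (2 * pi * real k / real N))) \<in> borel_measurable (restrict_space borel circle)"
    by measurable
  then have "preimage_sum N G \<in> borel_measurable (restrict_space borel circle)"
    by (subst measurable_cong[OF preimage_sum_Arg]) (auto simp: space_restrict_space)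
  then show ?thesis by (simp add: circle_measure_def)
qed

text \<open>
  In the angle coordinate the preimages of \<open>t\<close> are the \<open>(t + 2\<pi>k) / N\<close>, and the \<open>N\<close> intervals
  \<open>[2\<pi>k/N, 2\<pi>(k+1)/N)\<close> tile the circle.
\<close>

theorem preimage_sum_integral:
  fixes G :: "complex \<Rightarrow> 'b::{banach, second_countable_topology}"
  assumes G: "integrable \<mu> G"
  shows "integrable \<mu> (preimage_sum N G)" "(\<integral>z. preimage_sum N G z \<partial>\<mu>) = real N *\<^sub>R (\<integral>z. G z \<partial>\<mu>)"
proof -
  have Gm: "G \<in> borel_measurable \<mu>" using G by auto
  define g where "g t = G (cis t)" for t
  define I where "I k = {2 * pi * real k / real N..<2 * pi * real (Suc k) / real N}" for k
  let ?J = "{0..<2 * pi}"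
  have tile: "indicator ?J t = (\<Sum>k<N. indicator (I k) t :: real)" for t
  proof -
    have "(\<Union>k<n. I k) = {0..<2 * pi * real n / real N}" for n
    proof (induction n)
      case (Suc n)
      have "{0..<2 * pi * real n / real N} \<union> I n = {0..<2 * pi * real (Suc n) / real N}"
        unfolding I_def by (rule ivl_disj_un) (auto simp: divide_right_mono)
      then show ?case using Suc by (simp add: lessThan_Suc Un_commute)
    qed simp
    from this[of N] have J: "(\<Union>k<N. I k) = ?J" by simp
    have "disjoint_family_on I {..<N}"
      unfolding disjoint_family_on_def
    proof (intro ballI impI)
      have "I a \<inter> I b = {}" if "a < b" for a b
      proof -
        have "2 * pi * real (Suc a) / real N \<le> 2 * pi * real b / real N"
          using that by (intro divide_right_mono mult_left_mono) auto
        then show ?thesis by (auto simp: I_def)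
      qed
      then show "I a \<inter> I b = {}" if "a \<noteq> b" for a b using that by (metis Int_commute linorder_neqE_nat)
    qed
    then show ?thesis using indicator_UN_disjoint[of "{..<N}" I t] by (simp add: J)
  qed
  have int: "integrable lborel (\<lambda>t. indicator ?J t *\<^sub>R g t)"
    using circle_integrable_iff[OF Gm] G by (simp add: g_def)
  have gm: "g \<in> borel_measurable lborel"
    using measurable_compose[OF cis_measurable, of G borel] Gm by (simp add: g_def[abs_def] circle_measure_def)
  define c where "c k = (\<integral>t. indicator (I k) t *\<^sub>R g t \<partial>lborel)" for k
  have ck: "has_bochner_integral lborel (\<lambda>t. indicator (I k) t *\<^sub>R g t) (c k)" if "k < N" for k
  proof -
    have "integrable lborel (\<lambda>t. indicator (I k) t *\<^sub>R (indicator ?J t *\<^sub>R g t))"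
      by (rule integrable_mult_indicator[OF _ int]) (simp add: I_def)
    moreover have "indicator (I k) t *\<^sub>R (indicator ?J t *\<^sub>R g t) = indicator (I k) t *\<^sub>R g t" for t
    proof -
      have "2 * pi * real (Suc k) \<le> 2 * pi * real N" using that by (intro mult_left_mono) auto
      then have "2 * pi * real (Suc k) / real N \<le> 2 * pi" by (simp add: divide_le_eq)
      moreover have "0 \<le> 2 * pi * real k / real N" by simp
      ultimately have "I k \<subseteq> ?J" unfolding I_def by auto
      then show ?thesis by (auto split: split_indicator)
    qed
    ultimately have "integrable lborel (\<lambda>t. indicator (I k) t *\<^sub>R g t)" by (simp only:)
    then show ?thesis unfolding c_def by (rule has_bochner_integral_integrable)
  qed
  have sumc: "has_bochner_integral lborel (\<lambda>t. indicator ?J t *\<^sub>R g t) (\<Sum>k<N. c k)"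
    unfolding tile scaleR_sum_left by (rule has_bochner_integral_sum) (use ck in auto)
  have branch: "has_bochner_integral lborel (\<lambda>t. indicator ?J t *\<^sub>R g ((t + 2 * pi * real k) / real N)) (real N *\<^sub>R c k)"
    if "k < N" for k
  proof -
    have "has_bochner_integral lborel (\<lambda>x. indicator (I k) (2 * pi * real k / real N + 1 / real N * x) *\<^sub>R g (2 * pi * real k / real N + 1 / real N * x)) (c k /\<^sub>R \<bar>1 / real N\<bar>)"
      using ck[OF that] by (subst lborel_has_bochner_integral_real_affine_iff[symmetric]) auto
    moreover have "indicator (I k) (2 * pi * real k / real N + 1 / real N * x) = (indicator ?J x :: real)" for x
      by (auto simp: I_def field_simps split: split_indicator)
    moreover have "2 * pi * real k / real N + 1 / real N * x = (x + 2 * pi * real k) / real N" for x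
      by (simp add: field_simps)
    ultimately show ?thesis by simp
  qed
  have tot: "has_bochner_integral lborel (\<lambda>t. indicator ?J t *\<^sub>R preimage_sum N G (cis t)) (real N *\<^sub>R (\<Sum>k<N. c k))"
    unfolding preimage_sum_cis scaleR_sum_right g_def[symmetric]
    by (rule has_bochner_integral_sum) (use branch in auto)
  show "integrable \<mu> (preimage_sum N G)"
    using tot circle_integrable_iff[OF preimage_sum_measurable[OF Gm]] by (auto simp: has_bochner_integral_iff)
  show "(\<integral>z. preimage_sum N G z \<partial>\<mu>) = real N *\<^sub>R (\<integral>z. G z \<partial>\<mu>)"
    using tot sumc unfolding circle_integral_eq[OF preimage_sum_measurable[OF Gm]] circle_integral_eq[OF Gm]
    by (simp add: has_bochner_integral_iff g_def)
qed

text \<open>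
  For \<open>G(w) = 1\<^sub>B(w\<^sup>N)\<close> the sum over the \<open>N\<close> preimages of \<open>z\<close> is \<open>N 1\<^sub>B(z)\<close>.
\<close>

lemma circle_power_preserving: "distr \<mu> \<mu> (\<lambda>z. z ^ N) = \<mu>"
proof (rule measure_eqI)
  fix B assume "B \<in> sets (distr \<mu> \<mu> (\<lambda>z. z ^ N))"
  then have B [measurable]: "B \<in> sets \<mu>" by simp
  have P: "(\<lambda>z. z ^ N) \<in> \<mu> \<rightarrow>\<^sub>M \<mu>" using circle_power_measurable by (simp add: circle_measure_def)
  let ?G = "\<lambda>w. indicator B (w ^ N) :: real"
  have G: "integrable \<mu> ?G"
    using P by (intro \<mu>.integrable_const_bound[of _ 1]) (auto simp: measurable_compose[OF P] split: split_indicator)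
  have "preimage_sum N ?G z = real N * indicator B z" if "z \<in> circle" for z
  proof -
    have "card {w. w ^ N = z} = N" by (rule card_nth_roots) (use that in auto)
    then show ?thesis by (simp add: preimage_sum_def)
  qed
  then have "(\<integral>z. real N * indicator B z \<partial>\<mu>) = (\<integral>z. preimage_sum N ?G z \<partial>\<mu>)"
    by (intro Bochner_Integration.integral_cong) auto
  also have "\<dots> = real N * (\<integral>z. ?G z \<partial>\<mu>)" using preimage_sum_integral(2)[OF G] by simp
  finally have "measure \<mu> (B \<inter> circle) = (\<integral>z. ?G z \<partial>\<mu>)" by simp
  moreover have "B \<inter> circle = B" using sets.sets_into_space[OF B] by auto
  ultimately have "measure \<mu> B = (\<integral>z. ?G z \<partial>\<mu>)" by (simp only:)
  also have "\<dots> = (\<integral>z. indicator B z \<partial>distr \<mu> \<mu> (\<lambda>z. z ^ N))" by (rule integral_distr[symmetric, OF P]) measurable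
  also have "\<dots> = measure (distr \<mu> \<mu> (\<lambda>z. z ^ N)) (B \<inter> circle)" by simp
  also have "B \<inter> circle = B" using sets.sets_into_space[OF B] by auto
  finally show "emeasure (distr \<mu> \<mu> (\<lambda>z. z ^ N)) B = emeasure \<mu> B"
    using finite_measure.emeasure_eq_measure[OF \<mu>.finite_measure_distr[OF P]] \<mu>.emeasure_eq_measure by simp
qed simp

lemma AE_circle_power:
  assumes "AE z in \<mu>. Q z" shows "AE z in \<mu>. Q (z ^ N)"
proof -
  have P: "(\<lambda>z. z ^ N) \<in> \<mu> \<rightarrow>\<^sub>M \<mu>" using circle_power_measurable by (simp add: circle_measure_def)
  from assms obtain S where S: "S \<in> null_sets \<mu>" "{z \<in> space \<mu>. \<not> Q z} \<subseteq> S" by (auto simp: eventually_ae_filter)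
  have "AE z in distr \<mu> \<mu> (\<lambda>z. z ^ N). z \<notin> S" unfolding circle_power_preserving using S by (simp add: AE_not_in)
  moreover have "{z \<in> space \<mu>. z \<notin> S} = space \<mu> - S" "S \<in> sets \<mu>" using S by auto
  then have "{z \<in> space \<mu>. z \<notin> S} \<in> sets \<mu>" by (simp only: sets.compl_sets)
  ultimately have "AE z in \<mu>. z ^ N \<notin> S" by (subst (asm) AE_distr_iff[OF P])
  then show ?thesis
  proof (rule AE_mp, intro AE_I2 impI)
    fix z assume "z \<in> space \<mu>" "z ^ N \<notin> S"
    moreover from this have "z ^ N \<in> space \<mu>" by (simp add: norm_power)
    ultimately show "Q (z ^ N)" using S by blast
  qed
qed

lemma AE_circle_power_iter: "AE z in \<mu>. Q z \<Longrightarrow> AE z in \<mu>. Q (z ^ (N ^ k))"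
proof (induction k arbitrary: Q)
  case (Suc k)
  from Suc.IH[OF AE_circle_power[OF Suc.prems]] show ?case by (simp add: power_mult[symmetric] mult.commute)
qed simp

end

section \<open>Iterates of the Ruelle operator\<close>

locale filter_pair = scaling N for N +
  fixes m0 :: "complex \<Rightarrow> complex" and h :: "complex \<Rightarrow> real"
  assumes filter: "wavelet_filter N m0" and nonsing: "nonsingular m0" and harmonic: "ruelle_harmonic N m0 h"
begin

abbreviation "R \<equiv> ruelle N m0"

text \<open>
  The weight is the density that the \<open>k\<close>-th iterate of the Ruelle operator puts on its argument.
\<close>

definition weight :: "nat \<Rightarrow> complex \<Rightarrow> real" where
  "weight k z = (\<Prod>j<k. (cmod (m0 (z ^ (N ^ j))))\<^sup>2)"

lemma m0_measurable [measurable]: "m0 \<in> borel_measurable \<mu>" and m0_bounded: "\<exists>C. AE z in \<mu>. cmod (m0 z) \<le> C"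
  using filter by (auto simp: wavelet_filter_def Linf_def)

lemma m0_Linf: "m0 \<in> Linf" using filter by (simp add: wavelet_filter_def)

lemma h_integrable: "integrable \<mu> h" and h_nonneg: "AE z in \<mu>. h z \<ge> 0"
  and R_h: "AE z in \<mu>. R (\<lambda>w. of_real (h w)) z = of_real (h z)"
  using harmonic by (auto simp: ruelle_harmonic_def)

lemma h_measurable [measurable]: "h \<in> borel_measurable \<mu>" using h_integrable by auto

lemma power_measurable [measurable]: "(\<lambda>z. z ^ n) \<in> \<mu> \<rightarrow>\<^sub>M \<mu>"
  using circle_power_measurable by (simp add: circle_measure_def)

lemma law_power_measurable: "sets M = sets borel \<Longrightarrow> (\<lambda>z::complex. z ^ n) \<in> M \<rightarrow>\<^sub>M borel"
  by (subst measurable_cong_sets[OF _ refl]) (auto intro!: borel_measurable_continuous_onI continuous_intros)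

lemma weight_measurable [measurable]: "weight k \<in> borel_measurable \<mu>"
  unfolding weight_def[abs_def] by measurable

lemma weight_nonneg [simp]: "weight k z \<ge> 0" by (simp add: weight_def prod_nonneg)

lemma weight_0 [simp]: "weight 0 z = 1" by (simp add: weight_def)

lemma weight_Suc: "weight (Suc k) z = (cmod (m0 (z ^ (N ^ k))))\<^sup>2 * weight k z"
  by (simp add: weight_def lessThan_Suc)

lemma weight_Suc_shift: "weight (Suc k) z = (cmod (m0 z))\<^sup>2 * weight k (z ^ N)"
  unfolding weight_def prod.lessThan_Suc_shift by (simp add: power_mult)

lemma weight_bounded: "\<exists>C. AE z in \<mu>. cmod (of_real (weight k z)) \<le> C"
proof (induction k)
  case (Suc k)
  then obtain C where C: "AE z in \<mu>. cmod (of_real (weight k z)) \<le> C" by blast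
  obtain D where D: "AE z in \<mu>. cmod (m0 z) \<le> D" using m0_bounded by blast
  have "AE z in \<mu>. cmod (of_real (weight (Suc k) z)) \<le> D\<^sup>2 * C"
    using C AE_circle_power_iter[OF D, of k]
  proof eventually_elim
    case (elim z)
    then have "(cmod (m0 (z ^ (N ^ k))))\<^sup>2 * weight k z \<le> D\<^sup>2 * C" by (intro mult_mono power_mono) auto
    then show ?case by (simp add: weight_Suc Real_Vector_Spaces.norm_mult norm_power)
  qed
  then show ?case by blast
qed auto

lemma integrable_mult_bounded:
  fixes g b :: "complex \<Rightarrow> complex"
  assumes g: "integrable \<mu> g" and b: "b \<in> borel_measurable \<mu>" "AE z in \<mu>. cmod (b z) \<le> C"
  shows "integrable \<mu> (\<lambda>z. b z * g z)"
proof (rule Bochner_Integration.integrable_bound)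
  show "integrable \<mu> (\<lambda>z. of_real C * g z)" using g by simp
  show "(\<lambda>z. b z * g z) \<in> borel_measurable \<mu>" using b g by measurable
  show "AE z in \<mu>. norm (b z * g z) \<le> norm (of_real C * g z)"
    using b(2) by eventually_elim (auto simp: Real_Vector_Spaces.norm_mult intro!: mult_right_mono)
qed

text \<open>
  Multiplying by \<open>F(z)\<close> amounts to multiplying by \<open>F(w\<^sup>N)\<close> inside the sum over the \<open>N\<close>-th roots \<open>w\<close>
  of \<open>z\<close>, so the claim is \<open>preimage_sum_integral\<close>: the Ruelle operator is the transpose of
  \<open>F \<mapsto> |m\<^sub>0|\<^sup>2 F(z\<^sup>N)\<close>.
\<close>

lemma ruelle_transpose:
  fixes g F :: "complex \<Rightarrow> complex"
  assumes g: "integrable \<mu> (\<lambda>z. of_real ((cmod (m0 z))\<^sup>2) * g z * F (z ^ N))"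
  shows "integrable \<mu> (\<lambda>z. R g z * F z)"
    "(\<integral>z. R g z * F z \<partial>\<mu>) = (\<integral>z. of_real ((cmod (m0 z))\<^sup>2) * g z * F (z ^ N) \<partial>\<mu>)"
proof -
  let ?G = "\<lambda>z. of_real ((cmod (m0 z))\<^sup>2) * g z * F (z ^ N)"
  have eq: "R g z * F z = 1 / of_nat N * preimage_sum N ?G z" for z
    unfolding ruelle_def preimage_sum_def
    by (simp add: sum_distrib_right mult.assoc)
  show "integrable \<mu> (\<lambda>z. R g z * F z)" unfolding eq using preimage_sum_integral(1)[OF g] by simp
  show "(\<integral>z. R g z * F z \<partial>\<mu>) = (\<integral>z. ?G z \<partial>\<mu>)"
    unfolding eq using preimage_sum_integral(2)[OF g] by (simp add: scaleR_conv_of_real)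
qed

lemma ruelle_iterate_integral:
  fixes g :: "complex \<Rightarrow> complex"
  assumes "integrable \<mu> g"
  shows "(\<integral>z. (R ^^ k) g z \<partial>\<mu>) = (\<integral>z. of_real (weight k z) * g z \<partial>\<mu>)"
  using assms
proof (induction k arbitrary: g)
  case (Suc k)
  have int: "integrable \<mu> (\<lambda>z. of_real (weight j z) * g z)" for j
    using weight_bounded[of j] integrable_mult_bounded[OF Suc.prems] by auto
  have e: "of_real (weight (Suc j) z) * g z = of_real ((cmod (m0 z))\<^sup>2) * g z * of_real (weight j (z ^ N))" for j z
    by (simp add: weight_Suc_shift)
  have Rg: "integrable \<mu> (R g)"
    using ruelle_transpose(1)[of g "\<lambda>_. 1"] int[of 1] unfolding One_nat_def e by simp
  have "(\<integral>z. (R ^^ Suc k) g z \<partial>\<mu>) = (\<integral>z. of_real (weight k z) * R g z \<partial>\<mu>)"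
    using Suc.IH[OF Rg] by (simp add: funpow_swap1)
  also have "\<dots> = (\<integral>z. R g z * of_real (weight k z) \<partial>\<mu>)" by (simp add: mult.commute)
  also have "\<dots> = (\<integral>z. of_real (weight (Suc k) z) * g z \<partial>\<mu>)"
    unfolding e by (rule ruelle_transpose(2)) (use int[of "Suc k"] in \<open>simp only: e\<close>)
  finally show ?case .
qed simp

text \<open>
  This will be the distribution of the coordinate \<open>\<xi>(N\<^sup>-\<^sup>k)\<close>. It is regarded as a measure on the plane,
  so that Borel functions need not be restricted to the circle.
\<close>

definition law :: "nat \<Rightarrow> complex measure" where
  "law k = distr (density \<mu> (\<lambda>z. ennreal (h z * weight k z))) borel (\<lambda>z. z)"

lemma sets_law [simp, measurable_cong]: "sets (law k) = sets borel" and space_law [simp]: "space (law k) = UNIV"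
  by (simp_all add: law_def)

lemma density_nonneg: "AE z in \<mu>. 0 \<le> h z * weight k z"
  using h_nonneg by eventually_elim simp

lemma h_weight_integrable: "integrable \<mu> (\<lambda>z. h z * weight k z)"
proof -
  obtain C where C: "AE z in \<mu>. cmod (of_real (weight k z)) \<le> C" using weight_bounded by blast
  show ?thesis
  proof (rule Bochner_Integration.integrable_bound)
    show "integrable \<mu> (\<lambda>z. C * h z)" using h_integrable by simp
    show "AE z in \<mu>. norm (h z * weight k z) \<le> norm (C * h z)"
      using C
    proof eventually_elim
      case (elim z)
      then have "\<bar>h z\<bar> * weight k z \<le> \<bar>h z\<bar> * \<bar>C\<bar>" by (intro mult_left_mono) auto
      then show ?case by (simp add: abs_mult mult.commute)
    qed
  qed measurable
qed

lemma
  fixes F :: "complex \<Rightarrow> 'b::{banach, second_countable_topology}"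
  assumes F: "F \<in> borel_measurable borel"
  shows law_integral: "(\<integral>z. F z \<partial>law k) = (\<integral>z. (h z * weight k z) *\<^sub>R F z \<partial>\<mu>)"
    and law_integrable: "integrable (law k) F \<longleftrightarrow> integrable \<mu> (\<lambda>z. (h z * weight k z) *\<^sub>R F z)"
proof -
  have Fm: "F \<in> borel_measurable \<mu>" using measurable_restrict_space1[OF F] by (simp add: circle_measure_def)
  have id: "(\<lambda>z. z) \<in> density \<mu> (\<lambda>z. ennreal (h z * weight k z)) \<rightarrow>\<^sub>M borel"
    using circle_id_measurable by (simp add: circle_measure_def)
  show "(\<integral>z. F z \<partial>law k) = (\<integral>z. (h z * weight k z) *\<^sub>R F z \<partial>\<mu>)"
    unfolding law_def by (subst integral_distr[OF id F], subst integral_density) (use Fm density_nonneg in auto)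
  show "integrable (law k) F \<longleftrightarrow> integrable \<mu> (\<lambda>z. (h z * weight k z) *\<^sub>R F z)"
    unfolding law_def by (subst integrable_distr_eq[OF id F], subst integrable_density) (use Fm density_nonneg in auto)
qed

lemma AE_law:
  assumes "AE z in \<mu>. Q z" shows "AE z in law k. z \<in> circle \<and> Q z"
proof -
  have id: "(\<lambda>z. z) \<in> density \<mu> (\<lambda>z. ennreal (h z * weight k z)) \<rightarrow>\<^sub>M borel"
    using circle_id_measurable by (simp add: circle_measure_def)
  from assms obtain S where S: "S \<in> null_sets \<mu>" "{z \<in> space \<mu>. \<not> Q z} \<subseteq> S" by (auto simp: eventually_ae_filter)
  have Sb: "S \<in> sets borel" "S \<subseteq> circle"
    using S(1) unfolding null_sets_def sets_circle_measure by (auto simp: sets_restrict_space)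
  have "AE z in law k. z \<in> circle - S"
    unfolding law_def
  proof (subst AE_distr_iff[OF id])
    show "AE z in density \<mu> (\<lambda>z. ennreal (h z * weight k z)). z \<in> circle - S"
      using AE_not_in[OF S(1)] AE_space[of \<mu>] by (subst AE_density) (auto elim: eventually_elim2)
  qed (use Sb in auto)
  then show ?thesis by eventually_elim (use S in auto)
qed

lemma finite_measure_law: "finite_measure (law k)"
proof
  have "integrable (law k) (\<lambda>_. 1::real)" by (subst law_integrable) (use h_weight_integrable in auto)
  then show "emeasure (law k) (space (law k)) \<noteq> \<infinity>" by (simp add: integrable_iff_bounded)
qed

lemma h_weight_bounded_integrable:
  fixes F :: "complex \<Rightarrow> real"
  assumes F [measurable]: "F \<in> borel_measurable \<mu>" and b: "\<And>z. \<bar>F z\<bar> \<le> C"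
  shows "integrable \<mu> (\<lambda>z. (h z * weight k z) *\<^sub>R F z)"
proof (rule Bochner_Integration.integrable_bound)
  show "integrable \<mu> (\<lambda>z. C * (h z * weight k z))" using h_weight_integrable by (rule integrable_mult_right)
  have "C \<ge> 0" using b[of 0] abs_ge_zero[of "F 0"] by linarith
  have "\<bar>h z * weight k z\<bar> * \<bar>F z\<bar> \<le> C * \<bar>h z * weight k z\<bar>" for z
    using mult_right_mono[OF b[of z] abs_ge_zero[of "h z * weight k z"]] by (simp only: mult.commute)
  then show "AE z in \<mu>. norm ((h z * weight k z) *\<^sub>R F z) \<le> norm (C * (h z * weight k z))"
    using \<open>C \<ge> 0\<close> by (intro AE_I2) (simp add: abs_mult)
qed measurable

text \<open>
  Since \<open>h\<close> is harmonic, \<open>\<integral> h w\<^sub>k F = \<integral> R(h) w\<^sub>k F\<close> for the weight \<open>w\<^sub>k\<close>, and the transpose of \<open>R\<close> turns this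
  into \<open>\<integral> h |m\<^sub>0|\<^sup>2 (w\<^sub>k F)(z\<^sup>N) = \<integral> h w\<^sub>k\<^sub>+\<^sub>1 F(z\<^sup>N)\<close>.
\<close>

lemma law_Suc_integral:
  fixes F :: "complex \<Rightarrow> real"
  assumes F: "F \<in> borel_measurable borel" and b: "\<And>z. \<bar>F z\<bar> \<le> C"
  shows "(\<integral>z. F (z ^ N) \<partial>law (Suc k)) = (\<integral>z. F z \<partial>law k)"
proof -
  have pm: "(\<lambda>z::complex. z ^ N) \<in> borel_measurable borel" by (rule law_power_measurable) simp
  have FN: "(\<lambda>z. F (z ^ N)) \<in> borel_measurable borel" using measurable_compose[OF pm F] .
  have Fm [measurable]: "F \<in> borel_measurable \<mu>" using measurable_restrict_space1[OF F] by (simp add: circle_measure_def)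
  let ?F = "\<lambda>z. of_real (F z * weight k z) :: complex"
  have e: "of_real ((cmod (m0 z))\<^sup>2) * of_real (h z) * ?F (z ^ N) = of_real ((h z * weight (Suc k) z) *\<^sub>R F (z ^ N))" for z
    by (simp add: weight_Suc_shift)
  have intR: "integrable \<mu> (\<lambda>z. (h z * weight (Suc k) z) *\<^sub>R F (z ^ N))"
    and int0: "integrable \<mu> (\<lambda>z. (h z * weight k z) *\<^sub>R F z)"
    by (intro h_weight_bounded_integrable[of _ C] b; measurable)+
  have int: "integrable \<mu> (\<lambda>z. of_real ((h z * weight (Suc k) z) *\<^sub>R F (z ^ N)) :: complex)"
    using intR by (rule integrable_of_real)
  have eq: "(\<lambda>z. of_real ((cmod (m0 z))\<^sup>2) * of_real (h z) * ?F (z ^ N)) = (\<lambda>z. of_real ((h z * weight (Suc k) z) *\<^sub>R F (z ^ N)))"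
    by (rule ext) (rule e)
  have int2: "integrable \<mu> (\<lambda>z. of_real ((cmod (m0 z))\<^sup>2) * of_real (h z) * ?F (z ^ N))"
    unfolding eq by (rule int)
  have "of_real (\<integral>z. F (z ^ N) \<partial>law (Suc k)) = (\<integral>z. of_real ((h z * weight (Suc k) z) *\<^sub>R F (z ^ N)) \<partial>\<mu>)"
    unfolding law_integral[OF FN] by (rule integral_of_real[OF intR, symmetric])
  also have "\<dots> = (\<integral>z. R (\<lambda>w. of_real (h w)) z * ?F z \<partial>\<mu>)"
    using ruelle_transpose(2)[OF int2] unfolding eq by (rule sym)
  also have "\<dots> = (\<integral>z. of_real ((h z * weight k z) *\<^sub>R F z) \<partial>\<mu>)"
  proof (rule integral_cong_AE)
    have Rm: "(\<lambda>z. R (\<lambda>w. of_real (h w)) z) \<in> borel_measurable \<mu>"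
      using preimage_sum_measurable[of "\<lambda>w. of_real ((cmod (m0 w))\<^sup>2) * of_real (h w) :: complex"]
      unfolding ruelle_def preimage_sum_def by measurable
    then show "(\<lambda>z. R (\<lambda>w. of_real (h w)) z * ?F z) \<in> borel_measurable \<mu>" by measurable
    show "AE z in \<mu>. R (\<lambda>w. of_real (h w)) z * ?F z = of_real ((h z * weight k z) *\<^sub>R F z)"
      using R_h by eventually_elim simp
  qed measurable
  also have "\<dots> = of_real (\<integral>z. F z \<partial>law k)"
    unfolding law_integral[OF F] by (rule integral_of_real[OF int0])
  finally show ?thesis using of_real_eq_iff by blast
qed

text \<open>
  Consistency of the prescribed distributions: they form a projective system.
\<close>

theorem law_Suc: "distr (law (Suc k)) borel (\<lambda>z. z ^ N) = law k"
proof (rule measure_eqI)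
  fix B assume "B \<in> sets (distr (law (Suc k)) borel (\<lambda>z. z ^ N))"
  then have B: "B \<in> sets borel" by simp
  interpret a: finite_measure "law k" by (rule finite_measure_law)
  interpret b: finite_measure "law (Suc k)" by (rule finite_measure_law)
  have P: "(\<lambda>z. z ^ N) \<in> law (Suc k) \<rightarrow>\<^sub>M borel" by (rule law_power_measurable) simp
  interpret c: finite_measure "distr (law (Suc k)) borel (\<lambda>z. z ^ N)" by (rule b.finite_measure_distr[OF P])
  have "measure (distr (law (Suc k)) borel (\<lambda>z. z ^ N)) B = (\<integral>z. indicator B z \<partial>distr (law (Suc k)) borel (\<lambda>z. z ^ N))"
    using B by simp
  also have "\<dots> = (\<integral>z. indicator B (z ^ N) \<partial>law (Suc k))" by (rule integral_distr[OF P]) (use B in measurable)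
  also have "\<dots> = (\<integral>z. indicator B z \<partial>law k)"
    by (rule law_Suc_integral[of _ 1]) (use B in \<open>auto split: split_indicator\<close>)
  also have "\<dots> = measure (law k) B" using B by simp
  finally show "emeasure (distr (law (Suc k)) borel (\<lambda>z. z ^ N)) B = emeasure (law k) B"
    by (simp add: a.emeasure_eq_measure c.emeasure_eq_measure)
qed simp

lemma law_add: "distr (law (k + d)) borel (\<lambda>z. z ^ (N ^ d)) = law k"
proof (induction d)
  case 0
  show ?case by (simp add: distr_id2)
next
  case (Suc d)
  have "distr (law (k + Suc d)) borel (\<lambda>z. z ^ (N ^ Suc d)) = distr (distr (law (Suc (k + d))) borel (\<lambda>z. z ^ N)) borel (\<lambda>z. z ^ (N ^ d))"
    by (subst distr_distr) (auto simp: o_def power_mult intro!: law_power_measurable)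
  then show ?case using Suc by (simp only: law_Suc)
qed

lemma filter_integral:
  assumes f: "f \<in> carrier continuous_circle"
  shows "(\<integral>z. (R ^^ k) (\<lambda>w. f w * of_real (h w)) z \<partial>\<mu>) = (\<integral>z. (h z * weight k z) *\<^sub>R f z \<partial>\<mu>)"
proof -
  have fm: "f \<in> borel_measurable \<mu>"
    using borel_measurable_continuous_on_restrict[OF continuous_circleD[OF f]] by (simp add: circle_measure_def)
  have "compact (f ` circle)" by (rule compact_continuous_image[OF continuous_circleD[OF f]]) simp
  then obtain C where "\<forall>w\<in>f ` circle. norm w \<le> C" using compact_imp_bounded bounded_iff by metis
  then have "AE z in \<mu>. cmod (f z) \<le> C" by (intro AE_I2) auto
  from integrable_mult_bounded[OF _ fm this, of "\<lambda>z. of_real (h z)"]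
  have "integrable \<mu> (\<lambda>w. f w * of_real (h w))" using h_integrable by simp
  from ruelle_iterate_integral[OF this, of k] show ?thesis
    by (simp add: scaleR_conv_of_real mult_ac)
qed

end

section \<open>Measures on the solenoid\<close>

lemma distr_scale_measure:
  assumes f: "f \<in> M \<rightarrow>\<^sub>M X" shows "distr (scale_measure r M) X f = scale_measure r (distr M X f)"
proof (rule measure_eqI)
  fix B assume "B \<in> sets (distr (scale_measure r M) X f)"
  then have B: "B \<in> sets X" by simp
  have f': "f \<in> scale_measure r M \<rightarrow>\<^sub>M X" using f by (simp add: measurable_def space_scale_measure)
  show "emeasure (distr (scale_measure r M) X f) B = emeasure (scale_measure r (distr M X f)) B"
    using B f by (simp add: emeasure_distr[OF f'] emeasure_distr[OF f] space_scale_measure)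
qed simp

lemma AE_scale_measure: "AE x in M. Q x \<Longrightarrow> AE x in scale_measure r M. Q x"
  by (auto simp: eventually_ae_filter null_sets_def space_scale_measure)

lemma solenoid_step_sets:
  fixes f g :: "'x \<Rightarrow> complex"
  assumes f: "f \<in> borel_measurable M" and g: "g \<in> borel_measurable M"
  shows "{x \<in> space M. f x \<in> circle \<and> g x ^ n = f x} \<in> sets M"
proof -
  have d: "(\<lambda>x. g x ^ n - f x) \<in> borel_measurable M"
    by (intro borel_measurable_diff borel_measurable_power f g)
  have "{x \<in> space M. f x \<in> circle \<and> g x ^ n = f x} = (f -` circle \<inter> space M) \<inter> ((\<lambda>x. g x ^ n - f x) -` {0} \<inter> space M)"
    by auto
  moreover have "f -` circle \<inter> space M \<in> sets M" "(\<lambda>x. g x ^ n - f x) -` {0} \<inter> space M \<in> sets M"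
    using measurable_sets[OF f, of circle] measurable_sets[OF d, of "{0}"] by auto
  ultimately show ?thesis by (simp only: sets.Int)
qed

context scaling
begin

text \<open>
  The joint law of the coordinates in a finite index set \<open>J\<close> is the image of the law of one
  coordinate that is further out, since that coordinate determines all those before it. The sum of
  \<open>J\<close> is such an index, also for empty \<open>J\<close>.
\<close>

lemma solenoid_limit_prob:
  fixes law :: "nat \<Rightarrow> complex measure"
  assumes sets: "\<And>k. sets (law k) = sets borel" and prob: "\<And>k. prob_space (law k)"
    and power: "\<And>k d. distr (law (k + d)) borel (\<lambda>z. z ^ (N ^ d)) = law k"
    and circle: "\<And>k. AE z in law k. z \<in> circle"
  obtains L :: "(nat \<Rightarrow> complex) measure" where "prob_space L" "sets L = sets (PiM UNIV (\<lambda>_. borel))"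
    "\<And>k. distr L borel (\<lambda>\<omega>. \<omega> k) = law k" "AE \<omega> in L. \<omega> \<in> solenoid N"
proof -
  define s where "s J = \<Sum>J" for J :: "nat set"
  define coords where "coords n J w = (\<lambda>i\<in>J. w ^ (N ^ (n - i)))" for n :: nat and J :: "nat set" and w :: complex
  define P where "P J = distr (law (s J)) (PiM J (\<lambda>_. borel)) (coords (s J) J)" for J
  have pow: "(\<lambda>z::complex. z ^ n) \<in> law k \<rightarrow>\<^sub>M borel" for n k
    by (subst measurable_cong_sets[OF sets refl]) (intro borel_measurable_continuous_onI continuous_intros)
  have cm: "coords n J \<in> law k \<rightarrow>\<^sub>M PiM J (\<lambda>_. borel)" for n J k
    unfolding coords_def[abs_def] by (intro measurable_restrict pow)
  have cmb: "coords n J \<in> borel \<rightarrow>\<^sub>M PiM J (\<lambda>_. borel)" for n J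
    using cm[of n J 0] by (subst measurable_cong_sets[OF sets[symmetric] refl])
  have consistent: "P J = distr (P H) (PiM J (\<lambda>_. borel)) (\<lambda>f. restrict f J)" if JH: "J \<subseteq> H" "finite H" for J H
  proof -
    have le: "s J \<le> s H" unfolding s_def using JH by (intro sum_mono2) auto
    have lJ: "i \<le> s J" if "i \<in> J" for i
      unfolding s_def using JH that finite_subset by (intro member_le_sum) auto
    have "P J = distr (distr (law (s J + (s H - s J))) borel (\<lambda>z. z ^ (N ^ (s H - s J)))) (PiM J (\<lambda>_. borel)) (coords (s J) J)"
      unfolding P_def power ..
    also have "\<dots> = distr (law (s H)) (PiM J (\<lambda>_. borel)) (coords (s J) J \<circ> (\<lambda>z. z ^ (N ^ (s H - s J))))"
      using le by (subst distr_distr) (auto intro: cmb pow)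
    also have "coords (s J) J \<circ> (\<lambda>z. z ^ (N ^ (s H - s J))) = (\<lambda>f. restrict f J) \<circ> coords (s H) H"
    proof (rule ext)
      fix w :: complex
      have "(w ^ (N ^ (s H - s J))) ^ (N ^ (s J - i)) = w ^ (N ^ (s H - i))" if "i \<in> J" for i
      proof -
        have "(s H - s J) + (s J - i) = s H - i" using lJ[OF that] le by simp
        then have "N ^ (s H - s J) * N ^ (s J - i) = N ^ (s H - i)" by (simp only: power_add[symmetric])
        then show ?thesis by (simp only: power_mult[symmetric])
      qed
      then show "(coords (s J) J \<circ> (\<lambda>z. z ^ (N ^ (s H - s J)))) w = ((\<lambda>f. restrict f J) \<circ> coords (s H) H) w"
        using JH by (auto simp: coords_def restrict_def fun_eq_iff)
    qed
    also have "distr (law (s H)) (PiM J (\<lambda>_. borel)) ((\<lambda>f. restrict f J) \<circ> coords (s H) H) = distr (P H) (PiM J (\<lambda>_. borel)) (\<lambda>f. restrict f J)"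
      unfolding P_def by (rule distr_distr[symmetric]) (use JH in \<open>auto intro: cm measurable_restrict_subset\<close>)
    finally show ?thesis .
  qed
  have "prob_space (P J)" for J unfolding P_def by (rule prob_space.prob_space_distr[OF prob cm])
  then have "polish_projective UNIV P"
    unfolding polish_projective_def projective_family_def using consistent by blast
  then interpret polish_projective UNIV P .
  have rm: "(\<lambda>\<omega>. restrict \<omega> J) \<in> lim \<rightarrow>\<^sub>M PiM J (\<lambda>_. borel)" for J
    by (subst measurable_cong_sets[OF sets_lim refl]) (rule measurable_restrict_subset, simp)
  have margin: "distr lim (PiM J (\<lambda>_. borel)) (\<lambda>\<omega>. restrict \<omega> J) = P J" if J: "finite J" for J
  proof (rule measure_eqI)
    fix B assume "B \<in> sets (distr lim (PiM J (\<lambda>_. borel)) (\<lambda>\<omega>. restrict \<omega> J))"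
    then have B: "B \<in> sets (PiM J (\<lambda>_. borel))" by simp
    have "emeasure (distr lim (PiM J (\<lambda>_. borel)) (\<lambda>\<omega>. restrict \<omega> J)) B = emeasure lim (prod_emb UNIV (\<lambda>_. borel) J B)"
      by (subst emeasure_distr[OF rm B]) (simp add: prod_emb_def space_PiM)
    then show "emeasure (distr lim (PiM J (\<lambda>_. borel)) (\<lambda>\<omega>. restrict \<omega> J)) B = emeasure (P J) B"
      using emeasure_lim_emb[OF _ J B] by simp
  qed (simp add: P_def)
  have marg1: "distr lim borel (\<lambda>\<omega>. \<omega> k) = law k" for k
  proof -
    have "distr lim borel (\<lambda>\<omega>. \<omega> k) = distr (distr lim (PiM {k} (\<lambda>_. borel)) (\<lambda>\<omega>. restrict \<omega> {k})) borel (\<lambda>f. f k)"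
      by (subst distr_distr[OF _ rm]) (auto simp: o_def intro: measurable_component_singleton)
    also have "\<dots> = distr (distr (law k) (PiM {k} (\<lambda>_. borel)) (coords k {k})) borel (\<lambda>f. f k)"
      unfolding margin[of "{k}", simplified] by (simp add: P_def s_def)
    also have "\<dots> = distr (law (k + 0)) borel (\<lambda>z. z ^ (N ^ 0))"
      by (subst distr_distr[OF _ cm]) (auto simp: o_def coords_def intro: measurable_component_singleton)
    also have "\<dots> = law k" by (rule power)
    finally show ?thesis .
  qed
  have step: "AE \<omega> in lim. \<omega> k \<in> circle \<and> \<omega> (Suc k) ^ N = \<omega> k" for k
  proof -
    let ?J = "{k, Suc k}" and ?Q = "\<lambda>f. f k \<in> circle \<and> f (Suc k) ^ N = f k"
    have kJ: "k \<in> ?J" "Suc k \<in> ?J" by auto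
    have meas: "{f \<in> space (PiM ?J (\<lambda>_. borel)). ?Q f} \<in> sets (PiM ?J (\<lambda>_. borel :: complex measure))"
      by (rule solenoid_step_sets) (use measurable_component_singleton[OF kJ(1)] measurable_component_singleton[OF kJ(2)] in auto)
    have sJ: "s ?J = k + Suc k" by (simp add: s_def)
    have "AE w in law (s ?J). ?Q (coords (s ?J) ?J w)"
      using circle
    proof eventually_elim
      case (elim w)
      have "N ^ Suc k = N ^ k * N" by simp
      then have "(w ^ (N ^ k)) ^ N = w ^ (N ^ Suc k)" by (simp only: power_mult)
      then show ?case using elim by (simp add: coords_def sJ norm_power)
    qed
    then have "AE f in P ?J. ?Q f" unfolding P_def by (subst AE_distr_iff[OF cm meas])
    moreover have "distr lim (PiM ?J (\<lambda>_. borel)) (\<lambda>\<omega>. restrict \<omega> ?J) = P ?J" by (rule margin) simp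
    ultimately have "AE f in distr lim (PiM ?J (\<lambda>_. borel)) (\<lambda>\<omega>. restrict \<omega> ?J). ?Q f" by (simp only:)
    then have "AE \<omega> in lim. ?Q (restrict \<omega> ?J)" by (rule AE_distrD[OF rm])
    then show ?thesis by simp
  qed
  have "AE \<omega> in lim. \<forall>k. \<omega> k \<in> circle \<and> \<omega> (Suc k) ^ N = \<omega> k"
    using step by (simp add: AE_all_countable)
  then have "AE \<omega> in lim. \<omega> \<in> solenoid N" by eventually_elim (simp add: solenoid_def)
  from that[OF P.prob_space_axioms sets_lim marg1 this] show ?thesis .
qed

text \<open>
  All the given measures have the same mass. Unless it is 0, scaling it to 1 reduces the claim to
  probability measures.
\<close>

lemma solenoid_limit:
  fixes law :: "nat \<Rightarrow> complex measure"
  assumes sets: "\<And>k. sets (law k) = sets borel" and fin: "\<And>k. finite_measure (law k)"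
    and power: "\<And>k d. distr (law (k + d)) borel (\<lambda>z. z ^ (N ^ d)) = law k"
    and circle: "\<And>k. AE z in law k. z \<in> circle"
  obtains L :: "(nat \<Rightarrow> complex) measure" where "finite_measure L" "sets L = sets (PiM UNIV (\<lambda>_. borel))"
    "\<And>k. distr L borel (\<lambda>\<omega>. \<omega> k) = law k" "AE \<omega> in L. \<omega> \<in> solenoid N"
proof -
  define c where "c = measure (law 0) UNIV"
  have sp: "space (law k) = UNIV" for k using sets_eq_imp_space_eq[OF sets[of k]] by simp
  have pow: "(\<lambda>z::complex. z ^ n) \<in> law k \<rightarrow>\<^sub>M borel" for n k
    by (subst measurable_cong_sets[OF sets refl]) (intro borel_measurable_continuous_onI continuous_intros)
  have mass: "emeasure (law k) UNIV = ennreal c" for k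
  proof -
    have "emeasure (law 0) UNIV = emeasure (distr (law (0 + k)) borel (\<lambda>z. z ^ (N ^ k))) UNIV"
      unfolding power ..
    also have "\<dots> = emeasure (law k) UNIV" by (subst emeasure_distr[OF pow]) (auto simp: sp)
    finally show ?thesis using finite_measure.emeasure_eq_measure[OF fin[of 0]] by (simp add: c_def)
  qed
  have comp: "(\<lambda>\<omega>. \<omega> k) \<in> L \<rightarrow>\<^sub>M borel" if "sets L = sets (PiM UNIV (\<lambda>_. borel))" for L :: "(nat \<Rightarrow> complex) measure" and k
    by (subst measurable_cong_sets[OF that refl]) (rule measurable_component_singleton, simp)
  show ?thesis
  proof (cases "c = 0")
    case True
    let ?L = "null_measure (PiM UNIV (\<lambda>_. borel)) :: (nat \<Rightarrow> complex) measure"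
    show ?thesis
    proof (rule that[of ?L])
      show "finite_measure ?L" by (rule finite_measureI) simp
      show "distr ?L borel (\<lambda>\<omega>. \<omega> k) = law k" for k
      proof (rule measure_eqI)
        fix B assume "B \<in> sets (distr ?L borel (\<lambda>\<omega>. \<omega> k))"
        then have B: "B \<in> sets borel" by simp
        have "emeasure (law k) B \<le> emeasure (law k) UNIV" by (rule emeasure_mono) (auto simp: sets)
        then show "emeasure (distr ?L borel (\<lambda>\<omega>. \<omega> k)) B = emeasure (law k) B"
          using B mass[of k] True by (simp add: emeasure_distr[OF comp])
      qed (simp add: sets)
      show "AE \<omega> in ?L. \<omega> \<in> solenoid N" by (rule AE_I[of _ _ "space ?L"]) auto
    qed simp
  next
    case False
    have c: "c > 0" using False measure_nonneg[of "law 0" UNIV] unfolding c_def by linarith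
    define law' where "law' k = scale_measure (ennreal (1 / c)) (law k)" for k
    have p1: "prob_space (law' k)" for k
    proof (rule prob_spaceI)
      have "ennreal (1 / c) * ennreal c = 1" using c by (subst ennreal_mult[symmetric]) auto
      then show "emeasure (law' k) (space (law' k)) = 1" by (simp add: law'_def space_scale_measure sp mass)
    qed
    have p2: "distr (law' (k + d)) borel (\<lambda>z. z ^ (N ^ d)) = law' k" for k d
      unfolding law'_def distr_scale_measure[OF pow] power ..
    have p3: "AE z in law' k. z \<in> circle" for k
      unfolding law'_def by (rule AE_scale_measure[OF circle])
    have p0: "sets (law' k) = sets borel" for k by (simp add: law'_def sets)
    obtain L :: "(nat \<Rightarrow> complex) measure" where L: "prob_space L" "sets L = sets (PiM UNIV (\<lambda>_. borel))"
      "\<And>k. distr L borel (\<lambda>\<omega>. \<omega> k) = law' k" "AE \<omega> in L. \<omega> \<in> solenoid N"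
      by (rule solenoid_limit_prob[OF p0 p1 p2 p3]) blast
    show ?thesis
    proof (rule that[of "scale_measure (ennreal c) L"])
      show "finite_measure (scale_measure (ennreal c) L)"
        by (rule finite_measureI) (simp add: space_scale_measure prob_space.emeasure_space_1[OF L(1)] ennreal_mult_eq_top_iff)
      show "distr (scale_measure (ennreal c) L) borel (\<lambda>\<omega>. \<omega> k) = law k" for k
      proof -
        have "distr (scale_measure (ennreal c) L) borel (\<lambda>\<omega>. \<omega> k) = scale_measure (ennreal c) (law' k)"
          using distr_scale_measure[OF comp[OF L(2)]] L(3) by simp
        also have "\<dots> = law k"
        proof -
          have "ennreal c * ennreal (1 / c) = 1" using c by (subst ennreal_mult[symmetric]) auto
          then show ?thesis by (simp add: law'_def)
        qed
        finally show ?thesis .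
      qed
      show "AE \<omega> in scale_measure (ennreal c) L. \<omega> \<in> solenoid N" by (rule AE_scale_measure[OF L(4)])
    qed (simp add: L(2))
  qed
qed

section \<open>Borel measures on the dual group\<close>

text \<open>
  This identification makes the dual group a subspace of a countable product of planes, and there
  the Borel sets are generated by the coordinates.
\<close>

lemma seq_of_homeomorphic: "homeomorphic_map (dual_topology N) (top_of_set (solenoid N)) (seq_of N)"
proof (rule continuous_imp_homeomorphic_map)
  have "continuous_map (dual_topology N) euclidean (seq_of N)"
    unfolding euclidean_product_topology[symmetric] continuous_map_componentwise_UNIV
    using continuous_map_dual_eval by (simp add: seq_of_def)
  then show "continuous_map (dual_topology N) (top_of_set (solenoid N)) (seq_of N)"
    using seq_of_solenoid by (auto simp: continuous_map_in_subtopology)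
  show "compact_space (dual_topology N)" by (rule compact_space_dual)
  show "Hausdorff_space (top_of_set (solenoid N))" by (intro Hausdorff_space_subtopology) simp
  show "seq_of N ` topspace (dual_topology N) = topspace (top_of_set (solenoid N))"
    using seq_of_solenoid dual_of_carrier seq_of_dual_of by (auto intro!: rev_image_eqI)
  show "inj_on (seq_of N) (topspace (dual_topology N))"
    by (rule inj_onI) (simp add: dual_eqI)
qed

lemma openin_dual_iff:
  "openin (dual_topology N) V \<longleftrightarrow> (\<exists>W. open W \<and> V = {\<xi> \<in> K. seq_of N \<xi> \<in> W})"
proof
  assume V: "openin (dual_topology N) V"
  then have sub: "V \<subseteq> K" using openin_subset by fastforce
  have "openin (top_of_set (solenoid N)) (seq_of N ` V)"
    using homeomorphic_imp_open_map[OF seq_of_homeomorphic] V by (auto simp: open_map_def)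
  then obtain W where W: "open W" "seq_of N ` V = solenoid N \<inter> W" by (auto simp: openin_open)
  have "V = {\<xi> \<in> K. seq_of N \<xi> \<in> W}"
  proof (intro equalityI subsetI)
    fix \<xi> assume "\<xi> \<in> {\<xi> \<in> K. seq_of N \<xi> \<in> W}"
    then have \<xi>: "\<xi> \<in> K" "seq_of N \<xi> \<in> seq_of N ` V" using W seq_of_solenoid by auto
    then obtain \<psi> where "\<psi> \<in> V" "seq_of N \<xi> = seq_of N \<psi>" by auto
    then show "\<xi> \<in> V" using dual_eqI[of \<xi> \<psi>] \<xi> sub by auto
  qed (use W sub in auto)
  then show "\<exists>W. open W \<and> V = {\<xi> \<in> K. seq_of N \<xi> \<in> W}" using W by blast
next
  assume "\<exists>W. open W \<and> V = {\<xi> \<in> K. seq_of N \<xi> \<in> W}"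
  then obtain W where W: "open W" "V = {\<xi> \<in> K. seq_of N \<xi> \<in> W}" by blast
  have "continuous_map (dual_topology N) euclidean (seq_of N)"
    using homeomorphic_imp_continuous_map[OF seq_of_homeomorphic] by (simp add: continuous_map_in_subtopology)
  then show "openin (dual_topology N) V"
    using W openin_continuous_map_preimage[of "dual_topology N" euclidean "seq_of N" W] by simp
qed

definition dual_borel :: "(real \<Rightarrow> complex) measure" where
  "dual_borel = sigma K {V. openin (dual_topology N) V}"

lemma dual_opens_subset: "{V. openin (dual_topology N) V} \<subseteq> Pow K"
  using openin_subset by fastforce

lemma space_dual_borel [simp]: "space dual_borel = K"
  unfolding dual_borel_def by (rule space_measure_of[OF dual_opens_subset])

lemma sets_dual_borel: "sets dual_borel = sigma_sets K {V. openin (dual_topology N) V}"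
  unfolding dual_borel_def by (rule sets_measure_of[OF dual_opens_subset])

lemma finite_borel_measure_iff:
  "finite_borel_measure (dual_topology N) \<nu> \<longleftrightarrow> sets \<nu> = sets dual_borel \<and> finite_measure \<nu>"
proof -
  have "space \<nu> = K" if "sets \<nu> = sets dual_borel" using sets_eq_imp_space_eq[OF that] by simp
  then show ?thesis by (auto simp: finite_borel_measure_def sets_dual_borel)
qed

lemma continuous_dual_measurable:
  fixes f :: "(real \<Rightarrow> complex) \<Rightarrow> 'b::topological_space"
  assumes c: "continuous_map (dual_topology N) euclidean f" shows "f \<in> borel_measurable dual_borel"
proof (rule borel_measurableI)
  fix S :: "'b set" assume "open S"
  then have "openin (dual_topology N) {x \<in> topspace (dual_topology N). f x \<in> S}"
    by (intro openin_continuous_map_preimage[OF c]) simp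
  moreover have "{x \<in> topspace (dual_topology N). f x \<in> S} = f -` S \<inter> space dual_borel" by auto
  ultimately show "f -` S \<inter> space dual_borel \<in> sets dual_borel"
    unfolding sets_dual_borel by (auto intro: sigma_sets.Basic)
qed

lemma eval_measurable: "x \<in> Lambda N \<Longrightarrow> (\<lambda>\<xi>. \<xi> x) \<in> borel_measurable dual_borel"
  by (rule continuous_dual_measurable[OF continuous_map_dual_eval])

lemma seq_of_measurable: "(\<lambda>\<xi>. seq_of N \<xi> k) \<in> borel_measurable dual_borel"
  unfolding seq_of_def by (rule eval_measurable) simp

text \<open>
  One coordinate suffices, because each coordinate is a function of any later one. Closed bases make
  indicators limits of continuous functions.
\<close>

definition cylinders :: "(real \<Rightarrow> complex) set set" where
  "cylinders = {{\<xi> \<in> K. seq_of N \<xi> k \<in> B} | k B. closed B}"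

lemma Int_stable_cylinders: "Int_stable cylinders"
proof (rule Int_stableI)
  have main: "{\<xi> \<in> K. seq_of N \<xi> k \<in> B} \<inter> {\<xi> \<in> K. seq_of N \<xi> l \<in> B'} \<in> cylinders"
    if "k \<le> l" "closed B" "closed B'" for k l and B B' :: "complex set"
  proof -
    define p where "p = (\<lambda>z::complex. z ^ (N ^ (l - k)))"
    have "continuous_on UNIV p" unfolding p_def by (intro continuous_intros)
    then have p: "closed (p -` B)" by (rule closed_vimage[OF that(2)])
    have "seq_of N \<xi> k = p (seq_of N \<xi> l)" if "\<xi> \<in> K" for \<xi>
      using solenoid_power[OF seq_of_solenoid[OF that], of k "l - k"] \<open>k \<le> l\<close> by (simp add: p_def)
    then have "{\<xi> \<in> K. seq_of N \<xi> k \<in> B} \<inter> {\<xi> \<in> K. seq_of N \<xi> l \<in> B'} = {\<xi> \<in> K. seq_of N \<xi> l \<in> p -` B \<inter> B'}"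
      by auto
    moreover have "closed (p -` B \<inter> B')" using p that(3) by (rule closed_Int)
    ultimately show ?thesis unfolding cylinders_def by blast
  qed
  fix a b assume "a \<in> cylinders" "b \<in> cylinders"
  then obtain k B l B' where ab: "a = {\<xi> \<in> K. seq_of N \<xi> k \<in> B}" "b = {\<xi> \<in> K. seq_of N \<xi> l \<in> B'}"
    and BB: "closed B" "closed B'" unfolding cylinders_def by blast
  show "a \<inter> b \<in> cylinders"
    unfolding ab using main[of k l B B'] main[of l k B' B] BB by (cases "k \<le> l") (auto simp: Int_commute)
qed

lemma cylinders_subset: "cylinders \<subseteq> Pow K" by (auto simp: cylinders_def)

lemma K_cylinder: "K \<in> cylinders"
  unfolding cylinders_def by (intro CollectI exI[of _ 0] exI[of _ UNIV]) auto

lemma sets_dual_borel_cylinders: "sets dual_borel = sigma_sets K cylinders"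
proof
  have "seq_of N \<in> sigma K cylinders \<rightarrow>\<^sub>M PiM UNIV (\<lambda>_. borel)"
  proof (rule measurable_PiM_single'[of UNIV "\<lambda>k \<xi>. seq_of N \<xi> k", simplified])
    fix k show "(\<lambda>\<xi>. seq_of N \<xi> k) \<in> sigma K cylinders \<rightarrow>\<^sub>M borel"
      unfolding borel_eq_closed
    proof (rule measurable_measure_of)
      fix B :: "complex set" assume "B \<in> Collect closed"
      then have "{\<xi> \<in> K. seq_of N \<xi> k \<in> B} \<in> cylinders" by (auto simp: cylinders_def)
      moreover have "(\<lambda>\<xi>. seq_of N \<xi> k) -` B \<inter> space (sigma K cylinders) = {\<xi> \<in> K. seq_of N \<xi> k \<in> B}"
        using cylinders_subset by (auto simp: space_measure_of)
      ultimately show "(\<lambda>\<xi>. seq_of N \<xi> k) -` B \<inter> space (sigma K cylinders) \<in> sets (sigma K cylinders)"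
        using cylinders_subset by (auto simp: sets_measure_of intro: sigma_sets.Basic)
    qed auto
  qed (auto simp: PiE_UNIV_domain)
  then have m: "seq_of N \<in> sigma K cylinders \<rightarrow>\<^sub>M borel"
    by (subst (asm) measurable_cong_sets[OF refl sets_PiM_equal_borel])
  show "sets dual_borel \<subseteq> sigma_sets K cylinders"
    unfolding sets_dual_borel
  proof (rule sigma_sets_mono, rule subsetI)
    fix V assume "V \<in> {V. openin (dual_topology N) V}"
    then obtain W where W: "open W" "V = {\<xi> \<in> K. seq_of N \<xi> \<in> W}" using openin_dual_iff by auto
    have "seq_of N -` W \<inter> space (sigma K cylinders) \<in> sets (sigma K cylinders)"
      by (rule measurable_sets[OF m]) (simp add: W)
    moreover have "seq_of N -` W \<inter> space (sigma K cylinders) = V"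
      using W cylinders_subset by (auto simp: space_measure_of)
    ultimately show "V \<in> sigma_sets K cylinders" using cylinders_subset by (simp add: sets_measure_of)
  qed
  have "cylinders \<subseteq> sets dual_borel"
  proof
    fix a assume "a \<in> cylinders"
    then obtain k B where "a = {\<xi> \<in> K. seq_of N \<xi> k \<in> B}" "closed B" by (auto simp: cylinders_def)
    then show "a \<in> sets dual_borel"
      using measurable_sets[OF seq_of_measurable, of B k] by (simp add: vimage_def Int_def conj_commute)
  qed
  then show "sigma_sets K cylinders \<subseteq> sets dual_borel"
    using sets.sigma_sets_subset[of cylinders dual_borel] by simp
qed

lemma seq_of_measurable' [measurable]: "sets \<nu> = sets dual_borel \<Longrightarrow> (\<lambda>\<xi>. seq_of N \<xi> k) \<in> borel_measurable \<nu>"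
  using seq_of_measurable by (simp cong: measurable_cong_sets)

text \<open>
  The first \<open>k\<^sub>0\<close> coordinates are powers of later ones, so their distributions are determined as well.
\<close>

theorem dual_measure_eqI:
  assumes s1: "sets \<nu>1 = sets dual_borel" and s2: "sets \<nu>2 = sets dual_borel" and f1: "finite_measure \<nu>1"
    and eq: "\<And>k. k \<ge> k0 \<Longrightarrow> distr \<nu>1 borel (\<lambda>\<xi>. seq_of N \<xi> k) = distr \<nu>2 borel (\<lambda>\<xi>. seq_of N \<xi> k)"
  shows "\<nu>1 = \<nu>2"
proof (rule measure_eqI_generator_eq[of cylinders K])
  have sp: "space \<nu>1 = K" "space \<nu>2 = K" using sets_eq_imp_space_eq[OF s1] sets_eq_imp_space_eq[OF s2] by auto
  fix a assume "a \<in> cylinders"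
  then obtain k B where a: "a = {\<xi> \<in> K. seq_of N \<xi> k \<in> B}" "B \<in> sets borel" by (auto simp: cylinders_def)
  define p where "p = (\<lambda>z::complex. z ^ (N ^ k0))"
  have p: "p \<in> borel \<rightarrow>\<^sub>M borel" unfolding p_def by (intro borel_measurable_continuous_onI continuous_intros)
  define B' where "B' = p -` B"
  have B': "B' \<in> sets borel" using measurable_sets[OF p a(2)] by (simp add: B'_def)
  have "seq_of N \<xi> k = p (seq_of N \<xi> (k + k0))" if "\<xi> \<in> K" for \<xi>
    using solenoid_power[OF seq_of_solenoid[OF that], of k k0] by (simp add: p_def)
  then have a': "a = (\<lambda>\<xi>. seq_of N \<xi> (k + k0)) -` B' \<inter> K" by (auto simp: a B'_def)
  have "emeasure (distr \<nu>1 borel (\<lambda>\<xi>. seq_of N \<xi> (k + k0))) B' = emeasure \<nu>1 a"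
    by (subst emeasure_distr) (use seq_of_measurable' s1 B' in \<open>auto simp: a' sp\<close>)
  moreover have "emeasure (distr \<nu>2 borel (\<lambda>\<xi>. seq_of N \<xi> (k + k0))) B' = emeasure \<nu>2 a"
    by (subst emeasure_distr) (use seq_of_measurable' s2 B' in \<open>auto simp: a' sp\<close>)
  ultimately show "emeasure \<nu>1 a = emeasure \<nu>2 a" using eq[of "k + k0"] by simp
next
  show "range (\<lambda>_::nat. K) \<subseteq> cylinders" using K_cylinder by auto
  show "emeasure \<nu>1 K \<noteq> \<infinity>" using finite_measure.emeasure_finite[OF f1] by auto
qed (use s1 s2 in \<open>auto simp: Int_stable_cylinders cylinders_subset sets_dual_borel_cylinders\<close>)

text \<open>Sequences off the solenoid form a null set; they are sent to the trivial character.\<close>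

lemma dual_measure_exists:
  fixes law :: "nat \<Rightarrow> complex measure"
  assumes sets: "\<And>k. sets (law k) = sets borel" and fin: "\<And>k. finite_measure (law k)"
    and power: "\<And>k d. distr (law (k + d)) borel (\<lambda>z. z ^ (N ^ d)) = law k"
    and circle: "\<And>k. AE z in law k. z \<in> circle"
  obtains \<nu> where "sets \<nu> = sets dual_borel" "finite_measure \<nu>" 
    "\<And>k. distr \<nu> borel (\<lambda>\<xi>. seq_of N \<xi> k) = law k"
proof -
  obtain L :: "(nat \<Rightarrow> complex) measure" where L: "finite_measure L" "sets L = sets (PiM UNIV (\<lambda>_. borel))"
    "\<And>k. distr L borel (\<lambda>\<omega>. \<omega> k) = law k" "AE \<omega> in L. \<omega> \<in> solenoid N"
    by (rule solenoid_limit[OF sets fin power circle]) blast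
  have Lb: "sets L = sets borel" using L(2) sets_PiM_equal_borel by simp
  have spL: "space L = UNIV" using sets_eq_imp_space_eq[OF Lb] by simp
  have one: "(\<lambda>_. 1) \<in> solenoid N" by (simp add: solenoid_def)
  define g where "g \<omega> = dual_of N (if \<omega> \<in> solenoid N then \<omega> else (\<lambda>_. 1))" for \<omega>
  have gK: "g \<omega> \<in> K" for \<omega> using dual_of_carrier one by (simp add: g_def)
  have gs: "seq_of N (g \<omega>) = (if \<omega> \<in> solenoid N then \<omega> else (\<lambda>_. 1))" for \<omega>
    using seq_of_dual_of one by (simp add: g_def)
  have comp: "(\<lambda>\<omega>. \<omega> k) \<in> borel_measurable L" for k
    by (subst measurable_cong_sets[OF L(2) refl]) (rule measurable_component_singleton, simp)
  have sol: "solenoid N \<in> sets L"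
  proof -
    have "{\<omega> \<in> space L. \<omega> k \<in> circle \<and> \<omega> (Suc k) ^ N = \<omega> k} \<in> sets L" for k
      by (rule solenoid_step_sets[OF comp comp])
    then have "{\<omega> \<in> space L. \<forall>k. \<omega> k \<in> circle \<and> \<omega> (Suc k) ^ N = \<omega> k} \<in> sets L"
      by (rule sets.sets_Collect_countable_All)
    then show ?thesis by (simp add: solenoid_def spL)
  qed
  have g: "g \<in> L \<rightarrow>\<^sub>M dual_borel"
    unfolding dual_borel_def
  proof (rule measurable_measure_of[OF dual_opens_subset])
    show "g \<in> space L \<rightarrow> K" using gK by auto
    fix V assume "V \<in> {V. openin (dual_topology N) V}"
    then obtain W where W: "open W" "V = {\<xi> \<in> K. seq_of N \<xi> \<in> W}" using openin_dual_iff by auto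
    have "g -` V \<inter> space L = (solenoid N \<inter> W) \<union> ((space L - solenoid N) \<inter> (if (\<lambda>_. 1) \<in> W then UNIV else {}))"
      unfolding W using gK gs by (auto simp: spL split: if_splits)
    moreover have "W \<in> sets L" using W by (simp add: Lb)
    ultimately show "g -` V \<inter> space L \<in> sets L" using sol by (auto simp: spL)
  qed
  show ?thesis
  proof (rule that[of "distr L dual_borel g"])
    show "finite_measure (distr L dual_borel g)" by (rule finite_measure.finite_measure_distr[OF L(1) g])
    fix k
    have "distr (distr L dual_borel g) borel (\<lambda>\<xi>. seq_of N \<xi> k) = distr L borel (\<lambda>\<omega>. seq_of N (g \<omega>) k)"
      by (subst distr_distr[OF seq_of_measurable g]) (simp add: o_def)
    also have "\<dots> = distr L borel (\<lambda>\<omega>. \<omega> k)"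
    proof (rule distr_cong_AE)
      show "AE \<omega> in L. seq_of N (g \<omega>) k = \<omega> k" using L(4) by eventually_elim (simp add: gs)
      show "(\<lambda>\<omega>. seq_of N (g \<omega>) k) \<in> borel_measurable L" using measurable_compose[OF g seq_of_measurable] .
    qed (use comp in auto)
    finally show "distr (distr L dual_borel g) borel (\<lambda>\<xi>. seq_of N \<xi> k) = law k" using L(3) by simp
  qed simp
qed

end

section \<open>Existence and uniqueness of the filter measure\<close>

lemma indicator_closed_limit:
  fixes F :: "'x::metric_space set"
  assumes F: "closed F" "F \<noteq> {}"
  shows "(\<lambda>n. of_real (max 0 (1 - real n * infdist z F)) :: 'a::real_normed_algebra_1) \<longlonglongrightarrow> indicator F z"
proof (cases "z \<in> F")
  case True
  then have "infdist z F = 0" by (simp add: infdist_zero)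
  then show ?thesis using True by simp
next
  case z: False
  then have d: "infdist z F > 0" using in_closed_iff_infdist_zero[OF F, of z] infdist_nonneg[of z F] by (simp add: less_le)
  obtain n0 :: nat where n0: "1 / infdist z F < real n0" using reals_Archimedean2 by blast
  have "max 0 (1 - real n * infdist z F) = 0" if "n \<ge> n0" for n
  proof -
    have "1 / infdist z F \<le> real n" using n0 that by linarith
    then show ?thesis using d by (simp add: field_simps)
  qed
  then have "\<forall>\<^sub>F n in sequentially. of_real (max 0 (1 - real n * infdist z F)) = (indicator F z :: 'a)"
    using z by (auto simp: eventually_sequentially intro!: exI[of _ n0])
  then show ?thesis by (rule tendsto_eventually)
qed

text \<open>
  The indicator of a nonempty closed set \<open>F\<close> is the limit of the functions \<open>max 0 (1 - n d(z, F))\<close>.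
\<close>

lemma finite_measure_eqI_continuous:
  fixes M1 M2 :: "complex measure"
  assumes s: "sets M1 = sets borel" "sets M2 = sets borel" and f: "finite_measure M1" "finite_measure M2"
    and eq: "\<And>g :: complex \<Rightarrow> real. continuous_on UNIV g \<Longrightarrow> (\<And>z. 0 \<le> g z \<and> g z \<le> 1) \<Longrightarrow> (\<integral>z. g z \<partial>M1) = (\<integral>z. g z \<partial>M2)"
  shows "M1 = M2"
proof (rule measure_eqI_generator_eq[of "Collect closed" UNIV])
  fix F :: "complex set" assume "F \<in> Collect closed"
  then have F: "closed F" by simp
  show "emeasure M1 F = emeasure M2 F"
  proof (cases "F = {}")
    case False
    define g where "g n z = max 0 (1 - real n * infdist z F)" for n z
    have gc: "continuous_on UNIV (g n)" for n
      unfolding g_def[abs_def] by (intro continuous_intros)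
    have g01: "0 \<le> g n z \<and> g n z \<le> 1" for n z
      by (simp add: g_def infdist_nonneg)
    have conv: "(\<lambda>n. \<integral>z. g n z \<partial>M) \<longlonglongrightarrow> measure M F" if M: "sets M = sets borel" "finite_measure M" for M
    proof -
      have "(\<lambda>n. \<integral>z. g n z \<partial>M) \<longlonglongrightarrow> (\<integral>z. indicator F z \<partial>M)"
      proof (rule integral_dominated_convergence[where w="\<lambda>_. 1"])
        show "g n \<in> borel_measurable M" for n
          using borel_measurable_continuous_onI[OF gc] M(1) by (simp cong: measurable_cong_sets)
        show "(indicator F :: complex \<Rightarrow> real) \<in> borel_measurable M"
          by (rule borel_measurable_indicator) (use M(1) F in simp)
        show "integrable M (\<lambda>_. 1::real)" using finite_measure.integrable_const[OF M(2)] .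
        show "AE z in M. (\<lambda>n. g n z) \<longlonglongrightarrow> indicator F z"
        proof (rule AE_I2)
          fix z
          show "(\<lambda>n. g n z) \<longlonglongrightarrow> indicator F z"
            unfolding g_def using indicator_closed_limit[OF F False, where 'a = real] by simp
        qed
        show "AE z in M. norm (g n z) \<le> 1" for n using g01[of n] by auto
      qed
      moreover have "F \<in> sets M" using F M(1) by auto
      ultimately show ?thesis using sets.sets_into_space[of F M] by (simp add: Int_absorb2)
    qed
    have "(\<lambda>n. \<integral>z. g n z \<partial>M1) \<longlonglongrightarrow> measure M2 F"
      using conv[OF s(2) f(2)] eq[OF gc g01] by simp
    then have "measure M1 F = measure M2 F" using conv[OF s(1) f(1)] LIMSEQ_unique by blast
    then show ?thesis using finite_measure.emeasure_eq_measure[OF f(1)] finite_measure.emeasure_eq_measure[OF f(2)] by simp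
  qed simp
next
  show "Int_stable (Collect closed :: complex set set)" by (auto simp: Int_stable_def)
  have "sets (borel :: complex measure) = sigma_sets UNIV (Collect closed)"
    unfolding borel_eq_closed by (rule sets_measure_of) simp
  then show "sets M1 = sigma_sets UNIV (Collect closed)" "sets M2 = sigma_sets UNIV (Collect closed)" using s by auto
  show "range (\<lambda>_::nat. UNIV) \<subseteq> Collect (closed :: complex set \<Rightarrow> bool)" by auto
  show "emeasure M1 UNIV \<noteq> \<infinity>" using finite_measure.emeasure_finite[OF f(1)] by auto
qed auto

locale filter_algebra = universal_algebra N A \<iota> U + filter_pair N m0 h
  for N :: nat and A :: "'a cstar" (structure) and \<iota> U m0 h
begin

lemma circle_extend_measurable:
  assumes f: "f \<in> CT" shows "(\<lambda>z. indicator circle z *\<^sub>R f z) \<in> borel_measurable borel"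
  by (rule borel_measurable_continuous_on_indicator[OF _ continuous_circleD[OF f]]) simp

lemma law_integral_circle:
  assumes f: "f \<in> CT" 
  shows "(\<integral>z. indicator circle z *\<^sub>R f z \<partial>law k) = (\<integral>z. (R ^^ k) (\<lambda>w. f w * of_real (h w)) z \<partial>\<mu>)"
  unfolding filter_integral[OF f] law_integral[OF circle_extend_measurable[OF f]]
  by (rule Bochner_Integration.integral_cong) auto

lemma as_function_integral:
  assumes s: "sets \<nu> = sets dual_borel" and f: "f \<in> CT"
  shows "(\<integral>\<xi>. as_function N A \<iota> U (\<rho> k f) \<xi> \<partial>\<nu>) = (\<integral>z. indicator circle z *\<^sub>R f z \<partial>distr \<nu> borel (\<lambda>\<xi>. seq_of N \<xi> k))"
proof -
  have sp: "space \<nu> = K" using sets_eq_imp_space_eq[OF s] by simp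
  have "(\<integral>z. indicator circle z *\<^sub>R f z \<partial>distr \<nu> borel (\<lambda>\<xi>. seq_of N \<xi> k)) = (\<integral>\<xi>. indicator circle (seq_of N \<xi> k) *\<^sub>R f (seq_of N \<xi> k) \<partial>\<nu>)"
    by (rule integral_distr[OF seq_of_measurable'[OF s] circle_extend_measurable[OF f]])
  also have "\<dots> = (\<integral>\<xi>. as_function N A \<iota> U (\<rho> k f) \<xi> \<partial>\<nu>)"
    using solenoid_circle(1)[OF seq_of_solenoid] f
    by (intro Bochner_Integration.integral_cong) (auto simp: sp as_function_value)
  finally show ?thesis by simp
qed

text \<open>
  At level \<open>k\<close> the transform of \<open>U\<^sup>-\<^sup>k f U\<^sup>k\<close> is \<open>f\<close> at the coordinate \<open>\<xi>(N\<^sup>-\<^sup>k)\<close>, and the right-hand side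
  of the defining identity is the integral of \<open>f\<close> against \<open>law k\<close>. Continuous functions determine a
  finite measure on the plane, so the identities say precisely that the coordinates have these
  distributions.
\<close>

theorem filter_measure_iff:
  "filter_measure N A \<iota> U m0 h \<nu> \<longleftrightarrow>
    sets \<nu> = sets dual_borel \<and> finite_measure \<nu> \<and> (\<forall>k. distr \<nu> borel (\<lambda>\<xi>. seq_of N \<xi> k) = law k)"
proof
  assume *: "sets \<nu> = sets dual_borel \<and> finite_measure \<nu> \<and> (\<forall>k. distr \<nu> borel (\<lambda>\<xi>. seq_of N \<xi> k) = law k)"
  then show "filter_measure N A \<iota> U m0 h \<nu>"
    unfolding filter_measure_def finite_borel_measure_iff
    by (auto simp: as_function_integral law_integral_circle)
next
  assume fm: "filter_measure N A \<iota> U m0 h \<nu>"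
  then have s: "sets \<nu> = sets dual_borel" and fin: "finite_measure \<nu>"
    by (auto simp: filter_measure_def finite_borel_measure_iff)
  interpret finite_measure \<nu> by (rule fin)
  have sp: "space \<nu> = K" using sets_eq_imp_space_eq[OF s] by simp
  have "distr \<nu> borel (\<lambda>\<xi>. seq_of N \<xi> k) = law k" for k
  proof (rule finite_measure_eqI_continuous)
    show "finite_measure (distr \<nu> borel (\<lambda>\<xi>. seq_of N \<xi> k))" by (rule finite_measure_distr[OF seq_of_measurable'[OF s]])
    show "finite_measure (law k)" by (rule finite_measure_law)
    fix g :: "complex \<Rightarrow> real" assume g: "continuous_on UNIV g"
    define f where "f = (\<lambda>z\<in>circle. of_real (g z) :: complex)"
    have f: "f \<in> CT" unfolding f_def
      by (intro restrict_continuous_circle continuous_on_of_real continuous_on_subset[OF g]) simp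
    have ae1: "AE z in distr \<nu> borel (\<lambda>\<xi>. seq_of N \<xi> k). z \<in> circle"
      by (subst AE_distr_iff[OF seq_of_measurable'[OF s]])
        (use solenoid_circle(1)[OF seq_of_solenoid] in \<open>auto simp: sp\<close>)
    have ae2: "AE z in law k. z \<in> circle" using AE_law[of "\<lambda>_. True" k] by simp
    have re: "(\<integral>z. indicator circle z *\<^sub>R f z \<partial>M) = of_real (\<integral>z. g z \<partial>M)"
      if ae: "AE z in M. z \<in> circle" and M: "sets M = sets borel" for M
    proof -
      have "(\<integral>z. indicator circle z *\<^sub>R f z \<partial>M) = (\<integral>z. of_real (g z) \<partial>M)"
      proof (rule integral_cong_AE)
        show "(\<lambda>z. indicator circle z *\<^sub>R f z) \<in> borel_measurable M"
          using circle_extend_measurable[OF f] M by (simp cong: measurable_cong_sets)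
        show "(\<lambda>z. of_real (g z) :: complex) \<in> borel_measurable M"
          using borel_measurable_continuous_onI[OF continuous_on_of_real[OF g]] M by (simp cong: measurable_cong_sets)
        show "AE z in M. indicator circle z *\<^sub>R f z = of_real (g z)" using ae by eventually_elim (simp add: f_def)
      qed
      then show ?thesis by simp
    qed
    have "(\<integral>z. indicator circle z *\<^sub>R f z \<partial>distr \<nu> borel (\<lambda>\<xi>. seq_of N \<xi> k)) = (\<integral>z. indicator circle z *\<^sub>R f z \<partial>law k)"
      unfolding as_function_integral[OF s f, symmetric] law_integral_circle[OF f] using fm f
      unfolding filter_measure_def by blast
    then show "(\<integral>z. g z \<partial>distr \<nu> borel (\<lambda>\<xi>. seq_of N \<xi> k)) = (\<integral>z. g z \<partial>law k)"
      using re[OF ae1] re[OF ae2] by simp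
  qed simp_all
  then show "sets \<nu> = sets dual_borel \<and> finite_measure \<nu> \<and> (\<forall>k. distr \<nu> borel (\<lambda>\<xi>. seq_of N \<xi> k) = law k)"
    using s fin by simp
qed

theorem filter_measure_unique_exists: "\<exists>!\<nu>. filter_measure N A \<iota> U m0 h \<nu>"
proof -
  have ae: "AE z in law k. z \<in> circle" for k using AE_law[of "\<lambda>_. True" k] by simp
  obtain \<nu> where "sets \<nu> = sets dual_borel" "finite_measure \<nu>" "\<And>k. distr \<nu> borel (\<lambda>\<xi>. seq_of N \<xi> k) = law k"
    by (rule dual_measure_exists[of law, OF sets_law finite_measure_law law_add ae]) blast
  then show ?thesis
    unfolding filter_measure_iff by (intro ex1I[of _ \<nu>]) (auto intro!: dual_measure_eqI[of _ _ 0])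
qed

end

section \<open>Closures and unitaries in Hilbert spaces\<close>

lemma linear_subspace_add: "linear_subspace H M \<Longrightarrow> x \<in> M \<Longrightarrow> y \<in> M \<Longrightarrow> x \<oplus>\<^bsub>H\<^esub> y \<in> M"
  by (simp add: linear_subspace_def)

lemma linear_subspace_smult: "linear_subspace H M \<Longrightarrow> x \<in> M \<Longrightarrow> c \<odot>\<^bsub>H\<^esub> x \<in> M"
  by (simp add: linear_subspace_def)

context hilbert_space
begin

definition closure_of_set :: "'h set \<Rightarrow> 'h set" where
  "closure_of_set M = {x \<in> carrier H. \<forall>\<epsilon>>0. \<exists>y\<in>M. hnorm H (x \<ominus> y) < \<epsilon>}"

lemma closure_of_set_superset: "M \<subseteq> carrier H \<Longrightarrow> M \<subseteq> closure_of_set M"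
proof
  fix x assume M: "M \<subseteq> carrier H" and x: "x \<in> M"
  then have xH: "x \<in> carrier H" by (rule subsetD)
  have "hnorm H (x \<ominus> x) = 0" using xH by (simp add: hnorm_def inner_simps)
  then have "\<forall>\<epsilon>>0. \<exists>y\<in>M. hnorm H (x \<ominus> y) < \<epsilon>" using x by (intro allI impI bexI[of _ x]) simp_all
  then show "x \<in> closure_of_set M" unfolding closure_of_set_def using xH by (intro CollectI conjI)
qed

lemma smult_minus:
  assumes "a \<in> carrier H" "b \<in> carrier H" shows "c \<odot> a \<ominus> c \<odot> b = c \<odot> (a \<ominus> b)"
  by (rule eq_if_inner_eq) (use assms in \<open>auto simp: inner_simps algebra_simps\<close>)

lemma closure_of_set_closed:
  assumes M: "M \<subseteq> carrier H" and Y: "\<And>n::nat. Y n \<in> closure_of_set M" and x: "x \<in> carrier H"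
    and lim: "(\<lambda>n. hnorm H (Y n \<ominus> x)) \<longlonglongrightarrow> 0"
  shows "x \<in> closure_of_set M"
  unfolding closure_of_set_def
proof (intro CollectI conjI x allI impI)
  fix e :: real assume e: "e > 0"
  obtain n where n: "hnorm H (Y n \<ominus> x) < e / 2"
    using order_tendstoD(2)[OF lim, of "e / 2"] e by (auto simp: eventually_sequentially)
  have YH: "Y n \<in> carrier H" using Y by (simp add: closure_of_set_def)
  have "e / 2 > 0" using e by simp
  then obtain y where y: "y \<in> M" "hnorm H (Y n \<ominus> y) < e / 2"
    using Y[of n] unfolding closure_of_set_def by blast
  have "hnorm H (x \<ominus> y) < e"
    using hnorm_minus_triangle[of x "Y n" y] hnorm_minus_commute[of x "Y n"] n y YH x M by auto
  then show "\<exists>y\<in>M. hnorm H (x \<ominus> y) < e" using y by blast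
qed

lemma closure_of_set_add:
  assumes M: "linear_subspace H M" and x: "x \<in> closure_of_set M" and y: "y \<in> closure_of_set M"
  shows "x \<oplus> y \<in> closure_of_set M"
  unfolding closure_of_set_def
proof (intro CollectI conjI allI impI)
  have xy: "x \<in> carrier H" "y \<in> carrier H" using x y by (auto simp: closure_of_set_def)
  show "x \<oplus> y \<in> carrier H" using xy by simp
  fix e :: real assume "e > 0"
  then have e: "e / 2 > 0" by simp
  obtain a where a: "a \<in> M" "hnorm H (x \<ominus> a) < e / 2" using x e unfolding closure_of_set_def by blast
  obtain b where b: "b \<in> M" "hnorm H (y \<ominus> b) < e / 2" using y e unfolding closure_of_set_def by blast
  have ab: "a \<in> carrier H" "b \<in> carrier H" "a \<oplus> b \<in> M" using M a b by (auto simp: linear_subspace_def)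
  have "hnorm H ((x \<oplus> y) \<ominus> (a \<oplus> b)) \<le> hnorm H (x \<ominus> a) + hnorm H (y \<ominus> b)"
    using xy ab by (simp add: add_minus_add hnorm_triangle)
  then show "\<exists>z\<in>M. hnorm H (x \<oplus> y \<ominus> z) < e" using a b ab by (intro bexI[of _ "a \<oplus> b"]) auto
qed

lemma closure_of_set_smult:
  assumes M: "linear_subspace H M" and x: "x \<in> closure_of_set M"
  shows "c \<odot> x \<in> closure_of_set M"
  unfolding closure_of_set_def
proof (intro CollectI conjI allI impI)
  have xH: "x \<in> carrier H" using x by (auto simp: closure_of_set_def)
  show "c \<odot> x \<in> carrier H" using xH by simp
  fix e :: real assume e: "e > 0"
  have p: "cmod c + 1 > 0" using norm_ge_zero[of c] by linarith
  then have "e / (cmod c + 1) > 0" using e by simp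
  then obtain a where a: "a \<in> M" "hnorm H (x \<ominus> a) < e / (cmod c + 1)" using x unfolding closure_of_set_def by blast
  have aM: "a \<in> carrier H" "c \<odot> a \<in> M" using M a by (auto simp: linear_subspace_def)
  have "hnorm H (c \<odot> x \<ominus> c \<odot> a) = cmod c * hnorm H (x \<ominus> a)" using xH aM by (simp add: smult_minus hnorm_smult)
  also have "\<dots> \<le> (cmod c + 1) * hnorm H (x \<ominus> a)" using xH aM by (intro mult_right_mono) auto
  also have "\<dots> < e" using a p by (simp add: field_simps)
  finally show "\<exists>z\<in>M. hnorm H (c \<odot> x \<ominus> z) < e" using aM by blast
qed

lemma linear_span_subspace: "S \<subseteq> carrier H \<Longrightarrow> linear_subspace H (linear_span H S)"
  unfolding linear_subspace_def linear_span_def by (auto simp: subset_iff)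

lemma linear_span_superset: "S \<subseteq> linear_span H S"
  by (auto simp: linear_span_def)

lemma dense_in_iff: "M \<subseteq> carrier H \<Longrightarrow> dense_in H M \<longleftrightarrow> closure_of_set M = carrier H"
  by (auto simp: dense_in_def closure_of_set_def)

lemma dense_sequence:
  assumes u: "u \<in> J \<rightarrow> carrier H" and d: "dense_in H (u ` J)" and x: "x \<in> carrier H"
  obtains i where "\<And>n::nat. i n \<in> J" "(\<lambda>n. hnorm H (u (i n) \<ominus> x)) \<longlonglongrightarrow> 0"
proof -
  have "\<exists>j\<in>J. hnorm H (x \<ominus> u j) < 1 / real (Suc n)" for n
  proof -
    have "1 / real (Suc n) > 0" by simp
    then obtain y where "y \<in> u ` J" "hnorm H (x \<ominus> y) < 1 / real (Suc n)"
      using d x unfolding dense_in_def by blast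
    then show ?thesis by blast
  qed
  then obtain i where i: "\<And>n. i n \<in> J" "\<And>n. hnorm H (x \<ominus> u (i n)) < 1 / real (Suc n)" by metis
  have ui: "u (i n) \<in> carrier H" for n using u i by auto
  have "(\<lambda>n. hnorm H (u (i n) \<ominus> x)) \<longlonglongrightarrow> 0"
  proof (rule tendsto_sandwich[OF _ _ tendsto_const LIMSEQ_inverse_real_of_nat])
    show "\<forall>\<^sub>F n in sequentially. 0 \<le> hnorm H (u (i n) \<ominus> x)" using ui x by simp
    show "\<forall>\<^sub>F n in sequentially. hnorm H (u (i n) \<ominus> x) \<le> inverse (real (Suc n))"
    proof (rule always_eventually, rule allI)
      fix n show "hnorm H (u (i n) \<ominus> x) \<le> inverse (real (Suc n))"
        using i(2)[of n] hnorm_minus_commute[OF ui x, of n] by (simp add: inverse_eq_divide)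
    qed
  qed
  then show ?thesis using that i by blast
qed

end

text \<open>
  Two families with dense ranges and equal Gram matrices, \<open>u\<close> in \<open>H\<close> and \<open>v\<close> in \<open>G\<close>, are carried to each
  other by a unitary operator. It sends \<open>x\<close> to the vector \<open>y\<close> whose inner products with \<open>v\<close> are those of
  \<open>x\<close> with \<open>u\<close>; this relation makes linearity immediate.
\<close>

locale gram_family = H: hilbert_space H + G: hilbert_space G
  for H :: "'h hilbert" and G :: "'g hilbert" +
  fixes J :: "'j set" and u :: "'j \<Rightarrow> 'h" and v :: "'j \<Rightarrow> 'g"
  assumes u: "u \<in> J \<rightarrow> carrier H" and v: "v \<in> J \<rightarrow> carrier G"
    and dense_u: "dense_in H (u ` J)" and dense_v: "dense_in G (v ` J)"
    and gram: "\<And>i j. i \<in> J \<Longrightarrow> j \<in> J \<Longrightarrow> hinner H (u i) (u j) = hinner G (v i) (v j)"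
begin

definition matches :: "'h \<Rightarrow> 'g \<Rightarrow> bool" where
  "matches x y \<longleftrightarrow> x \<in> carrier H \<and> y \<in> carrier G \<and> (\<forall>j\<in>J. hinner G (v j) y = hinner H (u j) x)"

lemma matches_unique: "matches x y \<Longrightarrow> matches x y' \<Longrightarrow> y = y'"
  using v by (intro G.eq_if_inner_dense_eq[OF _ _ dense_v]) (auto simp: matches_def)

text \<open>
  Vectors of the family that approximate \<open>x\<close> have the same mutual distances on both sides, so their
  partners converge, and all inner products with the limit are limits of equal numbers.
\<close>

lemma matches_exists:
  assumes x: "x \<in> carrier H"
  shows "\<exists>y. matches x y \<and> (\<forall>x' y'. matches x' y' \<longrightarrow> hinner G y y' = hinner H x x')"
proof -
  obtain i where i: "\<And>n::nat. i n \<in> J" "(\<lambda>n. hnorm H (u (i n) \<ominus>\<^bsub>H\<^esub> x)) \<longlonglongrightarrow> 0"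
    using H.dense_sequence[OF u dense_u x] by metis
  have ui: "u (i n) \<in> carrier H" and vi: "v (i n) \<in> carrier G" for n using u v i by auto
  have dist: "hnorm G (v (i m) \<ominus>\<^bsub>G\<^esub> v (i n)) = hnorm H (u (i m) \<ominus>\<^bsub>H\<^esub> u (i n))" for m n
    using ui vi i by (simp add: hnorm_def H.inner_simps G.inner_simps gram)
  have "\<forall>\<epsilon>>0. \<exists>M. \<forall>m\<ge>M. \<forall>n\<ge>M. hnorm G (v (i m) \<ominus>\<^bsub>G\<^esub> v (i n)) < \<epsilon>"
  proof (intro allI impI)
    fix e :: real assume e: "e > 0"
    then obtain M where M: "\<And>n. n \<ge> M \<Longrightarrow> hnorm H (u (i n) \<ominus>\<^bsub>H\<^esub> x) < e / 2"
      using order_tendstoD(2)[OF i(2), of "e / 2"] by (auto simp: eventually_sequentially)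
    have "hnorm H (u (i m) \<ominus>\<^bsub>H\<^esub> u (i n)) < e" if "m \<ge> M" "n \<ge> M" for m n
      using H.hnorm_minus_triangle[OF ui x ui, of m n] H.hnorm_minus_commute[OF x ui, of n] M[OF that(1)] M[OF that(2)] by simp
    then show "\<exists>M. \<forall>m\<ge>M. \<forall>n\<ge>M. hnorm G (v (i m) \<ominus>\<^bsub>G\<^esub> v (i n)) < e" unfolding dist by blast
  qed
  from G.complete[OF vi this] obtain y where y: "y \<in> carrier G" "(\<lambda>n. hnorm G (v (i n) \<ominus>\<^bsub>G\<^esub> y)) \<longlonglongrightarrow> 0" by blast
  have "hinner G (v j) y = hinner H (u j) x" if j: "j \<in> J" for j
  proof (rule LIMSEQ_unique)
    have uj: "u j \<in> carrier H" and vj: "v j \<in> carrier G" using u v j by auto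
    show "(\<lambda>n. hinner G (v j) (v (i n))) \<longlonglongrightarrow> hinner G (v j) y" by (rule G.hlim_inner_right[OF vi y(1) vj y(2)])
    show "(\<lambda>n. hinner G (v j) (v (i n))) \<longlonglongrightarrow> hinner H (u j) x"
      using H.hlim_inner_right[OF ui x uj i(2)] gram[OF j i(1)] by simp
  qed
  then have "matches x y" using x y by (simp add: matches_def)
  moreover have "hinner G y y' = hinner H x x'" if "matches x' y'" for x' y'
  proof (rule LIMSEQ_unique)
    have x': "x' \<in> carrier H" and y': "y' \<in> carrier G" using that by (auto simp: matches_def)
    show "(\<lambda>n. hinner G (v (i n)) y') \<longlonglongrightarrow> hinner G y y'" by (rule G.hlim_inner[OF vi y(1) y' y(2)])
    show "(\<lambda>n. hinner G (v (i n)) y') \<longlonglongrightarrow> hinner H x x'"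
      using H.hlim_inner[OF ui x x' i(2)] that i(1) by (simp add: matches_def)
  qed
  ultimately show ?thesis by blast
qed

lemma gram_family_sym: "gram_family G H J v u"
  using u v dense_u dense_v gram H.hilbert_space_axioms G.hilbert_space_axioms
  by (simp add: gram_family_def gram_family_axioms_def)

theorem unitary_exists: "\<exists>T. unitary_op H G T \<and> (\<forall>x\<in>carrier H. matches x (T x))"
proof -
  define T where "T x = (SOME y. matches x y \<and> (\<forall>x' y'. matches x' y' \<longrightarrow> hinner G y y' = hinner H x x'))" for x
  have T: "matches x (T x)" "\<And>x' y'. matches x' y' \<Longrightarrow> hinner G (T x) y' = hinner H x x'" if "x \<in> carrier H" for x
    using someI_ex[OF matches_exists[OF that]] unfolding T_def by blast+
  have TG: "T x \<in> carrier G" if "x \<in> carrier H" for x using T(1)[OF that] by (simp add: matches_def)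
  have Tu: "T x = y" if "matches x y" for x y
    using matches_unique[OF T(1) that] that by (simp add: matches_def)
  have ujv: "u j \<in> carrier H" "v j \<in> carrier G" if "j \<in> J" for j using u v that by auto
  have lin: "linear_op H G T"
    unfolding linear_op_def
  proof (intro conjI ballI allI)
    fix x y assume x: "x \<in> carrier H" and y: "y \<in> carrier H"
    show "T (x \<oplus>\<^bsub>H\<^esub> y) = T x \<oplus>\<^bsub>G\<^esub> T y"
      using T(1)[OF x] T(1)[OF y] ujv by (intro Tu) (auto simp: matches_def H.inner_add G.inner_add)
  next
    fix c x assume x: "x \<in> carrier H"
    show "T (c \<odot>\<^bsub>H\<^esub> x) = c \<odot>\<^bsub>G\<^esub> T x"
      using T(1)[OF x] ujv by (intro Tu) (auto simp: matches_def H.inner_smult G.inner_smult)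
  qed (use TG in auto)
  have iso: "hinner G (T x) (T y) = hinner H x y" if "x \<in> carrier H" "y \<in> carrier H" for x y
    using T(2)[OF that(1) T(1)[OF that(2)]] .
  have "bij_betw T (carrier H) (carrier G)"
    unfolding bij_betw_def
  proof
    show "inj_on T (carrier H)"
    proof (rule inj_onI)
      fix x y assume xy: "x \<in> carrier H" "y \<in> carrier H" "T x = T y"
      show "x = y"
        by (rule H.eq_if_inner_dense_eq[OF xy(1,2) dense_u])
          (use T(1)[OF xy(1)] T(1)[OF xy(2)] xy u in \<open>auto simp: matches_def\<close>)
    qed
    show "T ` carrier H = carrier G"
    proof (intro equalityI subsetI)
      fix y assume y: "y \<in> carrier G"
      interpret S: gram_family G H J v u by (rule gram_family_sym)
      obtain x where "S.matches y x" using S.matches_exists[OF y] by blast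
      then have "matches x y" by (auto simp: matches_def S.matches_def)
      then show "y \<in> T ` carrier H" using Tu by (auto simp: matches_def)
    qed (use TG in auto)
  qed
  then have "unitary_op H G T" using lin iso by (simp add: unitary_op_def)
  then show ?thesis using T(1) by blast
qed

end

section \<open>Characters span the square integrable functions\<close>

lemma L2_dominated_limit:
  assumes f: "\<And>n. f n \<in> borel_measurable M" "g \<in> borel_measurable M" and w: "w \<in> borel_measurable M" "integrable M (\<lambda>x. (w x)\<^sup>2)"
    and lim: "AE x in M. (\<lambda>n. f n x) \<longlonglongrightarrow> g x" and b: "\<And>n. AE x in M. cmod (f n x) \<le> w x" "AE x in M. cmod (g x) \<le> w x"
  shows "f n \<in> L2_functions M" "g \<in> L2_functions M"
    "(\<lambda>n. hnorm (L2_space M) (L2_class M (f n) \<ominus>\<^bsub>L2_space M\<^esub> L2_class M g)) \<longlonglongrightarrow> 0"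
proof -
  have L2: "u \<in> L2_functions M" if "u \<in> borel_measurable M" "AE x in M. cmod (u x) \<le> w x" for u
  proof -
    have "integrable M (\<lambda>x. (cmod (u x))\<^sup>2)"
    proof (rule Bochner_Integration.integrable_bound[OF w(2)])
      show "AE x in M. norm ((cmod (u x))\<^sup>2) \<le> norm ((w x)\<^sup>2)"
        using that(2) by eventually_elim (simp add: power_mono)
    qed (use that in measurable)
    then show ?thesis using that by (simp add: L2_functions_def)
  qed
  show fL: "f n \<in> L2_functions M" and gL: "g \<in> L2_functions M" for n using L2 f b by auto
  have "(\<lambda>n. \<integral>x. (cmod (f n x - g x))\<^sup>2 \<partial>M) \<longlonglongrightarrow> (\<integral>x. 0 \<partial>M)"
  proof (rule integral_dominated_convergence[where w="\<lambda>x. 4 * (w x)\<^sup>2"])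
    show "integrable M (\<lambda>x. 4 * (w x)\<^sup>2)" using w by simp
    show "AE x in M. (\<lambda>n. (cmod (f n x - g x))\<^sup>2) \<longlonglongrightarrow> 0"
      using lim
    proof eventually_elim
      case (elim x)
      then have "(\<lambda>n. (cmod (f n x - g x))\<^sup>2) \<longlonglongrightarrow> (cmod (g x - g x))\<^sup>2" by (intro tendsto_intros)
      then show ?case by simp
    qed
    show "AE x in M. norm ((cmod (f n x - g x))\<^sup>2) \<le> 4 * (w x)\<^sup>2" for n
      using b(1)[of n] b(2)
    proof eventually_elim
      case (elim x)
      then have "cmod (f n x - g x) \<le> 2 * w x" using norm_triangle_ineq4[of "f n x" "g x"] by linarith
      then have "(cmod (f n x - g x))\<^sup>2 \<le> (2 * w x)\<^sup>2" by (intro power_mono) auto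
      then show ?case by (simp add: power_mult_distrib)
    qed
  qed (use f in measurable)
  then have "(\<lambda>n. sqrt (\<integral>x. (cmod (f n x - g x))\<^sup>2 \<partial>M)) \<longlonglongrightarrow> 0"
    using tendsto_real_sqrt by fastforce
  then show "(\<lambda>n. hnorm (L2_space M) (L2_class M (f n) \<ominus>\<^bsub>L2_space M\<^esub> L2_class M g)) \<longlonglongrightarrow> 0"
    using fL gL by (simp add: L2_space_minus L2_space_hnorm L2_diff)
qed

lemma (in finite_measure) L2_bounded:
  assumes "f \<in> borel_measurable M" "\<And>x. x \<in> space M \<Longrightarrow> cmod (f x) \<le> C"
  shows "f \<in> L2_functions M"
proof -
  have "integrable M (\<lambda>x. (cmod (f x))\<^sup>2)"
    by (rule integrable_const_bound[of _ "C\<^sup>2"]) (use assms in \<open>auto simp: power_mono\<close>)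
  then show ?thesis using assms by (simp add: L2_functions_def)
qed

locale dual_measure = scaling N for N +
  fixes \<nu> :: "(real \<Rightarrow> complex) measure"
  assumes sets_\<nu>: "sets \<nu> = sets dual_borel" and finite_\<nu>: "finite_measure \<nu>"
begin

sublocale finite_measure \<nu> by (rule finite_\<nu>)
sublocale L: hilbert_space "L2_space \<nu>" by (rule L2_space_hilbert)

lemma space_\<nu> [simp]: "space \<nu> = K" using sets_eq_imp_space_eq[OF sets_\<nu>] by simp

lemma measurable_\<nu>: "f \<in> dual_borel \<rightarrow>\<^sub>M M' \<Longrightarrow> f \<in> \<nu> \<rightarrow>\<^sub>M M'"
  using sets_\<nu> by (simp cong: measurable_cong_sets)

lemma efun_measurable: "x \<in> Lambda N \<Longrightarrow> efun x \<in> borel_measurable \<nu>"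
  unfolding efun_def by (rule measurable_\<nu>[OF eval_measurable])

lemma efun_norm: "x \<in> Lambda N \<Longrightarrow> \<xi> \<in> K \<Longrightarrow> cmod (efun x \<xi>) = 1"
  by (simp add: efun_def dualD)

lemma efun_L2: "x \<in> Lambda N \<Longrightarrow> efun x \<in> L2_functions \<nu>"
  by (rule L2_bounded[of _ 1]) (auto simp: efun_measurable efun_norm)

lemma seq_measurable: "(\<lambda>\<xi>. seq_of N \<xi> k) \<in> borel_measurable \<nu>"
  by (rule measurable_\<nu>[OF seq_of_measurable])

definition exponentials :: "((real \<Rightarrow> complex) \<Rightarrow> complex) set set" where
  "exponentials = {L2_class \<nu> (efun (of_int n / of_nat N ^ k)) | n k. True}"

abbreviation "S \<equiv> linear_span (L2_space \<nu>) exponentials"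

abbreviation "Cl \<equiv> L.closure_of_set S"

lemma exponentials_carrier: "exponentials \<subseteq> carrier (L2_space \<nu>)"
  using efun_L2 LambdaI by (auto simp: exponentials_def)

lemma S_subspace: "linear_subspace (L2_space \<nu>) S" by (rule L.linear_span_subspace[OF exponentials_carrier])

lemma S_carrier: "S \<subseteq> carrier (L2_space \<nu>)" using S_subspace by (simp add: linear_subspace_def)

lemma efun_S: "x \<in> Lambda N \<Longrightarrow> L2_class \<nu> (efun x) \<in> S"
  using L.linear_span_superset[of exponentials] by (auto simp: exponentials_def elim!: LambdaE)

lemma S_add:
  assumes "f \<in> L2_functions \<nu>" "g \<in> L2_functions \<nu>" "L2_class \<nu> f \<in> S" "L2_class \<nu> g \<in> S"
  shows "L2_class \<nu> (\<lambda>x. f x + g x) \<in> S"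
  unfolding L2_space_add[OF assms(1,2), symmetric]
  by (rule linear_subspace_add[OF S_subspace assms(3,4)])

lemma S_smult:
  assumes "f \<in> L2_functions \<nu>" "L2_class \<nu> f \<in> S"
  shows "L2_class \<nu> (\<lambda>x. c * f x) \<in> S"
  unfolding L2_space_smult[OF assms(1), symmetric]
  by (rule linear_subspace_smult[OF S_subspace assms(2)])

lemma Cl_add:
  assumes "f \<in> L2_functions \<nu>" "g \<in> L2_functions \<nu>" "L2_class \<nu> f \<in> Cl" "L2_class \<nu> g \<in> Cl"
  shows "L2_class \<nu> (\<lambda>x. f x + g x) \<in> Cl"
  unfolding L2_space_add[OF assms(1,2), symmetric] by (rule L.closure_of_set_add[OF S_subspace assms(3,4)])

lemma Cl_smult:
  assumes "f \<in> L2_functions \<nu>" "L2_class \<nu> f \<in> Cl"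
  shows "L2_class \<nu> (\<lambda>x. c * f x) \<in> Cl"
  unfolding L2_space_smult[OF assms(1), symmetric] by (rule L.closure_of_set_smult[OF S_subspace assms(2)])

text \<open>
  Dominated convergence: the closure of the span of the characters is closed under dominated
  pointwise limits. Through this lemma it is shown to contain continuous functions of a coordinate,
  then indicators of cylinders and of Borel sets, then simple functions, then everything.
\<close>

lemma Cl_limit:
  assumes f: "\<And>n. f n \<in> borel_measurable \<nu>" "g \<in> borel_measurable \<nu>" and w: "w \<in> borel_measurable \<nu>" "integrable \<nu> (\<lambda>x. (w x)\<^sup>2)"
    and lim: "\<And>x. x \<in> K \<Longrightarrow> (\<lambda>n. f n x) \<longlonglongrightarrow> g x" and b: "\<And>n x. x \<in> K \<Longrightarrow> cmod (f n x) \<le> w x" "\<And>x. x \<in> K \<Longrightarrow> cmod (g x) \<le> w x"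
    and Cl: "\<And>n. L2_class \<nu> (f n) \<in> Cl"
  shows "L2_class \<nu> g \<in> Cl"
proof -
  have ae: "AE x in \<nu>. (\<lambda>n. f n x) \<longlonglongrightarrow> g x" "AE x in \<nu>. cmod (f n x) \<le> w x" "AE x in \<nu>. cmod (g x) \<le> w x" for n
    by (rule AE_I2, simp add: lim b)+
  note l = L2_dominated_limit[OF f w ae]
  have "g \<in> L2_functions \<nu>" "(\<lambda>n. hnorm (L2_space \<nu>) (L2_class \<nu> (f n) \<ominus>\<^bsub>L2_space \<nu>\<^esub> L2_class \<nu> g)) \<longlonglongrightarrow> 0"
    by (rule l)+
  then show ?thesis by (intro L.closure_of_set_closed[OF S_carrier Cl]) auto
qed

lemma trig_poly_S:
  assumes "p \<in> trig_poly"
  shows "(\<lambda>\<xi>. p (seq_of N \<xi> k)) \<in> L2_functions \<nu> \<and> L2_class \<nu> (\<lambda>\<xi>. p (seq_of N \<xi> k)) \<in> S"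
  using assms
proof induction
  case (monomial n)
  have eq: "seq_of N \<xi> k powi n = efun (of_int n / of_nat N ^ k) \<xi>" if "\<xi> \<in> K" for \<xi>
    using dual_apply[OF that, of n k] by (simp add: efun_def)
  have m: "(\<lambda>\<xi>. seq_of N \<xi> k powi n) \<in> borel_measurable \<nu>"
    using efun_measurable[OF LambdaI[of n k]] by (subst measurable_cong[OF eq]) auto
  have "(\<lambda>\<xi>. seq_of N \<xi> k powi n) \<in> L2_functions \<nu>"
    by (rule L2_bounded[OF m, of 1]) (simp add: eq efun_norm LambdaI)
  moreover have "L2_class \<nu> (\<lambda>\<xi>. seq_of N \<xi> k powi n) = L2_class \<nu> (efun (of_int n / of_nat N ^ k))"
    by (intro L2_class_eqI AE_I2) (simp add: eq)
  ultimately show ?case using efun_S[OF LambdaI[of n k]] by simp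
next
  case (add p q)
  then show ?case by (simp add: L2_add S_add)
next
  case (smult p c)
  then show ?case by (simp add: L2_smult S_smult)
qed

lemma continuous_Cl:
  fixes g :: "complex \<Rightarrow> complex"
  assumes g: "continuous_on circle g" and m: "(\<lambda>\<xi>. g (seq_of N \<xi> k)) \<in> borel_measurable \<nu>"
  shows "L2_class \<nu> (\<lambda>\<xi>. g (seq_of N \<xi> k)) \<in> Cl"
proof -
  have "\<exists>p\<in>trig_poly. \<forall>z\<in>circle. cmod (g z - p z) < 1 / real (Suc n)" for n
    by (rule trig_poly_dense[OF g]) simp
  then obtain p where p: "\<And>n. p n \<in> trig_poly" "\<And>n z. z \<in> circle \<Longrightarrow> cmod (g z - p n z) < 1 / real (Suc n)" by metis
  have "compact (g ` circle)" by (rule compact_continuous_image[OF g]) simp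
  then obtain C where "\<forall>w\<in>g ` circle. norm w \<le> C" using compact_imp_bounded bounded_iff by metis
  then have C: "cmod (g z) \<le> C" if "z \<in> circle" for z using that by blast
  have sc: "seq_of N \<xi> k \<in> circle" if "\<xi> \<in> K" for \<xi> using solenoid_circle(1)[OF seq_of_solenoid[OF that]] .
  show ?thesis
  proof (rule Cl_limit[where f="\<lambda>n \<xi>. p n (seq_of N \<xi> k)" and w="\<lambda>_. C + 1"])
    show "(\<lambda>\<xi>. p n (seq_of N \<xi> k)) \<in> borel_measurable \<nu>" for n using trig_poly_S[OF p(1)] by blast
    show "L2_class \<nu> (\<lambda>\<xi>. p n (seq_of N \<xi> k)) \<in> Cl" for n
      using trig_poly_S[OF p(1)] L.closure_of_set_superset[OF S_carrier] by blast
    fix \<xi> assume \<xi>: "\<xi> \<in> K"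
    have le: "cmod (p n (seq_of N \<xi> k) - g (seq_of N \<xi> k)) \<le> inverse (real (Suc n))" for n
      using p(2)[OF sc[OF \<xi>], of n] by (simp add: norm_minus_commute inverse_eq_divide)
    have "(\<lambda>n. p n (seq_of N \<xi> k) - g (seq_of N \<xi> k)) \<longlonglongrightarrow> 0"
      by (rule Lim_null_comparison[OF _ LIMSEQ_inverse_real_of_nat]) (use le in auto)
    then show "(\<lambda>n. p n (seq_of N \<xi> k)) \<longlonglongrightarrow> g (seq_of N \<xi> k)" by (simp add: LIM_zero_iff)
    show "cmod (g (seq_of N \<xi> k)) \<le> C + 1" using C[OF sc[OF \<xi>]] by simp
    fix n
    have "inverse (real (Suc n)) \<le> 1" by (simp add: inverse_eq_divide)
    then show "cmod (p n (seq_of N \<xi> k)) \<le> C + 1"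
      using norm_triangle_ineq[of "p n (seq_of N \<xi> k) - g (seq_of N \<xi> k)" "g (seq_of N \<xi> k)"] le[of n] C[OF sc[OF \<xi>]] by simp
  qed (use m in simp_all)
qed

lemma cylinder_Cl:
  assumes "a \<in> cylinders" shows "L2_class \<nu> (\<lambda>\<xi>. indicator a \<xi>) \<in> Cl"
proof -
  obtain k F where a: "a = {\<xi> \<in> K. seq_of N \<xi> k \<in> F}" "closed F" using assms by (auto simp: cylinders_def)
  have ind: "indicator a \<xi> = (indicator F (seq_of N \<xi> k) :: complex)" if "\<xi> \<in> K" for \<xi>
    using that by (simp add: a indicator_def)
  have am: "a \<in> sets \<nu>" using assms unfolding sets_\<nu> sets_dual_borel_cylinders by (rule sigma_sets.Basic)
  show ?thesis
  proof (cases "F = {}")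
    case True
    then have "L2_class \<nu> (\<lambda>\<xi>. indicator a \<xi>) = L2_class \<nu> (\<lambda>\<xi>. 0 * efun 0 \<xi>)" by (intro L2_class_eqI AE_I2) (simp add: a)
    also have "\<dots> \<in> S" by (rule S_smult) (use efun_L2 efun_S in auto)
    finally show ?thesis using L.closure_of_set_superset[OF S_carrier] by blast
  next
    case False
    define g where "g n z = complex_of_real (max 0 (1 - real n * infdist z F))" for n z
    have gc: "continuous_on UNIV (g n)" for n unfolding g_def[abs_def] by (intro continuous_intros)
    have g1: "cmod (g n z) \<le> 1" for n z by (simp add: g_def infdist_nonneg)
    have gm: "(\<lambda>\<xi>. g n (seq_of N \<xi> k)) \<in> borel_measurable \<nu>" for n
      using measurable_compose[OF seq_measurable borel_measurable_continuous_onI[OF gc]] .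
    show ?thesis
    proof (rule Cl_limit[where f="\<lambda>n \<xi>. g n (seq_of N \<xi> k)" and w="\<lambda>_. 1"])
      show "L2_class \<nu> (\<lambda>\<xi>. g n (seq_of N \<xi> k)) \<in> Cl" for n
        by (rule continuous_Cl[OF continuous_on_subset[OF gc] gm]) simp
      fix \<xi> assume \<xi>: "\<xi> \<in> K"
      let ?z = "seq_of N \<xi> k"
      show "(\<lambda>n. g n ?z) \<longlonglongrightarrow> indicator a \<xi>"
        unfolding ind[OF \<xi>] g_def by (rule indicator_closed_limit[OF a(2) False])
      show "cmod (g n ?z) \<le> 1" for n by (rule g1)
      show "cmod (indicator a \<xi>) \<le> 1" by (simp split: split_indicator)
    next
      show "(\<lambda>\<xi>. g n (seq_of N \<xi> k)) \<in> borel_measurable \<nu>" for n by (rule gm)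
      show "(indicator a :: _ \<Rightarrow> complex) \<in> borel_measurable \<nu>" by (rule borel_measurable_indicator[OF am])
    qed simp_all
  qed
qed

lemma indicator_L2: "a \<in> sets \<nu> \<Longrightarrow> (\<lambda>\<xi>. indicator a \<xi>) \<in> L2_functions \<nu>"
  by (rule L2_bounded[of _ 1]) (simp_all split: split_indicator)

lemma one_L2: "(\<lambda>_. 1) \<in> L2_functions \<nu>"
  by (rule L2_bounded[of _ 1]) simp_all

lemma one_Cl: "L2_class \<nu> (\<lambda>_. 1) \<in> Cl"
proof -
  have "L2_class \<nu> (\<lambda>_. 1) = L2_class \<nu> (efun 0)" by (intro L2_class_eqI AE_I2) (simp add: efun_def dual_zero)
  then show ?thesis using efun_S[of 0] L.closure_of_set_superset[OF S_carrier] by auto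
qed

lemma zero_Cl: "L2_class \<nu> (\<lambda>_. 0) \<in> Cl"
  using Cl_smult[OF one_L2 one_Cl, of 0] by simp

text \<open>
  Cylinders are stable under intersection, so it suffices to pass to complements and to countable
  disjoint unions.
\<close>

lemma indicator_Cl:
  assumes "a \<in> sets \<nu>" shows "L2_class \<nu> (\<lambda>\<xi>. indicator a \<xi>) \<in> Cl"
proof -
  have "a \<in> sigma_sets K cylinders" using assms by (simp add: sets_\<nu> sets_dual_borel_cylinders)
  with Int_stable_cylinders cylinders_subset show ?thesis
  proof (induction rule: sigma_sets_induct_disjoint)
    case (basic a)
    then show ?case by (rule cylinder_Cl)
  next
    case empty
    then show ?case using zero_Cl by simp
  next
    case (compl a)
    then have a: "a \<in> sets \<nu>" by (simp add: sets_\<nu> sets_dual_borel_cylinders)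
    have "L2_class \<nu> (\<lambda>\<xi>. indicator a \<xi>) \<in> Cl" by (rule compl)
    from Cl_add[OF one_L2 L2_smult[OF indicator_L2[OF a]] one_Cl Cl_smult[OF indicator_L2[OF a] this], of "-1"]
    have "L2_class \<nu> (\<lambda>\<xi>. 1 + (-1) * indicator a \<xi>) \<in> Cl" .
    moreover have "L2_class \<nu> (\<lambda>\<xi>. indicator (K - a) \<xi>) = L2_class \<nu> (\<lambda>\<xi>. 1 + (-1) * indicator a \<xi>)"
      by (intro L2_class_eqI AE_I2) (auto split: split_indicator)
    ultimately show ?case by simp
  next
    case (union A)
    have A: "A i \<in> sets \<nu>" for i
      unfolding sets_\<nu> sets_dual_borel_cylinders using union(2) by blast
    have fin: "L2_class \<nu> (\<lambda>\<xi>. \<Sum>i<n. indicator (A i) \<xi>) \<in> Cl \<and> (\<lambda>\<xi>. \<Sum>i<n. indicator (A i) \<xi>) \<in> L2_functions \<nu>" for n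
    proof (induction n)
      case (Suc n)
      have "L2_class \<nu> (\<lambda>\<xi>. indicator (A n) \<xi>) \<in> Cl" by (rule union)
      from Cl_add[OF conjunct2[OF Suc] indicator_L2[OF A] conjunct1[OF Suc] this] L2_add[OF conjunct2[OF Suc] indicator_L2[OF A, of n]]
      show ?case unfolding sum.lessThan_Suc by (rule conjI)
    qed (simp add: zero_Cl L2_zero)
    have psum: "(\<Sum>i<n. indicator (A i) \<xi>) = (indicator (\<Union>i<n. A i) \<xi> :: complex)" for n \<xi>
      by (rule indicator_UN_disjoint[symmetric]) (use union(1) in \<open>auto simp: disjoint_family_on_def\<close>)
    show ?case
    proof (rule Cl_limit[where f="\<lambda>n \<xi>. \<Sum>i<n. indicator (A i) \<xi>" and w="\<lambda>_. 1"])
      show "L2_class \<nu> (\<lambda>\<xi>. \<Sum>i<n. indicator (A i) \<xi>) \<in> Cl" for n by (rule conjunct1[OF fin])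
      fix \<xi> assume "\<xi> \<in> K"
      show "(\<lambda>n. \<Sum>i<n. indicator (A i) \<xi> :: complex) \<longlonglongrightarrow> indicator (\<Union>i. A i) \<xi>"
        unfolding psum by (rule LIMSEQ_indicator_UN)
      show "cmod (\<Sum>i<n. indicator (A i) \<xi>) \<le> 1" for n unfolding psum by (simp split: split_indicator)
      show "cmod (indicator (\<Union>i. A i) \<xi>) \<le> 1" by (simp split: split_indicator)
    next
      show "(\<lambda>\<xi>. \<Sum>i<n. indicator (A i) \<xi> :: complex) \<in> borel_measurable \<nu>" for n by (rule L2_measurable[OF conjunct2[OF fin]])
      have "(\<Union>i. A i) \<in> sets \<nu>" using A by (intro sets.countable_UN) auto
      then show "(indicator (\<Union>i. A i) :: _ \<Rightarrow> complex) \<in> borel_measurable \<nu>" by (rule borel_measurable_indicator)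
    qed simp_all
  qed
qed

lemma simple_Cl:
  assumes s: "simple_function \<nu> s" shows "L2_class \<nu> (s :: _ \<Rightarrow> complex) \<in> Cl"
proof -
  have fin: "finite (s ` K)" using simple_functionD(1)[OF s] unfolding space_\<nu> .
  have sm: "s -` {y} \<inter> K \<in> sets \<nu>" for y using simple_functionD(2)[OF s, of "{y}"] unfolding space_\<nu> .
  have "L2_class \<nu> (\<lambda>\<xi>. \<Sum>y\<in>Y. y * indicator (s -` {y} \<inter> K) \<xi>) \<in> Cl \<and> (\<lambda>\<xi>. \<Sum>y\<in>Y. y * indicator (s -` {y} \<inter> K) \<xi>) \<in> L2_functions \<nu>"
    if "finite Y" for Y
    using that
  proof induction
    case (insert y Y)
    have 1: "(\<lambda>\<xi>. y * indicator (s -` {y} \<inter> K) \<xi>) \<in> L2_functions \<nu>"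
      by (rule L2_smult[OF indicator_L2[OF sm]])
    have 2: "L2_class \<nu> (\<lambda>\<xi>. y * indicator (s -` {y} \<inter> K) \<xi>) \<in> Cl"
      by (rule Cl_smult[OF indicator_L2[OF sm] indicator_Cl[OF sm]])
    show ?case
      unfolding sum.insert[OF insert.hyps]
      using L2_add[OF 1 insert.IH[THEN conjunct2]] Cl_add[OF 1 insert.IH[THEN conjunct2] 2 insert.IH[THEN conjunct1]] by blast
  qed (simp add: zero_Cl L2_zero)
  moreover have "L2_class \<nu> s = L2_class \<nu> (\<lambda>\<xi>. \<Sum>y\<in>s ` K. y * indicator (s -` {y} \<inter> K) \<xi>)"
  proof (intro L2_class_eqI AE_I2)
    fix \<xi> assume \<xi>: "\<xi> \<in> space \<nu>"
    have "(\<Sum>y\<in>s ` K. y * indicator (s -` {y} \<inter> K) \<xi>) = (\<Sum>y\<in>s ` K. if s \<xi> = y then y else 0)"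
      by (rule sum.cong) (use \<xi> in \<open>auto split: split_indicator\<close>)
    also have "\<dots> = s \<xi>" using \<xi> fin by simp
    finally show "s \<xi> = (\<Sum>y\<in>s ` K. y * indicator (s -` {y} \<inter> K) \<xi>)" by simp
  qed
  ultimately show ?thesis using fin by simp
qed

theorem exponentials_dense: "dense_in (L2_space \<nu>) S"
proof -
  have "F \<in> Cl" if "F \<in> carrier (L2_space \<nu>)" for F
  proof -
    obtain f where f: "f \<in> L2_functions \<nu>" "F = L2_class \<nu> f" using \<open>F \<in> carrier (L2_space \<nu>)\<close> by (rule L2_space_cases)
    obtain s where s: "\<And>i. simple_function \<nu> (s i)" "\<And>x. x \<in> K \<Longrightarrow> (\<lambda>i. s i x) \<longlonglongrightarrow> f x"
      "\<And>i x. x \<in> K \<Longrightarrow> dist (s i x) 0 \<le> 2 * dist (f x) 0"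
      using borel_measurable_implies_sequence_metric[OF L2_measurable[OF f(1)], of 0] unfolding space_\<nu> by metis
    show ?thesis unfolding f(2)
    proof (rule Cl_limit[where f=s and w="\<lambda>x. 2 * cmod (f x)"])
      show "integrable \<nu> (\<lambda>x. (2 * cmod (f x))\<^sup>2)" using L2_integrable[OF f(1)] by (simp add: power_mult_distrib)
      show "L2_class \<nu> (s n) \<in> Cl" for n by (rule simple_Cl[OF s(1)])
      show "s n \<in> borel_measurable \<nu>" for n by (rule borel_measurable_simple_function[OF s(1)])
      show "f \<in> borel_measurable \<nu>" by (rule L2_measurable[OF f(1)])
      then show "(\<lambda>x. 2 * cmod (f x)) \<in> borel_measurable \<nu>" by measurable
      fix x assume x: "x \<in> K"
      show "(\<lambda>n. s n x) \<longlonglongrightarrow> f x" by (rule s(2)[OF x])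
      show "cmod (s n x) \<le> 2 * cmod (f x)" for n using s(3)[OF x, of n] by simp
    qed simp
  qed
  then show ?thesis using L.dense_in_iff[OF S_carrier] by (auto simp: L.closure_of_set_def)
qed

end

section \<open>Cyclic representations are determined by filter and harmonic function\<close>

lemma dense_in_mono: "dense_in H A \<Longrightarrow> A \<subseteq> B \<Longrightarrow> dense_in H B"
  unfolding dense_in_def by blast

lemma LinfI: "f \<in> borel_measurable \<mu> \<Longrightarrow> AE z in \<mu>. cmod (f z) \<le> C \<Longrightarrow> f \<in> Linf"
  by (auto simp: Linf_def)

lemma Linf_mult:
  assumes "f \<in> Linf" "g \<in> Linf" shows "(\<lambda>z. f z * g z) \<in> Linf"
proof -
  obtain C D where b: "AE z in \<mu>. cmod (f z) \<le> C" "AE z in \<mu>. cmod (g z) \<le> D" using assms by (auto simp: Linf_def)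
  have "AE z in \<mu>. cmod (f z * g z) \<le> C * D"
    using b
  proof eventually_elim
    case (elim z)
    have "0 \<le> C" using norm_ge_zero[of "f z"] elim(1) by linarith
    then show ?case using elim by (simp add: Real_Vector_Spaces.norm_mult mult_mono)
  qed
  then show ?thesis using assms by (intro LinfI) (auto simp: Linf_def)
qed

lemma Linf_add:
  assumes "f \<in> Linf" "g \<in> Linf" shows "(\<lambda>z. f z + g z) \<in> Linf"
proof -
  obtain C D where b: "AE z in \<mu>. cmod (f z) \<le> C" "AE z in \<mu>. cmod (g z) \<le> D" using assms by (auto simp: Linf_def)
  have "AE z in \<mu>. cmod (f z + g z) \<le> C + D"
    using b by eventually_elim (auto intro: order_trans[OF norm_triangle_ineq])
  then show ?thesis using assms by (intro LinfI) (auto simp: Linf_def)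
qed

lemma Linf_const: "(\<lambda>_. c) \<in> Linf" by (rule LinfI[of _ "cmod c"]) auto

lemma Linf_smult: "f \<in> Linf \<Longrightarrow> (\<lambda>z. c * f z) \<in> Linf" by (rule Linf_mult[OF Linf_const])

lemma Linf_cnj: "f \<in> Linf \<Longrightarrow> (\<lambda>z. cnj (f z)) \<in> Linf"
  unfolding Linf_def using borel_measurable_cnj[of f \<mu>] by simp

lemma (in scaling) Linf_power:
  assumes "f \<in> Linf" shows "(\<lambda>z. f (z ^ (N ^ k))) \<in> Linf"
proof -
  obtain C where "AE z in \<mu>. cmod (f z) \<le> C" using assms by (auto simp: Linf_def)
  then have b: "AE z in \<mu>. cmod (f (z ^ (N ^ k))) \<le> C" by (rule AE_circle_power_iter)
  have f: "f \<in> borel_measurable \<mu>" using assms by (simp add: Linf_def)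
  have "(\<lambda>z. z ^ (N ^ k)) \<in> \<mu> \<rightarrow>\<^sub>M \<mu>" using circle_power_measurable by (simp add: circle_measure_def)
  from LinfI[OF measurable_compose[OF this f] b] show ?thesis .
qed

text \<open>
  Every vector of the form \<open>V\<^sup>-\<^sup>k \<pi>(f) \<phi>\<close> is also one with exponent \<open>k + 1\<close>, because
  \<open>V \<pi>(f) \<phi> = \<pi>(f(z\<^sup>N) m\<^sub>0) \<phi>\<close>. Hence these vectors form a subspace, it is invariant, and
  inner products of two of them reduce to an integral over the circle.
\<close>

locale cyclic_representation = filter_pair N m0 h + H: hilbert_space H
  for N m0 h and H :: "'h hilbert" +
  fixes \<pi> :: "(complex \<Rightarrow> complex) \<Rightarrow> 'h \<Rightarrow> 'h" and V :: "'h \<Rightarrow> 'h" and \<phi> :: 'h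
  assumes corresponding: "corresponding_representation N m0 h H \<pi> V \<phi>"
begin

abbreviation "W \<equiv> inv_into (carrier H) V"

text \<open>
  Chosen so that \<open>V \<pi>(f) \<phi> = \<pi>(lift f) \<phi>\<close>.
\<close>

definition lift :: "(complex \<Rightarrow> complex) \<Rightarrow> complex \<Rightarrow> complex" where
  "lift f = (\<lambda>z. f (z ^ N) * m0 z)"

definition vec :: "nat \<times> (complex \<Rightarrow> complex) \<Rightarrow> 'h" where
  "vec j = (W ^^ fst j) (\<pi> (snd j) \<phi>)"

lemma rep: "Linf_representation H \<pi>" and unitary: "unitary_op H H V"
  and covariant: "f \<in> Linf \<Longrightarrow> x \<in> carrier H \<Longrightarrow> V (\<pi> f (W x)) = \<pi> (\<lambda>z. f (z ^ N)) x"
  and phi [simp]: "\<phi> \<in> carrier H" and cyclic: "cyclic_vector H \<pi> V \<phi>"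
  and state: "f \<in> Linf \<Longrightarrow> hinner H \<phi> (\<pi> f \<phi>) = (\<integral>z. f z * of_real (h z) \<partial>\<mu>)"
  and V_phi: "V \<phi> = \<pi> m0 \<phi>"
  using corresponding unfolding corresponding_representation_def representation_def cyclic_vector_def by blast+

lemma pi_closed [simp]: "f \<in> Linf \<Longrightarrow> x \<in> carrier H \<Longrightarrow> \<pi> f x \<in> carrier H"
  using rep unfolding Linf_representation_def bounded_op_def linear_op_def by (meson Pi_mem)

lemmas rep_laws = rep[unfolded Linf_representation_def, THEN conjunct2, THEN conjunct2]

lemma pi_mult: "f \<in> Linf \<Longrightarrow> g \<in> Linf \<Longrightarrow> x \<in> carrier H \<Longrightarrow> \<pi> f (\<pi> g x) = \<pi> (\<lambda>z. f z * g z) x"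
  and pi_add: "f \<in> Linf \<Longrightarrow> g \<in> Linf \<Longrightarrow> x \<in> carrier H \<Longrightarrow> \<pi> (\<lambda>z. f z + g z) x = \<pi> f x \<oplus>\<^bsub>H\<^esub> \<pi> g x"
  using rep_laws[THEN conjunct1, THEN bspec, THEN bspec, THEN bspec, of f g x] by simp_all

lemma pi_smult: "f \<in> Linf \<Longrightarrow> x \<in> carrier H \<Longrightarrow> \<pi> (\<lambda>z. c * f z) x = c \<odot>\<^bsub>H\<^esub> \<pi> f x"
  by (rule rep_laws[THEN conjunct2, THEN conjunct1, THEN spec, THEN bspec, THEN bspec])

lemma pi_one: "x \<in> carrier H \<Longrightarrow> \<pi> (\<lambda>_. 1) x = x"
  by (rule rep_laws[THEN conjunct2, THEN conjunct2, THEN conjunct1, THEN bspec])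

lemma pi_adjoint: "f \<in> Linf \<Longrightarrow> x \<in> carrier H \<Longrightarrow> y \<in> carrier H \<Longrightarrow> hinner H (\<pi> (\<lambda>z. cnj (f z)) x) y = hinner H x (\<pi> f y)"
  by (rule rep_laws[THEN conjunct2, THEN conjunct2, THEN conjunct2, THEN bspec, THEN bspec, THEN bspec])

lemma bij: "bij_betw V (carrier H) (carrier H)" and V_lin: "linear_op H H V"
  and V_inner: "x \<in> carrier H \<Longrightarrow> y \<in> carrier H \<Longrightarrow> hinner H (V x) (V y) = hinner H x y"
  using unitary by (auto simp: unitary_op_def)

lemma V_closed [simp]: "x \<in> carrier H \<Longrightarrow> V x \<in> carrier H" using bij by (rule bij_betwE[THEN bspec])
lemma W_closed [simp]: "x \<in> carrier H \<Longrightarrow> W x \<in> carrier H"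
  using bij_betwE[OF bij_betw_inv_into[OF bij]] by (rule bspec)
lemma VW [simp]: "x \<in> carrier H \<Longrightarrow> V (W x) = x" using bij_betw_inv_into_right[OF bij] .
lemma WV [simp]: "x \<in> carrier H \<Longrightarrow> W (V x) = x" using bij_betw_inv_into_left[OF bij] .

lemma W_add: "x \<in> carrier H \<Longrightarrow> y \<in> carrier H \<Longrightarrow> W (x \<oplus>\<^bsub>H\<^esub> y) = W x \<oplus>\<^bsub>H\<^esub> W y"
proof -
  assume xy: "x \<in> carrier H" "y \<in> carrier H"
  have "V (W x \<oplus>\<^bsub>H\<^esub> W y) = x \<oplus>\<^bsub>H\<^esub> y" using V_lin xy by (simp add: linear_op_def)
  then show ?thesis using WV[of "W x \<oplus>\<^bsub>H\<^esub> W y"] xy by simp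
qed

lemma W_smult: "x \<in> carrier H \<Longrightarrow> W (c \<odot>\<^bsub>H\<^esub> x) = c \<odot>\<^bsub>H\<^esub> W x"
proof -
  assume x: "x \<in> carrier H"
  have "V (c \<odot>\<^bsub>H\<^esub> W x) = c \<odot>\<^bsub>H\<^esub> x" using V_lin x by (simp add: linear_op_def)
  then show ?thesis using WV[of "c \<odot>\<^bsub>H\<^esub> W x"] x by simp
qed

lemma W_adjoint: "x \<in> carrier H \<Longrightarrow> y \<in> carrier H \<Longrightarrow> hinner H (W x) y = hinner H x (V y)"
  using V_inner[of "W x" y] by simp

lemma W_inner: "x \<in> carrier H \<Longrightarrow> y \<in> carrier H \<Longrightarrow> hinner H (W x) (W y) = hinner H x y"
  using V_inner[of "W x" "W y"] by simp

lemma Wk_closed [simp]: "x \<in> carrier H \<Longrightarrow> (W ^^ k) x \<in> carrier H" by (induction k) auto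
lemma Wk_add: "x \<in> carrier H \<Longrightarrow> y \<in> carrier H \<Longrightarrow> (W ^^ k) (x \<oplus>\<^bsub>H\<^esub> y) = (W ^^ k) x \<oplus>\<^bsub>H\<^esub> (W ^^ k) y"
  by (induction k) (auto simp: W_add)
lemma Wk_smult: "x \<in> carrier H \<Longrightarrow> (W ^^ k) (c \<odot>\<^bsub>H\<^esub> x) = c \<odot>\<^bsub>H\<^esub> (W ^^ k) x"
  by (induction k) (auto simp: W_smult)
lemma Wk_inner: "x \<in> carrier H \<Longrightarrow> y \<in> carrier H \<Longrightarrow> hinner H ((W ^^ k) x) ((W ^^ k) y) = hinner H x y"
  by (induction k) (auto simp: W_inner)

lemma pi_W:
  assumes f: "f \<in> Linf" and x: "x \<in> carrier H" shows "\<pi> f (W x) = W (\<pi> (\<lambda>z. f (z ^ N)) x)"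
  using covariant[OF f x] WV[of "\<pi> f (W x)"] f x by simp

lemma Linf_power1: "f \<in> Linf \<Longrightarrow> (\<lambda>z. f (z ^ N)) \<in> Linf"
  using Linf_power[of f 1] by simp

lemma pi_Wk:
  assumes "f \<in> Linf" and x: "x \<in> carrier H" shows "\<pi> f ((W ^^ k) x) = (W ^^ k) (\<pi> (\<lambda>z. f (z ^ (N ^ k))) x)"
  using assms(1)
proof (induction k arbitrary: f)
  case (Suc k)
  have "\<pi> f ((W ^^ Suc k) x) = W (\<pi> (\<lambda>z. f (z ^ N)) ((W ^^ k) x))" using Suc.prems x by (simp add: pi_W)
  also have "\<dots> = W ((W ^^ k) (\<pi> (\<lambda>z. f ((z ^ (N ^ k)) ^ N)) x))" using Suc.IH[OF Linf_power1[OF Suc.prems]] by simp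
  finally show ?case by (simp add: power_mult[symmetric] mult.commute)
qed simp

lemma lift_Linf: "f \<in> Linf \<Longrightarrow> lift f \<in> Linf"
  unfolding lift_def by (rule Linf_mult[OF Linf_power1 m0_Linf])

lemma liftk_Linf: "f \<in> Linf \<Longrightarrow> (lift ^^ d) f \<in> Linf"
  by (induction d) (auto simp: lift_Linf)

lemma V_pi:
  assumes f: "f \<in> Linf" and x: "x \<in> carrier H" shows "V (\<pi> f x) = \<pi> (\<lambda>z. f (z ^ N)) (V x)"
  using covariant[OF f V_closed[OF x]] x by simp

lemma vec_closed [simp]: "f \<in> Linf \<Longrightarrow> vec (k, f) \<in> carrier H"
  by (simp add: vec_def)

lemma vec_lift:
  assumes f: "f \<in> Linf" shows "vec (Suc k, lift f) = vec (k, f)"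
proof -
  have "V (\<pi> f \<phi>) = \<pi> (lift f) \<phi>"
    using V_pi[OF f phi] pi_mult[OF Linf_power1[OF f] m0_Linf phi] by (simp add: V_phi lift_def)
  then have "W (\<pi> (lift f) \<phi>) = \<pi> f \<phi>" using WV[of "\<pi> f \<phi>"] f by simp
  then show ?thesis by (simp add: vec_def funpow_swap1)
qed

lemma vec_liftk: "f \<in> Linf \<Longrightarrow> vec (k + d, (lift ^^ d) f) = vec (k, f)"
  by (induction d) (auto simp: vec_lift liftk_Linf)

lemma W_vec: "W (vec (k, f)) = vec (Suc k, f)" by (simp add: vec_def)

lemma V_vec: "f \<in> Linf \<Longrightarrow> V (vec (k, f)) = vec (k, lift f)"
  using vec_lift[of f k] W_vec[of k "lift f"] VW[of "vec (k, lift f)"] by (simp add: lift_Linf)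

lemma pi_vec: "f \<in> Linf \<Longrightarrow> g \<in> Linf \<Longrightarrow> \<pi> g (vec (k, f)) = vec (k, \<lambda>z. g (z ^ (N ^ k)) * f z)"
  by (simp add: vec_def pi_Wk pi_mult Linf_power)

lemma phi_vec: "\<phi> = vec (0, \<lambda>_. 1)" by (simp add: vec_def pi_one)

lemma vec_subspace: "linear_subspace H (vec ` (UNIV \<times> Linf))"
  unfolding linear_subspace_def
proof (intro conjI ballI allI)
  show "vec ` (UNIV \<times> Linf) \<subseteq> carrier H" by auto
  have "0 \<odot>\<^bsub>H\<^esub> \<phi> = \<zero>\<^bsub>H\<^esub>" by (rule H.mod.smult_l_null[unfolded complex_ring_simps]) simp
  then have "vec (0, \<lambda>z. 0 * 1) = \<zero>\<^bsub>H\<^esub>" unfolding vec_def using pi_smult[OF Linf_const phi, of 0 1] by (simp add: pi_one)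
  then show "\<zero>\<^bsub>H\<^esub> \<in> vec ` (UNIV \<times> Linf)" using Linf_const by (intro image_eqI[of _ _ "(0, \<lambda>z. 0 * 1)"]) auto
next
  fix x y assume "x \<in> vec ` (UNIV \<times> Linf)" "y \<in> vec ` (UNIV \<times> Linf)"
  then obtain k f l g where f: "f \<in> Linf" "x = vec (k, f)" and g: "g \<in> Linf" "y = vec (l, g)" by auto
  let ?f = "(lift ^^ l) f" and ?g = "(lift ^^ k) g"
  have fg: "?f \<in> Linf" "?g \<in> Linf" using f g liftk_Linf by auto
  have "x \<oplus>\<^bsub>H\<^esub> y = vec (k + l, ?f) \<oplus>\<^bsub>H\<^esub> vec (k + l, ?g)"
    using vec_liftk[OF f(1), of k l] vec_liftk[OF g(1), of l k] f g by (simp add: add.commute)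
  also have "\<dots> = vec (k + l, \<lambda>z. ?f z + ?g z)"
    using fg by (simp add: vec_def Wk_add pi_add)
  finally show "x \<oplus>\<^bsub>H\<^esub> y \<in> vec ` (UNIV \<times> Linf)" using Linf_add[OF fg] by simp
next
  fix c x assume "x \<in> vec ` (UNIV \<times> Linf)"
  then obtain k f where f: "f \<in> Linf" "x = vec (k, f)" by auto
  then have "c \<odot>\<^bsub>H\<^esub> x = vec (k, \<lambda>z. c * f z)" by (simp add: vec_def Wk_smult pi_smult)
  then show "c \<odot>\<^bsub>H\<^esub> x \<in> vec ` (UNIV \<times> Linf)" using Linf_smult[OF f(1), of c] by simp
qed

lemma vec_dense: "dense_in H (vec ` (UNIV \<times> Linf))"
proof -
  let ?D = "vec ` (UNIV \<times> Linf)"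
  let ?M = "{M. linear_subspace H M \<and> \<phi> \<in> M \<and> (\<forall>f\<in>Linf. \<forall>x\<in>M. \<pi> f x \<in> M) \<and> (\<forall>x\<in>M. V x \<in> M \<and> W x \<in> M)}"
  have "?D \<in> ?M"
  proof (intro CollectI conjI ballI)
    show "linear_subspace H ?D" by (rule vec_subspace)
    show "\<phi> \<in> ?D" by (subst phi_vec) (use Linf_const in auto)
    show "\<pi> g x \<in> ?D" if g: "g \<in> Linf" and x: "x \<in> ?D" for g x
    proof -
      obtain k f where f: "f \<in> Linf" "x = vec (k, f)" using x by auto
      show ?thesis unfolding f(2) pi_vec[OF f(1) g] using Linf_mult[OF Linf_power[OF g] f(1)] by simp
    qed
    show "V x \<in> ?D" if "x \<in> ?D" for x using that by (auto simp: V_vec lift_Linf)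
    show "W x \<in> ?D" if "x \<in> ?D" for x using that by (auto simp: W_vec)
  qed
  then have sub: "\<Inter>?M \<subseteq> ?D" by (rule Inter_lower)
  have "dense_in H (\<Inter>?M)" using cyclic unfolding cyclic_vector_def by (rule conjunct2)
  then show ?thesis using sub by (rule dense_in_mono)
qed

lemma vec_inner:
  assumes f: "f \<in> Linf" and g: "g \<in> Linf"
  shows "hinner H (vec (k, f)) (vec (l, g)) = (\<integral>z. cnj ((lift ^^ l) f z) * (lift ^^ k) g z * of_real (h z) \<partial>\<mu>)"
proof -
  let ?f = "(lift ^^ l) f" and ?g = "(lift ^^ k) g"
  have fg: "?f \<in> Linf" "?g \<in> Linf" using f g liftk_Linf by auto
  have "hinner H (vec (k, f)) (vec (l, g)) = hinner H (vec (k + l, ?f)) (vec (k + l, ?g))"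
    using vec_liftk[OF f, of k l] vec_liftk[OF g, of l k] by (simp add: add.commute)
  also have "\<dots> = hinner H (\<pi> ?f \<phi>) (\<pi> ?g \<phi>)" using fg by (simp add: vec_def Wk_inner)
  also have "\<dots> = hinner H \<phi> (\<pi> (\<lambda>z. cnj (?f z)) (\<pi> ?g \<phi>))"
    using pi_adjoint[OF Linf_cnj[OF fg(1)] phi, of "\<pi> ?g \<phi>"] fg by simp
  also have "\<dots> = (\<integral>z. cnj (?f z) * ?g z * of_real (h z) \<partial>\<mu>)"
    unfolding pi_mult[OF Linf_cnj[OF fg(1)] fg(2) phi] by (rule state[OF Linf_mult[OF Linf_cnj[OF fg(1)] fg(2)]])
  finally show ?thesis .
qed

end

text \<open>
  By \<open>vec_inner\<close> the Gram matrix of the vectors \<open>V\<^sup>-\<^sup>k \<pi>(f) \<phi>\<close> depends only on the filter and on \<open>h\<close>. The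
  resulting unitary operator intertwines the representations because \<open>V\<^sup>-\<^sup>1\<close> and \<open>\<pi>(f)\<^sup>*\<close> act on the index
  set by the same formula on both sides.
\<close>

theorem (in filter_pair) corresponding_representation_unique:
  assumes a: "corresponding_representation N m0 h H \<pi> V \<phi>" and b: "corresponding_representation N m0 h G \<rho> V' \<psi>"
  shows "unitarily_equivalent H \<pi> V \<phi> G \<rho> V' \<psi>"
proof -
  interpret A: cyclic_representation N m0 h H \<pi> V \<phi>
    using a by (intro cyclic_representation.intro cyclic_representation_axioms.intro filter_pair_axioms)
      (auto simp: corresponding_representation_def representation_def)
  interpret B: cyclic_representation N m0 h G \<rho> V' \<psi>
    using b by (intro cyclic_representation.intro cyclic_representation_axioms.intro filter_pair_axioms)
      (auto simp: corresponding_representation_def representation_def)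
  interpret gram_family H G "UNIV \<times> Linf" A.vec B.vec
  proof
    show "A.vec \<in> UNIV \<times> Linf \<rightarrow> carrier H" "B.vec \<in> UNIV \<times> Linf \<rightarrow> carrier G" by auto
    show "dense_in H (A.vec ` (UNIV \<times> Linf))" "dense_in G (B.vec ` (UNIV \<times> Linf))" by (rule A.vec_dense B.vec_dense)+
    fix i j :: "nat \<times> (complex \<Rightarrow> complex)" assume i: "i \<in> UNIV \<times> Linf" and j: "j \<in> UNIV \<times> Linf"
    obtain k f where k: "i = (k, f)" "f \<in> Linf" using i by (rule SigmaE)
    obtain l g where l: "j = (l, g)" "g \<in> Linf" using j by (rule SigmaE)
    note ij = k(1) l(1) k(2) l(2)
    show "hinner H (A.vec i) (A.vec j) = hinner G (B.vec i) (B.vec j)"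
      unfolding ij(1,2) A.vec_inner[OF ij(3,4)] B.vec_inner[OF ij(3,4)] ..
  qed
  obtain T where T: "unitary_op H G T" "\<And>x. x \<in> carrier H \<Longrightarrow> matches x (T x)"
    using unitary_exists by blast
  have Tx: "T x \<in> carrier G" if "x \<in> carrier H" for x using T(2)[OF that] by (simp add: matches_def)
  have m: "hinner G (B.vec (k, f)) (T x) = hinner H (A.vec (k, f)) x" if "x \<in> carrier H" "f \<in> Linf" for k f x
    using T(2)[OF that(1)] that(2) by (simp add: matches_def)
  have matchesI: "matches x y" if "x \<in> carrier H" "y \<in> carrier G"
    "\<And>k f. f \<in> Linf \<Longrightarrow> hinner G (B.vec (k, f)) y = hinner H (A.vec (k, f)) x" for x y
    using that unfolding matches_def by auto
  have Tu: "T x = y" if "matches x y" for x y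
  proof -
    have "x \<in> carrier H" using that by (simp add: matches_def)
    from matches_unique[OF T(2)[OF this] that] show ?thesis .
  qed
  have "T \<phi> = \<psi>"
  proof (rule Tu[OF matchesI])
    fix k f assume f: "f \<in> Linf"
    show "hinner G (B.vec (k, f)) \<psi> = hinner H (A.vec (k, f)) \<phi>"
      using A.vec_inner[OF f Linf_const, of k 0 1] B.vec_inner[OF f Linf_const, of k 0 1]
      by (simp only: A.phi_vec[symmetric] B.phi_vec[symmetric])
  qed simp_all
  moreover have "T (V x) = V' (T x)" if x: "x \<in> carrier H" for x
  proof (rule Tu[OF matchesI])
    fix k f assume f: "f \<in> Linf"
    show "hinner G (B.vec (k, f)) (V' (T x)) = hinner H (A.vec (k, f)) (V x)"
      using m[OF x f, of "Suc k"] A.W_adjoint[OF A.vec_closed[OF f] x] B.W_adjoint[OF B.vec_closed[OF f] Tx[OF x]]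
      by (simp add: A.W_vec B.W_vec)
  qed (use x Tx in simp_all)
  moreover have "T (\<pi> g x) = \<rho> g (T x)" if g: "g \<in> Linf" and x: "x \<in> carrier H" for g x
  proof (rule Tu[OF matchesI])
    fix k f assume f: "f \<in> Linf"
    have c: "(\<lambda>z. cnj (g (z ^ (N ^ k))) * f z) \<in> Linf"
      by (rule Linf_mult[OF Linf_cnj[OF Linf_power[OF g]] f])
    show "hinner G (B.vec (k, f)) (\<rho> g (T x)) = hinner H (A.vec (k, f)) (\<pi> g x)"
      unfolding A.pi_adjoint[OF g A.vec_closed[OF f] x, symmetric] B.pi_adjoint[OF g B.vec_closed[OF f] Tx[OF x], symmetric]
        A.pi_vec[OF f Linf_cnj[OF g]] B.pi_vec[OF f Linf_cnj[OF g]] by (rule m[OF x c])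
  qed (use g x Tx in simp_all)
  ultimately show ?thesis unfolding unitarily_equivalent_def using T(1) by blast
qed

section \<open>The shift on the dual group\<close>

context scaling
begin

definition shift :: "(real \<Rightarrow> complex) \<Rightarrow> real \<Rightarrow> complex" where
  "shift \<xi> = (\<lambda>x\<in>Lambda N. \<xi> (real N * x))"

definition unshift :: "(real \<Rightarrow> complex) \<Rightarrow> real \<Rightarrow> complex" where
  "unshift \<xi> = (\<lambda>x\<in>Lambda N. \<xi> (x / real N))"

lemma shift_dual: "\<xi> \<in> K \<Longrightarrow> shift \<xi> \<in> K"
  by (rule dualI) (auto simp: shift_def dualD Lambda_mult_N Lambda_add distrib_left)

lemma unshift_dual: "\<xi> \<in> K \<Longrightarrow> unshift \<xi> \<in> K"
  by (rule dualI) (auto simp: unshift_def dualD Lambda_div_N Lambda_add add_divide_distrib)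

lemma unshift_shift: 
  assumes "\<xi> \<in> K" shows "unshift (shift \<xi>) = \<xi>"
  by (rule extensionalityI[of _ "Lambda N"]) (use dualD(1)[OF assms] in \<open>auto simp: unshift_def shift_def Lambda_div_N\<close>)

lemma seq_of_shift: "seq_of N (shift \<xi>) (Suc k) = seq_of N \<xi> k"
  using Lambda_inv[of "Suc k"] by (simp add: seq_of_def shift_def)

lemma seq_of_unshift: "seq_of N (unshift \<xi>) k = seq_of N \<xi> (Suc k)"
  using Lambda_inv[of k] by (simp add: seq_of_def unshift_def mult.commute)

lemma shift_1: "\<xi> \<in> K \<Longrightarrow> shift \<xi> 1 = \<xi> 1 ^ N"
  using dual_power[of \<xi> 1 N] by (simp add: shift_def)

lemma efun_shift: "efun (of_int n / real N ^ Suc k) (shift \<xi>) = efun (of_int n / real N ^ k) \<xi>"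
  using LambdaI[of n "Suc k"] by (simp add: efun_def shift_def)

lemma seq_of_0: "seq_of N \<xi> 0 = \<xi> 1" by (simp add: seq_of_def)

lemma measurable_into_dual:
  assumes g: "g \<in> space M \<rightarrow> K" and m: "\<And>k. (\<lambda>x. seq_of N (g x) k) \<in> borel_measurable M"
  shows "g \<in> M \<rightarrow>\<^sub>M dual_borel"
proof (rule measurable_sigma_sets[OF sets_dual_borel_cylinders cylinders_subset g])
  fix C assume "C \<in> cylinders"
  then obtain k B where C: "C = {\<xi> \<in> K. seq_of N \<xi> k \<in> B}" "closed B" by (auto simp: cylinders_def)
  have "g -` C \<inter> space M = (\<lambda>x. seq_of N (g x) k) -` B \<inter> space M" using g by (auto simp: C)
  also have "\<dots> \<in> sets M" using m by (rule measurable_sets) (use C in auto)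
  finally show "g -` C \<inter> space M \<in> sets M" .
qed

lemma shift_measurable: "shift \<in> dual_borel \<rightarrow>\<^sub>M dual_borel"
proof (rule measurable_into_dual)
  fix k show "(\<lambda>\<xi>. seq_of N (shift \<xi>) k) \<in> borel_measurable dual_borel"
  proof (cases k)
    case 0
    have "(\<lambda>\<xi>. \<xi> (real N)) \<in> borel_measurable dual_borel" using eval_measurable[of "real N"] Lambda_mult_N[of 1] by simp
    then show ?thesis by (simp add: 0 seq_of_def shift_def)
  next
    case (Suc j)
    show ?thesis unfolding Suc seq_of_shift by (rule seq_of_measurable)
  qed
qed (auto simp only: space_dual_borel intro!: shift_dual)

lemma unshift_measurable: "unshift \<in> dual_borel \<rightarrow>\<^sub>M dual_borel"
  by (rule measurable_into_dual) (auto simp: seq_of_unshift seq_of_measurable intro!: unshift_dual)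

end

text \<open>
  The measure \<open>\<nu>\<close> with marginals \<open>law k\<close> is in general not invariant under the shift: the shift carries
  \<open>|m\<^sub>0(\<xi>(1))|\<^sup>2 d\<nu>\<close> to \<open>d\<nu>\<close>.
\<close>

locale marginal_measure = filter_pair N m0 h + dual_measure N \<nu> for N m0 h \<nu> +
  assumes marginal: "\<And>k. distr \<nu> borel (\<lambda>\<xi>. seq_of N \<xi> k) = law k"
begin

lemma AE_marginal:
  assumes "AE z in \<mu>. Q z" shows "AE \<xi> in \<nu>. Q (seq_of N \<xi> k)"
proof -
  have "AE z in distr \<nu> borel (\<lambda>\<xi>. seq_of N \<xi> k). z \<in> circle \<and> Q z"
    unfolding marginal by (rule AE_law[OF assms])
  from AE_distrD[OF seq_measurable this] show ?thesis by eventually_elim simp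
qed

lemma AE_marginal_1: "AE z in \<mu>. Q z \<Longrightarrow> AE \<xi> in \<nu>. Q (\<xi> 1)"
  using AE_marginal[of Q 0] by (simp only: seq_of_0)

lemma seq_of_circle: "\<xi> \<in> K \<Longrightarrow> seq_of N \<xi> k \<in> circle"
  using solenoid_circle(1)[OF seq_of_solenoid] .

lemma seq_measurable_circle: "(\<lambda>\<xi>. seq_of N \<xi> k) \<in> \<nu> \<rightarrow>\<^sub>M \<mu>"
proof -
  have "(\<lambda>\<xi>. seq_of N \<xi> k) \<in> \<nu> \<rightarrow>\<^sub>M restrict_space borel circle"
    by (rule measurable_restrict_space2[OF _ seq_measurable]) (use seq_of_circle in \<open>simp only: space_\<nu> Pi_iff, blast\<close>)
  then show ?thesis by (simp add: circle_measure_def)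
qed

lemma circle_function_measurable: "f \<in> borel_measurable \<mu> \<Longrightarrow> (\<lambda>\<xi>. f (\<xi> 1)) \<in> borel_measurable \<nu>"
  using measurable_compose[OF seq_measurable_circle[of 0]] by (simp only: seq_of_0)

text \<open>
  Functions on the circle are measurable on the circle only, whereas \<open>law k\<close> lives on the plane;
  extension by 0 makes them Borel functions there.
\<close>

definition on_plane :: "(complex \<Rightarrow> complex) \<Rightarrow> complex \<Rightarrow> complex" where
  "on_plane f z = (if z \<in> circle then f z else 0)"

lemma on_plane_measurable:
  assumes "f \<in> borel_measurable \<mu>" shows "on_plane f \<in> borel_measurable borel"
proof -
  have "f \<in> borel_measurable (restrict_space borel circle)" using assms by (simp add: circle_measure_def)
  then have "(\<lambda>z. indicator circle z *\<^sub>R f z) \<in> borel_measurable borel"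
    by (subst (asm) borel_measurable_restrict_space_iff) simp_all
  moreover have "on_plane f = (\<lambda>z. indicator circle z *\<^sub>R f z)"
    by (intro ext) (simp add: on_plane_def indicator_def)
  ultimately show ?thesis by simp
qed

text \<open>
  The weight with index \<open>k + 1\<close> is the weight with index \<open>k\<close> times \<open>|m\<^sub>0(z\<^sup>N\<^sup>^\<^sup>k)|\<^sup>2\<close>.
\<close>

lemma weighted_law: "density (law k) (\<lambda>z. ennreal ((cmod (on_plane m0 (z ^ (N ^ k))))\<^sup>2)) = law (Suc k)"
proof -
  let ?d = "\<lambda>k z. ennreal (h z * weight k z)"
  let ?w = "\<lambda>z. ennreal ((cmod (on_plane m0 (z ^ (N ^ k))))\<^sup>2)"
  have id: "(\<lambda>z. z) \<in> density \<mu> f \<rightarrow>\<^sub>M borel" for f :: "complex \<Rightarrow> ennreal"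
    using circle_id_measurable by (simp add: circle_measure_def)
  have pm: "(\<lambda>z::complex. z ^ (N ^ k)) \<in> borel \<rightarrow>\<^sub>M borel" by (rule law_power_measurable) simp
  have om: "(\<lambda>z. on_plane m0 (z ^ (N ^ k))) \<in> borel_measurable borel"
    by (rule measurable_compose[OF pm on_plane_measurable[OF m0_measurable]])
  have w: "?w \<in> borel_measurable borel" using om by measurable
  have w\<mu>: "?w \<in> borel_measurable \<mu>" using measurable_restrict_space1[OF w] by (simp add: circle_measure_def)
  have d: "?d j \<in> borel_measurable \<mu>" for j by measurable
  have "density (law k) ?w = distr (density (density \<mu> (?d k)) ?w) borel (\<lambda>z. z)"
    unfolding law_def by (rule density_distr[OF w id])
  also have "density (density \<mu> (?d k)) ?w = density \<mu> (\<lambda>z. ?d k z * ?w z)"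
    by (rule density_density_eq[OF d w\<mu>])
  also have "\<dots> = density \<mu> (?d (Suc k))"
  proof (rule density_cong)
    show "(\<lambda>z. ?d k z * ?w z) \<in> borel_measurable \<mu>" using d w\<mu> by measurable
    show "AE z in \<mu>. ?d k z * ?w z = ?d (Suc k) z"
    proof (rule AE_I2)
      fix z assume z: "z \<in> space \<mu>"
      then have "on_plane m0 (z ^ (N ^ k)) = m0 (z ^ (N ^ k))" by (simp add: on_plane_def norm_power)
      then show "?d k z * ?w z = ?d (Suc k) z"
        by (simp add: weight_Suc ennreal_mult''[symmetric] mult_ac)
    qed
  qed (rule d)
  finally show ?thesis by (simp only: law_def)
qed

definition jacobian :: "(real \<Rightarrow> complex) \<Rightarrow> ennreal" where
  "jacobian \<xi> = ennreal ((cmod (m0 (\<xi> 1)))\<^sup>2)"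

lemma m0_at_1_measurable: "(\<lambda>\<xi>. m0 (\<xi> 1)) \<in> borel_measurable \<nu>"
  by (rule circle_function_measurable[OF m0_measurable])

lemma jacobian_measurable: "jacobian \<in> borel_measurable \<nu>"
  unfolding jacobian_def[abs_def] using m0_at_1_measurable by measurable

lemma shift_measurable_\<nu>: "shift \<in> \<nu> \<rightarrow>\<^sub>M dual_borel"
  by (rule measurable_\<nu>[OF shift_measurable])

text \<open>
  The coordinate \<open>k + 1\<close> of the shifted point is the coordinate \<open>k\<close> of the point, with distribution
  \<open>law k\<close>. The density \<open>|m\<^sub>0(\<xi>(1))|\<^sup>2\<close> is a function of this coordinate, since \<open>\<xi>(1)\<close> is its
  power with exponent \<open>N\<^sup>k\<close>, and it turns \<open>law k\<close> into \<open>law (k + 1)\<close>. Coordinate 0 is determined by the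
  others.
\<close>

theorem shift_quasi_invariant: "distr (density \<nu> jacobian) dual_borel shift = \<nu>"
proof (rule sym, rule dual_measure_eqI[where ?k0.0 = 1])
  show "sets \<nu> = sets dual_borel" "finite_measure \<nu>" by (rule sets_\<nu> finite_\<nu>)+
  show "sets (distr (density \<nu> jacobian) dual_borel shift) = sets dual_borel" by simp
  fix k :: nat assume "k \<ge> 1"
  then obtain j where k: "k = Suc j" by (cases k) auto
  have s: "shift \<in> density \<nu> jacobian \<rightarrow>\<^sub>M dual_borel" using shift_measurable_\<nu> by simp
  let ?w = "\<lambda>z. ennreal ((cmod (on_plane m0 (z ^ (N ^ j))))\<^sup>2)"
  have pm: "(\<lambda>z::complex. z ^ (N ^ j)) \<in> borel \<rightarrow>\<^sub>M borel" by (rule law_power_measurable) simp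
  have om: "(\<lambda>z. on_plane m0 (z ^ (N ^ j))) \<in> borel_measurable borel"
    by (rule measurable_compose[OF pm on_plane_measurable[OF m0_measurable]])
  have w: "?w \<in> borel_measurable borel" using om by measurable
  have jac: "jacobian \<xi> = ?w (seq_of N \<xi> j)" if "\<xi> \<in> K" for \<xi>
  proof -
    have "seq_of N \<xi> j ^ (N ^ j) = \<xi> 1" using solenoid_power[OF seq_of_solenoid[OF that], of 0 j] by (simp add: seq_of_0)
    moreover have "\<xi> 1 \<in> circle" by (rule dualD(2)[OF that Lambda_1])
    ultimately show ?thesis by (simp only: jacobian_def on_plane_def if_True)
  qed
  have dens: "density \<nu> jacobian = density \<nu> (\<lambda>\<xi>. ?w (seq_of N \<xi> j))"
    by (rule density_cong[OF jacobian_measurable measurable_compose[OF seq_measurable w]]) (rule AE_I2, simp only: space_\<nu> jac)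
  have "distr (distr (density \<nu> jacobian) dual_borel shift) borel (\<lambda>\<xi>. seq_of N \<xi> k) = distr (density \<nu> jacobian) borel (\<lambda>\<xi>. seq_of N \<xi> j)"
    by (subst distr_distr[OF seq_of_measurable s]) (simp add: o_def k seq_of_shift)
  also have "\<dots> = density (law j) ?w"
    unfolding dens marginal[symmetric] by (rule density_distr[OF w seq_measurable, symmetric])
  also have "\<dots> = distr \<nu> borel (\<lambda>\<xi>. seq_of N \<xi> k)" unfolding weighted_law marginal k ..
  finally show "distr \<nu> borel (\<lambda>\<xi>. seq_of N \<xi> k) = distr (distr (density \<nu> jacobian) dual_borel shift) borel (\<lambda>\<xi>. seq_of N \<xi> k)"
    by (rule sym)
qed

lemma
  fixes F :: "(real \<Rightarrow> complex) \<Rightarrow> 'b::{banach, second_countable_topology}"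
  assumes F: "F \<in> borel_measurable \<nu>"
  shows shift_integral: "(\<integral>\<xi>. (cmod (m0 (\<xi> 1)))\<^sup>2 *\<^sub>R F (shift \<xi>) \<partial>\<nu>) = (\<integral>\<xi>. F \<xi> \<partial>\<nu>)"
    and shift_integrable: "integrable \<nu> (\<lambda>\<xi>. (cmod (m0 (\<xi> 1)))\<^sup>2 *\<^sub>R F (shift \<xi>)) \<longleftrightarrow> integrable \<nu> F"
proof -
  have Fd: "F \<in> borel_measurable dual_borel" using F sets_\<nu> by (simp cong: measurable_cong_sets)
  have s: "shift \<in> density \<nu> jacobian \<rightarrow>\<^sub>M dual_borel" using shift_measurable_\<nu> by simp
  have Fs: "(\<lambda>\<xi>. F (shift \<xi>)) \<in> borel_measurable \<nu>" by (rule measurable_compose[OF shift_measurable_\<nu> Fd])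
  have jm: "(\<lambda>\<xi>. (cmod (m0 (\<xi> 1)))\<^sup>2) \<in> borel_measurable \<nu>" using m0_at_1_measurable by measurable
  have nn: "AE \<xi> in \<nu>. 0 \<le> (cmod (m0 (\<xi> 1)))\<^sup>2" by simp
  have "(\<integral>\<xi>. F \<xi> \<partial>\<nu>) = (\<integral>\<xi>. F \<xi> \<partial>distr (density \<nu> jacobian) dual_borel shift)"
    by (simp only: shift_quasi_invariant)
  also have "\<dots> = (\<integral>\<xi>. F (shift \<xi>) \<partial>density \<nu> jacobian)" by (rule integral_distr[OF s Fd])
  also have "\<dots> = (\<integral>\<xi>. (cmod (m0 (\<xi> 1)))\<^sup>2 *\<^sub>R F (shift \<xi>) \<partial>\<nu>)"
    unfolding jacobian_def[abs_def] by (rule integral_density[OF Fs jm nn])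
  finally show "(\<integral>\<xi>. (cmod (m0 (\<xi> 1)))\<^sup>2 *\<^sub>R F (shift \<xi>) \<partial>\<nu>) = (\<integral>\<xi>. F \<xi> \<partial>\<nu>)" by (rule sym)
  have "integrable \<nu> F \<longleftrightarrow> integrable (distr (density \<nu> jacobian) dual_borel shift) F"
    by (simp only: shift_quasi_invariant)
  also have "\<dots> \<longleftrightarrow> integrable (density \<nu> jacobian) (\<lambda>\<xi>. F (shift \<xi>))" by (rule integrable_distr_eq[OF s Fd])
  also have "\<dots> \<longleftrightarrow> integrable \<nu> (\<lambda>\<xi>. (cmod (m0 (\<xi> 1)))\<^sup>2 *\<^sub>R F (shift \<xi>))"
    unfolding jacobian_def[abs_def] by (rule integrable_density[OF Fs jm nn])
  finally show "integrable \<nu> (\<lambda>\<xi>. (cmod (m0 (\<xi> 1)))\<^sup>2 *\<^sub>R F (shift \<xi>)) \<longleftrightarrow> integrable \<nu> F" by (rule sym)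
qed

lemma m0_nonzero: "AE z in \<mu>. m0 z \<noteq> 0"
proof -
  let ?S = "{z \<in> space \<mu>. m0 z = 0}"
  have S: "?S \<in> sets \<mu>" by measurable
  have "\<not> (emeasure \<mu> ?S > 0 \<and> (\<forall>z\<in>?S. m0 z = 0))" using nonsing S unfolding nonsingular_def by blast
  then have "emeasure \<mu> ?S = 0" by (simp add: not_less)
  then show ?thesis using AE_iff_measurable[OF S, of "\<lambda>z. m0 z \<noteq> 0"] by simp
qed

lemma m0_at_1_nonzero: "AE \<xi> in \<nu>. m0 (\<xi> 1) \<noteq> 0"
  by (rule AE_marginal_1[OF m0_nonzero])

text \<open>
  The shift maps \<open>|m\<^sub>0(\<xi>(1))|\<^sup>2 d\<nu>\<close> to \<open>d\<nu>\<close>, so preimages of null sets are null where \<open>m\<^sub>0(\<xi>(1)) \<noteq> 0\<close>,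
  which is almost everywhere.
\<close>

lemma AE_shift:
  assumes "AE \<xi> in \<nu>. Q \<xi>" shows "AE \<xi> in \<nu>. Q (shift \<xi>)"
proof -
  have s: "shift \<in> density \<nu> jacobian \<rightarrow>\<^sub>M dual_borel" using shift_measurable_\<nu> by simp
  have "AE \<xi> in distr (density \<nu> jacobian) dual_borel shift. Q \<xi>" unfolding shift_quasi_invariant by (rule assms)
  from AE_distrD[OF s this] have "AE \<xi> in \<nu>. 0 < jacobian \<xi> \<longrightarrow> Q (shift \<xi>)"
    by (simp add: AE_density[OF jacobian_measurable])
  then show ?thesis using m0_at_1_nonzero by eventually_elim (simp add: jacobian_def)
qed

end

section \<open>The representation on the square integrable functions\<close>

context marginal_measure
begin

abbreviation "H \<equiv> L2_space \<nu>"
abbreviation "cls \<equiv> L2_class \<nu>"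

definition multiply :: "(complex \<Rightarrow> complex) \<Rightarrow> ((real \<Rightarrow> complex) \<Rightarrow> complex) set \<Rightarrow> ((real \<Rightarrow> complex) \<Rightarrow> complex) set" where
  "multiply f F = cls (\<lambda>\<xi>. f (\<xi> 1) * L2_rep F \<xi>)"

definition weighted_shift :: "((real \<Rightarrow> complex) \<Rightarrow> complex) set \<Rightarrow> ((real \<Rightarrow> complex) \<Rightarrow> complex) set" where
  "weighted_shift F = cls (\<lambda>\<xi>. m0 (\<xi> 1) * L2_rep F (shift \<xi>))"

lemma
  assumes f: "f \<in> Linf" and g: "g \<in> L2_functions \<nu>"
  shows multiply_L2: "(\<lambda>\<xi>. f (\<xi> 1) * g \<xi>) \<in> L2_functions \<nu>"
    and multiply_bound: "AE z in \<mu>. cmod (f z) \<le> C \<Longrightarrow> (\<integral>\<xi>. (cmod (f (\<xi> 1) * g \<xi>))\<^sup>2 \<partial>\<nu>) \<le> C\<^sup>2 * (\<integral>\<xi>. (cmod (g \<xi>))\<^sup>2 \<partial>\<nu>)"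
proof -
  have fm: "(\<lambda>\<xi>. f (\<xi> 1)) \<in> borel_measurable \<nu>" using f by (intro circle_function_measurable) (simp add: Linf_def)
  have m: "(\<lambda>\<xi>. f (\<xi> 1) * g \<xi>) \<in> borel_measurable \<nu>" using fm L2_measurable[OF g] by measurable
  have le: "AE \<xi> in \<nu>. (cmod (f (\<xi> 1) * g \<xi>))\<^sup>2 \<le> C\<^sup>2 * (cmod (g \<xi>))\<^sup>2" if "AE z in \<mu>. cmod (f z) \<le> C" for C
    using AE_marginal_1[OF that]
  proof eventually_elim
    case (elim \<xi>)
    then have "(cmod (f (\<xi> 1)))\<^sup>2 \<le> C\<^sup>2" by (rule power_mono) simp
    then show ?case unfolding Real_Vector_Spaces.norm_mult power_mult_distrib by (rule mult_right_mono) simp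
  qed
  have int: "integrable \<nu> (\<lambda>\<xi>. C\<^sup>2 * (cmod (g \<xi>))\<^sup>2)" for C by (rule integrable_mult_right[OF L2_integrable[OF g]])
  obtain D where D: "AE z in \<mu>. cmod (f z) \<le> D" using f by (auto simp: Linf_def)
  have i: "integrable \<nu> (\<lambda>\<xi>. (cmod (f (\<xi> 1) * g \<xi>))\<^sup>2)"
  proof (rule Bochner_Integration.integrable_bound[OF int[of D]])
    show "(\<lambda>\<xi>. (cmod (f (\<xi> 1) * g \<xi>))\<^sup>2) \<in> borel_measurable \<nu>" using m by measurable
    show "AE \<xi> in \<nu>. norm ((cmod (f (\<xi> 1) * g \<xi>))\<^sup>2) \<le> norm (D\<^sup>2 * (cmod (g \<xi>))\<^sup>2)"
      using le[OF D] by eventually_elim simp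
  qed
  then show "(\<lambda>\<xi>. f (\<xi> 1) * g \<xi>) \<in> L2_functions \<nu>" using m by (simp add: L2_functions_def)
  assume C: "AE z in \<mu>. cmod (f z) \<le> C"
  have "(\<integral>\<xi>. (cmod (f (\<xi> 1) * g \<xi>))\<^sup>2 \<partial>\<nu>) \<le> (\<integral>\<xi>. C\<^sup>2 * (cmod (g \<xi>))\<^sup>2 \<partial>\<nu>)"
    by (rule integral_mono_AE[OF i int le[OF C]])
  then show "(\<integral>\<xi>. (cmod (f (\<xi> 1) * g \<xi>))\<^sup>2 \<partial>\<nu>) \<le> C\<^sup>2 * (\<integral>\<xi>. (cmod (g \<xi>))\<^sup>2 \<partial>\<nu>)" by simp
qed

lemma multiply_class:
  assumes g: "g \<in> L2_functions \<nu>" shows "multiply f (cls g) = cls (\<lambda>\<xi>. f (\<xi> 1) * g \<xi>)"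
  unfolding multiply_def
proof (rule L2_class_eqI)
  show "AE \<xi> in \<nu>. f (\<xi> 1) * L2_rep (cls g) \<xi> = f (\<xi> 1) * g \<xi>"
    using L2_rep_class[OF g] by eventually_elim simp
qed

lemma function_shift_measurable: "g \<in> borel_measurable \<nu> \<Longrightarrow> (\<lambda>\<xi>. g (shift \<xi>)) \<in> borel_measurable \<nu>"
  using measurable_compose[OF shift_measurable_\<nu>, of g borel] sets_\<nu> by (simp cong: measurable_cong_sets)

lemma weighted_shift_product_measurable: "g \<in> borel_measurable \<nu> \<Longrightarrow> (\<lambda>\<xi>. m0 (\<xi> 1) * g (shift \<xi>)) \<in> borel_measurable \<nu>"
  using m0_at_1_measurable function_shift_measurable[of g] by (rule borel_measurable_times)

lemma weighted_shift_L2: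
  assumes "g \<in> L2_functions \<nu>" shows "(\<lambda>\<xi>. m0 (\<xi> 1) * g (shift \<xi>)) \<in> L2_functions \<nu>"
proof -
  have "(\<lambda>\<xi>. (cmod (g \<xi>))\<^sup>2) \<in> borel_measurable \<nu>" using L2_measurable[OF assms] by measurable
  from shift_integrable[OF this] L2_integrable[OF assms]
  have "integrable \<nu> (\<lambda>\<xi>. (cmod (m0 (\<xi> 1)))\<^sup>2 *\<^sub>R (cmod (g (shift \<xi>)))\<^sup>2)" by simp
  then show ?thesis
    using weighted_shift_product_measurable[OF L2_measurable[OF assms]]
    by (simp add: L2_functions_def Real_Vector_Spaces.norm_mult power_mult_distrib)
qed

lemma weighted_shift_class:
  assumes g: "g \<in> L2_functions \<nu>" shows "weighted_shift (cls g) = cls (\<lambda>\<xi>. m0 (\<xi> 1) * g (shift \<xi>))"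
  unfolding weighted_shift_def
proof (rule L2_class_eqI)
  show "AE \<xi> in \<nu>. m0 (\<xi> 1) * L2_rep (cls g) (shift \<xi>) = m0 (\<xi> 1) * g (shift \<xi>)"
    using AE_shift[OF L2_rep_class[OF g]] by eventually_elim simp
qed

lemma multiply_closed: "f \<in> Linf \<Longrightarrow> F \<in> carrier H \<Longrightarrow> multiply f F \<in> carrier H"
  unfolding multiply_def by (intro L2_class_carrier multiply_L2 L2_rep)

lemma weighted_shift_closed: "F \<in> carrier H \<Longrightarrow> weighted_shift F \<in> carrier H"
  unfolding weighted_shift_def by (intro L2_class_carrier weighted_shift_L2 L2_rep)

lemma linear_op_H:
  assumes closed: "\<And>g. g \<in> L2_functions \<nu> \<Longrightarrow> T (cls g) \<in> carrier H"
    and add: "\<And>f g. f \<in> L2_functions \<nu> \<Longrightarrow> g \<in> L2_functions \<nu> \<Longrightarrow> T (cls (\<lambda>\<xi>. f \<xi> + g \<xi>)) = T (cls f) \<oplus>\<^bsub>H\<^esub> T (cls g)"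
    and smult: "\<And>c g. g \<in> L2_functions \<nu> \<Longrightarrow> T (cls (\<lambda>\<xi>. c * g \<xi>)) = c \<odot>\<^bsub>H\<^esub> T (cls g)"
  shows "linear_op H H T"
  unfolding linear_op_def
proof (intro conjI funcsetI ballI allI)
  fix x assume x: "x \<in> carrier H"
  obtain f where f: "f \<in> L2_functions \<nu>" "x = cls f" using x by (rule L2_space_cases)
  show "T x \<in> carrier H" unfolding f(2) by (rule closed[OF f(1)])
  show "T (c \<odot>\<^bsub>H\<^esub> x) = c \<odot>\<^bsub>H\<^esub> T x" for c unfolding f(2) L2_space_smult[OF f(1)] by (rule smult[OF f(1)])
  fix y assume y: "y \<in> carrier H"
  obtain g where g: "g \<in> L2_functions \<nu>" "y = cls g" using y by (rule L2_space_cases)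
  show "T (x \<oplus>\<^bsub>H\<^esub> y) = T x \<oplus>\<^bsub>H\<^esub> T y" unfolding f(2) g(2) L2_space_add[OF f(1) g(1)] by (rule add[OF f(1) g(1)])
qed

lemma multiply_linear:
  assumes f: "f \<in> Linf" shows "linear_op H H (multiply f)"
proof (rule linear_op_H)
  fix u v c assume u: "u \<in> L2_functions \<nu>"
  show "multiply f (cls u) \<in> carrier H" by (rule multiply_closed[OF f L2_class_carrier[OF u]])
  show "multiply f (cls (\<lambda>\<xi>. c * u \<xi>)) = c \<odot>\<^bsub>H\<^esub> multiply f (cls u)"
    unfolding multiply_class[OF L2_smult[OF u]] multiply_class[OF u] L2_space_smult[OF multiply_L2[OF f u]]
    by (rule L2_class_eqI, rule AE_I2) simp
  assume v: "v \<in> L2_functions \<nu>"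
  show "multiply f (cls (\<lambda>\<xi>. u \<xi> + v \<xi>)) = multiply f (cls u) \<oplus>\<^bsub>H\<^esub> multiply f (cls v)"
    unfolding multiply_class[OF L2_add[OF u v]] multiply_class[OF u] multiply_class[OF v]
      L2_space_add[OF multiply_L2[OF f u] multiply_L2[OF f v]]
    by (simp only: distrib_left)
qed

lemma weighted_shift_linear: "linear_op H H weighted_shift"
proof (rule linear_op_H)
  fix u v c assume u: "u \<in> L2_functions \<nu>"
  show "weighted_shift (cls u) \<in> carrier H" by (rule weighted_shift_closed[OF L2_class_carrier[OF u]])
  show "weighted_shift (cls (\<lambda>\<xi>. c * u \<xi>)) = c \<odot>\<^bsub>H\<^esub> weighted_shift (cls u)"
    unfolding weighted_shift_class[OF L2_smult[OF u]] weighted_shift_class[OF u] L2_space_smult[OF weighted_shift_L2[OF u]]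
    by (rule L2_class_eqI, rule AE_I2) simp
  assume v: "v \<in> L2_functions \<nu>"
  show "weighted_shift (cls (\<lambda>\<xi>. u \<xi> + v \<xi>)) = weighted_shift (cls u) \<oplus>\<^bsub>H\<^esub> weighted_shift (cls v)"
    unfolding weighted_shift_class[OF L2_add[OF u v]] weighted_shift_class[OF u] weighted_shift_class[OF v]
      L2_space_add[OF weighted_shift_L2[OF u] weighted_shift_L2[OF v]]
    by (simp only: distrib_left)
qed

lemma multiply_bounded:
  assumes f: "f \<in> Linf" shows "bounded_op H (multiply f)"
proof -
  obtain C where C: "AE z in \<mu>. cmod (f z) \<le> C" using f by (auto simp: Linf_def)
  have "hnorm H (multiply f x) \<le> \<bar>C\<bar> * hnorm H x" if x: "x \<in> carrier H" for x
  proof -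
    obtain g where g: "g \<in> L2_functions \<nu>" "x = cls g" using x by (rule L2_space_cases)
    have "sqrt (\<integral>\<xi>. (cmod (f (\<xi> 1) * g \<xi>))\<^sup>2 \<partial>\<nu>) \<le> sqrt (C\<^sup>2 * (\<integral>\<xi>. (cmod (g \<xi>))\<^sup>2 \<partial>\<nu>))"
      by (rule real_sqrt_le_mono[OF multiply_bound[OF f g(1) C]])
    then show ?thesis
      by (simp add: g multiply_class L2_space_hnorm multiply_L2[OF f] real_sqrt_mult)
  qed
  then show ?thesis unfolding bounded_op_def using multiply_linear[OF f] by blast
qed

theorem multiply_representation: "Linf_representation H multiply"
  unfolding Linf_representation_def
proof (intro conjI ballI allI impI)
  fix f x assume f: "f \<in> Linf"
  show "bounded_op H (multiply f)" by (rule multiply_bounded[OF f])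
  assume x: "x \<in> carrier H"
  obtain u where u: "u \<in> L2_functions \<nu>" "x = cls u" using x by (rule L2_space_cases)
  show "multiply (\<lambda>z. c * f z) x = c \<odot>\<^bsub>H\<^esub> multiply f x" for c
    by (simp add: u multiply_class L2_space_smult multiply_L2[OF f] mult.assoc)
  show "hinner H (multiply (\<lambda>z. cnj (f z)) x) y = hinner H x (multiply f y)" if y: "y \<in> carrier H" for y
  proof -
    obtain v where v: "v \<in> L2_functions \<nu>" "y = cls v" using y by (rule L2_space_cases)
    show ?thesis
      unfolding u(2) v(2) multiply_class[OF u(1)] multiply_class[OF v(1)]
        L2_space_inner[OF multiply_L2[OF Linf_cnj[OF f] u(1)] v(1)] L2_space_inner[OF u(1) multiply_L2[OF f v(1)]]
      by (simp add: mult_ac)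
  qed
next
  fix x assume "x \<in> carrier H"
  then show "multiply (\<lambda>_. 1) x = x" by (simp add: multiply_def L2_rep(2))
next
  fix f g x assume f: "f \<in> Linf" and g: "g \<in> Linf" and x: "x \<in> carrier H"
  obtain u where u: "u \<in> L2_functions \<nu>" "x = cls u" using x by (rule L2_space_cases)
  show "multiply f x = multiply g x" if fg: "AE z in \<mu>. f z = g z"
    unfolding u(2) multiply_class[OF u(1)]
  proof (rule L2_class_eqI)
    show "AE \<xi> in \<nu>. f (\<xi> 1) * u \<xi> = g (\<xi> 1) * u \<xi>" using AE_marginal_1[OF fg] by eventually_elim simp
  qed
  show "multiply (\<lambda>z. f z + g z) x = multiply f x \<oplus>\<^bsub>H\<^esub> multiply g x"
    by (simp add: u multiply_class L2_space_add multiply_L2[OF f] multiply_L2[OF g] distrib_right)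
  show "multiply (\<lambda>z. f z * g z) x = multiply f (multiply g x)"
    by (simp add: u multiply_class multiply_L2[OF g] mult.assoc)
qed

text \<open>
  The factor \<open>|m\<^sub>0(\<xi>(1))|\<^sup>2\<close> that appears in the integral is the density in \<open>shift_integral\<close>.
\<close>

lemma weighted_shift_inner:
  assumes x: "x \<in> carrier H" and y: "y \<in> carrier H"
  shows "hinner H (weighted_shift x) (weighted_shift y) = hinner H x y"
proof -
  obtain u where u: "u \<in> L2_functions \<nu>" "x = cls u" using x by (rule L2_space_cases)
  obtain v where v: "v \<in> L2_functions \<nu>" "y = cls v" using y by (rule L2_space_cases)
  have m: "(\<lambda>\<xi>. cnj (u \<xi>) * v \<xi>) \<in> borel_measurable \<nu>"
    using borel_measurable_cnj[OF L2_measurable[OF u(1)]] L2_measurable[OF v(1)] by measurable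
  have e: "cnj (m0 (\<xi> 1) * u (shift \<xi>)) * (m0 (\<xi> 1) * v (shift \<xi>))
      = (cmod (m0 (\<xi> 1)))\<^sup>2 *\<^sub>R (cnj (u (shift \<xi>)) * v (shift \<xi>))" for \<xi>
    unfolding scaleR_conv_of_real complex_norm_square by (simp add: mult_ac)
  have "hinner H (weighted_shift x) (weighted_shift y) = (\<integral>\<xi>. cnj (m0 (\<xi> 1) * u (shift \<xi>)) * (m0 (\<xi> 1) * v (shift \<xi>)) \<partial>\<nu>)"
    unfolding u(2) v(2) weighted_shift_class[OF u(1)] weighted_shift_class[OF v(1)]
    by (rule L2_space_inner[OF weighted_shift_L2[OF u(1)] weighted_shift_L2[OF v(1)]])
  also have "\<dots> = hinner H x y"
    unfolding e shift_integral[OF m] u(2) v(2) by (rule L2_space_inner[OF u(1) v(1), symmetric])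
  finally show ?thesis .
qed

text \<open>
  Dividing by \<open>m\<^sub>0\<close> is possible almost everywhere because the filter is non-singular: the preimage of
  \<open>g\<close> is \<open>g / m\<^sub>0\<close> composed with the inverse of the shift. It is square integrable by the
  quasi-invariance of \<open>\<nu>\<close>.
\<close>

lemma weighted_shift_surj:
  assumes y: "y \<in> carrier H" shows "\<exists>x\<in>carrier H. weighted_shift x = y"
proof -
  obtain g where g: "g \<in> L2_functions \<nu>" "y = cls g" using y by (rule L2_space_cases)
  define f where "f \<xi> = g (unshift \<xi>) / m0 (unshift \<xi> 1)" for \<xi>
  have un: "unshift \<in> \<nu> \<rightarrow>\<^sub>M \<nu>"
    using measurable_\<nu>[OF unshift_measurable] sets_\<nu> by (simp cong: measurable_cong_sets)
  have fm: "f \<in> borel_measurable \<nu>"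
    unfolding f_def[abs_def]
    by (intro borel_measurable_divide measurable_compose[OF un L2_measurable[OF g(1)]] measurable_compose[OF un m0_at_1_measurable])
  have ae: "AE \<xi> in \<nu>. m0 (\<xi> 1) * f (shift \<xi>) = g \<xi>"
    using m0_at_1_nonzero AE_space
  proof eventually_elim
    case (elim \<xi>)
    then have "unshift (shift \<xi>) = \<xi>" using unshift_shift by simp
    then show ?case using elim by (simp add: f_def)
  qed
  have "integrable \<nu> (\<lambda>\<xi>. (cmod (m0 (\<xi> 1)))\<^sup>2 *\<^sub>R (cmod (f (shift \<xi>)))\<^sup>2)"
  proof (rule integrable_cong_AE_imp[OF L2_integrable[OF g(1)]])
    show "(\<lambda>\<xi>. (cmod (m0 (\<xi> 1)))\<^sup>2 *\<^sub>R (cmod (f (shift \<xi>)))\<^sup>2) \<in> borel_measurable \<nu>"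
      using m0_at_1_measurable function_shift_measurable[OF fm] by measurable
    show "AE \<xi> in \<nu>. (cmod (g \<xi>))\<^sup>2 = (cmod (m0 (\<xi> 1)))\<^sup>2 *\<^sub>R (cmod (f (shift \<xi>)))\<^sup>2"
      using ae
    proof eventually_elim
      case (elim \<xi>)
      show ?case unfolding elim[symmetric] by (simp add: Real_Vector_Spaces.norm_mult power_mult_distrib)
    qed
  qed
  then have "integrable \<nu> (\<lambda>\<xi>. (cmod (f \<xi>))\<^sup>2)" 
    using shift_integrable[of "\<lambda>\<xi>. (cmod (f \<xi>))\<^sup>2"] fm by simp
  then have fL: "f \<in> L2_functions \<nu>" using fm by (simp add: L2_functions_def)
  have "weighted_shift (cls f) = y" unfolding weighted_shift_class[OF fL] g(2) by (rule L2_class_eqI[OF ae])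
  then show ?thesis using fL by blast
qed

theorem weighted_shift_unitary: "unitary_op H H weighted_shift"
  unfolding unitary_op_def bij_betw_def
proof (intro conjI ballI)
  show "linear_op H H weighted_shift" by (rule weighted_shift_linear)
  show "inj_on weighted_shift (carrier H)"
  proof (rule inj_onI)
    fix x y assume x: "x \<in> carrier H" and y: "y \<in> carrier H" and eq: "weighted_shift x = weighted_shift y"
    show "x = y"
    proof (rule L.eq_if_inner_eq[OF x y])
      fix z assume z: "z \<in> carrier H"
      show "hinner H z x = hinner H z y"
        using weighted_shift_inner[OF z x] weighted_shift_inner[OF z y] eq by simp
    qed
  qed
  show "weighted_shift ` carrier H = carrier H"
  proof
    show "weighted_shift ` carrier H \<subseteq> carrier H" using weighted_shift_closed by (rule image_subsetI)
    show "carrier H \<subseteq> weighted_shift ` carrier H"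
    proof
      fix y assume "y \<in> carrier H"
      from weighted_shift_surj[OF this] obtain x where "x \<in> carrier H" "weighted_shift x = y" by (rule bexE)
      then show "y \<in> weighted_shift ` carrier H" by (intro image_eqI[of y weighted_shift x]) simp_all
    qed
  qed
  show "hinner H (weighted_shift x) (weighted_shift y) = hinner H x y" if "x \<in> carrier H" "y \<in> carrier H" for x y
    by (rule weighted_shift_inner[OF that])
qed

abbreviation "weighted_shift_inv \<equiv> inv_into (carrier H) weighted_shift"

lemma weighted_shift_inv: 
  assumes "x \<in> carrier H" 
  shows "weighted_shift_inv (weighted_shift x) = x" "weighted_shift_inv x \<in> carrier H" "weighted_shift (weighted_shift_inv x) = x"
proof -
  have b: "bij_betw weighted_shift (carrier H) (carrier H)" using weighted_shift_unitary by (simp add: unitary_op_def)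
  show "weighted_shift_inv (weighted_shift x) = x" by (rule bij_betw_inv_into_left[OF b assms])
  show "weighted_shift_inv x \<in> carrier H" using bij_betwE[OF bij_betw_inv_into[OF b]] assms by (rule bspec)
  show "weighted_shift (weighted_shift_inv x) = x" by (rule bij_betw_inv_into_right[OF b assms])
qed

lemma weighted_shift_covariant:
  assumes f: "f \<in> Linf" and x: "x \<in> carrier H"
  shows "weighted_shift (multiply f (weighted_shift_inv x)) = multiply (\<lambda>z. f (z ^ N)) x"
proof -
  obtain u where u: "u \<in> L2_functions \<nu>" "weighted_shift_inv x = cls u" using weighted_shift_inv(2)[OF x] by (rule L2_space_cases)
  have "x = weighted_shift (cls u)" using weighted_shift_inv(3)[OF x] u by simp
  then have "x = cls (\<lambda>\<xi>. m0 (\<xi> 1) * u (shift \<xi>))" using weighted_shift_class[OF u(1)] by simp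
  then have r: "multiply (\<lambda>z. f (z ^ N)) x = cls (\<lambda>\<xi>. f (\<xi> 1 ^ N) * (m0 (\<xi> 1) * u (shift \<xi>)))"
    using multiply_class[OF weighted_shift_L2[OF u(1)]] by simp
  have "weighted_shift (multiply f (weighted_shift_inv x)) = cls (\<lambda>\<xi>. m0 (\<xi> 1) * (f (shift \<xi> 1) * u (shift \<xi>)))"
    unfolding u(2) multiply_class[OF u(1)] by (rule weighted_shift_class[OF multiply_L2[OF f u(1)]])
  also have "\<dots> = cls (\<lambda>\<xi>. f (\<xi> 1 ^ N) * (m0 (\<xi> 1) * u (shift \<xi>)))"
    by (rule L2_class_eqI, rule AE_I2) (simp add: shift_1)
  finally show ?thesis using r by simp
qed

theorem weighted_shift_multiply_representation: "representation N H multiply weighted_shift"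
  unfolding representation_def
  using L.hilbert_space_axioms multiply_representation weighted_shift_unitary weighted_shift_covariant by blast

lemma monomial_Linf: "(\<lambda>z. z powi n) \<in> Linf"
proof (rule LinfI)
  have "continuous_on circle (\<lambda>z::complex. z powi n)" by (intro continuous_intros) auto
  then show "(\<lambda>z. z powi n) \<in> borel_measurable \<mu>"
    using borel_measurable_continuous_on_restrict by (simp add: circle_measure_def)
  show "AE z in \<mu>. cmod (z powi n) \<le> 1" by (rule AE_I2) (simp add: norm_power_int)
qed

lemma multiply_monomial:
  assumes x: "x \<in> Lambda N"
  shows "multiply (\<lambda>z. z powi n) (cls (efun x)) = cls (efun (of_int n + x))"
  unfolding multiply_class[OF efun_L2[OF x]]
proof (rule L2_class_eqI, rule AE_I2)
  fix \<xi> assume "\<xi> \<in> space \<nu>"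
  then have \<xi>: "\<xi> \<in> K" by simp
  show "\<xi> 1 powi n * efun x \<xi> = efun (of_int n + x) \<xi>"
    using dual_power_int[OF \<xi> Lambda_1, of n] dualD(4)[OF \<xi> Lambda_int x, of n] by (simp add: efun_def)
qed

lemma multiply_filter: "x \<in> Lambda N \<Longrightarrow> multiply m0 (cls (efun x)) = circle_times_efun \<nu> m0 x"
  unfolding circle_times_efun_def by (rule multiply_class[OF efun_L2])

lemma weighted_shift_efun:
  "weighted_shift (cls (efun (of_int n / real N ^ Suc k))) = multiply m0 (cls (efun (of_int n / real N ^ k)))"
  unfolding weighted_shift_class[OF efun_L2[OF LambdaI]] multiply_class[OF efun_L2[OF LambdaI]]
  by (simp only: efun_shift)

lemma weighted_shift_one: "weighted_shift (cls (\<lambda>_. 1)) = cls (\<lambda>\<xi>. m0 (\<xi> 1))"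
  using weighted_shift_class[OF one_L2] by simp

lemma multiply_one: "multiply f (cls (\<lambda>_. 1)) = cls (\<lambda>\<xi>. f (\<xi> 1))"
  using multiply_class[OF one_L2] by simp

text \<open>
  Conjugation by the weighted shift turns multiplication by \<open>e(n/N\<^sup>k\<^sup>+\<^sup>1)\<close> into multiplication by
  \<open>e(n/N\<^sup>k)\<close>, and \<open>e(n)\<close> is a function on the circle. Hence an invariant subspace is stable under
  multiplication by all characters.
\<close>

lemma invariant_efun:
  assumes M: "linear_subspace H M" and pi: "\<And>f x. f \<in> Linf \<Longrightarrow> x \<in> M \<Longrightarrow> multiply f x \<in> M"
    and V: "\<And>x. x \<in> M \<Longrightarrow> weighted_shift x \<in> M" "\<And>x. x \<in> M \<Longrightarrow> weighted_shift_inv x \<in> M"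
    and g: "g \<in> L2_functions \<nu>" "cls g \<in> M"
  shows "(\<lambda>\<xi>. efun (of_int n / real N ^ k) \<xi> * g \<xi>) \<in> L2_functions \<nu> \<and> cls (\<lambda>\<xi>. efun (of_int n / real N ^ k) \<xi> * g \<xi>) \<in> M"
  using g
proof (induction k arbitrary: g)
  case 0
  have e: "efun (of_int n / real N ^ 0) \<xi> * g \<xi> = \<xi> 1 powi n * g \<xi>" if "\<xi> \<in> K" for \<xi>
    using dual_power_int[OF that Lambda_1, of n] by (simp add: efun_def)
  have m: "(\<lambda>\<xi>. efun (of_int n / real N ^ 0) \<xi> * g \<xi>) \<in> borel_measurable \<nu>"
    using efun_measurable[OF LambdaI] L2_measurable[OF 0(1)] by (rule borel_measurable_times)
  have "(\<lambda>\<xi>. efun (of_int n / real N ^ 0) \<xi> * g \<xi>) \<in> L2_functions \<nu>"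
    by (rule L2_cong[OF multiply_L2[OF monomial_Linf 0(1)] m]) (rule AE_I2, simp only: space_\<nu> e)
  moreover have "cls (\<lambda>\<xi>. efun (of_int n / real N ^ 0) \<xi> * g \<xi>) = multiply (\<lambda>z. z powi n) (cls g)"
    unfolding multiply_class[OF 0(1)] by (rule L2_class_eqI, rule AE_I2) (simp only: space_\<nu> e)
  ultimately show ?case using pi[OF monomial_Linf 0(2)] by simp
next
  case (Suc k)
  let ?e = "\<lambda>k. efun (of_int n / real N ^ k)"
  let ?g = "\<lambda>\<xi>. m0 (\<xi> 1) * g (shift \<xi>)"
  have "cls ?g \<in> M" using V(1)[OF Suc.prems(2)] weighted_shift_class[OF Suc.prems(1)] by simp
  from Suc.IH[OF weighted_shift_L2[OF Suc.prems(1)] this] have IH: "cls (\<lambda>\<xi>. ?e k \<xi> * ?g \<xi>) \<in> M" by (rule conjunct2)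
  have m: "(\<lambda>\<xi>. ?e (Suc k) \<xi> * g \<xi>) \<in> borel_measurable \<nu>"
    using efun_measurable[OF LambdaI] L2_measurable[OF Suc.prems(1)] by (rule borel_measurable_times)
  have "integrable \<nu> (\<lambda>\<xi>. (cmod (?e (Suc k) \<xi> * g \<xi>))\<^sup>2)"
  proof (rule integrable_cong_AE_imp[OF L2_integrable[OF Suc.prems(1)]])
    show "(\<lambda>\<xi>. (cmod (?e (Suc k) \<xi> * g \<xi>))\<^sup>2) \<in> borel_measurable \<nu>" using m by measurable
    show "AE \<xi> in \<nu>. (cmod (g \<xi>))\<^sup>2 = (cmod (?e (Suc k) \<xi> * g \<xi>))\<^sup>2"
      by (rule AE_I2) (simp only: space_\<nu> Real_Vector_Spaces.norm_mult efun_norm[OF LambdaI] mult_1_left)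
  qed
  then have L: "(\<lambda>\<xi>. ?e (Suc k) \<xi> * g \<xi>) \<in> L2_functions \<nu>" using m by (simp add: L2_functions_def)
  have "weighted_shift (cls (\<lambda>\<xi>. ?e (Suc k) \<xi> * g \<xi>)) = cls (\<lambda>\<xi>. ?e k \<xi> * ?g \<xi>)"
    unfolding weighted_shift_class[OF L] efun_shift by (simp only: mult.left_commute)
  then have "weighted_shift_inv (cls (\<lambda>\<xi>. ?e k \<xi> * ?g \<xi>)) = cls (\<lambda>\<xi>. ?e (Suc k) \<xi> * g \<xi>)"
    using weighted_shift_inv(1)[OF L2_class_carrier[OF L]] by simp
  then show ?case using V(2)[OF IH] L by simp
qed

text \<open>
  An invariant subspace containing 1 contains all characters, and these span a dense subspace.
\<close>

theorem one_cyclic: "cyclic_vector H multiply weighted_shift (cls (\<lambda>_. 1))"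
  unfolding cyclic_vector_def
proof (intro conjI)
  show "cls (\<lambda>_. 1) \<in> carrier H" by (rule L2_class_carrier[OF one_L2])
  have "S \<subseteq> \<Inter>{M. linear_subspace H M \<and> cls (\<lambda>_. 1) \<in> M
         \<and> (\<forall>f\<in>Linf. \<forall>x\<in>M. multiply f x \<in> M) \<and> (\<forall>x\<in>M. weighted_shift x \<in> M \<and> weighted_shift_inv x \<in> M)}"
  proof (rule Inter_greatest)
    fix M assume M': "M \<in> {M. linear_subspace H M \<and> cls (\<lambda>_. 1) \<in> M
         \<and> (\<forall>f\<in>Linf. \<forall>x\<in>M. multiply f x \<in> M) \<and> (\<forall>x\<in>M. weighted_shift x \<in> M \<and> weighted_shift_inv x \<in> M)}"
    note m = M'[THEN CollectD]
    note M = m[THEN conjunct1] m[THEN conjunct2, THEN conjunct1]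
      and pi = m[THEN conjunct2, THEN conjunct2, THEN conjunct1]
      and V = m[THEN conjunct2, THEN conjunct2, THEN conjunct2]
    have "exponentials \<subseteq> M"
    proof
      fix X assume "X \<in> exponentials"
      then obtain n k where X: "X = cls (efun (of_int n / real N ^ k))" by (auto simp: exponentials_def)
      have "cls (\<lambda>\<xi>. efun (of_int n / real N ^ k) \<xi> * 1) \<in> M"
        by (rule conjunct2[OF invariant_efun[OF M(1) pi[THEN bspec, THEN bspec] V[THEN bspec, THEN conjunct1] V[THEN bspec, THEN conjunct2] one_L2 M(2)]])
      then show "X \<in> M" unfolding X by simp
    qed
    then show "S \<subseteq> M" unfolding linear_span_def using M(1) by (intro Inter_lower CollectI conjI)
  qed
  with exponentials_dense show "dense_in H (\<Inter>{M. linear_subspace H M \<and> cls (\<lambda>_. 1) \<in> M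
         \<and> (\<forall>f\<in>Linf. \<forall>x\<in>M. multiply f x \<in> M) \<and> (\<forall>x\<in>M. weighted_shift x \<in> M \<and> weighted_shift_inv x \<in> M)})"
    by (rule dense_in_mono)
qed

lemma one_state:
  assumes f: "f \<in> Linf"
  shows "hinner H (cls (\<lambda>_. 1)) (multiply f (cls (\<lambda>_. 1))) = (\<integral>z. f z * of_real (h z) \<partial>\<mu>)"
proof -
  have fm: "on_plane f \<in> borel_measurable borel" using f by (intro on_plane_measurable) (simp add: Linf_def)
  have fL: "(\<lambda>\<xi>. f (\<xi> 1)) \<in> L2_functions \<nu>" using multiply_L2[OF f one_L2] by simp
  have "hinner H (cls (\<lambda>_. 1)) (multiply f (cls (\<lambda>_. 1))) = (\<integral>\<xi>. cnj 1 * f (\<xi> 1) \<partial>\<nu>)"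
    unfolding multiply_one by (rule L2_space_inner[OF one_L2 fL])
  also have "\<dots> = (\<integral>\<xi>. on_plane f (seq_of N \<xi> 0) \<partial>\<nu>)"
  proof (rule Bochner_Integration.integral_cong[OF refl])
    fix \<xi> assume "\<xi> \<in> space \<nu>"
    then have "\<xi> 1 \<in> circle" using dualD(2)[OF _ Lambda_1] by simp
    then show "cnj 1 * f (\<xi> 1) = on_plane f (seq_of N \<xi> 0)" by (simp add: on_plane_def seq_of_0)
  qed
  also have "\<dots> = (\<integral>z. on_plane f z \<partial>law 0)"
    unfolding marginal[symmetric] by (rule integral_distr[OF seq_measurable fm, symmetric])
  also have "\<dots> = (\<integral>z. f z * of_real (h z) \<partial>\<mu>)"
    unfolding law_integral[OF fm]
    by (rule Bochner_Integration.integral_cong[OF refl]) (simp add: on_plane_def scaleR_conv_of_real)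
  finally show ?thesis .
qed

theorem corresponding: "corresponding_representation N m0 h H multiply weighted_shift (cls (\<lambda>_. 1))"
  unfolding corresponding_representation_def
proof (intro conjI ballI)
  show "weighted_shift (cls (\<lambda>_. 1)) = multiply m0 (cls (\<lambda>_. 1))" by (simp only: weighted_shift_one multiply_one)
qed (rule weighted_shift_multiply_representation one_cyclic one_state, assumption?)+

lemma fourier_expansion:
  assumes "x \<in> Lambda N" shows "has_fourier_expansion \<nu> (multiply m0 (cls (efun x))) (fourier_coeff m0) x"
  unfolding has_fourier_expansion_def using multiply_filter[OF assms] m0_Linf by (intro bexI[of _ m0] conjI allI refl)

lemma fourier_expansion_one: "has_fourier_expansion \<nu> (weighted_shift (cls (\<lambda>_. 1))) (fourier_coeff m0) 0"
proof -
  have c: "cls (\<lambda>_. 1) = cls (efun 0)"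
    by (rule L2_class_eqI, rule AE_I2) (simp add: efun_def dual_zero)
  have "weighted_shift (cls (\<lambda>_. 1)) = multiply m0 (cls (\<lambda>_. 1))" by (simp only: weighted_shift_one multiply_one)
  also have "\<dots> = multiply m0 (cls (efun 0))" by (rule arg_cong[OF c])
  finally show ?thesis using fourier_expansion[of 0] by simp
qed

end

section \<open>The Gelfand space and the representation\<close>

lemma (in scaling) efun_real_point:
  "efun (of_int n / of_nat N ^ k) (real_point N t) = exp (\<i> * (of_int n * of_real t / of_nat N ^ k))"
  using LambdaI[of n k] by (simp add: efun_def real_point_def cis_conv_exp)

lemma (in universal_algebra) abelian_part_commutative:
  assumes "a \<in> carrier (abelian_part A \<iota> U)" "b \<in> carrier (abelian_part A \<iota> U)"
  shows "a \<otimes> b = b \<otimes> a"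
  using assms gen_commutative by (simp add: abelian_part_def)

lemma (in filter_algebra) marginal_measure:
  assumes "filter_measure N A \<iota> U m0 h \<nu>" shows "marginal_measure N m0 h \<nu>"
  using assms scaling_axioms filter_pair_axioms unfolding filter_measure_iff
  by (simp add: marginal_measure_def marginal_measure_axioms_def dual_measure_def dual_measure_axioms_def)

lemma (in marginal_measure) weighted_shift_efun':
  "weighted_shift (cls (efun (of_int n / of_nat N ^ (k + 1)))) = multiply m0 (cls (efun (of_int n / of_nat N ^ k)))"
  using weighted_shift_efun[of n k] by simp

theorem theorem7p1:
  fixes N :: nat
    and A :: "'a cstar"
    and \<iota> :: "(complex \<Rightarrow> complex) \<Rightarrow> 'a"
    and U :: 'a
  assumes "N \<ge> 2"
    and "universal_covariant N A \<iota> U"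
  shows
    "((\<forall>a\<in>carrier (abelian_part A \<iota> U). \<forall>b\<in>carrier (abelian_part A \<iota> U). a \<otimes>\<^bsub>A\<^esub> b = b \<otimes>\<^bsub>A\<^esub> a)
      \<and> compact_topological_group (dual_group N) (dual_topology N)
      \<and> homeomorphic_map (dual_topology N) (gelfand_space (abelian_part A \<iota> U))
          (gelfand_point N A \<iota> U)
      \<and> (\<forall>\<xi>\<in>carrier (dual_group N). \<forall>n k.
           as_function N A \<iota> U (conj_power A \<iota> U k (circle_monomial n)) \<xi> =
           efun (of_int n / of_nat N ^ k) \<xi>))
   \<and> (\<forall>m0 h. wavelet_filter N m0 \<and> nonsingular m0 \<and> ruelle_harmonic N m0 h \<longrightarrow>
        (\<exists>!\<nu>. filter_measure N A \<iota> U m0 h \<nu>))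
   \<and> (\<forall>m0 h \<nu>. wavelet_filter N m0 \<and> nonsingular m0 \<and> ruelle_harmonic N m0 h
        \<and> filter_measure N A \<iota> U m0 h \<nu> \<longrightarrow>
        (\<forall>t. real_point N t \<in> carrier (dual_group N)
           \<and> (\<forall>n k. efun (of_int n / of_nat N ^ k) (real_point N t) =
                     exp (\<i> * (of_int n * of_real t / of_nat N ^ k))))
      \<and> (\<forall>x\<in>Lambda N. efun x \<in> L2_functions \<nu>)
      \<and> dense_in (L2_space \<nu>) (linear_span (L2_space \<nu>)
          {L2_class \<nu> (efun (of_int n / of_nat N ^ k)) | n k. True})
      \<and> (\<exists>\<pi> V. corresponding_representation N m0 h (L2_space \<nu>) \<pi> V (L2_class \<nu> (\<lambda>_. 1))
          \<and> (\<forall>(H :: 'h hilbert) \<pi>' V' \<phi>'. corresponding_representation N m0 h H \<pi>' V' \<phi>' \<longrightarrow>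
               unitarily_equivalent H \<pi>' V' \<phi>' (L2_space \<nu>) \<pi> V (L2_class \<nu> (\<lambda>_. 1)))
          \<and> (\<forall>n. \<forall>x\<in>Lambda N. \<pi> (\<lambda>z. z powi n) (L2_class \<nu> (efun x)) =
               L2_class \<nu> (efun (of_int n + x)))
          \<and> (\<forall>x\<in>Lambda N. \<pi> m0 (L2_class \<nu> (efun x)) = circle_times_efun \<nu> m0 x)
          \<and> (\<forall>n k. V (L2_class \<nu> (efun (of_int n / of_nat N ^ (k + 1)))) =
                 \<pi> m0 (L2_class \<nu> (efun (of_int n / of_nat N ^ k)))
             \<and> has_fourier_expansion \<nu> (V (L2_class \<nu> (efun (of_int n / of_nat N ^ (k + 1)))))
                 (fourier_coeff m0) (of_int n / of_nat N ^ k))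
          \<and> V (L2_class \<nu> (\<lambda>_. 1)) = L2_class \<nu> (\<lambda>\<xi>. m0 (\<xi> 1))
          \<and> has_fourier_expansion \<nu> (V (L2_class \<nu> (\<lambda>_. 1))) (fourier_coeff m0) 0))"
proof -
  have ua: "universal_algebra N A \<iota> U"
    using assms by (simp add: universal_algebra_def universal_algebra_axioms_def covariant_algebra_def
        covariant_algebra_axioms_def scaling_def universal_covariant_def)
  interpret universal_algebra N A \<iota> U by (rule ua)
  have fa: "filter_algebra N A \<iota> U m0 h"
    if "wavelet_filter N m0 \<and> nonsingular m0 \<and> ruelle_harmonic N m0 h" for m0 h
    using that ua scaling_axioms by (simp add: filter_algebra_def filter_pair_def filter_pair_axioms_def)
  show ?thesis
  proof (intro conjI allI impI)
    show "\<forall>a\<in>carrier (abelian_part A \<iota> U). \<forall>b\<in>carrier (abelian_part A \<iota> U). a \<otimes>\<^bsub>A\<^esub> b = b \<otimes>\<^bsub>A\<^esub> a"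
      by (intro ballI abelian_part_commutative)
    show "compact_topological_group (dual_group N) (dual_topology N)" by (rule dual_compact_group)
    show "homeomorphic_map (dual_topology N) (gelfand_space (abelian_part A \<iota> U)) (gelfand_point N A \<iota> U)"
      by (rule gelfand_homeomorphism)
    show "\<forall>\<xi>\<in>carrier (dual_group N). \<forall>n k.
        as_function N A \<iota> U (conj_power A \<iota> U k (circle_monomial n)) \<xi> = efun (of_int n / of_nat N ^ k) \<xi>"
      by (intro ballI allI as_function_monomial)
  next
    fix m0 h assume "wavelet_filter N m0 \<and> nonsingular m0 \<and> ruelle_harmonic N m0 h"
    then interpret filter_algebra N A \<iota> U m0 h by (rule fa)
    show "\<exists>!\<nu>. filter_measure N A \<iota> U m0 h \<nu>" by (rule filter_measure_unique_exists)
  next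
    fix m0 h \<nu>
    assume a: "wavelet_filter N m0 \<and> nonsingular m0 \<and> ruelle_harmonic N m0 h \<and> filter_measure N A \<iota> U m0 h \<nu>"
    then interpret F: filter_algebra N A \<iota> U m0 h by (intro fa) simp
    interpret M: marginal_measure N m0 h \<nu> using a by (intro F.marginal_measure) simp
    show "real_point N t \<in> carrier (dual_group N)" for t by (rule real_point_dual)
    show "efun (of_int n / of_nat N ^ k) (real_point N t) = exp (\<i> * (of_int n * of_real t / of_nat N ^ k))" for t n k
      by (rule efun_real_point)
    show "\<forall>x\<in>Lambda N. efun x \<in> L2_functions \<nu>" by (rule ballI) (rule M.efun_L2)
    show "dense_in (L2_space \<nu>) (linear_span (L2_space \<nu>) {L2_class \<nu> (efun (of_int n / of_nat N ^ k)) | n k. True})"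
      using M.exponentials_dense unfolding M.exponentials_def .
    show "\<exists>\<pi> V. corresponding_representation N m0 h (L2_space \<nu>) \<pi> V (L2_class \<nu> (\<lambda>_. 1))
          \<and> (\<forall>(H :: 'h hilbert) \<pi>' V' \<phi>'. corresponding_representation N m0 h H \<pi>' V' \<phi>' \<longrightarrow>
               unitarily_equivalent H \<pi>' V' \<phi>' (L2_space \<nu>) \<pi> V (L2_class \<nu> (\<lambda>_. 1)))
          \<and> (\<forall>n. \<forall>x\<in>Lambda N. \<pi> (\<lambda>z. z powi n) (L2_class \<nu> (efun x)) =
               L2_class \<nu> (efun (of_int n + x)))
          \<and> (\<forall>x\<in>Lambda N. \<pi> m0 (L2_class \<nu> (efun x)) = circle_times_efun \<nu> m0 x)
          \<and> (\<forall>n k. V (L2_class \<nu> (efun (of_int n / of_nat N ^ (k + 1)))) =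
                 \<pi> m0 (L2_class \<nu> (efun (of_int n / of_nat N ^ k)))
             \<and> has_fourier_expansion \<nu> (V (L2_class \<nu> (efun (of_int n / of_nat N ^ (k + 1)))))
                 (fourier_coeff m0) (of_int n / of_nat N ^ k))
          \<and> V (L2_class \<nu> (\<lambda>_. 1)) = L2_class \<nu> (\<lambda>\<xi>. m0 (\<xi> 1))
          \<and> has_fourier_expansion \<nu> (V (L2_class \<nu> (\<lambda>_. 1))) (fourier_coeff m0) 0"
    proof (rule exI[of _ M.multiply], rule exI[of _ M.weighted_shift], intro conjI allI impI ballI)
      fix H :: "'h hilbert" and \<pi>' V' \<phi>' assume "corresponding_representation N m0 h H \<pi>' V' \<phi>'"
      then show "unitarily_equivalent H \<pi>' V' \<phi>' (L2_space \<nu>) M.multiply M.weighted_shift (L2_class \<nu> (\<lambda>_. 1))"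
        using M.corresponding by (rule F.corresponding_representation_unique)
    next
      fix n k
      show "has_fourier_expansion \<nu> (M.weighted_shift (L2_class \<nu> (efun (of_int n / of_nat N ^ (k + 1)))))
          (fourier_coeff m0) (of_int n / of_nat N ^ k)"
        unfolding M.weighted_shift_efun' by (rule M.fourier_expansion[OF LambdaI])
    qed (rule M.corresponding M.multiply_monomial M.multiply_filter M.weighted_shift_efun' M.weighted_shift_one
        M.fourier_expansion_one, assumption?)+
  qed
qed

end
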